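(* Let $H,K$ be Hilbert spaces, let $U\in M_n(B(H))$ be a magic unitary, and let $V^1,\dots,V^n\in M_m(B(K))$ be magic unitaries. Let $A$ be the Hopf image for $U$, and let $B$ be the common Hopf image for $V^1,\dots,V^n$. Then the Hopf algebra associated to the magic unitary $U\otimes(V^1,\dots,V^n)$ is a quotient of the free wreath product $B*_wA$.
   Context: C*-algebras and morphisms are unital. A magic unitary over a C*-algebra $A$ is a matrix $u\in M_n(A)$ of projections such that on each row and each column the entries are pairwise orthogonal and sum to $1$. The Diţă product $W=U\otimes(V^1,\dots,V^n)$ is the $nm\times nm$ magic unitary over $B(H\otimes K)$ given by $W_{ia,jb}=U_{ij}\otimes V^i_{ab}$. $A_s(n)$ is the universal C*-algebra generated by $n^2$ elements $u_{ij}$ with the relations making $(u_{ij})$ a magic unitary. A quantum permutation algebra is a C*-algebra $A$ with a magic unitary $u\in M_n(A)$ whose entries generate $A$, and such that $\Delta(u_{ij})=\sum_k u_{ik}\otimes u_{kj}$, $\varepsilon(u_{ij})=\delta_{ij}$, $S(u_{ij})=u_{ji}$ define morphisms $\Delta:A\to A\otimes A$, $\varepsilon:A\to\mathbb C$, $S:A\to A^{op}$. All quantum permutation algebras are taken full: $A$ is the enveloping C*-algebra of the $*$-algebra generated by the $u_{ij}$. Quotients are quotients as quantum permutation algebras. Given a representation $\pi:A_s(n)\to C$ into a C*-algebra, its Hopf image is the smallest quantum permutation algebra $A$ (with $n\times n$ magic unitary) realizing a factorization $A_s(n)\to A\to C$ of $\pi$, the first map sending generators to generators; smallest means that any other algebra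 realizing such a factorization maps onto $A$, generators being sent to generators. The common Hopf image of a family of representations $\pi_i:A_s(n)\to C$ is the smallest quantum permutation algebra $A$ realizing a factorization $A_s(n)\to A\to C$ of $\pi_i$ for every $i$ (the map $A\to C$ may depend on $i$, while $A_s(n)\to A$ sends generators to generators). The Hopf image for (or Hopf algebra associated to) a magic unitary $U\in M_n(B(H))$ is the Hopf image of $A_s(n)\to B(H)$, $u_{ij}\mapsto U_{ij}$; the common Hopf image for a family of magic unitaries is defined in the same way. If $(B,v)$ and $(A,u)$ are quantum permutation algebras, with $v$ of size $m\times m$ and $u$ of size $n\times n$, their free wreath product is $B*_wA=(B^{*n}*A)/\langle[v_{ab}^{(i)},u_{ij}]=0\rangle$, where $v^{(i)}$ is the copy of $v$ in the $i$-th copy of $B$; it is a quantum permutation algebra with magic unitary $w_{ia,jb}=v_{ab}^{(i)}u_{ij}$. *)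

theory Defs
  imports "HOL-Analysis.Analysis" "HOL-Algebra.RingHom" "HOL-Library.Poly_Mapping"
begin

record 'a star_alg = "'a ring" +
  cscale :: "complex \<Rightarrow> 'a \<Rightarrow> 'a"
  star :: "'a \<Rightarrow> 'a"

record 'a cstar_alg = "'a star_alg" +
  cnorm :: "'a \<Rightarrow> real"

locale star_algebra = ring A for A :: "('a, 'e) star_alg_scheme" (structure) +
  assumes cscale_closed: "x \<in> carrier A \<Longrightarrow> cscale A c x \<in> carrier A"
    and cscale_add_right:
      "x \<in> carrier A \<Longrightarrow> y \<in> carrier A \<Longrightarrow> cscale A c (x \<oplus> y) = cscale A c x \<oplus> cscale A c y"
    and cscale_add_left: "x \<in> carrier A \<Longrightarrow> cscale A (c + d) x = cscale A c x \<oplus> cscale A d x"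
    and cscale_cscale: "x \<in> carrier A \<Longrightarrow> cscale A c (cscale A d x) = cscale A (c * d) x"
    and cscale_one: "x \<in> carrier A \<Longrightarrow> cscale A 1 x = x"
    and cscale_mult_left:
      "x \<in> carrier A \<Longrightarrow> y \<in> carrier A \<Longrightarrow> cscale A c x \<otimes> y = cscale A c (x \<otimes> y)"
    and cscale_mult_right:
      "x \<in> carrier A \<Longrightarrow> y \<in> carrier A \<Longrightarrow> x \<otimes> cscale A c y = cscale A c (x \<otimes> y)"
    and star_closed: "x \<in> carrier A \<Longrightarrow> star A x \<in> carrier A"
    and star_star: "x \<in> carrier A \<Longrightarrow> star A (star A x) = x"
    and star_add: "x \<in> carrier A \<Longrightarrow> y \<in> carrier A \<Longrightarrow> star A (x \<oplus> y) = star A x \<oplus> star A y"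
    and star_mult: "x \<in> carrier A \<Longrightarrow> y \<in> carrier A \<Longrightarrow> star A (x \<otimes> y) = star A y \<otimes> star A x"
    and star_cscale: "x \<in> carrier A \<Longrightarrow> star A (cscale A c x) = cscale A (cnj c) (star A x)"

definition cstar_seminorm :: "('a, 'e) star_alg_scheme \<Rightarrow> ('a \<Rightarrow> real) \<Rightarrow> bool" where
  "cstar_seminorm P q \<longleftrightarrow>
    (\<forall>x\<in>carrier P. 0 \<le> q x) \<and>
    (\<forall>x\<in>carrier P. \<forall>y\<in>carrier P. q (x \<oplus>\<^bsub>P\<^esub> y) \<le> q x + q y) \<and>
    (\<forall>c. \<forall>x\<in>carrier P. q (cscale P c x) = cmod c * q x) \<and>
    (\<forall>x\<in>carrier P. \<forall>y\<in>carrier P. q (x \<otimes>\<^bsub>P\<^esub> y) \<le> q x * q y) \<and>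
    (\<forall>x\<in>carrier P. q (star P x \<otimes>\<^bsub>P\<^esub> x) = (q x)\<^sup>2)"

definition cauchy_seqs :: "('a, 'e) star_alg_scheme \<Rightarrow> ('a \<Rightarrow> real) \<Rightarrow> (nat \<Rightarrow> 'a) set" where
  "cauchy_seqs P p = {f. (\<forall>k. f k \<in> carrier P) \<and>
     (\<forall>e>0. \<exists>N. \<forall>j\<ge>N. \<forall>k\<ge>N. p (f j \<ominus>\<^bsub>P\<^esub> f k) < e)}"

(* The zero algebra is not excluded, so that B(0) is allowed. *)
locale cstar_algebra = star_algebra A for A :: "('a, 'e) cstar_alg_scheme" (structure) +
  assumes cnorm_seminorm: "cstar_seminorm A (cnorm A)"
    and cnorm_definite: "x \<in> carrier A \<Longrightarrow> cnorm A x = 0 \<Longrightarrow> x = \<zero>"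
    and complete: "f \<in> cauchy_seqs A (cnorm A) \<Longrightarrow>
      \<exists>x\<in>carrier A. (\<lambda>k. cnorm A (f k \<ominus> x)) \<longlonglongrightarrow> 0"

definition star_hom ::
    "('a, 'e) star_alg_scheme \<Rightarrow> ('b, 'f) star_alg_scheme \<Rightarrow> ('a \<Rightarrow> 'b) set" where
  "star_hom A B = {f \<in> ring_hom A B.
     (\<forall>c. \<forall>x\<in>carrier A. f (cscale A c x) = cscale B c (f x)) \<and>
     (\<forall>x\<in>carrier A. f (star A x) = star B (f x))}"

definition opposite :: "('a, 'e) star_alg_scheme \<Rightarrow> ('a, 'e) star_alg_scheme" where
  "opposite A = A\<lparr>mult := (\<lambda>x y. y \<otimes>\<^bsub>A\<^esub> x)\<rparr>"

definition complex_cstar :: "complex cstar_alg" where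
  "complex_cstar = \<lparr>carrier = UNIV, mult = (*), one = 1, zero = 0, add = (+),
     cscale = (*), star = cnj, cnorm = cmod\<rparr>"

inductive_set star_generated :: "('a, 'e) star_alg_scheme \<Rightarrow> 'a set \<Rightarrow> 'a set"
  for A :: "('a, 'e) star_alg_scheme" and S :: "'a set" where
  incl: "x \<in> S \<Longrightarrow> x \<in> star_generated A S"
| one: "\<one>\<^bsub>A\<^esub> \<in> star_generated A S"
| add: "x \<in> star_generated A S \<Longrightarrow> y \<in> star_generated A S \<Longrightarrow> x \<oplus>\<^bsub>A\<^esub> y \<in> star_generated A S"
| mult: "x \<in> star_generated A S \<Longrightarrow> y \<in> star_generated A S \<Longrightarrow> x \<otimes>\<^bsub>A\<^esub> y \<in> star_generated A S"
| cscale: "x \<in> star_generated A S \<Longrightarrow> cscale A c x \<in> star_generated A S"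
| star: "x \<in> star_generated A S \<Longrightarrow> star A x \<in> star_generated A S"

definition cnorm_closure :: "('a, 'e) cstar_alg_scheme \<Rightarrow> 'a set \<Rightarrow> 'a set" where
  "cnorm_closure A S = {x \<in> carrier A. \<forall>e>0. \<exists>y\<in>S. cnorm A (x \<ominus>\<^bsub>A\<^esub> y) < e}"

definition closed_ideal_generated :: "('a, 'e) cstar_alg_scheme \<Rightarrow> 'a set \<Rightarrow> 'a set" where
  "closed_ideal_generated A S = \<Inter>{I. ideal I A \<and> cnorm_closure A I \<subseteq> I \<and> S \<subseteq> I}"

text \<open>
  \<open>univ_cstar P R\<close> is the universal (enveloping) C*-algebra of the unital *-algebra \<open>P\<close> subject to
  the relations \<open>r = 0\<close>, \<open>r \<in> R\<close>: the Hausdorff completion of \<open>P\<close>, by classes of Cauchy sequences,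
  for the largest C*-seminorm that vanishes on \<open>R\<close>.  It is meaningful whenever the supremum below
  is finite on every element; this is so in all the uses below, because the generators are
  projections or are elements of C*-algebras, on which every C*-seminorm is at most the norm.
\<close>

definition univ_seminorm :: "('a, 'e) star_alg_scheme \<Rightarrow> 'a set \<Rightarrow> 'a \<Rightarrow> real" where
  "univ_seminorm P R x = (SUP q\<in>{q. cstar_seminorm P q \<and> (\<forall>r\<in>R. q r = 0)}. q x)"

definition null_rel ::
    "('a, 'e) star_alg_scheme \<Rightarrow> ('a \<Rightarrow> real) \<Rightarrow> ((nat \<Rightarrow> 'a) \<times> (nat \<Rightarrow> 'a)) set" where
  "null_rel P p = {(f, g). f \<in> cauchy_seqs P p \<and> g \<in> cauchy_seqs P p \<and>
     (\<lambda>k. p (f k \<ominus>\<^bsub>P\<^esub> g k)) \<longlonglongrightarrow> 0}"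

definition completion ::
    "('a, 'e) star_alg_scheme \<Rightarrow> ('a \<Rightarrow> real) \<Rightarrow> ((nat \<Rightarrow> 'a) set) cstar_alg" where
  "completion P p = \<lparr>
     carrier = cauchy_seqs P p // null_rel P p,
     mult = (\<lambda>X Y. \<Union>f\<in>X. \<Union>g\<in>Y. null_rel P p `` {\<lambda>k. f k \<otimes>\<^bsub>P\<^esub> g k}),
     one = null_rel P p `` {\<lambda>k. \<one>\<^bsub>P\<^esub>},
     zero = null_rel P p `` {\<lambda>k. \<zero>\<^bsub>P\<^esub>},
     add = (\<lambda>X Y. \<Union>f\<in>X. \<Union>g\<in>Y. null_rel P p `` {\<lambda>k. f k \<oplus>\<^bsub>P\<^esub> g k}),
     cscale = (\<lambda>c X. \<Union>f\<in>X. null_rel P p `` {\<lambda>k. cscale P c (f k)}),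
     star = (\<lambda>X. \<Union>f\<in>X. null_rel P p `` {\<lambda>k. star P (f k)}),
     cnorm = (\<lambda>X. THE r. \<forall>f\<in>X. (\<lambda>k. p (f k)) \<longlonglongrightarrow> r)\<rparr>"

definition univ_cstar ::
    "('a, 'e) star_alg_scheme \<Rightarrow> 'a set \<Rightarrow> ((nat \<Rightarrow> 'a) set) cstar_alg" where
  "univ_cstar P R = completion P (univ_seminorm P R)"

definition univ_elem ::
    "('a, 'e) star_alg_scheme \<Rightarrow> 'a set \<Rightarrow> 'a \<Rightarrow> (nat \<Rightarrow> 'a) set" where
  "univ_elem P R x = null_rel P (univ_seminorm P R) `` {\<lambda>k. x}"

text \<open>
  A letter \<open>(x, False)\<close> stands for the generator \<open>x\<close>, a letter \<open>(x, True)\<close> for its adjoint.  Words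
  form an additively written monoid, so that the multiplication of finitely supported
  functions on words is the convolution product.
\<close>

datatype 'x star_word = StarWord (letters: "('x \<times> bool) list")

instantiation star_word :: (type) monoid_add
begin

definition zero_star_word :: "'a star_word" where
  "zero_star_word = StarWord []"

definition plus_star_word :: "'a star_word \<Rightarrow> 'a star_word \<Rightarrow> 'a star_word" where
  "plus_star_word v w = StarWord (letters v @ letters w)"

instance
  by standard (simp_all add: zero_star_word_def plus_star_word_def)

end

type_synonym 'x star_poly = "'x star_word \<Rightarrow>\<^sub>0 complex"

definition gen :: "'x \<Rightarrow> 'x star_poly" where
  "gen x = Poly_Mapping.single (StarWord [(x, False)]) 1"

definition word_star :: "'x star_word \<Rightarrow> 'x star_word" where
  "word_star w = StarWord (rev (map (\<lambda>(x, b). (x, \<not> b)) (letters w)))"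

definition poly_star :: "'x star_poly \<Rightarrow> 'x star_poly" where
  "poly_star f = (\<Sum>w\<in>Poly_Mapping.keys f.
     Poly_Mapping.single (word_star w) (cnj (Poly_Mapping.lookup f w)))"

definition poly_scale :: "complex \<Rightarrow> 'x star_poly \<Rightarrow> 'x star_poly" where
  "poly_scale c f = Poly_Mapping.single 0 c * f"

definition free_star_alg :: "'x set \<Rightarrow> 'x star_poly star_alg" where
  "free_star_alg G = \<lparr>
     carrier = {f. \<forall>w\<in>Poly_Mapping.keys f. fst ` set (letters w) \<subseteq> G},
     mult = (*), one = 1, zero = 0, add = (+),
     cscale = poly_scale, star = poly_star\<rparr>"

text \<open>
  The relations saying that \<open>d \<mapsto> gen (e d)\<close> is a unital *-homomorphism on \<open>D\<close>.
\<close>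

definition copy_relations :: "('d, 'e) star_alg_scheme \<Rightarrow> ('d \<Rightarrow> 'x) \<Rightarrow> 'x star_poly set" where
  "copy_relations D e =
     {gen (e (x \<oplus>\<^bsub>D\<^esub> y)) - (gen (e x) + gen (e y)) | x y. x \<in> carrier D \<and> y \<in> carrier D} \<union>
     {gen (e (x \<otimes>\<^bsub>D\<^esub> y)) - gen (e x) * gen (e y) | x y. x \<in> carrier D \<and> y \<in> carrier D} \<union>
     {gen (e (cscale D c x)) - poly_scale c (gen (e x)) | c x. x \<in> carrier D} \<union>
     {gen (e (star D x)) - poly_star (gen (e x)) | x. x \<in> carrier D} \<union>
     {gen (e \<one>\<^bsub>D\<^esub>) - 1}"

text \<open>
  The tensor product of C*-algebras is the maximal one, i.e. the enveloping C*-algebra of the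
  algebraic tensor product, which is the unital *-algebra generated by commuting copies of the
  two factors.  For the full algebras considered here the choice of the C*-norm is
  immaterial: a comultiplication with values in any C*-completion of the algebraic tensor
  product maps the dense *-algebra into the algebraic tensor product and so, by fullness,
  extends to a morphism into the maximal one, which maps onto all the others.
\<close>

definition tensor_gens ::
    "('a, 'e) cstar_alg_scheme \<Rightarrow> ('b, 'f) cstar_alg_scheme \<Rightarrow> ('a + 'b) star_poly star_alg" where
  "tensor_gens A B = free_star_alg (Inl ` carrier A \<union> Inr ` carrier B)"

definition tensor_rels ::
    "('a, 'e) cstar_alg_scheme \<Rightarrow> ('b, 'f) cstar_alg_scheme \<Rightarrow> ('a + 'b) star_poly set" where
  "tensor_rels A B = copy_relations A Inl \<union> copy_relations B Inr \<union>
     {gen (Inl x) * gen (Inr y) - gen (Inr y) * gen (Inl x) | x y.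
        x \<in> carrier A \<and> y \<in> carrier B}"

definition max_tensor ::
    "('a, 'e) cstar_alg_scheme \<Rightarrow> ('b, 'f) cstar_alg_scheme \<Rightarrow>
     (nat \<Rightarrow> ('a + 'b) star_poly) set cstar_alg" where
  "max_tensor A B = univ_cstar (tensor_gens A B) (tensor_rels A B)"

definition tensor_elem ::
    "('a, 'e) cstar_alg_scheme \<Rightarrow> ('b, 'f) cstar_alg_scheme \<Rightarrow> 'a \<Rightarrow> 'b \<Rightarrow>
     (nat \<Rightarrow> ('a + 'b) star_poly) set" where
  "tensor_elem A B x y =
     univ_elem (tensor_gens A B) (tensor_rels A B) (gen (Inl x) * gen (Inr y))"

text \<open>
  The free product \<open>B\<^sup>*\<^sup>n * A\<close> of unital C*-algebras, where \<open>n\<close> is the cardinality of the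
  index type \<open>'n\<close>: \<open>Inl (i, x)\<close> is \<open>x\<close> in the \<open>i\<close>-th copy of \<open>B\<close>, and \<open>Inr y\<close> is \<open>y\<close> in \<open>A\<close>.
\<close>

definition free_prod_gens ::
    "('b, 'e) cstar_alg_scheme \<Rightarrow> ('a, 'f) cstar_alg_scheme \<Rightarrow>
     ('n \<times> 'b + 'a) star_poly star_alg" where
  "free_prod_gens B A = free_star_alg (Inl ` (UNIV \<times> carrier B) \<union> Inr ` carrier A)"

definition free_prod_rels ::
    "('b, 'e) cstar_alg_scheme \<Rightarrow> ('a, 'f) cstar_alg_scheme \<Rightarrow> ('n \<times> 'b + 'a) star_poly set" where
  "free_prod_rels B A =
     (\<Union>i. copy_relations B (\<lambda>x. Inl (i, x))) \<union> copy_relations A Inr"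

definition free_prod ::
    "('b, 'e) cstar_alg_scheme \<Rightarrow> ('a, 'f) cstar_alg_scheme \<Rightarrow>
     (nat \<Rightarrow> ('n \<times> 'b + 'a) star_poly) set cstar_alg" where
  "free_prod B A = univ_cstar (free_prod_gens B A) (free_prod_rels B A)"

definition free_prod_inl ::
    "('b, 'e) cstar_alg_scheme \<Rightarrow> ('a, 'f) cstar_alg_scheme \<Rightarrow> 'n \<Rightarrow> 'b \<Rightarrow>
     (nat \<Rightarrow> ('n \<times> 'b + 'a) star_poly) set" where
  "free_prod_inl B A i x =
     univ_elem (free_prod_gens B A) (free_prod_rels B A) (gen (Inl (i, x)))"

definition free_prod_inr ::
    "('b, 'e) cstar_alg_scheme \<Rightarrow> ('a, 'f) cstar_alg_scheme \<Rightarrow> 'a \<Rightarrow>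
     (nat \<Rightarrow> ('n \<times> 'b + 'a) star_poly) set" where
  "free_prod_inr B A y =
     univ_elem (free_prod_gens B A) (free_prod_rels B A) (gen (Inr y))"

definition magic_unitary ::
    "('a, 'e) star_alg_scheme \<Rightarrow> ('n::finite \<Rightarrow> 'n \<Rightarrow> 'a) \<Rightarrow> bool" where
  "magic_unitary A u \<longleftrightarrow>
    (\<forall>i j. u i j \<in> carrier A \<and> u i j \<otimes>\<^bsub>A\<^esub> u i j = u i j \<and> star A (u i j) = u i j) \<and>
    (\<forall>i j k. j \<noteq> k \<longrightarrow> u i j \<otimes>\<^bsub>A\<^esub> u i k = \<zero>\<^bsub>A\<^esub>) \<and>
    (\<forall>i j k. i \<noteq> k \<longrightarrow> u i j \<otimes>\<^bsub>A\<^esub> u k j = \<zero>\<^bsub>A\<^esub>) \<and>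
    (\<forall>i. (\<Oplus>\<^bsub>A\<^esub>j\<in>UNIV. u i j) = \<one>\<^bsub>A\<^esub>) \<and>
    (\<forall>j. (\<Oplus>\<^bsub>A\<^esub>i\<in>UNIV. u i j) = \<one>\<^bsub>A\<^esub>)"

abbreviation entries :: "('n \<Rightarrow> 'n \<Rightarrow> 'a) \<Rightarrow> 'a set" where
  "entries u \<equiv> {u i j | i j. True}"

text \<open>The last conjunct is fullness: the norm is the largest C*-seminorm on the dense *-algebra
  generated by the entries of \<open>u\<close>.\<close>

definition quantum_permutation_algebra ::
    "('a, 'e) cstar_alg_scheme \<Rightarrow> ('n::finite \<Rightarrow> 'n \<Rightarrow> 'a) \<Rightarrow> bool" where
  "quantum_permutation_algebra A u \<longleftrightarrow>
    cstar_algebra A \<and> magic_unitary A u \<and>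
    cnorm_closure A (star_generated A (entries u)) = carrier A \<and>
    (\<exists>\<Delta>\<in>star_hom A (max_tensor A A). \<forall>i j.
       \<Delta> (u i j) = (\<Oplus>\<^bsub>max_tensor A A\<^esub>k\<in>UNIV. tensor_elem A A (u i k) (u k j))) \<and>
    (\<exists>\<epsilon>\<in>star_hom A complex_cstar. \<forall>i j. \<epsilon> (u i j) = of_bool (i = j)) \<and>
    (\<exists>S\<in>star_hom A (opposite A). \<forall>i j. S (u i j) = u j i) \<and>
    (\<forall>q. cstar_seminorm (A\<lparr>carrier := star_generated A (entries u)\<rparr>) q \<longrightarrow>
       (\<forall>x\<in>star_generated A (entries u). q x \<le> cnorm A x))"

definition maps_onto ::
    "('a, 'e) cstar_alg_scheme \<Rightarrow> ('n \<Rightarrow> 'n \<Rightarrow> 'a) \<Rightarrow>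
     ('b, 'f) cstar_alg_scheme \<Rightarrow> ('n \<Rightarrow> 'n \<Rightarrow> 'b) \<Rightarrow> bool" where
  "maps_onto A u B v \<longleftrightarrow>
    (\<exists>f\<in>star_hom A B. f ` carrier A = carrier B \<and> (\<forall>i j. f (u i j) = v i j))"

definition qpa_quotient ::
    "('b, 'f) cstar_alg_scheme \<Rightarrow> ('n::finite \<Rightarrow> 'n \<Rightarrow> 'b) \<Rightarrow>
     ('a, 'e) cstar_alg_scheme \<Rightarrow> ('n \<Rightarrow> 'n \<Rightarrow> 'a) \<Rightarrow> bool" where
  "qpa_quotient B v A u \<longleftrightarrow>
    quantum_permutation_algebra B v \<and> quantum_permutation_algebra A u \<and> maps_onto A u B v"

definition magic_relations :: "('n::finite \<times> 'n) star_poly set" where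
  "magic_relations =
     {gen (i, j) * gen (i, j) - gen (i, j) | i j. True} \<union>
     {poly_star (gen (i, j)) - gen (i, j) | i j. True} \<union>
     {gen (i, j) * gen (i, k) | i j k. j \<noteq> k} \<union>
     {gen (i, j) * gen (k, j) | i j k. i \<noteq> k} \<union>
     {(\<Sum>j\<in>UNIV. gen (i, j)) - 1 | i. True} \<union>
     {(\<Sum>i\<in>UNIV. gen (i, j)) - 1 | j. True}"

definition A_s :: "(nat \<Rightarrow> ('n::finite \<times> 'n) star_poly) set cstar_alg" where
  "A_s = univ_cstar (free_star_alg UNIV) magic_relations"

definition A_s_gen :: "'n::finite \<Rightarrow> 'n \<Rightarrow> (nat \<Rightarrow> ('n \<times> 'n) star_poly) set" where
  "A_s_gen i j = univ_elem (free_star_alg UNIV) magic_relations (gen (i, j))"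

definition factors_through ::
    "('c, 'f) cstar_alg_scheme \<Rightarrow> ((nat \<Rightarrow> ('n::finite \<times> 'n) star_poly) set \<Rightarrow> 'c) \<Rightarrow>
     ('a, 'e) cstar_alg_scheme \<Rightarrow> ('n \<Rightarrow> 'n \<Rightarrow> 'a) \<Rightarrow> bool" where
  "factors_through C \<pi> A u \<longleftrightarrow>
    (\<exists>f\<in>star_hom A_s A. \<exists>g\<in>star_hom A C.
       (\<forall>i j. f (A_s_gen i j) = u i j) \<and> (\<forall>x\<in>carrier A_s. \<pi> x = g (f x)))"

text \<open>
  In the two minimality clauses the competing algebras are those whose carrier is a set of
  real numbers.  This is no restriction: a C*-algebra generated by finitely many elements is
  separable, so it has at most continuum many elements and is isomorphic to one of these.
\<close>

definition hopf_image ::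
    "('c, 'f) cstar_alg_scheme \<Rightarrow> ((nat \<Rightarrow> ('n::finite \<times> 'n) star_poly) set \<Rightarrow> 'c) \<Rightarrow>
     ('a, 'e) cstar_alg_scheme \<Rightarrow> ('n \<Rightarrow> 'n \<Rightarrow> 'a) \<Rightarrow> bool" where
  "hopf_image C \<pi> A u \<longleftrightarrow>
    quantum_permutation_algebra A u \<and> factors_through C \<pi> A u \<and>
    (\<forall>(A' :: real cstar_alg) u'.
       quantum_permutation_algebra A' u' \<and> factors_through C \<pi> A' u' \<longrightarrow> maps_onto A' u' A u)"

definition common_hopf_image ::
    "('c, 'f) cstar_alg_scheme \<Rightarrow> ('i \<Rightarrow> (nat \<Rightarrow> ('n::finite \<times> 'n) star_poly) set \<Rightarrow> 'c) \<Rightarrow>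
     ('a, 'e) cstar_alg_scheme \<Rightarrow> ('n \<Rightarrow> 'n \<Rightarrow> 'a) \<Rightarrow> bool" where
  "common_hopf_image C \<pi> A u \<longleftrightarrow>
    quantum_permutation_algebra A u \<and> (\<forall>i. factors_through C (\<pi> i) A u) \<and>
    (\<forall>(A' :: real cstar_alg) u'.
       quantum_permutation_algebra A' u' \<and> (\<forall>i. factors_through C (\<pi> i) A' u') \<longrightarrow>
       maps_onto A' u' A u)"

definition represents ::
    "('c, 'f) cstar_alg_scheme \<Rightarrow> ((nat \<Rightarrow> ('n::finite \<times> 'n) star_poly) set \<Rightarrow> 'c) \<Rightarrow>
     ('n \<Rightarrow> 'n \<Rightarrow> 'c) \<Rightarrow> bool" where
  "represents C \<pi> U \<longleftrightarrow> \<pi> \<in> star_hom A_s C \<and> (\<forall>i j. \<pi> (A_s_gen i j) = U i j)"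

definition hopf_image_for ::
    "('c, 'f) cstar_alg_scheme \<Rightarrow> ('n::finite \<Rightarrow> 'n \<Rightarrow> 'c) \<Rightarrow>
     ('a, 'e) cstar_alg_scheme \<Rightarrow> ('n \<Rightarrow> 'n \<Rightarrow> 'a) \<Rightarrow> bool" where
  "hopf_image_for C U A u \<longleftrightarrow> (\<exists>\<pi>. represents C \<pi> U \<and> hopf_image C \<pi> A u)"

definition common_hopf_image_for ::
    "('c, 'f) cstar_alg_scheme \<Rightarrow> ('i \<Rightarrow> 'n::finite \<Rightarrow> 'n \<Rightarrow> 'c) \<Rightarrow>
     ('a, 'e) cstar_alg_scheme \<Rightarrow> ('n \<Rightarrow> 'n \<Rightarrow> 'a) \<Rightarrow> bool" where
  "common_hopf_image_for C V A u \<longleftrightarrow>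
    (\<exists>\<pi>. (\<forall>i. represents C (\<pi> i) (V i)) \<and> common_hopf_image C \<pi> A u)"

definition wreath_commutators ::
    "('b, 'f) cstar_alg_scheme \<Rightarrow> ('m \<Rightarrow> 'm \<Rightarrow> 'b) \<Rightarrow> ('a, 'e) cstar_alg_scheme \<Rightarrow>
     ('n \<Rightarrow> 'n \<Rightarrow> 'a) \<Rightarrow> (nat \<Rightarrow> ('n \<times> 'b + 'a) star_poly) set set" where
  "wreath_commutators B v A u =
     {(free_prod_inl B A i (v a b) \<otimes>\<^bsub>free_prod B A\<^esub> free_prod_inr B A (u i j))
        \<ominus>\<^bsub>free_prod B A\<^esub>
      (free_prod_inr B A (u i j) \<otimes>\<^bsub>free_prod B A\<^esub> free_prod_inl B A i (v a b)) | i j a b. True}"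

text \<open>
  \<open>(Q, w)\<close> is the free wreath product of \<open>(B, v)\<close> by \<open>(A, u)\<close>.  The quotient of the free product
  by the closed ideal generated by the commutators is given, up to isomorphism, as a
  C*-algebra \<open>Q\<close> with a morphism onto \<open>Q\<close> whose kernel is that ideal.
\<close>

definition free_wreath_product ::
    "('b, 'f) cstar_alg_scheme \<Rightarrow> ('m::finite \<Rightarrow> 'm \<Rightarrow> 'b) \<Rightarrow> ('a, 'e) cstar_alg_scheme \<Rightarrow>
     ('n::finite \<Rightarrow> 'n \<Rightarrow> 'a) \<Rightarrow> ('q, 'g) cstar_alg_scheme \<Rightarrow>
     ('n \<times> 'm \<Rightarrow> 'n \<times> 'm \<Rightarrow> 'q) \<Rightarrow> bool" where
  "free_wreath_product B v A u Q w \<longleftrightarrow>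
    cstar_algebra Q \<and>
    (\<exists>p\<in>star_hom (free_prod B A) Q.
       p ` carrier (free_prod B A) = carrier Q \<and>
       a_kernel (free_prod B A) Q p =
         closed_ideal_generated (free_prod B A) (wreath_commutators B v A u) \<and>
       (\<forall>i a j b. w (i, a) (j, b) =
          p (free_prod_inl B A i (v a b) \<otimes>\<^bsub>free_prod B A\<^esub> free_prod_inr B A (u i j))))"

class chilbert_space = banach +
  fixes scaleC :: "complex \<Rightarrow> 'a \<Rightarrow> 'a" (infixr "*\<^sub>C" 75)
    and cinner :: "'a \<Rightarrow> 'a \<Rightarrow> complex"
  assumes scaleC_add_right: "c *\<^sub>C (x + y) = c *\<^sub>C x + c *\<^sub>C y"
    and scaleC_add_left: "(c + d) *\<^sub>C x = c *\<^sub>C x + d *\<^sub>C x"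
    and scaleC_scaleC: "c *\<^sub>C d *\<^sub>C x = (c * d) *\<^sub>C x"
    and scaleC_of_real: "complex_of_real r *\<^sub>C x = r *\<^sub>R x"
    and cinner_commute: "cinner x y = cnj (cinner y x)"
    and cinner_add_right: "cinner x (y + z) = cinner x y + cinner x z"
    and cinner_scaleC_right: "cinner x (c *\<^sub>C y) = c * cinner x y"
    and cinner_self: "cinner x x = complex_of_real ((norm x)\<^sup>2)"

definition bounded_ops :: "('h::chilbert_space \<Rightarrow> 'h) cstar_alg" where
  "bounded_ops = \<lparr>
     carrier = {T. bounded_linear T \<and> (\<forall>c x. T (c *\<^sub>C x) = c *\<^sub>C T x)},
     mult = (\<circ>), one = id, zero = (\<lambda>x. 0), add = (\<lambda>S T x. S x + T x),
     cscale = (\<lambda>c T x. c *\<^sub>C T x),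
     star = (\<lambda>T. THE T'. \<forall>x y. cinner (T' x) y = cinner x (T y)),
     cnorm = onorm\<rparr>"

text \<open>
  \<open>t\<close> exhibits the Hilbert space \<open>'l\<close> as the tensor product of \<open>'h\<close> and \<open>'k\<close>, with simple tensors
  \<open>t x y\<close>; this determines \<open>'l\<close> and \<open>t\<close> up to a unique unitary.  The real span of the
  simple tensors is their complex span, as \<open>t\<close> is complex linear in \<open>x\<close>.
\<close>

definition hilbert_tensor ::
    "('h::chilbert_space \<Rightarrow> 'k::chilbert_space \<Rightarrow> 'l::chilbert_space) \<Rightarrow> bool" where
  "hilbert_tensor t \<longleftrightarrow>
    (\<forall>x x' y. t (x + x') y = t x y + t x' y) \<and>
    (\<forall>x y y'. t x (y + y') = t x y + t x y') \<and>
    (\<forall>c x y. t (c *\<^sub>C x) y = c *\<^sub>C t x y) \<and>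
    (\<forall>c x y. t x (c *\<^sub>C y) = c *\<^sub>C t x y) \<and>
    (\<forall>x x' y y'. cinner (t x y) (t x' y') = cinner x x' * cinner y y') \<and>
    closure (span (\<Union>x. range (t x))) = UNIV"

definition op_tensor ::
    "('h::chilbert_space \<Rightarrow> 'k::chilbert_space \<Rightarrow> 'l::chilbert_space) \<Rightarrow>
     ('h \<Rightarrow> 'h) \<Rightarrow> ('k \<Rightarrow> 'k) \<Rightarrow> 'l \<Rightarrow> 'l" where
  "op_tensor t S T =
     (THE X. X \<in> carrier bounded_ops \<and> (\<forall>x y. X (t x y) = t (S x) (T y)))"

definition dita_product ::
    "('h::chilbert_space \<Rightarrow> 'k::chilbert_space \<Rightarrow> 'l::chilbert_space) \<Rightarrow>
     ('n \<Rightarrow> 'n \<Rightarrow> 'h \<Rightarrow> 'h) \<Rightarrow> ('n \<Rightarrow> 'm \<Rightarrow> 'm \<Rightarrow> 'k \<Rightarrow> 'k) \<Rightarrow>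
     'n \<times> 'm \<Rightarrow> 'n \<times> 'm \<Rightarrow> 'l \<Rightarrow> 'l" where
  "dita_product t U V = (\<lambda>(i, a) (j, b). op_tensor t (U i j) (V i a b))"

end

theory Submission
  imports Defs
begin

text \<open>The free wreath product \<open>Q\<close> of \<open>B\<close> and \<open>A\<close> is itself a full quantum permutation algebra: its structure maps
  come from those of \<open>A\<close> and \<open>B\<close> by the universal property, and the copies of \<open>A\<close> and \<open>B\<close> are recovered from
  the magic unitary by summing \<open>w\<^bsub>ia,jb\<^esub>\<close> over \<open>b\<close> and over \<open>j\<close>, so that \<open>w\<close> generates. The maps of \<open>A\<close> into
  \<open>B(H) \<otimes> 1\<close> and of the \<open>i\<close>-th copy of \<open>B\<close> into \<open>1 \<otimes> B(K)\<close> have commuting ranges, hence define a map of \<open>Q\<close>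
  into the bounded operators sending \<open>w\<close> to the Dita product. Minimality of the Hopf image then
  yields the quotient map.\<close>

section \<open>C*-seminorms and their completions\<close>

text \<open>Morphisms are purely algebraic here: \<open>star_hom\<close> has no norm clause, and
  fullness and the universal norms are stated through C*-seminorms. The analysis rests on one fact:
  a C*-seminorm on a C*-algebra is at most its norm. It makes morphisms contractive and their
  kernels closed, and it bounds the seminorms on copies of C*-algebras. Fullness of \<open>Q\<close>
  also comes from it: complete the *-algebra generated by \<open>w\<close> for an arbitrary
  C*-seminorm; fullness of A and B extends their copies to morphisms into the completion, and the
  resulting morphism on \<open>Q\<close> is contractive. The comultiplication and the antipode on
  the i-th copy of B are forced: sum the prescribed values on \<open>w (i, a) (j, b)\<close> over
  \<open>j\<close>. What appears is a sum of morphisms weighted by the projections of a row or a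
  column of \<open>u\<close>; it is again a morphism because each summand commutes with its weight.
  Minimality of the Hopf image is stated for competitors carried by sets of reals, so
  \<open>Q\<close> is first moved onto such a set, which is possible because \<open>Q\<close> is
  separable.\<close>

context star_algebra
begin

lemmas star_alg_closed [simp] = cscale_closed star_closed
lemmas star_alg_simps [simp] = cscale_one star_star

lemma cscale_zero_left [simp]: "x \<in> carrier A \<Longrightarrow> cscale A 0 x = \<zero>"
  using cscale_add_left[of x 0 0] by (metis add.r_cancel_one' add_0 cscale_closed)

lemma cscale_zero_right [simp]: "cscale A c \<zero> = \<zero>"
  by (metis cscale_cscale cscale_zero_left mult_zero_right zero_closed)

lemma cscale_minus_one: "x \<in> carrier A \<Longrightarrow> cscale A (-1) x = \<ominus> x"
proof -
  assume x: "x \<in> carrier A"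
  have "cscale A (-1) x \<oplus> x = \<zero>"
    using cscale_add_left[of x "-1" 1] x by simp
  thus ?thesis using x by (simp add: minus_equality)
qed

lemma cscale_uminus: "x \<in> carrier A \<Longrightarrow> cscale A c (\<ominus> x) = \<ominus> (cscale A c x)"
  by (metis cscale_closed cscale_cscale cscale_minus_one mult.commute)

lemma cscale_minus:
  "x \<in> carrier A \<Longrightarrow> y \<in> carrier A \<Longrightarrow> cscale A c (x \<ominus> y) = cscale A c x \<ominus> cscale A c y"
  by (simp add: a_minus_def cscale_add_right cscale_uminus)

lemma star_zero [simp]: "star A \<zero> = \<zero>"
  using star_cscale[of \<zero> 0] by simp

lemma star_uminus: "x \<in> carrier A \<Longrightarrow> star A (\<ominus> x) = \<ominus> (star A x)"
  using star_cscale[of x "-1"] by (simp add: cscale_minus_one)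

lemma star_minus:
  "x \<in> carrier A \<Longrightarrow> y \<in> carrier A \<Longrightarrow> star A (x \<ominus> y) = star A x \<ominus> star A y"
  by (simp add: a_minus_def star_add star_uminus)

lemma star_one [simp]: "star A \<one> = \<one>"
  by (metis l_one one_closed r_one star_closed star_mult star_star)

lemma cscale_finsum:
  assumes "f \<in> I \<rightarrow> carrier A"
  shows "cscale A c (finsum A f I) = finsum A (\<lambda>i. cscale A c (f i)) I"
  using assms
  by (induction I rule: infinite_finite_induct) (simp_all add: cscale_add_right Pi_iff)

lemma star_finsum:
  assumes "f \<in> I \<rightarrow> carrier A"
  shows "star A (finsum A f I) = finsum A (\<lambda>i. star A (f i)) I"
  using assms
  by (induction I rule: infinite_finite_induct) (simp_all add: star_add Pi_iff)

lemma minus_add_cancel: "x \<in> carrier A \<Longrightarrow> y \<in> carrier A \<Longrightarrow> (x \<ominus> y) \<oplus> y = x"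
  by (simp add: a_minus_def a_assoc l_neg)

lemma minus_eq_zero_iff: "x \<in> carrier A \<Longrightarrow> y \<in> carrier A \<Longrightarrow> x \<ominus> y = \<zero> \<longleftrightarrow> x = y"
  using minus_add_cancel[of x y] by (auto simp: a_minus_def r_neg)

lemma minus_split:
  "x \<in> carrier A \<Longrightarrow> y \<in> carrier A \<Longrightarrow> z \<in> carrier A \<Longrightarrow> x \<ominus> z = (x \<ominus> y) \<oplus> (y \<ominus> z)"
  by (simp add: a_minus_def a_assoc r_neg1)

lemma add_minus_add:
  "x \<in> carrier A \<Longrightarrow> y \<in> carrier A \<Longrightarrow> x' \<in> carrier A \<Longrightarrow> y' \<in> carrier A \<Longrightarrow>
   (x \<oplus> y) \<ominus> (x' \<oplus> y') = (x \<ominus> x') \<oplus> (y \<ominus> y')"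
  by (simp add: a_minus_def minus_add a_ac)

text \<open>The splitting behind joint continuity of the product: each term contains one difference,
  and the other factor stays bounded along convergent or Cauchy sequences.\<close>

lemma mult_minus_mult:
  assumes "x \<in> carrier A" "y \<in> carrier A" "x' \<in> carrier A" "y' \<in> carrier A"
  shows "x \<otimes> y \<ominus> x' \<otimes> y' = x \<otimes> (y \<ominus> y') \<oplus> (x \<ominus> x') \<otimes> y'"
proof -
  have "x \<otimes> (y \<ominus> y') \<oplus> (x \<ominus> x') \<otimes> y' = (x \<otimes> y \<ominus> x \<otimes> y') \<oplus> (x \<otimes> y' \<ominus> x' \<otimes> y')"
    using assms by (simp add: a_minus_def l_distr r_distr l_minus r_minus)
  thus ?thesis using assms minus_split[of "x \<otimes> y" "x \<otimes> y'" "x' \<otimes> y'"] by simp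
qed

end

lemma star_hom_closed: "f \<in> star_hom A B \<Longrightarrow> x \<in> carrier A \<Longrightarrow> f x \<in> carrier B"
  by (auto simp: star_hom_def ring_hom_def)

lemma star_hom_add: "f \<in> star_hom A B \<Longrightarrow> x \<in> carrier A \<Longrightarrow> y \<in> carrier A \<Longrightarrow>
    f (x \<oplus>\<^bsub>A\<^esub> y) = f x \<oplus>\<^bsub>B\<^esub> f y"
  by (auto simp: star_hom_def ring_hom_def)

lemma star_hom_mult: "f \<in> star_hom A B \<Longrightarrow> x \<in> carrier A \<Longrightarrow> y \<in> carrier A \<Longrightarrow>
    f (x \<otimes>\<^bsub>A\<^esub> y) = f x \<otimes>\<^bsub>B\<^esub> f y"
  by (auto simp: star_hom_def ring_hom_def)

lemma star_hom_one: "f \<in> star_hom A B \<Longrightarrow> f \<one>\<^bsub>A\<^esub> = \<one>\<^bsub>B\<^esub>"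
  by (auto simp: star_hom_def ring_hom_def)

lemma star_hom_cscale: "f \<in> star_hom A B \<Longrightarrow> x \<in> carrier A \<Longrightarrow> f (cscale A c x) = cscale B c (f x)"
  by (auto simp: star_hom_def)

lemma star_hom_star: "f \<in> star_hom A B \<Longrightarrow> x \<in> carrier A \<Longrightarrow> f (star A x) = star B (f x)"
  by (auto simp: star_hom_def)

lemma star_homI:
  assumes "\<And>x. x \<in> carrier A \<Longrightarrow> f x \<in> carrier B"
    and "\<And>x y. x \<in> carrier A \<Longrightarrow> y \<in> carrier A \<Longrightarrow> f (x \<oplus>\<^bsub>A\<^esub> y) = f x \<oplus>\<^bsub>B\<^esub> f y"
    and "\<And>x y. x \<in> carrier A \<Longrightarrow> y \<in> carrier A \<Longrightarrow> f (x \<otimes>\<^bsub>A\<^esub> y) = f x \<otimes>\<^bsub>B\<^esub> f y"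
    and "f \<one>\<^bsub>A\<^esub> = \<one>\<^bsub>B\<^esub>"
    and "\<And>c x. x \<in> carrier A \<Longrightarrow> f (cscale A c x) = cscale B c (f x)"
    and "\<And>x. x \<in> carrier A \<Longrightarrow> f (star A x) = star B (f x)"
  shows "f \<in> star_hom A B"
  using assms by (auto simp: star_hom_def ring_hom_def)

lemma star_hom_comp: "f \<in> star_hom A B \<Longrightarrow> g \<in> star_hom B C \<Longrightarrow> (\<lambda>x. g (f x)) \<in> star_hom A C"
  by (auto simp: star_hom_def ring_hom_def Pi_iff)

text \<open>\<open>ring_hom\<close> has no clause for zero; compatibility with scaling by 0 supplies
  it.\<close>

lemma star_hom_zero:
  assumes "star_algebra A" "star_algebra B" "f \<in> star_hom A B"
  shows "f \<zero>\<^bsub>A\<^esub> = \<zero>\<^bsub>B\<^esub>"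
proof -
  interpret A: star_algebra A by fact
  interpret B: star_algebra B by fact
  show ?thesis using star_hom_cscale[OF assms(3), of "\<zero>\<^bsub>A\<^esub>" 0] star_hom_closed[OF assms(3)] by simp
qed

lemma star_hom_uminus:
  assumes "star_algebra A" "star_algebra B" "f \<in> star_hom A B" "x \<in> carrier A"
  shows "f (\<ominus>\<^bsub>A\<^esub> x) = \<ominus>\<^bsub>B\<^esub> f x"
proof -
  interpret A: star_algebra A by fact
  interpret B: star_algebra B by fact
  show ?thesis
    using star_hom_cscale[OF assms(3), of x "-1"] star_hom_closed[OF assms(3)] assms
    by (simp add: A.cscale_minus_one B.cscale_minus_one)
qed

lemma star_hom_minus:
  assumes "star_algebra A" "star_algebra B" "f \<in> star_hom A B" "x \<in> carrier A" "y \<in> carrier A"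
  shows "f (x \<ominus>\<^bsub>A\<^esub> y) = f x \<ominus>\<^bsub>B\<^esub> f y"
proof -
  interpret A: star_algebra A by fact
  interpret B: star_algebra B by fact
  show ?thesis
    using star_hom_add[OF assms(3), of x "\<ominus>\<^bsub>A\<^esub> y"] star_hom_uminus[OF assms(1-3)] assms
    by (simp add: a_minus_def)
qed

lemma star_hom_finsum:
  assumes "star_algebra A" "star_algebra B" "f \<in> star_hom A B" "g \<in> I \<rightarrow> carrier A"
  shows "f (finsum A g I) = finsum B (\<lambda>i. f (g i)) I"
proof -
  interpret A: star_algebra A by fact
  interpret B: star_algebra B by fact
  show ?thesis
    using assms(4)
  proof (induction I rule: infinite_finite_induct)
    case (insert i I)
    thus ?case using star_hom_add[OF assms(3)] star_hom_closed[OF assms(3)]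
      by (simp add: Pi_iff)
  qed (simp_all add: star_hom_zero[OF assms(1-3)])
qed

section \<open>C*-seminorms and convergence in a seminormed *-algebra\<close>

locale cstar_seminormed = star_algebra A for A :: "('a, 'e) star_alg_scheme" (structure) +
  fixes q :: "'a \<Rightarrow> real"
  assumes seminorm: "cstar_seminorm A q"
begin

lemma q_nonneg [simp]: "x \<in> carrier A \<Longrightarrow> 0 \<le> q x"
  and q_add: "x \<in> carrier A \<Longrightarrow> y \<in> carrier A \<Longrightarrow> q (x \<oplus> y) \<le> q x + q y"
  and q_cscale: "x \<in> carrier A \<Longrightarrow> q (cscale A c x) = cmod c * q x"
  and q_mult: "x \<in> carrier A \<Longrightarrow> y \<in> carrier A \<Longrightarrow> q (x \<otimes> y) \<le> q x * q y"
  and q_star_mult: "x \<in> carrier A \<Longrightarrow> q (star A x \<otimes> x) = (q x)\<^sup>2"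
  using seminorm by (auto simp: cstar_seminorm_def)

lemma q_zero [simp]: "q \<zero> = 0"
  using q_cscale[of \<zero> 0] by simp

lemma q_uminus: "x \<in> carrier A \<Longrightarrow> q (\<ominus> x) = q x"
  using q_cscale[of x "-1"] by (simp add: cscale_minus_one)

lemma q_minus_commute: "x \<in> carrier A \<Longrightarrow> y \<in> carrier A \<Longrightarrow> q (x \<ominus> y) = q (y \<ominus> x)"
  using q_uminus[of "x \<ominus> y"] by (simp add: a_minus_def minus_add a_comm)

lemma q_triangle: "x \<in> carrier A \<Longrightarrow> y \<in> carrier A \<Longrightarrow> z \<in> carrier A \<Longrightarrow>
    q (x \<ominus> z) \<le> q (x \<ominus> y) + q (y \<ominus> z)"
  using q_add[of "x \<ominus> y" "y \<ominus> z"] minus_split[of x y z] by simp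

lemma q_diff: "x \<in> carrier A \<Longrightarrow> y \<in> carrier A \<Longrightarrow> \<bar>q x - q y\<bar> \<le> q (x \<ominus> y)"
  using q_triangle[of x y \<zero>] q_triangle[of y x \<zero>] q_minus_commute[of x y]
  by (simp add: a_minus_def)

text \<open>The C*-identity and submultiplicativity give
  \<open>(q x)^2 <= q (star A x) * q x\<close>. Cancelling \<open>q x\<close> gives one inequality,
  and applying it to the adjoint gives the other.\<close>

lemma q_star: "x \<in> carrier A \<Longrightarrow> q (star A x) = q x"
proof -
  have le: "q x \<le> q (star A x)" if x: "x \<in> carrier A" for x
  proof (cases "q x = 0")
    case False
    hence "0 < q x" using q_nonneg[OF x] by linarith
    moreover have "q x * q x \<le> q (star A x) * q x"
      using q_star_mult[OF x] q_mult[of "star A x" x] x by (simp add: power2_eq_square)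
    ultimately show ?thesis by simp
  qed (simp add: x)
  assume "x \<in> carrier A"
  thus ?thesis using le[of x] le[of "star A x"] by simp
qed

text \<open>The C*-identity makes the number \<open>q \<one>\<close> idempotent. The value 0 does
  occur, for seminorms that vanish identically.\<close>

lemma q_one_cases: "q \<one> = 0 \<or> q \<one> = 1"
  using q_star_mult[of \<one>] by (auto simp: power2_eq_square)

lemma q_one_le: "q \<one> \<le> 1"
  using q_one_cases by auto

lemma q_mult_minus:
  assumes "x \<in> carrier A" "y \<in> carrier A" "x' \<in> carrier A" "y' \<in> carrier A"
  shows "q (x \<otimes> y \<ominus> x' \<otimes> y') \<le> q x * q (y \<ominus> y') + q (x \<ominus> x') * q y'"
  using mult_minus_mult[OF assms] q_add[of "x \<otimes> (y \<ominus> y')" "(x \<ominus> x') \<otimes> y'"]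
    q_mult[of x "y \<ominus> y'"] q_mult[of "x \<ominus> x'" y'] assms by simp

lemma q_add_minus:
  assumes "x \<in> carrier A" "y \<in> carrier A" "x' \<in> carrier A" "y' \<in> carrier A"
  shows "q ((x \<oplus> y) \<ominus> (x' \<oplus> y')) \<le> q (x \<ominus> x') + q (y \<ominus> y')"
  using add_minus_add[OF assms(1,2,3,4)] q_add[of "x \<ominus> x'" "y \<ominus> y'"] assms by simp

text \<open>Membership in the carrier is part of convergence, so that the limit rules carry no side
  conditions.\<close>

definition tends :: "(nat \<Rightarrow> 'a) \<Rightarrow> 'a \<Rightarrow> bool" where
  "tends f x \<longleftrightarrow> (\<forall>k. f k \<in> carrier A) \<and> x \<in> carrier A \<and> (\<lambda>k. q (f k \<ominus> x)) \<longlonglongrightarrow> 0"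

lemma null_dominated:
  assumes "\<And>k. f k \<in> carrier A" "\<And>k. q (f k) \<le> d k" "d \<longlonglongrightarrow> 0"
  shows "(\<lambda>k. q (f k)) \<longlonglongrightarrow> 0"
  by (rule Lim_null_comparison[OF always_eventually, of _ d]) (use assms in auto)

lemma tends_closed: "tends f x \<Longrightarrow> f k \<in> carrier A" "tends f x \<Longrightarrow> x \<in> carrier A"
  by (auto simp: tends_def)

lemma tends_const: "x \<in> carrier A \<Longrightarrow> tends (\<lambda>_. x) x"
  by (simp add: tends_def a_minus_def r_neg)

lemma tends_q: "tends f x \<Longrightarrow> (\<lambda>k. q (f k)) \<longlonglongrightarrow> q x"
  unfolding tends_def
  by (rule LIM_zero_cancel, rule Lim_null_comparison[where g = "\<lambda>k. q (f k \<ominus> x)"])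
     (auto simp: q_diff)

lemma tends_add: "tends f x \<Longrightarrow> tends g y \<Longrightarrow> tends (\<lambda>k. f k \<oplus> g k) (x \<oplus> y)"
proof -
  assume a: "tends f x" "tends g y"
  have d: "(\<lambda>k. q (f k \<ominus> x) + q (g k \<ominus> y)) \<longlonglongrightarrow> 0 + 0"
    using a by (intro tendsto_add) (auto simp: tends_def)
  have "(\<lambda>k. q ((f k \<oplus> g k) \<ominus> (x \<oplus> y))) \<longlonglongrightarrow> 0"
    by (rule null_dominated[OF _ q_add_minus]) (use a d in \<open>simp_all add: tends_def\<close>)
  thus ?thesis using a by (simp add: tends_def)
qed

lemma tends_mult: "tends f x \<Longrightarrow> tends g y \<Longrightarrow> tends (\<lambda>k. f k \<otimes> g k) (x \<otimes> y)"
proof -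
  assume a: "tends f x" "tends g y"
  have d: "(\<lambda>k. q (f k) * q (g k \<ominus> y) + q (f k \<ominus> x) * q y) \<longlonglongrightarrow> q x * 0 + 0 * q y"
    using a tends_q[OF a(1)] by (intro tendsto_intros) (auto simp: tends_def)
  have "(\<lambda>k. q ((f k \<otimes> g k) \<ominus> (x \<otimes> y))) \<longlonglongrightarrow> 0"
    by (rule null_dominated[OF _ q_mult_minus]) (use a d in \<open>simp_all add: tends_def\<close>)
  thus ?thesis using a by (simp add: tends_def)
qed

lemma tends_cscale: "tends f x \<Longrightarrow> tends (\<lambda>k. cscale A c (f k)) (cscale A c x)"
proof -
  assume a: "tends f x"
  have "(\<lambda>k. cmod c * q (f k \<ominus> x)) \<longlonglongrightarrow> cmod c * 0"
    using a by (intro tendsto_intros) (auto simp: tends_def)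
  thus ?thesis using a by (simp add: tends_def cscale_minus[symmetric] q_cscale)
qed

lemma tends_star: "tends f x \<Longrightarrow> tends (\<lambda>k. star A (f k)) (star A x)"
  by (simp add: tends_def star_minus[symmetric] q_star)

lemma tends_minus: "tends f x \<Longrightarrow> tends g y \<Longrightarrow> tends (\<lambda>k. f k \<ominus> g k) (x \<ominus> y)"
  using tends_add[OF _ tends_cscale[of g y "-1"], of f x]
  by (simp add: cscale_minus_one tends_closed a_minus_def)

lemma tends_dist: "tends f x \<Longrightarrow> tends g y \<Longrightarrow> (\<lambda>k. q (f k \<ominus> g k)) \<longlonglongrightarrow> q (x \<ominus> y)"
  by (rule tends_q[OF tends_minus])

lemma cauchy_seqsI:
  assumes "\<And>k. f k \<in> carrier A"
    and "\<And>e. e > 0 \<Longrightarrow> \<exists>N. \<forall>j\<ge>N. \<forall>k\<ge>N. q (f j \<ominus> f k) < e"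
  shows "f \<in> cauchy_seqs A q"
  using assms by (simp add: cauchy_seqs_def)

text \<open>A Cauchy criterion that does not order the two indices. It serves convergent sequences,
  with the distance to the limit as \<open>d\<close>, and the geometric estimate of the square-root
  iteration.\<close>

lemma cauchy_seqs_dominated:
  assumes f: "\<And>k. f k \<in> carrier A" and d: "(\<lambda>k. d k) \<longlonglongrightarrow> (0::real)"
    and b: "\<And>j k. q (f j \<ominus> f k) \<le> d j + d k"
  shows "f \<in> cauchy_seqs A q"
proof (rule cauchy_seqsI[OF f])
  fix e :: real assume "e > 0"
  then obtain N where N: "\<forall>k\<ge>N. \<bar>d k\<bar> < e / 2"
    using LIMSEQ_D[OF d, of "e / 2"] by auto
  have "q (f j \<ominus> f k) < e" if "j \<ge> N" "k \<ge> N" for j k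
    using N[rule_format, OF that(1)] N[rule_format, OF that(2)] b[of j k] by linarith
  thus "\<exists>N. \<forall>j\<ge>N. \<forall>k\<ge>N. q (f j \<ominus> f k) < e" by blast
qed

lemma tends_cauchy: "tends f x \<Longrightarrow> f \<in> cauchy_seqs A q"
proof (rule cauchy_seqs_dominated[where d = "\<lambda>k. q (f k \<ominus> x)"])
  fix j k assume "tends f x"
  thus "q (f j \<ominus> f k) \<le> q (f j \<ominus> x) + q (f k \<ominus> x)"
    using q_triangle[of "f j" x "f k"] q_minus_commute[of x "f k"] by (simp add: tends_def)
qed (auto simp: tends_def)

end

section \<open>Limits in C*-algebras and domination of C*-seminorms by the norm\<close>

locale cstar = cstar_algebra A for A :: "('a, 'e) cstar_alg_scheme" (structure)
begin
sublocale cstar_seminormed A "cnorm A"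
  by unfold_locales (rule cnorm_seminorm)

text \<open>Subtracting the sequence from itself gives zero at each index, while the norms tend to
  that of \<open>x \<ominus> y\<close>; definiteness of the norm finishes.\<close>

lemma tends_unique: "tends f x \<Longrightarrow> tends f y \<Longrightarrow> x = y"
proof -
  assume a: "tends f x" "tends f y"
  have "(\<lambda>k. cnorm A (f k \<ominus> f k)) \<longlonglongrightarrow> cnorm A (x \<ominus> y)" by (rule tends_dist[OF a])
  moreover have "f k \<ominus> f k = \<zero>" for k using tends_closed[OF a(1)] by (simp add: a_minus_def r_neg)
  ultimately have "cnorm A (x \<ominus> y) = 0" by (simp add: LIMSEQ_const_iff)
  hence "x \<ominus> y = \<zero>" using a tends_closed cnorm_definite by (metis minus_closed)
  thus ?thesis using a tends_closed minus_eq_zero_iff by metis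
qed

lemma cauchy_tends: "f \<in> cauchy_seqs A (cnorm A) \<Longrightarrow> \<exists>x. tends f x"
  using complete[of f] by (auto simp: tends_def cauchy_seqs_def)

lemma cnorm_closure_iff: 
  assumes "S \<subseteq> carrier A"
  shows "x \<in> cnorm_closure A S \<longleftrightarrow> (\<exists>f. (\<forall>k. f k \<in> S) \<and> tends f x)"
proof
  assume x: "x \<in> cnorm_closure A S"
  hence "\<forall>k. \<exists>y\<in>S. cnorm A (x \<ominus> y) < inverse (real (Suc k))"
    by (auto simp: cnorm_closure_def)
  then obtain f where f: "\<And>k. f k \<in> S" "\<And>k. cnorm A (x \<ominus> f k) < inverse (real (Suc k))"
    by metis
  have "(\<lambda>k. cnorm A (f k \<ominus> x)) \<longlonglongrightarrow> 0"
  proof (rule Lim_null_comparison[OF _ LIMSEQ_inverse_real_of_nat], rule always_eventually, rule allI)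
    fix k
    show "norm (cnorm A (f k \<ominus> x)) \<le> inverse (real (Suc k))"
      using f(2)[of k] q_minus_commute[of "f k" x] f(1)[of k] x assms
      by (auto simp: cnorm_closure_def subset_iff)
  qed
  hence "tends f x" using f(1) x assms by (auto simp: tends_def cnorm_closure_def)
  thus "\<exists>f. (\<forall>k. f k \<in> S) \<and> tends f x" using f(1) by blast
next
  assume "\<exists>f. (\<forall>k. f k \<in> S) \<and> tends f x"
  then obtain f where f: "\<And>k. f k \<in> S" "tends f x" by blast
  have "\<exists>y\<in>S. cnorm A (x \<ominus> y) < e" if "e > 0" for e
  proof -
    have "(\<lambda>k. cnorm A (f k \<ominus> x)) \<longlonglongrightarrow> 0" using f(2) by (simp add: tends_def)
    from LIMSEQ_D[OF this that]
    obtain k where "norm (cnorm A (f k \<ominus> x) - 0) < e" by blast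
    thus ?thesis using f(1)[of k] q_minus_commute[of "f k" x] f(2) by (auto simp: tends_def)
  qed
  thus "x \<in> cnorm_closure A S" using f(2) by (auto simp: cnorm_closure_def tends_def)
qed

lemma tends_Suc: "tends f x \<Longrightarrow> tends (\<lambda>k. f (Suc k)) x"
  using LIMSEQ_Suc[of "\<lambda>k. cnorm A (f k \<ominus> x)"] by (auto simp: tends_def)

text \<open>The iteration \<open>y \<mapsto> (c + y\<^sup>2) / 2\<close> contracts the ball of radius \<open>1 - sqrt (1 - norm c)\<close>; its fixed
  point \<open>y\<close> gives \<open>(1 - y)\<^sup>2 = 1 - c\<close>.\<close>

lemma sqrt_one_minus:
  assumes c: "c \<in> carrier A" "star A c = c" "cnorm A c < 1"
  obtains b where "b \<in> carrier A" "star A b = b" "b \<otimes> b = \<one> \<ominus> c"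
    "\<And>a. a \<in> carrier A \<Longrightarrow> a \<otimes> c = c \<otimes> a \<Longrightarrow> a \<otimes> b = b \<otimes> a"
proof -
  \<comment> \<open>Starting from zero, each iterate is a polynomial in \<open>c\<close>. It is
    therefore self-adjoint and commutes with whatever commutes with \<open>c\<close>, and both
    properties pass to the limit.\<close>
  define y where "y = rec_nat \<zero> (\<lambda>_ y. cscale A (1/2) (c \<oplus> y \<otimes> y))"
  have y0: "y 0 = \<zero>" and ySuc: "\<And>n. y (Suc n) = cscale A (1/2) (c \<oplus> y n \<otimes> y n)"
    by (simp_all add: y_def)
  have yc [simp]: "y n \<in> carrier A" for n
    by (induction n) (use c in \<open>simp_all add: y0 ySuc\<close>)
  have ys: "star A (y n) = y n" for n
    by (induction n) (use c in \<open>simp_all add: y0 ySuc star_cscale star_add star_mult\<close>)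
  have ycomm: "a \<otimes> y n = y n \<otimes> a" if "a \<in> carrier A" "a \<otimes> c = c \<otimes> a" for a n
  proof (induction n)
    case (Suc n)
    have "a \<otimes> (y n \<otimes> y n) = (y n \<otimes> y n) \<otimes> a"
      using that(1) Suc by (metis m_assoc yc)
    thus ?case using that c
      by (simp add: ySuc cscale_mult_left cscale_mult_right l_distr r_distr)
  qed (use that in \<open>simp add: y0\<close>)
  \<comment> \<open>The smaller root of \<open>(cnorm A c + r * r) / 2 = r\<close>, so the iteration
    maps the ball of radius \<open>r\<close> into itself.\<close>
  define r where "r = 1 - sqrt (1 - cnorm A c)"
  have n0: "0 \<le> cnorm A c" using c by simp
  have r: "0 \<le> r" "r < 1" using c n0 by (auto simp: r_def)
  have rr: "(cnorm A c + r * r) / 2 = r"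
  proof -
    have "sqrt (1 - cnorm A c) * sqrt (1 - cnorm A c) = 1 - cnorm A c" using c by simp
    thus ?thesis unfolding r_def by (simp add: field_simps del: real_sqrt_mult_self)
  qed
  have ynorm: "cnorm A (y n) \<le> r" for n
  proof (induction n)
    case (Suc n)
    have "cnorm A (y (Suc n)) = cnorm A (c \<oplus> y n \<otimes> y n) / 2"
      using c by (simp add: ySuc q_cscale)
    also have "\<dots> \<le> (cnorm A c + cnorm A (y n) * cnorm A (y n)) / 2"
      using q_add[of c "y n \<otimes> y n"] q_mult[of "y n" "y n"] c by simp
    also have "\<dots> \<le> (cnorm A c + r * r) / 2"
      using Suc mult_mono[OF Suc Suc r(1)] by simp
    finally show ?case using rr by simp
  qed (use r in \<open>simp add: y0\<close>)
  \<comment> \<open>The first step divided by \<open>1 - r\<close>: the steps shrink with ratio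
    \<open>r\<close>, so all steps from index \<open>n\<close> on add up to at most
    \<open>K * r ^ n\<close>.\<close>
  define K where "K = cnorm A (y 1 \<ominus> y 0) / (1 - r)"
  have K0: "0 \<le> K" unfolding K_def using r by simp
  have step: "cnorm A (y (Suc n) \<ominus> y n) \<le> K * (1 - r) * r ^ n" for n
  proof (induction n)
    case 0
    show ?case using r by (simp add: K_def)
  next
    case (Suc n)
    have "y (Suc (Suc n)) \<ominus> y (Suc n)
        = cscale A (1/2) ((c \<oplus> y (Suc n) \<otimes> y (Suc n)) \<ominus> (c \<oplus> y n \<otimes> y n))"
      using c(1) by (simp only: cscale_minus ySuc[symmetric] m_closed a_closed yc)
    hence "cnorm A (y (Suc (Suc n)) \<ominus> y (Suc n))
        = cnorm A ((c \<oplus> y (Suc n) \<otimes> y (Suc n)) \<ominus> (c \<oplus> y n \<otimes> y n)) / 2"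
      using c(1) by (simp add: q_cscale)
    also have "\<dots> \<le> cnorm A (y (Suc n) \<otimes> y (Suc n) \<ominus> y n \<otimes> y n) / 2"
      using q_add_minus[of c "y (Suc n) \<otimes> y (Suc n)" c "y n \<otimes> y n"] c
      by (simp add: a_minus_def r_neg)
    \<comment> \<open>Squaring has Lipschitz constant at most \<open>2 * r\<close> on the ball, and
      the factor 1/2 of the iteration turns this into \<open>r\<close>.\<close>
    also have "\<dots> \<le> (r * cnorm A (y (Suc n) \<ominus> y n) + cnorm A (y (Suc n) \<ominus> y n) * r) / 2"
      by (intro divide_right_mono order_trans[OF q_mult_minus[OF yc yc yc yc]] add_mono
          mult_right_mono mult_left_mono ynorm q_nonneg minus_closed yc) simp
    also have "\<dots> = r * cnorm A (y (Suc n) \<ominus> y n)" by simp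
    also have "\<dots> \<le> r * (K * (1 - r) * r ^ n)" using Suc r by (intro mult_left_mono)
    finally show ?case by (simp add: mult_ac)
  qed
  have tele: "cnorm A (y (n + m) \<ominus> y n) \<le> K * (r ^ n - r ^ (n + m))" for n m
  proof (induction m)
    case 0
    show ?case by (simp add: a_minus_def r_neg)
  next
    case (Suc m)
    have "cnorm A (y (n + Suc m) \<ominus> y n) \<le> K * (1 - r) * r ^ (n + m) + K * (r ^ n - r ^ (n + m))"
      using q_triangle[of "y (Suc (n + m))" "y (n + m)" "y n"] step[of "n + m"] Suc by simp
    thus ?case by (simp add: algebra_simps)
  qed
  have tele': "cnorm A (y j \<ominus> y k) \<le> K * r ^ j + K * r ^ k" for j k
  proof (cases "j \<le> k")
    case True
    have "cnorm A (y j \<ominus> y k) \<le> K * (r ^ j - r ^ k)"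
      using tele[of j "k - j"] True q_minus_commute[of "y j" "y k"] by simp
    moreover have "0 \<le> K * r ^ k" using K0 r by simp
    ultimately show ?thesis by (simp add: algebra_simps)
  next
    case False
    have "cnorm A (y j \<ominus> y k) \<le> K * (r ^ k - r ^ j)"
      using tele[of k "j - k"] False by simp
    moreover have "0 \<le> K * r ^ j" using K0 r by simp
    ultimately show ?thesis by (simp add: algebra_simps)
  qed
  have "(\<lambda>n. K * r ^ n) \<longlonglongrightarrow> K * 0"
    using r by (intro tendsto_mult tendsto_const LIMSEQ_power_zero) simp
  hence "y \<in> cauchy_seqs A (cnorm A)"
    using cauchy_seqs_dominated[of y "\<lambda>n. K * r ^ n"] tele' by simp
  then obtain Y where Y: "tends y Y" using cauchy_tends by blast
  have Yc [simp]: "Y \<in> carrier A" using tends_closed Y by blast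
  have "tends (\<lambda>n. y (Suc n)) (cscale A (1/2) (c \<oplus> Y \<otimes> Y))"
    unfolding ySuc using Y c by (intro tends_cscale tends_add tends_mult tends_const)
  hence Yeq: "Y = cscale A (1/2) (c \<oplus> Y \<otimes> Y)" using tends_unique tends_Suc[OF Y] by blast
  \<comment> \<open>The doubled fixed-point equation; it rearranges to \<open>(\<one> \<ominus> Y)
    \<otimes> (\<one> \<ominus> Y) = \<one> \<ominus> c\<close>.\<close>
  have Y2: "Y \<oplus> Y = c \<oplus> Y \<otimes> Y"
  proof -
    have "Y \<oplus> Y = cscale A (1/2 + 1/2) (c \<oplus> Y \<otimes> Y)"
      unfolding cscale_add_left[OF a_closed[OF c(1) m_closed[OF Yc Yc]]] Yeq[symmetric] ..
    thus ?thesis using c by simp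
  qed
  have Ys: "star A Y = Y"
    using tends_unique[OF tends_star[OF Y]] Y by (simp add: ys)
  have Ycomm: "a \<otimes> Y = Y \<otimes> a" if "a \<in> carrier A" "a \<otimes> c = c \<otimes> a" for a
    using tends_unique[OF tends_mult[OF tends_const[OF that(1)] Y]]
      tends_mult[OF Y tends_const[OF that(1)]] by (simp add: ycomm[OF that])
  show ?thesis
  proof (rule that[of "\<one> \<ominus> Y"])
    have "(\<one> \<ominus> Y) \<otimes> (\<one> \<ominus> Y) = \<one> \<ominus> (Y \<oplus> Y) \<oplus> Y \<otimes> Y"
      by (simp add: a_minus_def l_distr r_distr l_minus r_minus minus_add a_ac)
    also have "\<dots> = \<one> \<ominus> c"
      unfolding Y2 using c by (simp add: a_minus_def minus_add a_assoc l_neg)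
    finally show "(\<one> \<ominus> Y) \<otimes> (\<one> \<ominus> Y) = \<one> \<ominus> c" .
    show "star A (\<one> \<ominus> Y) = \<one> \<ominus> Y" by (simp add: star_minus Ys)
    show "a \<otimes> (\<one> \<ominus> Y) = (\<one> \<ominus> Y) \<otimes> a" if "a \<in> carrier A" "a \<otimes> c = c \<otimes> a" for a
      using that(1) by (simp add: a_minus_def l_distr r_distr l_minus r_minus Ycomm[OF that])
  qed simp
qed

text \<open>A self-adjoint \<open>a\<close> of norm less than \<open>1\<close> is the real part of the unitary
  \<open>a + \<i> sqrt (1 - a\<^sup>2)\<close>, and every C*-seminorm is at most \<open>1\<close> on a unitary.\<close>

lemma seminorm_le_cnorm:
  assumes "cstar_seminorm A q" and x: "x \<in> carrier A"
  shows "q x \<le> cnorm A x"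
proof -
  interpret q: cstar_seminormed A q by unfold_locales fact
  have unit: "q a \<le> 1" if a: "a \<in> carrier A" "star A a = a" "cnorm A a < 1" for a
  proof -
    have aa: "cnorm A (a \<otimes> a) < 1"
      using q_star_mult[OF a(1)] a power_strict_mono[of "cnorm A a" 1 2] by simp
    have aas: "star A (a \<otimes> a) = a \<otimes> a" using a by (simp add: star_mult)
    obtain b where b: "b \<in> carrier A" "star A b = b" "b \<otimes> b = \<one> \<ominus> a \<otimes> a"
      and bc: "\<And>x. x \<in> carrier A \<Longrightarrow> x \<otimes> (a \<otimes> a) = a \<otimes> a \<otimes> x \<Longrightarrow> x \<otimes> b = b \<otimes> x"
      using sqrt_one_minus[OF m_closed[OF a(1) a(1)] aas aa] by blast
    have ab: "a \<otimes> b = b \<otimes> a" using a(1) by (intro bc) (simp_all add: m_assoc)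
    define u where "u = a \<oplus> cscale A \<i> b"
    have uc [simp]: "u \<in> carrier A" using a b by (simp add: u_def)
    have us: "star A u = a \<oplus> cscale A (-\<i>) b" using a b by (simp add: u_def star_add star_cscale)
    \<comment> \<open>The mixed terms cancel because \<open>a\<close> and \<open>b\<close> commute,
      which leaves \<open>a \<otimes> a \<oplus> b \<otimes> b = \<one>\<close>.\<close>
    have "star A u \<otimes> u = a \<otimes> a \<oplus> cscale A \<i> (a \<otimes> b) \<oplus> (cscale A (-\<i>) (a \<otimes> b) \<oplus> b \<otimes> b)"
      unfolding us unfolding u_def using a(1) b(1)
      by (simp add: l_distr r_distr cscale_mult_left cscale_mult_right cscale_cscale ab
          cscale_add_right a_ac)
    also have "\<dots> = a \<otimes> a \<oplus> (cscale A (\<i> + -\<i>) (a \<otimes> b) \<oplus> b \<otimes> b)"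
      using a(1) b(1) by (simp only: cscale_add_left a_assoc m_closed cscale_closed a_closed)
    also have "\<dots> = \<one>"
      using a(1) b(1) by (simp add: b(3) a_minus_def a_lcomm[of "a \<otimes> a" \<one>] r_neg)
    finally have "(q u)\<^sup>2 = q \<one>" using q.q_star_mult[of u] by simp
    hence "(q u)\<^sup>2 \<le> 1\<^sup>2" using q.q_one_le by simp
    hence qu: "q u \<le> 1" by (rule power2_le_imp_le) simp
    have "u \<oplus> star A u = a \<oplus> a \<oplus> cscale A (\<i> + -\<i>) b"
      unfolding us cscale_add_left[OF b(1)] unfolding u_def using a(1) b(1) by (simp add: a_ac)
    hence "u \<oplus> star A u = cscale A (1 + 1) a"
      unfolding cscale_add_left[OF a(1)] using a b by simp
    hence "2 * q a \<le> q u + q (star A u)"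
      using q.q_add[of u "star A u"] q.q_cscale[of a "1+1"] a by simp
    thus ?thesis using qu q.q_star[of u] by simp
  qed
  have sa: "q a \<le> cnorm A a" if a: "a \<in> carrier A" "star A a = a" for a
  proof (rule field_le_epsilon)
    fix e :: real assume e: "e > 0"
    \<comment> \<open>Dividing by slightly more than the norm keeps the rescaled element strictly
      inside the unit ball and also makes sense when \<open>a\<close> is zero.\<close>
    define t where "t = cnorm A a + e"
    have t: "t > 0" "cnorm A a < t" using e q_nonneg[OF a(1)] by (auto simp: t_def)
    have "q (cscale A (complex_of_real (1 / t)) a) \<le> 1"
      using t by (intro unit) (simp_all add: a star_cscale q_cscale norm_divide)
    thus "q a \<le> cnorm A a + e"
      using t a(1) unfolding t_def[symmetric]
      by (simp add: q.q_cscale norm_divide field_simps)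
  qed
  \<comment> \<open>The C*-identity reduces a general element to the self-adjoint
    \<open>star A x \<otimes> x\<close>.\<close>
  have "(q x)\<^sup>2 \<le> (cnorm A x)\<^sup>2"
    using sa[of "star A x \<otimes> x"] x q.q_star_mult[OF x] q_star_mult[OF x] by (simp add: star_mult)
  thus ?thesis using power2_le_imp_le[OF _ q_nonneg[OF x]] by blast
qed

end

text \<open>Through this, every morphism into a C*-algebra yields a competitor in the suprema that
  define universal norms and in the fullness clause.\<close>

lemma pullback_seminorm:
  assumes "star_algebra P" "cstar_seminorm B q" "f \<in> star_hom P B"
  shows "cstar_seminorm P (\<lambda>x. q (f x))"
proof -
  interpret P: star_algebra P by fact
  show ?thesis
    unfolding cstar_seminorm_def
  proof (intro conjI ballI allI)
    fix c x y assume x: "x \<in> carrier P" and y: "y \<in> carrier P"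
    note c = star_hom_closed[OF assms(3) x] star_hom_closed[OF assms(3) y]
    show "0 \<le> q (f x)"
      using assms(2) c by (simp add: cstar_seminorm_def)
    show "q (f (x \<oplus>\<^bsub>P\<^esub> y)) \<le> q (f x) + q (f y)"
      unfolding star_hom_add[OF assms(3) x y] using assms(2) c by (simp add: cstar_seminorm_def)
    show "q (f (cscale P c x)) = cmod c * q (f x)"
      unfolding star_hom_cscale[OF assms(3) x] using assms(2) c by (simp add: cstar_seminorm_def)
    show "q (f (x \<otimes>\<^bsub>P\<^esub> y)) \<le> q (f x) * q (f y)"
      unfolding star_hom_mult[OF assms(3) x y] using assms(2) c by (simp add: cstar_seminorm_def)
    show "q (f (star P x \<otimes>\<^bsub>P\<^esub> x)) = (q (f x))\<^sup>2"
      unfolding star_hom_mult[OF assms(3) P.star_closed[OF x] x] star_hom_star[OF assms(3) x]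
      using assms(2) c by (simp add: cstar_seminorm_def)
  qed
qed

text \<open>Automatic continuity: the norm of the target, pulled back along \<open>f\<close>, is a
  C*-seminorm on the source.\<close>

lemma star_hom_contractive:
  assumes "cstar_algebra A" "cstar_algebra B" "f \<in> star_hom A B" "x \<in> carrier A"
  shows "cnorm B (f x) \<le> cnorm A x"
proof -
  interpret A: cstar A using assms by (simp add: cstar_def)
  interpret B: cstar B using assms by (simp add: cstar_def)
  show ?thesis
    by (rule A.seminorm_le_cnorm[OF pullback_seminorm[OF _ B.seminorm assms(3)] assms(4)])
       unfold_locales
qed

lemma star_hom_tends:
  assumes "cstar_algebra A" "cstar_algebra B" "f \<in> star_hom A B" "cstar_seminormed.tends A (cnorm A) s x"
  shows "cstar_seminormed.tends B (cnorm B) (\<lambda>k. f (s k)) (f x)"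
proof -
  interpret A: cstar A using assms by (simp add: cstar_def)
  interpret B: cstar B using assms by (simp add: cstar_def)
  have sa: "star_algebra A" "star_algebra B" by unfold_locales
  note c = A.tends_closed[OF assms(4)]
  have "(\<lambda>k. cnorm B (f (s k) \<ominus>\<^bsub>B\<^esub> f x)) \<longlonglongrightarrow> 0"
  proof (rule B.null_dominated)
    show "cnorm B (f (s k) \<ominus>\<^bsub>B\<^esub> f x) \<le> cnorm A (s k \<ominus>\<^bsub>A\<^esub> x)" for k
    proof -
      have e: "f (s k) \<ominus>\<^bsub>B\<^esub> f x = f (s k \<ominus>\<^bsub>A\<^esub> x)"
        by (rule star_hom_minus[OF sa assms(3) c(1) c(2), symmetric])
      show ?thesis unfolding e by (rule star_hom_contractive[OF assms(1-3) A.minus_closed[OF c(1) c(2)]])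
    qed
    show "f (s k) \<ominus>\<^bsub>B\<^esub> f x \<in> carrier B" for k
      using c star_hom_closed[OF assms(3)] by simp
    show "(\<lambda>k. cnorm A (s k \<ominus>\<^bsub>A\<^esub> x)) \<longlonglongrightarrow> 0"
      using assms(4) unfolding A.tends_def by blast
  qed
  moreover have "\<forall>k. f (s k) \<in> carrier B" "f x \<in> carrier B"
    using c star_hom_closed[OF assms(3)] by blast+
  ultimately show ?thesis unfolding B.tends_def by blast
qed

section \<open>The Hausdorff completion for a C*-seminorm\<close>

context cstar_seminormed
begin

lemma cauchy_seqs_closed: "f \<in> cauchy_seqs A q \<Longrightarrow> f k \<in> carrier A"
  by (simp add: cauchy_seqs_def)

lemma cauchy_seqsD: "f \<in> cauchy_seqs A q \<Longrightarrow> e > 0 \<Longrightarrow> \<exists>N. \<forall>j\<ge>N. \<forall>k\<ge>N. q (f j \<ominus> f k) < e"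
  by (simp add: cauchy_seqs_def)

lemma cauchy_const: "x \<in> carrier A \<Longrightarrow> (\<lambda>_. x) \<in> cauchy_seqs A q"
  by (rule tends_cauchy[OF tends_const])

lemma cauchy_q_convergent:
  assumes "f \<in> cauchy_seqs A q"
  shows "convergent (\<lambda>k. q (f k))"
proof (rule Cauchy_convergent, rule CauchyI)
  fix e :: real assume "e > 0"
  then obtain N where N: "\<forall>j\<ge>N. \<forall>k\<ge>N. q (f j \<ominus> f k) < e" using cauchy_seqsD[OF assms] by blast
  have "norm (q (f j) - q (f k)) < e" if "j \<ge> N" "k \<ge> N" for j k
    using q_diff[OF cauchy_seqs_closed[OF assms] cauchy_seqs_closed[OF assms], of j k]
      N[rule_format, OF that] by simp
  thus "\<exists>N. \<forall>j\<ge>N. \<forall>k\<ge>N. norm (q (f j) - q (f k)) < e" by blast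
qed

lemma cauchy_q_bounded:
  assumes "f \<in> cauchy_seqs A q"
  obtains K where "K > 0" "\<And>k. q (f k) \<le> K"
proof -
  obtain K where K: "K > 0" "\<forall>k. norm (q (f k)) \<le> K"
    using convergent_imp_Bseq[OF cauchy_q_convergent[OF assms]] by (rule BseqE)
  have "q (f k) \<le> K" for k using K(2)[rule_format, of k] by simp
  thus ?thesis using that[OF K(1)] by simp
qed

lemma cauchy_add:
  assumes f: "f \<in> cauchy_seqs A q" and g: "g \<in> cauchy_seqs A q"
  shows "(\<lambda>k. f k \<oplus> g k) \<in> cauchy_seqs A q"
proof (rule cauchy_seqsI)
  note [simp] = cauchy_seqs_closed[OF f] cauchy_seqs_closed[OF g]
  show "f k \<oplus> g k \<in> carrier A" for k by simp
  fix e :: real assume "e > 0"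
  hence e: "e / 2 > 0" by simp
  obtain N where N: "\<forall>j\<ge>N. \<forall>k\<ge>N. q (f j \<ominus> f k) < e / 2" using cauchy_seqsD[OF f e] by blast
  obtain M where M: "\<forall>j\<ge>M. \<forall>k\<ge>M. q (g j \<ominus> g k) < e / 2" using cauchy_seqsD[OF g e] by blast
  have "q ((f j \<oplus> g j) \<ominus> (f k \<oplus> g k)) < e" if "j \<ge> max N M" "k \<ge> max N M" for j k
  proof -
    have "q (f j \<ominus> f k) < e / 2" "q (g j \<ominus> g k) < e / 2" using N M that by simp_all
    thus ?thesis using q_add_minus[of "f j" "g j" "f k" "g k"] by simp
  qed
  thus "\<exists>N. \<forall>j\<ge>N. \<forall>k\<ge>N. q ((f j \<oplus> g j) \<ominus> (f k \<oplus> g k)) < e" by blast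
qed

lemma cauchy_mult:
  assumes f: "f \<in> cauchy_seqs A q" and g: "g \<in> cauchy_seqs A q"
  shows "(\<lambda>k. f k \<otimes> g k) \<in> cauchy_seqs A q"
proof (rule cauchy_seqsI)
  note [simp] = cauchy_seqs_closed[OF f] cauchy_seqs_closed[OF g]
  show "f k \<otimes> g k \<in> carrier A" for k by simp
  obtain K where K: "K > 0" "\<And>k. q (f k) \<le> K" using cauchy_q_bounded[OF f] by blast
  obtain L where L: "L > 0" "\<And>k. q (g k) \<le> L" using cauchy_q_bounded[OF g] by blast
  fix e :: real assume "e > 0"
  hence e: "e / 2 / L > 0" "e / 2 / K > 0" using K L by simp_all
  obtain N where N: "\<forall>j\<ge>N. \<forall>k\<ge>N. q (f j \<ominus> f k) < e / 2 / L" using cauchy_seqsD[OF f e(1)] by blast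
  obtain M where M: "\<forall>j\<ge>M. \<forall>k\<ge>M. q (g j \<ominus> g k) < e / 2 / K" using cauchy_seqsD[OF g e(2)] by blast
  have "q ((f j \<otimes> g j) \<ominus> (f k \<otimes> g k)) < e" if "j \<ge> max N M" "k \<ge> max N M" for j k
  proof -
    have 1: "q (f j \<ominus> f k) < e / 2 / L" "q (g j \<ominus> g k) < e / 2 / K" using N M that by simp_all
    have "q (f j) * q (g j \<ominus> g k) \<le> K * q (g j \<ominus> g k)"
      using K by (intro mult_right_mono) simp_all
    also have "\<dots> < K * (e / 2 / K)" using 1 K by (intro mult_strict_left_mono)
    also have "\<dots> = e / 2" using K by simp
    finally have 2: "q (f j) * q (g j \<ominus> g k) < e / 2" .
    have "q (f j \<ominus> f k) * q (g k) \<le> q (f j \<ominus> f k) * L"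
      using L by (intro mult_left_mono) simp_all
    also have "\<dots> < (e / 2 / L) * L" using 1 L by (intro mult_strict_right_mono)
    also have "\<dots> = e / 2" using L by simp
    finally show ?thesis using 2 q_mult_minus[of "f j" "g j" "f k" "g k"] by simp
  qed
  thus "\<exists>N. \<forall>j\<ge>N. \<forall>k\<ge>N. q ((f j \<otimes> g j) \<ominus> (f k \<otimes> g k)) < e" by blast
qed

lemma cauchy_cscale:
  assumes f: "f \<in> cauchy_seqs A q"
  shows "(\<lambda>k. cscale A c (f k)) \<in> cauchy_seqs A q"
proof -
  note [simp] = cauchy_seqs_closed[OF f]
  \<comment> \<open>Scaling is multiplication by a constant sequence, so the product rule covers
    it.\<close>
  have "(\<lambda>k. cscale A c \<one> \<otimes> f k) \<in> cauchy_seqs A q"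
    by (rule cauchy_mult[OF cauchy_const f]) simp
  thus ?thesis by (simp add: cscale_mult_left)
qed

lemma cauchy_star:
  assumes f: "f \<in> cauchy_seqs A q"
  shows "(\<lambda>k. star A (f k)) \<in> cauchy_seqs A q"
  using f by (simp add: cauchy_seqs_def star_minus[symmetric] q_star)

lemma null_rel_iff: "(f, g) \<in> null_rel A q \<longleftrightarrow>
    f \<in> cauchy_seqs A q \<and> g \<in> cauchy_seqs A q \<and> (\<lambda>k. q (f k \<ominus> g k)) \<longlonglongrightarrow> 0"
  by (simp add: null_rel_def)

lemma null_rel_equiv: "equiv (cauchy_seqs A q) (null_rel A q)"
proof (rule equivI)
  show "null_rel A q \<subseteq> cauchy_seqs A q \<times> cauchy_seqs A q" by (auto simp: null_rel_def)
  show "refl_on (cauchy_seqs A q) (null_rel A q)"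
    by (auto simp: refl_on_def null_rel_def a_minus_def cauchy_seqs_closed r_neg)
  show "sym (null_rel A q)"
  proof (rule symI)
    fix f g assume fg: "(f, g) \<in> null_rel A q"
    hence "(\<lambda>k. q (f k \<ominus> g k)) = (\<lambda>k. q (g k \<ominus> f k))"
      by (intro ext q_minus_commute) (simp_all add: null_rel_iff cauchy_seqs_closed)
    thus "(g, f) \<in> null_rel A q" using fg by (simp add: null_rel_iff)
  qed
  show "trans (null_rel A q)"
  proof (rule transI)
    fix f g h assume a: "(f, g) \<in> null_rel A q" "(g, h) \<in> null_rel A q"
    have "(\<lambda>k. q (f k \<ominus> h k)) \<longlonglongrightarrow> 0"
    proof (rule null_dominated)
      show "(\<lambda>k. q (f k \<ominus> g k) + q (g k \<ominus> h k)) \<longlonglongrightarrow> 0"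
        using tendsto_add[of "\<lambda>k. q (f k \<ominus> g k)" 0 sequentially "\<lambda>k. q (g k \<ominus> h k)" 0] a
        by (simp add: null_rel_iff)
    qed (use a in \<open>simp_all add: null_rel_iff cauchy_seqs_closed q_triangle\<close>)
    thus "(f, h) \<in> null_rel A q" using a by (simp add: null_rel_iff)
  qed
qed

definition cls :: "(nat \<Rightarrow> 'a) \<Rightarrow> (nat \<Rightarrow> 'a) set" where
  "cls f = null_rel A q `` {f}"

definition embed :: "'a \<Rightarrow> (nat \<Rightarrow> 'a) set" where
  "embed x = cls (\<lambda>_. x)"

lemma cls_eqI: "(f, g) \<in> null_rel A q \<Longrightarrow> cls f = cls g"
  unfolding cls_def by (rule equiv_class_eq[OF null_rel_equiv])

lemma null_rel_add:
  assumes "(f, f') \<in> null_rel A q" "(g, g') \<in> null_rel A q"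
  shows "((\<lambda>k. f k \<oplus> g k), (\<lambda>k. f' k \<oplus> g' k)) \<in> null_rel A q"
proof -
  have "(\<lambda>k. q ((f k \<oplus> g k) \<ominus> (f' k \<oplus> g' k))) \<longlonglongrightarrow> 0"
  proof (rule null_dominated[OF _ q_add_minus])
    show "(\<lambda>k. q (f k \<ominus> f' k) + q (g k \<ominus> g' k)) \<longlonglongrightarrow> 0"
      using tendsto_add[of "\<lambda>k. q (f k \<ominus> f' k)" 0 sequentially "\<lambda>k. q (g k \<ominus> g' k)" 0] assms
      by (simp add: null_rel_iff)
  qed (use assms in \<open>simp_all add: null_rel_iff cauchy_seqs_closed\<close>)
  thus ?thesis using assms by (simp add: null_rel_iff cauchy_add)
qed

lemma null_rel_mult:
  assumes "(f, f') \<in> null_rel A q" "(g, g') \<in> null_rel A q"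
  shows "((\<lambda>k. f k \<otimes> g k), (\<lambda>k. f' k \<otimes> g' k)) \<in> null_rel A q"
proof -
  have c: "f \<in> cauchy_seqs A q" "g' \<in> cauchy_seqs A q" using assms by (auto simp: null_rel_iff)
  obtain K where K: "(\<lambda>k. q (f k)) \<longlonglongrightarrow> K" using cauchy_q_convergent[OF c(1)] convergentD by blast
  obtain L where L: "(\<lambda>k. q (g' k)) \<longlonglongrightarrow> L" using cauchy_q_convergent[OF c(2)] convergentD by blast
  have d: "(\<lambda>k. q (f k) * q (g k \<ominus> g' k) + q (f k \<ominus> f' k) * q (g' k)) \<longlonglongrightarrow> K * 0 + 0 * L"
    using assms K L by (intro tendsto_add tendsto_mult) (simp_all add: null_rel_iff)
  have "(\<lambda>k. q ((f k \<otimes> g k) \<ominus> (f' k \<otimes> g' k))) \<longlonglongrightarrow> 0"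
    by (rule null_dominated[OF _ q_mult_minus])
       (use assms d in \<open>simp_all add: null_rel_iff cauchy_seqs_closed\<close>)
  thus ?thesis using assms by (simp add: null_rel_iff cauchy_mult)
qed

lemma null_rel_cscale:
  assumes "(f, f') \<in> null_rel A q"
  shows "((\<lambda>k. cscale A c (f k)), (\<lambda>k. cscale A c (f' k))) \<in> null_rel A q"
proof -
  have "(\<lambda>k. cmod c * q (f k \<ominus> f' k)) \<longlonglongrightarrow> cmod c * 0"
    using assms by (intro tendsto_mult tendsto_const) (simp add: null_rel_iff)
  thus ?thesis using assms
    by (simp add: null_rel_iff cauchy_cscale cscale_minus[symmetric] q_cscale cauchy_seqs_closed)
qed

lemma null_rel_star:
  assumes "(f, f') \<in> null_rel A q"
  shows "((\<lambda>k. star A (f k)), (\<lambda>k. star A (f' k))) \<in> null_rel A q"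
  using assms
  by (simp add: null_rel_iff cauchy_star star_minus[symmetric] q_star cauchy_seqs_closed)

abbreviation compl :: "((nat \<Rightarrow> 'a) set) cstar_alg" where
  "compl \<equiv> completion A q"

lemma compl_cases:
  assumes "X \<in> carrier compl"
  obtains f where "f \<in> cauchy_seqs A q" "X = cls f"
  using assms by (auto simp: completion_def cls_def elim!: quotientE)

lemma cls_closed [simp]: "f \<in> cauchy_seqs A q \<Longrightarrow> cls f \<in> carrier compl"
  by (simp add: completion_def cls_def quotientI)

text \<open>The operations of \<open>completion\<close> are unions over all representatives; such a
  union collapses to a single class because the operation respects \<open>null_rel\<close>. Product,
  scaling and adjoint are treated alike.\<close>

lemma compl_add: "f \<in> cauchy_seqs A q \<Longrightarrow> g \<in> cauchy_seqs A q \<Longrightarrow>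
    cls f \<oplus>\<^bsub>compl\<^esub> cls g = cls (\<lambda>k. f k \<oplus> g k)"
proof -
  assume fg: "f \<in> cauchy_seqs A q" "g \<in> cauchy_seqs A q"
  have "(\<lambda>f g. null_rel A q `` {\<lambda>k. f k \<oplus> g k}) respects2 null_rel A q"
    by (rule congruent2I') (rule equiv_class_eq[OF null_rel_equiv null_rel_add])
  from UN_equiv_class2[OF null_rel_equiv null_rel_equiv this fg] show ?thesis
    by (simp add: completion_def cls_def)
qed

lemma compl_mult: "f \<in> cauchy_seqs A q \<Longrightarrow> g \<in> cauchy_seqs A q \<Longrightarrow>
    cls f \<otimes>\<^bsub>compl\<^esub> cls g = cls (\<lambda>k. f k \<otimes> g k)"
proof -
  assume fg: "f \<in> cauchy_seqs A q" "g \<in> cauchy_seqs A q"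
  have "(\<lambda>f g. null_rel A q `` {\<lambda>k. f k \<otimes> g k}) respects2 null_rel A q"
    by (rule congruent2I') (rule equiv_class_eq[OF null_rel_equiv null_rel_mult])
  from UN_equiv_class2[OF null_rel_equiv null_rel_equiv this fg] show ?thesis
    by (simp add: completion_def cls_def)
qed

lemma compl_cscale: "f \<in> cauchy_seqs A q \<Longrightarrow>
    cscale compl c (cls f) = cls (\<lambda>k. cscale A c (f k))"
proof -
  assume f: "f \<in> cauchy_seqs A q"
  have "(\<lambda>f. null_rel A q `` {\<lambda>k. cscale A c (f k)}) respects null_rel A q"
    by (rule congruentI) (rule equiv_class_eq[OF null_rel_equiv null_rel_cscale])
  from UN_equiv_class[OF null_rel_equiv this f] show ?thesis
    by (simp add: completion_def cls_def)
qed

lemma compl_star: "f \<in> cauchy_seqs A q \<Longrightarrow>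
    star compl (cls f) = cls (\<lambda>k. star A (f k))"
proof -
  assume f: "f \<in> cauchy_seqs A q"
  have "(\<lambda>f. null_rel A q `` {\<lambda>k. star A (f k)}) respects null_rel A q"
    by (rule congruentI) (rule equiv_class_eq[OF null_rel_equiv null_rel_star])
  from UN_equiv_class[OF null_rel_equiv this f] show ?thesis
    by (simp add: completion_def cls_def)
qed

lemma compl_one: "\<one>\<^bsub>compl\<^esub> = cls (\<lambda>_. \<one>)"
  and compl_zero: "\<zero>\<^bsub>compl\<^esub> = cls (\<lambda>_. \<zero>)"
  by (simp_all add: completion_def cls_def)

lemmas compl_ops = compl_add compl_mult compl_cscale compl_star compl_one compl_zero
lemmas cauchy_ops = cauchy_add cauchy_mult cauchy_cscale cauchy_star cauchy_const cauchy_seqs_closed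

lemma compl_ring: "ring compl"
proof (rule ringI)
  show "abelian_group compl"
  proof (rule abelian_groupI)
    fix X assume X: "X \<in> carrier compl"
    then obtain f where f: "f \<in> cauchy_seqs A q" "X = cls f" by (rule compl_cases)
    \<comment> \<open>The additive inverse is produced by scaling with -1, since scaling of classes
      is already known.\<close>
    have "cls (\<lambda>k. cscale A (-1) (f k)) \<oplus>\<^bsub>compl\<^esub> X = \<zero>\<^bsub>compl\<^esub>"
      using f by (simp add: compl_ops cauchy_ops) (simp add: cscale_minus_one l_neg cauchy_ops)
    thus "\<exists>Y\<in>carrier compl. Y \<oplus>\<^bsub>compl\<^esub> X = \<zero>\<^bsub>compl\<^esub>"
      using f by (intro bexI[of _ "cls (\<lambda>k. cscale A (-1) (f k))"]) (simp_all add: cauchy_ops)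
  qed (auto elim!: compl_cases simp: compl_ops cauchy_ops a_ac)
  show "monoid compl"
    by (rule monoidI) (auto elim!: compl_cases simp: compl_ops cauchy_ops m_assoc)
qed (auto elim!: compl_cases simp: compl_ops cauchy_ops l_distr r_distr)

lemma compl_star_algebra: "star_algebra compl"
proof (rule star_algebra.intro[OF compl_ring], rule star_algebra_axioms.intro)
qed (auto elim!: compl_cases simp: compl_ops cauchy_ops cscale_add_right cscale_add_left
    cscale_cscale cscale_mult_left cscale_mult_right star_add star_mult star_cscale)

interpretation compl: star_algebra compl by (rule compl_star_algebra)

lemma compl_minus:
  assumes "f \<in> cauchy_seqs A q" "g \<in> cauchy_seqs A q"
  shows "cls f \<ominus>\<^bsub>compl\<^esub> cls g = cls (\<lambda>k. f k \<ominus> g k)"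
  using assms
  by (simp add: a_minus_def compl.cscale_minus_one[symmetric] cscale_minus_one[symmetric]
      compl_ops cauchy_ops)

lemma cauchy_minus:
  assumes "f \<in> cauchy_seqs A q" "g \<in> cauchy_seqs A q"
  shows "(\<lambda>k. f k \<ominus> g k) \<in> cauchy_seqs A q"
  using cauchy_add[OF assms(1) cauchy_cscale[OF assms(2), of "-1"]] assms
  by (simp add: cscale_minus_one cauchy_seqs_closed a_minus_def)

text \<open>The norm of a class is a definite description. Equivalent sequences have the same limit
  of seminorms, so it denotes the limit along any representative.\<close>

lemma compl_cnorm:
  assumes f: "f \<in> cauchy_seqs A q"
  shows "(\<lambda>k. q (f k)) \<longlonglongrightarrow> cnorm compl (cls f)"
proof -
  obtain r where r: "(\<lambda>k. q (f k)) \<longlonglongrightarrow> r" using cauchy_q_convergent[OF f] convergentD by blast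
  have all: "(\<lambda>k. q (g k)) \<longlonglongrightarrow> r" if "g \<in> cls f" for g
  proof -
    have fg: "(f, g) \<in> null_rel A q" using that by (simp add: cls_def)
    hence fg': "g \<in> cauchy_seqs A q" "(\<lambda>k. q (f k \<ominus> g k)) \<longlonglongrightarrow> 0" by (simp_all add: null_rel_iff)
    have "(\<lambda>k. q (f k) - q (g k)) \<longlonglongrightarrow> 0"
      by (rule Lim_null_comparison[OF always_eventually fg'(2)])
         (simp add: q_diff cauchy_seqs_closed f fg'(1))
    from tendsto_diff[OF r this] show ?thesis by simp
  qed
  have mem: "f \<in> cls f" unfolding cls_def by (rule equiv_class_self[OF null_rel_equiv f])
  have "cnorm compl (cls f) = (THE r. \<forall>g\<in>cls f. (\<lambda>k. q (g k)) \<longlonglongrightarrow> r)"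
    by (simp add: completion_def)
  also have "\<dots> = r"
  proof (rule the_equality)
    fix s assume "\<forall>g\<in>cls f. (\<lambda>k. q (g k)) \<longlonglongrightarrow> s"
    hence "(\<lambda>k. q (f k)) \<longlonglongrightarrow> s" using mem by blast
    thus "s = r" using r LIMSEQ_unique by blast
  qed (use all in blast)
  finally show ?thesis using r by simp
qed

text \<open>Each law holds termwise for representatives, and weak inequalities and equations survive
  the limit.\<close>

lemma compl_seminorm: "cstar_seminorm compl (cnorm compl)"
  unfolding cstar_seminorm_def
proof (intro conjI ballI allI)
  fix X c assume "X \<in> carrier compl"
  then obtain f where f: "f \<in> cauchy_seqs A q" and X: "X = cls f" by (rule compl_cases)
  note [simp] = cauchy_seqs_closed[OF f]
  show "0 \<le> cnorm compl X"
    unfolding X by (rule LIMSEQ_le_const[OF compl_cnorm[OF f]]) simp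
  have "(\<lambda>k. q (cscale A c (f k))) \<longlonglongrightarrow> cmod c * cnorm compl (cls f)"
    using tendsto_mult[OF tendsto_const compl_cnorm[OF f], of "cmod c"] by (simp add: q_cscale)
  thus "cnorm compl (cscale compl c X) = cmod c * cnorm compl X"
    unfolding X compl_cscale[OF f]
    using LIMSEQ_unique[OF compl_cnorm[OF cauchy_cscale[OF f]]] by blast
  have "(\<lambda>k. q (star A (f k) \<otimes> f k)) \<longlonglongrightarrow> (cnorm compl (cls f))\<^sup>2"
    using tendsto_power[OF compl_cnorm[OF f], of 2] by (simp add: q_star_mult)
  thus "cnorm compl (star compl X \<otimes>\<^bsub>compl\<^esub> X) = (cnorm compl X)\<^sup>2"
    unfolding X compl_star[OF f] compl_mult[OF cauchy_star[OF f] f]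
    using LIMSEQ_unique[OF compl_cnorm[OF cauchy_mult[OF cauchy_star[OF f] f]]] by blast
  fix Y assume "Y \<in> carrier compl"
  then obtain g where g: "g \<in> cauchy_seqs A q" and Y: "Y = cls g" by (rule compl_cases)
  note [simp] = cauchy_seqs_closed[OF g]
  show "cnorm compl (X \<oplus>\<^bsub>compl\<^esub> Y) \<le> cnorm compl X + cnorm compl Y"
    unfolding X Y compl_add[OF f g]
    by (rule LIMSEQ_le[OF compl_cnorm[OF cauchy_add[OF f g]]
          tendsto_add[OF compl_cnorm[OF f] compl_cnorm[OF g]]]) (simp add: q_add)
  show "cnorm compl (X \<otimes>\<^bsub>compl\<^esub> Y) \<le> cnorm compl X * cnorm compl Y"
    unfolding X Y compl_mult[OF f g]
    by (rule LIMSEQ_le[OF compl_cnorm[OF cauchy_mult[OF f g]]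
          tendsto_mult[OF compl_cnorm[OF f] compl_cnorm[OF g]]]) (simp add: q_mult)
qed

lemma embed_star_hom: "embed \<in> star_hom A compl"
  by (rule star_homI) (simp_all add: embed_def compl_ops cauchy_ops)

lemma cnorm_embed: "x \<in> carrier A \<Longrightarrow> cnorm compl (embed x) = q x"
  unfolding embed_def
  by (rule LIMSEQ_unique[OF compl_cnorm[OF cauchy_const]]) simp_all

text \<open>The terms of a Cauchy sequence, embedded as constants, approach its class. This gives
  density of the embedding and provides the limit in the completeness proof.\<close>

lemma embed_tends_cls:
  assumes g: "g \<in> cauchy_seqs A q"
  shows "(\<lambda>n. cnorm compl (embed (g n) \<ominus>\<^bsub>compl\<^esub> cls g)) \<longlonglongrightarrow> 0"
proof (rule LIMSEQ_I)
  interpret c: cstar_seminormed compl "cnorm compl" by unfold_locales (rule compl_seminorm)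
  fix e :: real assume "e > 0"
  \<comment> \<open>Half of \<open>e\<close>, because the bound survives the limit in
    \<open>k\<close> only as a weak inequality.\<close>
  hence "e / 2 > 0" by simp
  then obtain N where N: "\<forall>j\<ge>N. \<forall>k\<ge>N. q (g j \<ominus> g k) < e / 2" using cauchy_seqsD[OF g] by blast
  have "norm (cnorm compl (embed (g n) \<ominus>\<^bsub>compl\<^esub> cls g) - 0) < e" if n: "n \<ge> N" for n
  proof -
    have gn: "(\<lambda>_. g n) \<in> cauchy_seqs A q" by (simp add: cauchy_ops g)
    have "cnorm compl (cls (\<lambda>k. g n \<ominus> g k)) \<le> e / 2"
      by (rule LIMSEQ_le_const2[OF compl_cnorm[OF cauchy_minus[OF gn g]]])
         (use N n less_imp_le in blast)
    moreover have "0 \<le> cnorm compl (cls (\<lambda>k. g n \<ominus> g k))"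
      using cauchy_minus[OF gn g] by simp
    ultimately show ?thesis using \<open>e > 0\<close> by (simp add: embed_def compl_minus[OF gn g])
  qed
  thus "\<exists>N. \<forall>n\<ge>N. norm (cnorm compl (embed (g n) \<ominus>\<^bsub>compl\<^esub> cls g) - 0) < e" by blast
qed

lemma embed_closed: "x \<in> carrier A \<Longrightarrow> embed x \<in> carrier compl"
  by (simp add: embed_def cauchy_ops)

lemma embed_dense: "carrier compl \<subseteq> cnorm_closure compl (embed ` carrier A)"
proof
  interpret c: cstar_seminormed compl "cnorm compl" by unfold_locales (rule compl_seminorm)
  fix X assume X: "X \<in> carrier compl"
  then obtain g where g: "g \<in> cauchy_seqs A q" "X = cls g" by (rule compl_cases)
  have "\<exists>Y\<in>embed ` carrier A. cnorm compl (X \<ominus>\<^bsub>compl\<^esub> Y) < e" if e: "e > 0" for e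
  proof -
    obtain N where N: "\<forall>n\<ge>N. norm (cnorm compl (embed (g n) \<ominus>\<^bsub>compl\<^esub> cls g) - 0) < e"
      using LIMSEQ_D[OF embed_tends_cls[OF g(1)] e] by blast
    have "norm (cnorm compl (embed (g N) \<ominus>\<^bsub>compl\<^esub> X) - 0) < e"
      unfolding g(2) using N by blast
    hence "cnorm compl (embed (g N) \<ominus>\<^bsub>compl\<^esub> X) < e" by simp
    hence "cnorm compl (X \<ominus>\<^bsub>compl\<^esub> embed (g N)) < e"
      using c.q_minus_commute[OF X embed_closed[OF cauchy_seqs_closed[OF g(1)]]] by simp
    thus ?thesis using cauchy_seqs_closed[OF g(1)] by blast
  qed
  thus "X \<in> cnorm_closure compl (embed ` carrier A)" using X by (simp add: cnorm_closure_def)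
qed

lemma compl_cstar_algebra: "cstar_algebra compl"
proof (rule cstar_algebra.intro[OF compl_star_algebra], rule cstar_algebra_axioms.intro)
  show "cstar_seminorm compl (cnorm compl)" by (rule compl_seminorm)
  interpret c: cstar_seminormed compl "cnorm compl" by unfold_locales (rule compl_seminorm)
  fix X assume "X \<in> carrier compl" and 0: "cnorm compl X = 0"
  then obtain f where f: "f \<in> cauchy_seqs A q" "X = cls f" by (auto elim: compl_cases)
  have "(f, \<lambda>_. \<zero>) \<in> null_rel A q"
    using compl_cnorm[OF f(1)] f 0
    by (simp add: null_rel_iff cauchy_ops a_minus_def)
  thus "X = \<zero>\<^bsub>compl\<^esub>" unfolding compl_zero f(2) by (rule cls_eqI)
next
  interpret c: cstar_seminormed compl "cnorm compl" by unfold_locales (rule compl_seminorm)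
  fix X assume X: "X \<in> cauchy_seqs compl (cnorm compl)"
  note Xc = c.cauchy_seqs_closed[OF X]
  \<comment> \<open>Replace the n-th member by an element of the dense image at distance less than
    1/(n+1). The replacements form a Cauchy sequence in the original algebra, and the class of that
    sequence is the limit.\<close>
  have "\<exists>x\<in>carrier A. cnorm compl (X n \<ominus>\<^bsub>compl\<^esub> embed x) < inverse (real (Suc n))" for n
  proof -
    have "0 < inverse (real (Suc n))" by simp
    moreover have "X n \<in> cnorm_closure compl (embed ` carrier A)" using Xc embed_dense by blast
    ultimately show ?thesis unfolding cnorm_closure_def by blast
  qed
  then obtain g where g: "\<And>n. g n \<in> carrier A"
    "\<And>n. cnorm compl (X n \<ominus>\<^bsub>compl\<^esub> embed (g n)) < inverse (real (Suc n))" by metis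
  note ec = embed_closed[OF g(1)]
  have dist: "q (g j \<ominus> g k) = cnorm compl (embed (g j) \<ominus>\<^bsub>compl\<^esub> embed (g k))" for j k
    using cnorm_embed[OF minus_closed[OF g(1) g(1)]]
      star_hom_minus[OF star_algebra_axioms compl_star_algebra embed_star_hom g(1) g(1)] by simp
  have gC: "g \<in> cauchy_seqs A q"
  proof (rule cauchy_seqsI[OF g(1)])
    fix e :: real assume "e > 0"
    hence e: "e / 3 > 0" by simp
    obtain N where N: "\<forall>j\<ge>N. \<forall>k\<ge>N. cnorm compl (X j \<ominus>\<^bsub>compl\<^esub> X k) < e / 3"
      using c.cauchy_seqsD[OF X e] by blast
    obtain M where M: "inverse (real (Suc M)) < e / 3" using reals_Archimedean[OF e] by blast
    have M': "cnorm compl (X j \<ominus>\<^bsub>compl\<^esub> embed (g j)) < e / 3" if "j \<ge> M" for j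
    proof -
      have "inverse (real (Suc j)) \<le> inverse (real (Suc M))" using that by simp
      thus ?thesis using g(2)[of j] M by linarith
    qed
    have "q (g j \<ominus> g k) < e" if "j \<ge> max N M" "k \<ge> max N M" for j k
    proof -
      have "cnorm compl (X j \<ominus>\<^bsub>compl\<^esub> X k) < e / 3" using N that by simp
      moreover have "cnorm compl (embed (g j) \<ominus>\<^bsub>compl\<^esub> X j) < e / 3"
        using M'[of j] that c.q_minus_commute[OF Xc ec, of j j] by simp
      moreover have "cnorm compl (X k \<ominus>\<^bsub>compl\<^esub> embed (g k)) < e / 3" using M'[of k] that by simp
      moreover have "cnorm compl (embed (g j) \<ominus>\<^bsub>compl\<^esub> embed (g k))
          \<le> cnorm compl (embed (g j) \<ominus>\<^bsub>compl\<^esub> X j) + cnorm compl (X j \<ominus>\<^bsub>compl\<^esub> embed (g k))"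
        by (rule c.q_triangle[OF ec Xc ec])
      moreover have "cnorm compl (X j \<ominus>\<^bsub>compl\<^esub> embed (g k))
          \<le> cnorm compl (X j \<ominus>\<^bsub>compl\<^esub> X k) + cnorm compl (X k \<ominus>\<^bsub>compl\<^esub> embed (g k))"
        by (rule c.q_triangle[OF Xc Xc ec])
      ultimately show ?thesis unfolding dist by linarith
    qed
    thus "\<exists>N. \<forall>j\<ge>N. \<forall>k\<ge>N. q (g j \<ominus> g k) < e" by blast
  qed
  have "(\<lambda>n. cnorm compl (X n \<ominus>\<^bsub>compl\<^esub> cls g)) \<longlonglongrightarrow> 0"
  proof (rule c.null_dominated)
    show "X n \<ominus>\<^bsub>compl\<^esub> cls g \<in> carrier compl" for n using Xc gC by simp
    show "cnorm compl (X n \<ominus>\<^bsub>compl\<^esub> cls g)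
        \<le> inverse (real (Suc n)) + cnorm compl (embed (g n) \<ominus>\<^bsub>compl\<^esub> cls g)" for n
      using c.q_triangle[OF Xc ec cls_closed[OF gC], of n n] g(2)[of n] by linarith
    show "(\<lambda>n. inverse (real (Suc n)) + cnorm compl (embed (g n) \<ominus>\<^bsub>compl\<^esub> cls g)) \<longlonglongrightarrow> 0"
      using tendsto_add[OF LIMSEQ_inverse_real_of_nat embed_tends_cls[OF gC]] by simp
  qed
  thus "\<exists>x\<in>carrier compl. (\<lambda>n. cnorm compl (X n \<ominus>\<^bsub>compl\<^esub> x)) \<longlonglongrightarrow> 0" using cls_closed[OF gC] by blast
qed

end

text \<open>Extension by continuity from a dense image. The domination \<open>le\<close> makes the
  value well defined: sequences with the same limit in \<open>E\<close> have images with the same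
  limit in \<open>D\<close>, in particular where \<open>i\<close> identifies points.\<close>

lemma star_hom_extend:
  assumes P: "star_algebra P" and E: "cstar_algebra E" and D: "cstar_algebra D"
    and i: "i \<in> star_hom P E" and h: "h \<in> star_hom P D"
    and dense: "carrier E \<subseteq> cnorm_closure E (i ` carrier P)"
    and le: "\<And>x. x \<in> carrier P \<Longrightarrow> cnorm D (h x) \<le> cnorm E (i x)"
  shows "\<exists>H\<in>star_hom E D. \<forall>x\<in>carrier P. H (i x) = h x"
proof -
  interpret P: star_algebra P by fact
  interpret E: cstar E using E by (simp add: cstar_def)
  interpret D: cstar D using D by (simp add: cstar_def)
  have sa: "star_algebra E" "star_algebra D" by unfold_locales
  note ic = star_hom_closed[OF i] and hc = star_hom_closed[OF h]
  have dist: "cnorm D (h x \<ominus>\<^bsub>D\<^esub> h y) \<le> cnorm E (i x \<ominus>\<^bsub>E\<^esub> i y)"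
    if "x \<in> carrier P" "y \<in> carrier P" for x y
    using le[OF P.minus_closed[OF that]]
    unfolding star_hom_minus[OF P sa(1) i that] star_hom_minus[OF P sa(2) h that] .
  \<comment> \<open>The extension is first a relation: a single sequence in \<open>P\<close> reaches
    \<open>y\<close> through \<open>i\<close> and \<open>z\<close> through \<open>h\<close>.
    Compatibility with the operations then follows by combining such sequences.\<close>
  define G where "G y z \<longleftrightarrow> (\<exists>s. (\<forall>k. s k \<in> carrier P) \<and> E.tends (\<lambda>k. i (s k)) y \<and> D.tends (\<lambda>k. h (s k)) z)"
    for y z
  have Gc: "y \<in> carrier E \<and> z \<in> carrier D" if "G y z" for y z
    using that unfolding G_def E.tends_def D.tends_def by blast
  have ex: "\<exists>z. G y z" if y: "y \<in> carrier E" for y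
  proof -
    have "i ` carrier P \<subseteq> carrier E" using ic by blast
    from iffD1[OF E.cnorm_closure_iff[OF this] subsetD[OF dense y]]
    obtain f where f: "\<And>k. f k \<in> i ` carrier P" "E.tends f y" by blast
    hence "\<forall>k. \<exists>x. x \<in> carrier P \<and> f k = i x" by blast
    then obtain s where s: "\<And>k. s k \<in> carrier P" "\<And>k. f k = i (s k)" by metis
    have fs: "f = (\<lambda>k. i (s k))" by (rule ext) (rule s(2))
    have C: "(\<lambda>k. i (s k)) \<in> cauchy_seqs E (cnorm E)"
      using E.tends_cauchy[OF f(2)] unfolding fs .
    have "(\<lambda>k. h (s k)) \<in> cauchy_seqs D (cnorm D)"
    proof (rule D.cauchy_seqsI[OF hc[OF s(1)]])
      fix e :: real assume "e > 0"
      then obtain N where N: "\<forall>j\<ge>N. \<forall>k\<ge>N. cnorm E (i (s j) \<ominus>\<^bsub>E\<^esub> i (s k)) < e"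
        using E.cauchy_seqsD[OF C] by blast
      have "cnorm D (h (s j) \<ominus>\<^bsub>D\<^esub> h (s k)) < e" if "j \<ge> N" "k \<ge> N" for j k
        using order_le_less_trans[OF dist[OF s(1) s(1)] N[rule_format, OF that]] .
      thus "\<exists>N. \<forall>j\<ge>N. \<forall>k\<ge>N. cnorm D (h (s j) \<ominus>\<^bsub>D\<^esub> h (s k)) < e" by blast
    qed
    then obtain z where "D.tends (\<lambda>k. h (s k)) z" using D.cauchy_tends by blast
    thus ?thesis using s(1) f(2) unfolding G_def fs by blast
  qed
  have uniq: "z = z'" if "G y z" "G y z'" for y z z'
  proof -
    obtain s where s: "\<forall>k. s k \<in> carrier P" "E.tends (\<lambda>k. i (s k)) y" "D.tends (\<lambda>k. h (s k)) z"
      using \<open>G y z\<close> unfolding G_def by blast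
    obtain t where t: "\<forall>k. t k \<in> carrier P" "E.tends (\<lambda>k. i (t k)) y" "D.tends (\<lambda>k. h (t k)) z'"
      using \<open>G y z'\<close> unfolding G_def by blast
    have "y \<in> carrier E" "z \<in> carrier D" "z' \<in> carrier D" using Gc that by blast+
    have "cnorm D (z \<ominus>\<^bsub>D\<^esub> z') \<le> cnorm E (y \<ominus>\<^bsub>E\<^esub> y)"
      by (rule LIMSEQ_le[OF D.tends_dist[OF s(3) t(3)] E.tends_dist[OF s(2) t(2)]])
         (use dist s(1) t(1) in blast)
    also have "\<dots> = 0" using \<open>y \<in> carrier E\<close> by (simp add: a_minus_def E.r_neg)
    finally have "cnorm D (z \<ominus>\<^bsub>D\<^esub> z') = 0"
      using D.q_nonneg[OF D.minus_closed[OF \<open>z \<in> carrier D\<close> \<open>z' \<in> carrier D\<close>]] by linarith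
    hence "z \<ominus>\<^bsub>D\<^esub> z' = \<zero>\<^bsub>D\<^esub>"
      by (rule D.cnorm_definite[OF D.minus_closed[OF \<open>z \<in> carrier D\<close> \<open>z' \<in> carrier D\<close>]])
    thus ?thesis using D.minus_eq_zero_iff \<open>z \<in> carrier D\<close> \<open>z' \<in> carrier D\<close> by blast
  qed
  define H where "H y = (THE z. G y z)" for y
  have HG: "G y (H y)" if "y \<in> carrier E" for y
    unfolding H_def by (rule theI') (use ex[OF that] uniq in blast)
  have HI: "H y = z" if "G y z" for y z
    using uniq[OF HG that] Gc[OF that] by blast
  have Gi: "G (i x) (h x)" if "x \<in> carrier P" for x
    unfolding G_def using that E.tends_const[OF ic] D.tends_const[OF hc]
    by (intro exI[of _ "\<lambda>_. x"]) blast
  have Hi: "H (i x) = h x" if "x \<in> carrier P" for x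
    by (rule HI[OF Gi[OF that]])
  have "H \<in> star_hom E D"
  proof (rule star_homI)
    show "H \<one>\<^bsub>E\<^esub> = \<one>\<^bsub>D\<^esub>"
      using Hi[of "\<one>\<^bsub>P\<^esub>"] by (simp add: star_hom_one[OF i] star_hom_one[OF h])
    fix x c assume x: "x \<in> carrier E"
    obtain s where s: "\<forall>k. s k \<in> carrier P" "E.tends (\<lambda>k. i (s k)) x" "D.tends (\<lambda>k. h (s k)) (H x)"
      using HG[OF x] unfolding G_def by blast
    show "H x \<in> carrier D" using Gc[OF HG[OF x]] by blast
    have "G (cscale E c x) (cscale D c (H x))"
      unfolding G_def
      using E.tends_cscale[OF s(2), of c] D.tends_cscale[OF s(3), of c] s(1)
      by (intro exI[of _ "\<lambda>k. cscale P c (s k)"])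
         (simp add: star_hom_cscale[OF i] star_hom_cscale[OF h])
    thus "H (cscale E c x) = cscale D c (H x)" by (rule HI)
    have "G (star E x) (star D (H x))"
      unfolding G_def
      using E.tends_star[OF s(2)] D.tends_star[OF s(3)] s(1)
      by (intro exI[of _ "\<lambda>k. star P (s k)"])
         (simp add: star_hom_star[OF i] star_hom_star[OF h])
    thus "H (star E x) = star D (H x)" by (rule HI)
    fix y assume y: "y \<in> carrier E"
    obtain t where t: "\<forall>k. t k \<in> carrier P" "E.tends (\<lambda>k. i (t k)) y" "D.tends (\<lambda>k. h (t k)) (H y)"
      using HG[OF y] unfolding G_def by blast
    have "G (x \<oplus>\<^bsub>E\<^esub> y) (H x \<oplus>\<^bsub>D\<^esub> H y)"
      unfolding G_def
      using E.tends_add[OF s(2) t(2)] D.tends_add[OF s(3) t(3)] s(1) t(1)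
      by (intro exI[of _ "\<lambda>k. s k \<oplus>\<^bsub>P\<^esub> t k"])
         (simp add: star_hom_add[OF i] star_hom_add[OF h])
    thus "H (x \<oplus>\<^bsub>E\<^esub> y) = H x \<oplus>\<^bsub>D\<^esub> H y" by (rule HI)
    have "G (x \<otimes>\<^bsub>E\<^esub> y) (H x \<otimes>\<^bsub>D\<^esub> H y)"
      unfolding G_def
      using E.tends_mult[OF s(2) t(2)] D.tends_mult[OF s(3) t(3)] s(1) t(1)
      by (intro exI[of _ "\<lambda>k. s k \<otimes>\<^bsub>P\<^esub> t k"])
         (simp add: star_hom_mult[OF i] star_hom_mult[OF h])
    thus "H (x \<otimes>\<^bsub>E\<^esub> y) = H x \<otimes>\<^bsub>D\<^esub> H y" by (rule HI)
  qed
  thus ?thesis using Hi by (intro bexI[of _ H] ballI)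
qed

section \<open>Generated subalgebras and the free star-algebra\<close>

context star_algebra
begin

lemma star_generated_closed: "x \<in> star_generated A S \<Longrightarrow> S \<subseteq> carrier A \<Longrightarrow> x \<in> carrier A"
  by (induction rule: star_generated.induct) auto

lemma star_generated_zero: "\<zero> \<in> star_generated A S"
  using star_generated.cscale[OF star_generated.one, of A 0 S] by simp

lemma star_generated_uminus:
  "x \<in> star_generated A S \<Longrightarrow> S \<subseteq> carrier A \<Longrightarrow> \<ominus> x \<in> star_generated A S"
  using star_generated.cscale[of x A S "-1"] by (simp add: cscale_minus_one star_generated_closed)

lemma star_generated_finsum:
  assumes "\<And>i. i \<in> I \<Longrightarrow> f i \<in> star_generated A S" "S \<subseteq> carrier A"
  shows "finsum A f I \<in> star_generated A S"
  using assms(1)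
proof (induction I rule: infinite_finite_induct)
  case (insert i I)
  have "f \<in> I \<rightarrow> carrier A" "f i \<in> carrier A"
    using insert.prems star_generated_closed[OF _ assms(2)] by auto
  thus ?case using insert by (simp add: star_generated.add)
qed (simp_all add: star_generated_zero)

text \<open>The fullness clause speaks of C*-seminorms on this algebra; to complete it for such a
  seminorm, it has to be a *-algebra in its own right.\<close>

lemma generated_star_algebra:
  assumes S: "S \<subseteq> carrier A"
  shows "star_algebra (A\<lparr>carrier := star_generated A S\<rparr>)"
proof -
  note c = star_generated_closed[OF _ S]
  note i = star_generated.add star_generated.mult star_generated.one star_generated_zero
    star_generated.cscale star_generated.star
  have "ring (A\<lparr>carrier := star_generated A S\<rparr>)"
  proof (rule ringI)
    show "abelian_group (A\<lparr>carrier := star_generated A S\<rparr>)"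
    proof (rule abelian_groupI)
      fix x assume "x \<in> carrier (A\<lparr>carrier := star_generated A S\<rparr>)"
      thus "\<exists>y\<in>carrier (A\<lparr>carrier := star_generated A S\<rparr>).
          y \<oplus>\<^bsub>A\<lparr>carrier := star_generated A S\<rparr>\<^esub> x = \<zero>\<^bsub>A\<lparr>carrier := star_generated A S\<rparr>\<^esub>"
        by (intro bexI[of _ "\<ominus> x"]) (simp_all add: c l_neg star_generated_uminus S)
    qed (simp_all add: c i a_ac)
    show "monoid (A\<lparr>carrier := star_generated A S\<rparr>)"
      by (rule monoidI) (simp_all add: c i m_assoc)
  qed (simp_all add: c i l_distr r_distr)
  thus ?thesis
    by (rule star_algebra.intro, intro star_algebra_axioms.intro)
       (simp_all add: c i cscale_add_right cscale_add_left cscale_cscale cscale_mult_left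
         cscale_mult_right star_add star_mult star_cscale)
qed

end

lemma star_hom_image_generated:
  assumes "star_algebra A" "f \<in> star_hom A B" "S \<subseteq> carrier A" "x \<in> star_generated A S"
    and "\<And>s. s \<in> S \<Longrightarrow> f s \<in> star_generated B T"
  shows "f x \<in> star_generated B T"
proof -
  note c = star_algebra.star_generated_closed[OF assms(1) _ assms(3)]
  show ?thesis using assms(4)
  proof (induction rule: star_generated.induct)
    case (add x y)
    thus ?case by (simp add: star_hom_add[OF assms(2)] c star_generated.add)
  next
    case (mult x y)
    thus ?case by (simp add: star_hom_mult[OF assms(2)] c star_generated.mult)
  qed (simp_all add: star_hom_one[OF assms(2)] star_hom_cscale[OF assms(2)]
      star_hom_star[OF assms(2)] c star_generated.intros assms(5))
qed

lemma star_hom_eq_generated: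
  assumes "star_algebra A" "f \<in> star_hom A B" "g \<in> star_hom A B" "S \<subseteq> carrier A"
    and "\<And>s. s \<in> S \<Longrightarrow> f s = g s" and "x \<in> star_generated A S"
  shows "f x = g x"
proof -
  note c = star_algebra.star_generated_closed[OF assms(1) _ assms(4)]
  note h = star_hom_add star_hom_mult star_hom_one star_hom_cscale star_hom_star
  show ?thesis using assms(6)
    by (induction rule: star_generated.induct) (simp_all add: h[OF assms(2)] h[OF assms(3)] c assms(5))
qed

lemma star_hom_eq_dense:
  assumes E: "cstar_algebra E" and D: "cstar_algebra D"
    and f: "f \<in> star_hom E D" and g: "g \<in> star_hom E D" and S: "S \<subseteq> carrier E"
    and dense: "carrier E \<subseteq> cnorm_closure E (star_generated E S)"
    and eq: "\<And>s. s \<in> S \<Longrightarrow> f s = g s" and x: "x \<in> carrier E"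
  shows "f x = g x"
proof -
  interpret E: cstar E using E by (simp add: cstar_def)
  interpret D: cstar D using D by (simp add: cstar_def)
  have "star_generated E S \<subseteq> carrier E" using E.star_generated_closed[OF _ S] by blast
  from iffD1[OF E.cnorm_closure_iff[OF this] subsetD[OF dense x]]
  obtain s where s: "\<And>k. s k \<in> star_generated E S" "E.tends s x" by blast
  have "(\<lambda>k. f (s k)) = (\<lambda>k. g (s k))"
    by (intro ext star_hom_eq_generated[OF E.star_algebra_axioms f g S eq s(1)])
  thus ?thesis
    using D.tends_unique[OF star_hom_tends[OF E D f s(2)]] star_hom_tends[OF E D g s(2)] by simp
qed

text \<open>The elements that commute with \<open>y\<close> form a closed subalgebra, which is
  closed under adjoints because \<open>y\<close> is self-adjoint. So commutation spreads from the
  generators.\<close>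

lemma star_hom_commute_dense:
  assumes E: "cstar_algebra E" and D: "cstar_algebra D"
    and f: "f \<in> star_hom E D" and y: "y \<in> carrier D" "star D y = y" and S: "S \<subseteq> carrier E"
    and dense: "carrier E \<subseteq> cnorm_closure E (star_generated E S)"
    and comm: "\<And>s. s \<in> S \<Longrightarrow> f s \<otimes>\<^bsub>D\<^esub> y = y \<otimes>\<^bsub>D\<^esub> f s" and x: "x \<in> carrier E"
  shows "f x \<otimes>\<^bsub>D\<^esub> y = y \<otimes>\<^bsub>D\<^esub> f x"
proof -
  interpret E: cstar E using E by (simp add: cstar_def)
  interpret D: cstar D using D by (simp add: cstar_def)
  note c = E.star_generated_closed[OF _ S] and fc = star_hom_closed[OF f]
  have gen: "f z \<otimes>\<^bsub>D\<^esub> y = y \<otimes>\<^bsub>D\<^esub> f z" if "z \<in> star_generated E S" for z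
    using that
  proof (induction rule: star_generated.induct)
    case (mult u v)
    have cl: "f u \<in> carrier D" "f v \<in> carrier D" using mult c fc by blast+
    have "f u \<otimes>\<^bsub>D\<^esub> f v \<otimes>\<^bsub>D\<^esub> y = f u \<otimes>\<^bsub>D\<^esub> (y \<otimes>\<^bsub>D\<^esub> f v)"
      using cl y by (simp add: D.m_assoc mult.IH)
    also have "\<dots> = y \<otimes>\<^bsub>D\<^esub> f u \<otimes>\<^bsub>D\<^esub> f v"
      using cl y by (simp add: D.m_assoc[symmetric] mult.IH)
    finally show ?case using mult cl y by (simp add: star_hom_mult[OF f] c D.m_assoc)
  next
    case (star u)
    have cl: "f u \<in> carrier D" using star c fc by blast
    \<comment> \<open>Adjoints of the induction hypothesis, where \<open>y\<close> is its own
      adjoint.\<close>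
    have "star D (f u) \<otimes>\<^bsub>D\<^esub> y = star D (y \<otimes>\<^bsub>D\<^esub> f u)" using cl y by (simp add: D.star_mult)
    also have "\<dots> = star D (f u \<otimes>\<^bsub>D\<^esub> y)" using star.IH by simp
    also have "\<dots> = y \<otimes>\<^bsub>D\<^esub> star D (f u)" using cl y by (simp add: D.star_mult)
    finally show ?case using star by (simp add: star_hom_star[OF f] c)
  qed (use y in \<open>simp_all add: comm star_hom_one[OF f] star_hom_add[OF f] star_hom_cscale[OF f] c fc
      D.l_distr D.r_distr D.cscale_mult_left D.cscale_mult_right\<close>)
  have "star_generated E S \<subseteq> carrier E" using c by blast
  from iffD1[OF E.cnorm_closure_iff[OF this] subsetD[OF dense x]]
  obtain s where s: "\<And>k. s k \<in> star_generated E S" "E.tends s x" by blast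
  note t = star_hom_tends[OF E D f s(2)] and ty = D.tends_const[OF y(1)]
  have "(\<lambda>k. f (s k) \<otimes>\<^bsub>D\<^esub> y) = (\<lambda>k. y \<otimes>\<^bsub>D\<^esub> f (s k))" by (simp add: gen[OF s(1)])
  thus ?thesis using D.tends_unique[OF D.tends_mult[OF t ty]] D.tends_mult[OF ty t] by simp
qed

section \<open>The free unital *-algebra on a set of letters\<close>

lemma word_star_add: "word_star (v + w) = word_star w + word_star v"
  by (simp add: word_star_def plus_star_word_def)

lemma word_star_word_star [simp]: "word_star (word_star w) = w"
  by (cases w) (simp add: word_star_def rev_map[symmetric] comp_def case_prod_beta)

text \<open>\<open>word_star\<close> is an involution, so a single monomial contributes to each
  coefficient. With this formula the linear laws of the adjoint are compared
  coefficientwise.\<close>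

lemma lookup_poly_star:
  "Poly_Mapping.lookup (poly_star f) w = cnj (Poly_Mapping.lookup f (word_star w))"
proof -
  have "Poly_Mapping.lookup (poly_star f) w
      = (\<Sum>v\<in>Poly_Mapping.keys f. if v = word_star w then cnj (Poly_Mapping.lookup f v) else 0)"
    unfolding poly_star_def lookup_sum lookup_single
    by (rule sum.cong) (auto simp: when_def)
  also have "\<dots> = cnj (Poly_Mapping.lookup f (word_star w))"
    by (simp add: sum.delta in_keys_iff)
  finally show ?thesis .
qed

lemma poly_star_single: "poly_star (Poly_Mapping.single w c) = Poly_Mapping.single (word_star w) (cnj c)"
  by (rule poly_mapping_eqI) (auto simp: lookup_poly_star lookup_single when_def)

lemma poly_star_add: "poly_star (f + g) = poly_star f + poly_star g"
  by (rule poly_mapping_eqI) (simp add: lookup_poly_star lookup_add)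

lemma poly_star_poly_star: "poly_star (poly_star f) = f"
  by (rule poly_mapping_eqI) (simp add: lookup_poly_star)

lemma lookup_poly_scale: "Poly_Mapping.lookup (poly_scale c f) w = c * Poly_Mapping.lookup f w"
  unfolding poly_scale_def mult_map_scale_conv_mult[symmetric]
  by (simp add: Poly_Mapping.map.rep_eq when_def)

lemma poly_star_scale: "poly_star (poly_scale c f) = poly_scale (cnj c) (poly_star f)"
  by (rule poly_mapping_eqI) (simp add: lookup_poly_star lookup_poly_scale)

lemma poly_sum_monomials:
  "f = (\<Sum>w\<in>Poly_Mapping.keys f. Poly_Mapping.single w (Poly_Mapping.lookup f w))"
  by (rule poly_mapping_eqI) (simp add: lookup_sum lookup_single when_def sum.delta' in_keys_iff)

definition words :: "'x set \<Rightarrow> 'x star_word set" where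
  "words G = {w. fst ` set (letters w) \<subseteq> G}"

lemma words_zero: "0 \<in> words G"
  and words_add: "v \<in> words G \<Longrightarrow> w \<in> words G \<Longrightarrow> v + w \<in> words G"
  and words_star: "w \<in> words G \<Longrightarrow> word_star w \<in> words G"
  by (auto simp: words_def zero_star_word_def plus_star_word_def word_star_def)

lemma free_carrier: "carrier (free_star_alg G) = {f. Poly_Mapping.keys f \<subseteq> words G}"
  by (auto simp: free_star_alg_def words_def)

lemma free_simps [simp]:
  "mult (free_star_alg G) = (*)" "one (free_star_alg G) = 1" "zero (free_star_alg G) = 0"
  "add (free_star_alg G) = (+)" "cscale (free_star_alg G) = poly_scale"
  "star (free_star_alg G) = poly_star"
  by (simp_all add: free_star_alg_def)

text \<open>Induction over finite sums of monomials that stays within the letters \<open>G\<close>.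
  The \<open>add\<close> case provides membership of both summands, since evaluation is additive
  only on the carrier.\<close>

lemma free_induct [consumes 1, case_names single add]:
  assumes f: "f \<in> carrier (free_star_alg G)"
    and single: "\<And>w c. w \<in> words G \<Longrightarrow> P (Poly_Mapping.single w c)"
    and add: "\<And>f g. f \<in> carrier (free_star_alg G) \<Longrightarrow> g \<in> carrier (free_star_alg G) \<Longrightarrow>
      P f \<Longrightarrow> P g \<Longrightarrow> P (f + g)"
  shows "P f"
proof -
  have 0: "P 0" using single[OF words_zero, of 0] by simp
  \<comment> \<open>Partial sums are shown to lie in the carrier along with satisfying
    \<open>P\<close>, as the \<open>add\<close> rule asks for both.\<close>
  have "(\<Sum>w\<in>K. Poly_Mapping.single w (h w)) \<in> carrier (free_star_alg G) \<and>
      P (\<Sum>w\<in>K. Poly_Mapping.single w (h w))" if "finite K" "K \<subseteq> words G" for K and h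
    using that
  proof (induction K rule: finite_induct)
    case (insert w K)
    have "Poly_Mapping.single w (h w) \<in> carrier (free_star_alg G)"
      using insert.prems by (auto simp: free_carrier)
    moreover from this have "Poly_Mapping.single w (h w) + (\<Sum>w\<in>K. Poly_Mapping.single w (h w))
        \<in> carrier (free_star_alg G)"
      using insert by (auto simp: free_carrier intro!: order_trans[OF keys_add])
    ultimately show ?case using insert add single by simp
  qed (simp add: 0 free_carrier)
  from this[of "Poly_Mapping.keys f" "Poly_Mapping.lookup f"] f
  have "P (\<Sum>w\<in>Poly_Mapping.keys f. Poly_Mapping.single w (Poly_Mapping.lookup f w))"
    by (simp add: free_carrier)
  thus ?thesis by (simp only: poly_sum_monomials[symmetric])
qed

lemma poly_induct [case_names single add]:
  fixes f :: "'x star_poly"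
  assumes "\<And>w c. P (Poly_Mapping.single w c)" "\<And>f g. P f \<Longrightarrow> P g \<Longrightarrow> P (f + g)"
  shows "P f"
proof -
  have "f \<in> carrier (free_star_alg UNIV)" by (simp add: free_carrier words_def)
  thus ?thesis by (induction rule: free_induct) (use assms in auto)
qed

lemma poly_star_mult: "poly_star (f * g) = poly_star g * poly_star f"
proof (induction f rule: poly_induct)
  case (single v a)
  show ?case
    by (induction g rule: poly_induct)
       (simp_all add: mult_single poly_star_single word_star_add mult.commute poly_star_add algebra_simps)
qed (simp add: poly_star_add algebra_simps)

text \<open>Scalars sit at the empty word, which is neutral for concatenation; hence they are
  central although \<open>poly_scale\<close> multiplies from the left.\<close>

lemma poly_scale_right: "f * Poly_Mapping.single 0 c = poly_scale c (f :: 'x star_poly)"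
  by (induction f rule: poly_induct) (simp_all add: poly_scale_def mult_single algebra_simps)

lemma poly_scale_mult_right: "f * poly_scale c g = poly_scale c (f * g)"
  unfolding poly_scale_def mult.assoc[symmetric] poly_scale_right by (simp add: poly_scale_def)

lemma poly_scale_mult_left: "poly_scale c f * g = poly_scale c (f * g)"
  by (simp add: poly_scale_def mult.assoc)

lemma poly_scale_linear:
  "poly_scale c (f + g) = poly_scale c f + poly_scale c g"
  "poly_scale (c + d) f = poly_scale c f + poly_scale d f"
  "poly_scale c (poly_scale d f) = poly_scale (c * d) f"
  "poly_scale 1 f = f"
  by (rule poly_mapping_eqI; simp add: lookup_poly_scale lookup_add algebra_simps)+

lemma free_star_algebra: "star_algebra (free_star_alg G)"
proof -
  have mc: "Poly_Mapping.keys f \<subseteq> words G \<Longrightarrow> Poly_Mapping.keys g \<subseteq> words G \<Longrightarrow> Poly_Mapping.keys (f * g) \<subseteq> words G"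
    for f g :: "'a star_poly" by (rule order_trans[OF keys_mult]) (auto intro: words_add)
  have ac: "Poly_Mapping.keys f \<subseteq> words G \<Longrightarrow> Poly_Mapping.keys g \<subseteq> words G \<Longrightarrow> Poly_Mapping.keys (f + g) \<subseteq> words G"
    for f g :: "'a star_poly" using keys_add[of f g] by blast
  have uc: "Poly_Mapping.keys f \<subseteq> words G \<Longrightarrow> Poly_Mapping.keys (- f) \<subseteq> words G"
    for f :: "'a star_poly" by (auto simp: in_keys_iff)
  have sc: "Poly_Mapping.keys f \<subseteq> words G \<Longrightarrow> Poly_Mapping.keys (poly_scale c f) \<subseteq> words G"
    for f :: "'a star_poly" and c by (auto simp: in_keys_iff lookup_poly_scale)
  have stc: "Poly_Mapping.keys f \<subseteq> words G \<Longrightarrow> Poly_Mapping.keys (poly_star f) \<subseteq> words G" for f :: "'a star_poly"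
  proof
    fix w assume "Poly_Mapping.keys f \<subseteq> words G" "w \<in> Poly_Mapping.keys (poly_star f)"
    hence "word_star w \<in> words G" by (auto simp: in_keys_iff lookup_poly_star)
    thus "w \<in> words G" using words_star[of "word_star w"] by simp
  qed
  note [simp] = free_carrier mc ac uc sc stc
  have "ring (free_star_alg G)"
  proof (rule ringI)
    show "abelian_group (free_star_alg G)"
    proof (rule abelian_groupI)
      fix f assume "f \<in> carrier (free_star_alg G)"
      thus "\<exists>g\<in>carrier (free_star_alg G). g \<oplus>\<^bsub>free_star_alg G\<^esub> f = \<zero>\<^bsub>free_star_alg G\<^esub>"
        by (intro bexI[of _ "- f"]) simp_all
    qed (simp_all add: ac_simps)
    show "monoid (free_star_alg G)"
      by (rule monoidI) (simp_all add: mult.assoc words_zero)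
  qed (simp_all add: algebra_simps)
  thus ?thesis
    by (rule star_algebra.intro, intro star_algebra_axioms.intro)
       (simp_all add: poly_star_poly_star poly_star_add poly_star_mult poly_star_scale
         poly_scale_mult_right poly_scale_mult_left poly_scale_linear)
qed

lemma free_minus:
  assumes "f \<in> carrier (free_star_alg G)" "g \<in> carrier (free_star_alg G)"
  shows "f \<ominus>\<^bsub>free_star_alg G\<^esub> g = f - g"
  using star_algebra.minus_add_cancel[OF free_star_algebra assms] by (simp add: algebra_simps)

lemma free_closed:
  assumes f: "f \<in> carrier (free_star_alg G)"
  shows "poly_star f \<in> carrier (free_star_alg G)" "poly_scale c f \<in> carrier (free_star_alg G)"
    and "g \<in> carrier (free_star_alg G) \<Longrightarrow> f + g \<in> carrier (free_star_alg G)"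
    and "g \<in> carrier (free_star_alg G) \<Longrightarrow> f - g \<in> carrier (free_star_alg G)"
    and "g \<in> carrier (free_star_alg G) \<Longrightarrow> f * g \<in> carrier (free_star_alg G)"
proof -
  interpret star_algebra "free_star_alg G" by (rule free_star_algebra)
  show "poly_star f \<in> carrier (free_star_alg G)" "poly_scale c f \<in> carrier (free_star_alg G)"
    using star_closed[OF f] cscale_closed[OF f] by simp_all
  assume g: "g \<in> carrier (free_star_alg G)"
  show "f + g \<in> carrier (free_star_alg G)" "f * g \<in> carrier (free_star_alg G)"
    "f - g \<in> carrier (free_star_alg G)"
    using a_closed[OF f g] m_closed[OF f g] minus_closed[OF f g] free_minus[OF f g] by simp_all
qed

lemma gen_closed: "x \<in> G \<Longrightarrow> gen x \<in> carrier (free_star_alg G)"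
  by (auto simp: gen_def free_carrier words_def)

text \<open>A word is a product of letters, and a letter flagged \<open>True\<close> is the adjoint
  of a generator. Bounds on seminorms and density statements thereby reduce to generators.\<close>

lemma free_generated:
  assumes "f \<in> carrier (free_star_alg G)"
  shows "f \<in> star_generated (free_star_alg G) (gen ` G)"
  using assms
proof (induction rule: free_induct)
  case (single w c)
  have "Poly_Mapping.single (StarWord ls) 1 \<in> star_generated (free_star_alg G) (gen ` G)"
    if "StarWord ls \<in> words G" for ls
    using that
  proof (induction ls)
    case Nil
    show ?case using star_generated.one[of "free_star_alg G" "gen ` G"]
      by (simp add: zero_star_word_def[symmetric])
  next
    case (Cons l ls)
    obtain x b where l: "l = (x, b)" by (cases l)
    have x: "x \<in> G" and ls: "StarWord ls \<in> words G" using Cons.prems by (auto simp: words_def l)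
    have "poly_star (gen x) = Poly_Mapping.single (StarWord [(x, True)]) 1"
      by (simp add: gen_def poly_star_single word_star_def)
    moreover have g: "gen x \<in> star_generated (free_star_alg G) (gen ` G)"
      using x by (intro star_generated.incl imageI)
    moreover note star_generated.star[OF g]
    ultimately have "Poly_Mapping.single (StarWord [l]) 1 \<in> star_generated (free_star_alg G) (gen ` G)"
      by (cases b) (simp_all add: l gen_def[symmetric])
    from star_generated.mult[OF this Cons.IH[OF ls]] show ?case
      by (simp add: mult_single plus_star_word_def)
  qed
  from star_generated.cscale[OF this, of "letters w" c] single show ?case
    by (simp add: poly_scale_def mult_single)
next
  case (add f g)
  thus ?case using star_generated.add[of f "free_star_alg G" "gen ` G" g] by simp
qed

section \<open>Evaluation of *-polynomials\<close>

context star_algebra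
begin

definition eval_letter :: "('x \<Rightarrow> 'a) \<Rightarrow> 'x \<times> bool \<Rightarrow> 'a" where
  "eval_letter h l = (if snd l then star A (h (fst l)) else h (fst l))"

definition eval_word :: "('x \<Rightarrow> 'a) \<Rightarrow> 'x star_word \<Rightarrow> 'a" where
  "eval_word h w = foldr (\<lambda>l z. eval_letter h l \<otimes> z) (letters w) \<one>"

definition eval_poly :: "('x \<Rightarrow> 'a) \<Rightarrow> 'x star_poly \<Rightarrow> 'a" where
  "eval_poly h f = (\<Oplus>w\<in>Poly_Mapping.keys f. cscale A (Poly_Mapping.lookup f w) (eval_word h w))"

lemma eval_word_closed:
  assumes "h \<in> G \<rightarrow> carrier A" "w \<in> words G"
  shows "eval_word h w \<in> carrier A"
proof -
  have "foldr (\<lambda>l z. eval_letter h l \<otimes> z) ls \<one> \<in> carrier A" if "fst ` set ls \<subseteq> G" for ls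
    using that assms(1) by (induction ls) (auto simp: eval_letter_def Pi_iff)
  thus ?thesis using assms(2) by (simp add: eval_word_def words_def)
qed

lemma eval_word_add:
  assumes h: "h \<in> G \<rightarrow> carrier A" and "v \<in> words G" "w \<in> words G"
  shows "eval_word h (v + w) = eval_word h v \<otimes> eval_word h w"
proof -
  note wc = eval_word_closed[OF h assms(3)]
  have "eval_word h (StarWord ls + w) = eval_word h (StarWord ls) \<otimes> eval_word h w"
    if "StarWord ls \<in> words G" for ls
    using that
  proof (induction ls)
    case Nil
    show ?case using wc by (simp add: eval_word_def plus_star_word_def)
  next
    case (Cons l ls)
    have ls: "StarWord ls \<in> words G" and l: "fst l \<in> G" using Cons.prems by (auto simp: words_def)
    have lc: "eval_letter h l \<in> carrier A"
      using funcset_mem[OF h l] by (simp add: eval_letter_def)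
    have "eval_word h (StarWord (l # ls) + w) = eval_letter h l \<otimes> eval_word h (StarWord ls + w)"
      by (simp add: eval_word_def plus_star_word_def)
    also have "\<dots> = eval_letter h l \<otimes> eval_word h (StarWord ls) \<otimes> eval_word h w"
      unfolding Cons.IH[OF ls] by (rule m_assoc[symmetric, OF lc eval_word_closed[OF h ls] wc])
    finally show ?case by (simp add: eval_word_def)
  qed
  from this[of "letters v"] assms(2) show ?thesis by simp
qed

lemma eval_word_star:
  assumes h: "h \<in> G \<rightarrow> carrier A" and "w \<in> words G"
  shows "eval_word h (word_star w) = star A (eval_word h w)"
proof -
  have "eval_word h (word_star (StarWord ls)) = star A (eval_word h (StarWord ls))"
    if "StarWord ls \<in> words G" for ls
    using that
  proof (induction ls)
    case Nil
    show ?case by (simp add: eval_word_def word_star_def)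
  next
    case (Cons l ls)
    have l: "StarWord [l] \<in> words G" and ls: "StarWord ls \<in> words G"
      using Cons.prems by (auto simp: words_def)
    have e: "StarWord (l # ls) = StarWord [l] + StarWord ls" by (simp add: plus_star_word_def)
    have hl: "h (fst l) \<in> carrier A" using l h by (auto simp: words_def)
    have "eval_word h (word_star (StarWord [l])) = star A (eval_word h (StarWord [l]))"
      using hl by (cases l) (auto simp: eval_word_def word_star_def eval_letter_def)
    thus ?case
      unfolding e word_star_add
      by (simp add: eval_word_add[OF h] words_star l ls Cons.IH eval_word_closed[OF h] star_mult)
  qed
  from this[of "letters w"] assms(2) show ?thesis by simp
qed

text \<open>Words outside the support contribute zero, so several polynomials can be evaluated over
  one common set of words.\<close>

lemma eval_poly_superset:
  assumes h: "h \<in> G \<rightarrow> carrier A" and K: "finite K" "K \<subseteq> words G" "Poly_Mapping.keys f \<subseteq> K"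
  shows "eval_poly h f = (\<Oplus>w\<in>K. cscale A (Poly_Mapping.lookup f w) (eval_word h w))"
  unfolding eval_poly_def
  by (rule add.finprod_mono_neutral_cong_left)
     (use K eval_word_closed[OF h] in \<open>auto simp: in_keys_iff subset_iff\<close>)

lemma eval_poly_single:
  assumes h: "h \<in> G \<rightarrow> carrier A" and w: "w \<in> words G"
  shows "eval_poly h (Poly_Mapping.single w c) = cscale A c (eval_word h w)"
  using eval_poly_superset[OF h, of "{w}" "Poly_Mapping.single w c"] w eval_word_closed[OF h w]
  by simp

lemma eval_poly_closed:
  assumes h: "h \<in> G \<rightarrow> carrier A" and f: "f \<in> carrier (free_star_alg G)"
  shows "eval_poly h f \<in> carrier A"
  unfolding eval_poly_def using f
  by (intro finsum_closed) (auto simp: free_carrier intro!: cscale_closed eval_word_closed[OF h])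

lemma eval_poly_add:
  assumes h: "h \<in> G \<rightarrow> carrier A"
    and f: "f \<in> carrier (free_star_alg G)" and g: "g \<in> carrier (free_star_alg G)"
  shows "eval_poly h (f + g) = eval_poly h f \<oplus> eval_poly h g"
proof -
  define K where "K = Poly_Mapping.keys f \<union> Poly_Mapping.keys g"
  have K: "finite K" "K \<subseteq> words G" using f g by (auto simp: K_def free_carrier)
  have sub: "Poly_Mapping.keys f \<subseteq> K" "Poly_Mapping.keys g \<subseteq> K" "Poly_Mapping.keys (f + g) \<subseteq> K"
    using keys_add[of f g] by (auto simp: K_def)
  have ec: "w \<in> K \<Longrightarrow> eval_word h w \<in> carrier A" for w using K(2) eval_word_closed[OF h] by blast
  have "eval_poly h (f + g) = (\<Oplus>w\<in>K. cscale A (Poly_Mapping.lookup f w) (eval_word h w) \<oplus>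
      cscale A (Poly_Mapping.lookup g w) (eval_word h w))"
    unfolding eval_poly_superset[OF h K sub(3)]
    by (rule finsum_cong) (auto simp: lookup_add cscale_add_left ec simp_implies_def)
  also have "\<dots> = eval_poly h f \<oplus> eval_poly h g"
    unfolding eval_poly_superset[OF h K sub(1)] eval_poly_superset[OF h K sub(2)]
    by (rule finsum_addf) (auto simp: ec)
  finally show ?thesis .
qed

lemma eval_poly_scale:
  assumes h: "h \<in> G \<rightarrow> carrier A" and f: "f \<in> carrier (free_star_alg G)"
  shows "eval_poly h (poly_scale c f) = cscale A c (eval_poly h f)"
proof -
  have K: "finite (Poly_Mapping.keys f)" "Poly_Mapping.keys f \<subseteq> words G"
    using f by (auto simp: free_carrier)
  have sub: "Poly_Mapping.keys (poly_scale c f) \<subseteq> Poly_Mapping.keys f"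
    by (auto simp: in_keys_iff lookup_poly_scale)
  have ec: "w \<in> Poly_Mapping.keys f \<Longrightarrow> eval_word h w \<in> carrier A" for w
    using K(2) eval_word_closed[OF h] by blast
  have "eval_poly h (poly_scale c f) = (\<Oplus>w\<in>Poly_Mapping.keys f.
      cscale A c (cscale A (Poly_Mapping.lookup f w) (eval_word h w)))"
    unfolding eval_poly_superset[OF h K sub]
    by (rule finsum_cong) (auto simp: lookup_poly_scale cscale_cscale ec simp_implies_def)
  also have "\<dots> = cscale A c (eval_poly h f)"
    unfolding eval_poly_def by (rule cscale_finsum[symmetric]) (auto simp: ec)
  finally show ?thesis .
qed

lemma eval_poly_star:
  assumes h: "h \<in> G \<rightarrow> carrier A" and f: "f \<in> carrier (free_star_alg G)"
  shows "eval_poly h (poly_star f) = star A (eval_poly h f)"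
  using f
proof (induction rule: free_induct)
  case (single w c)
  thus ?case
    by (simp add: poly_star_single eval_poly_single[OF h] words_star eval_word_star[OF h]
        star_cscale eval_word_closed[OF h])
next
  case (add f g)
  thus ?case
    by (simp add: free_closed poly_star_add eval_poly_add[OF h] star_add eval_poly_closed[OF h])
qed

lemma eval_poly_mult:
  assumes h: "h \<in> G \<rightarrow> carrier A"
    and f: "f \<in> carrier (free_star_alg G)" and g: "g \<in> carrier (free_star_alg G)"
  shows "eval_poly h (f * g) = eval_poly h f \<otimes> eval_poly h g"
  using f
proof (induction rule: free_induct)
  case (single v a)
  note v = this
  have vc: "Poly_Mapping.single v a \<in> carrier (free_star_alg G)" using v by (auto simp: free_carrier)
  show ?case using g
  proof (induction rule: free_induct)
    case (single w b)
    thus ?case using v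
      by (simp add: mult_single eval_poly_single[OF h] words_add eval_word_add[OF h]
          cscale_mult_left cscale_mult_right cscale_cscale eval_word_closed[OF h] mult.commute)
  next
    case (add f g)
    thus ?case
      by (simp add: free_closed distrib_left eval_poly_add[OF h] eval_poly_closed[OF h] vc r_distr)
  qed
next
  case (add f f')
  thus ?case
    by (simp add: free_closed distrib_right eval_poly_add[OF h] eval_poly_closed[OF h] g l_distr)
qed

lemma eval_poly_gen:
  assumes "h \<in> G \<rightarrow> carrier A" "x \<in> G"
  shows "eval_poly h (gen x) = h x"
proof -
  have "StarWord [(x, False)] \<in> words G" "h x \<in> carrier A" using assms by (auto simp: words_def)
  thus ?thesis unfolding gen_def
    by (simp add: eval_poly_single[OF assms(1)] eval_word_def eval_letter_def)
qed

text \<open>The universal property of the free unital *-algebra, in the form from which morphisms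
  out of presented C*-algebras are built.\<close>

lemma eval_poly_star_hom:
  assumes h: "h \<in> G \<rightarrow> carrier A"
  shows "eval_poly h \<in> star_hom (free_star_alg G) A"
proof (rule star_homI)
  have "eval_poly h (Poly_Mapping.single 0 1) = \<one>"
    unfolding eval_poly_single[OF h words_zero] by (simp add: eval_word_def zero_star_word_def)
  thus "eval_poly h \<one>\<^bsub>free_star_alg G\<^esub> = \<one>" by simp
qed (simp_all add: eval_poly_closed[OF h] eval_poly_add[OF h] eval_poly_mult[OF h]
    eval_poly_scale[OF h] eval_poly_star[OF h])

end

section \<open>Universal C*-algebras\<close>

lemma cnorm_closure_mono: "S \<subseteq> T \<Longrightarrow> cnorm_closure A S \<subseteq> cnorm_closure A T"
  unfolding cnorm_closure_def by fast

text \<open>Row and column sums in the relations are type-class sums, while morphisms are additive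
  for \<open>finsum\<close>; the two agree on the free algebra.\<close>

lemma free_finsum:
  assumes "f \<in> I \<rightarrow> carrier (free_star_alg G)"
  shows "finsum (free_star_alg G) f I = sum f I"
proof -
  interpret star_algebra "free_star_alg G" by (rule free_star_algebra)
  show ?thesis using assms
  proof (induction I rule: infinite_finite_induct)
    case (insert i I)
    have "f \<in> I \<rightarrow> carrier (free_star_alg G)" "f i \<in> carrier (free_star_alg G)"
      using insert.prems by auto
    from finsum_insert[OF insert.hyps this] insert.IH[OF this(1)] insert.hyps show ?case by simp
  qed simp_all
qed

lemma free_one_closed: "1 \<in> carrier (free_star_alg G)"
  by (simp add: free_carrier words_zero)

lemma free_sum_closed:
  assumes "\<And>i. i \<in> I \<Longrightarrow> f i \<in> carrier (free_star_alg G)"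
  shows "sum f I \<in> carrier (free_star_alg G)"
proof -
  interpret star_algebra "free_star_alg G" by (rule free_star_algebra)
  have f: "f \<in> I \<rightarrow> carrier (free_star_alg G)" using assms by blast
  show ?thesis using finsum_closed[OF f] by (simp only: free_finsum[OF f])
qed

context star_algebra
begin

lemma eval_poly_minus:
  assumes h: "h \<in> G \<rightarrow> carrier A"
    and f: "f \<in> carrier (free_star_alg G)" and g: "g \<in> carrier (free_star_alg G)"
  shows "eval_poly h (f - g) = eval_poly h f \<ominus> eval_poly h g"
  using star_hom_minus[OF free_star_algebra star_algebra_axioms eval_poly_star_hom[OF h] f g]
  by (simp only: free_minus[OF f g])

lemma eval_poly_minus_zero:
  assumes "h \<in> G \<rightarrow> carrier A" "f \<in> carrier (free_star_alg G)" "g \<in> carrier (free_star_alg G)"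
    and "eval_poly h f = eval_poly h g"
  shows "eval_poly h (f - g) = \<zero>"
  using eval_poly_minus[OF assms(1-3)] assms(4) eval_poly_closed[OF assms(1,3)]
  by (simp add: minus_eq_zero_iff)

lemma eval_poly_one:
  assumes "h \<in> G \<rightarrow> carrier A"
  shows "eval_poly h 1 = \<one>"
  using star_hom_one[OF eval_poly_star_hom[OF assms]] by simp

lemma eval_poly_sum:
  assumes h: "h \<in> G \<rightarrow> carrier A" and f: "\<And>i. i \<in> I \<Longrightarrow> f i \<in> carrier (free_star_alg G)"
  shows "eval_poly h (sum f I) = (\<Oplus>i\<in>I. eval_poly h (f i))"
proof -
  have f': "f \<in> I \<rightarrow> carrier (free_star_alg G)" using f by blast
  show ?thesis
    using star_hom_finsum[OF free_star_algebra star_algebra_axioms eval_poly_star_hom[OF h] f']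
    by (simp only: free_finsum[OF f'])
qed

end

lemma copy_relations_cases:
  assumes "r \<in> copy_relations D e"
  obtains
    (add) x y where "x \<in> carrier D" "y \<in> carrier D"
      "r = gen (e (x \<oplus>\<^bsub>D\<^esub> y)) - (gen (e x) + gen (e y))"
  | (mult) x y where "x \<in> carrier D" "y \<in> carrier D"
      "r = gen (e (x \<otimes>\<^bsub>D\<^esub> y)) - gen (e x) * gen (e y)"
  | (cscale) c x where "x \<in> carrier D" "r = gen (e (cscale D c x)) - poly_scale c (gen (e x))"
  | (star) x where "x \<in> carrier D" "r = gen (e (star D x)) - poly_star (gen (e x))"
  | (one) "r = gen (e \<one>\<^bsub>D\<^esub>) - 1"
  using assms unfolding copy_relations_def Un_iff mem_Collect_eq singleton_iff by metis

lemma copy_relationsI: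
  "x \<in> carrier D \<Longrightarrow> y \<in> carrier D \<Longrightarrow>
    gen (e (x \<oplus>\<^bsub>D\<^esub> y)) - (gen (e x) + gen (e y)) \<in> copy_relations D e"
  "x \<in> carrier D \<Longrightarrow> y \<in> carrier D \<Longrightarrow>
    gen (e (x \<otimes>\<^bsub>D\<^esub> y)) - gen (e x) * gen (e y) \<in> copy_relations D e"
  "x \<in> carrier D \<Longrightarrow> gen (e (cscale D c x)) - poly_scale c (gen (e x)) \<in> copy_relations D e"
  "x \<in> carrier D \<Longrightarrow> gen (e (star D x)) - poly_star (gen (e x)) \<in> copy_relations D e"
  "gen (e \<one>\<^bsub>D\<^esub>) - 1 \<in> copy_relations D e"
  unfolding copy_relations_def by blast+

lemma copy_relations_closed:
  assumes D: "star_algebra D" and e: "\<And>x. x \<in> carrier D \<Longrightarrow> e x \<in> G"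
  shows "copy_relations D e \<subseteq> carrier (free_star_alg G)"
proof
  interpret D: star_algebra D by (rule D)
  fix r assume "r \<in> copy_relations D e"
  thus "r \<in> carrier (free_star_alg G)"
    by (cases rule: copy_relations_cases)
       (simp_all add: free_closed gen_closed e free_one_closed)
qed

text \<open>Each relation evaluates to one of the morphism laws of \<open>k\<close>. This is the
  verification needed whenever a morphism out of a tensor product or a free product is
  built.\<close>

lemma eval_copy_relations:
  assumes A: "star_algebra A" and D: "star_algebra D" and k: "k \<in> star_hom D A"
    and e: "\<And>x. x \<in> carrier D \<Longrightarrow> e x \<in> G" and h: "h \<in> G \<rightarrow> carrier A"
    and eq: "\<And>x. x \<in> carrier D \<Longrightarrow> h (e x) = k x" and r: "r \<in> copy_relations D e"
  shows "star_algebra.eval_poly A h r = \<zero>\<^bsub>A\<^esub>"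
proof -
  interpret A: star_algebra A by (rule A)
  interpret D: star_algebra D by (rule D)
  have g: "x \<in> carrier D \<Longrightarrow> gen (e x) \<in> carrier (free_star_alg G)" for x
    by (intro gen_closed e)
  have v: "x \<in> carrier D \<Longrightarrow> A.eval_poly h (gen (e x)) = k x" for x
    by (simp add: A.eval_poly_gen[OF h] e eq)
  note ev = A.eval_poly_add[OF h] A.eval_poly_mult[OF h] A.eval_poly_scale[OF h]
    A.eval_poly_star[OF h] A.eval_poly_one[OF h]
  show ?thesis using r
  proof (cases rule: copy_relations_cases)
    case (add x y)
    thus ?thesis by (simp add: A.eval_poly_minus_zero[OF h] g free_closed ev v star_hom_add[OF k])
  next
    case (mult x y)
    thus ?thesis by (simp add: A.eval_poly_minus_zero[OF h] g free_closed ev v star_hom_mult[OF k])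
  next
    case (cscale c x)
    thus ?thesis by (simp add: A.eval_poly_minus_zero[OF h] g free_closed ev v star_hom_cscale[OF k])
  next
    case (star x)
    thus ?thesis by (simp add: A.eval_poly_minus_zero[OF h] g free_closed ev v star_hom_star[OF k])
  next
    case one
    thus ?thesis
      by (simp add: A.eval_poly_minus_zero[OF h] g free_closed free_one_closed ev v star_hom_one[OF k])
  qed
qed

context cstar_seminormed
begin

lemma embed_eqI:
  assumes "x \<in> carrier A" "y \<in> carrier A" "q (x \<ominus> y) = 0"
  shows "embed x = embed y"
  unfolding embed_def by (rule cls_eqI) (simp add: null_rel_iff cauchy_const assms)

end

text \<open>The converse direction: where the copy relations have seminorm zero, the copies obey the
  morphism laws. The seminorm is arbitrary, because the fact is used for each competitor of the
  supremum and for the supremum itself.\<close>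

lemma copy_star_hom:
  assumes q: "cstar_seminorm (free_star_alg G) q" and D: "star_algebra D"
    and e: "\<And>x. x \<in> carrier D \<Longrightarrow> e x \<in> G" and rel: "\<And>r. r \<in> copy_relations D e \<Longrightarrow> q r = 0"
  shows "(\<lambda>x. cstar_seminormed.embed (free_star_alg G) q (gen (e x)))
    \<in> star_hom D (completion (free_star_alg G) q)"
proof -
  interpret D: star_algebra D by (rule D)
  interpret F: cstar_seminormed "free_star_alg G" q
    by (rule cstar_seminormed.intro[OF free_star_algebra], unfold_locales) (rule q)
  have g: "x \<in> carrier D \<Longrightarrow> gen (e x) \<in> carrier (free_star_alg G)" for x
    by (intro gen_closed e)
  have eq: "F.embed f = F.embed f'" if "f \<in> carrier (free_star_alg G)" "f' \<in> carrier (free_star_alg G)"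
    "f - f' \<in> copy_relations D e" for f f'
    using that rel by (intro F.embed_eqI) (simp_all add: free_minus)
  note E = F.embed_star_hom
  show ?thesis
  proof (rule star_homI)
    fix x c assume x: "x \<in> carrier D"
    show "F.embed (gen (e x)) \<in> carrier F.compl" by (intro F.embed_closed g x)
    have "F.embed (gen (e (cscale D c x))) = F.embed (poly_scale c (gen (e x)))"
      by (intro eq copy_relationsI free_closed g x D.cscale_closed)
    thus "F.embed (gen (e (cscale D c x))) = cscale F.compl c (F.embed (gen (e x)))"
      using star_hom_cscale[OF E g[OF x], of c] by simp
    have "F.embed (gen (e (star D x))) = F.embed (poly_star (gen (e x)))"
      by (intro eq copy_relationsI free_closed g x D.star_closed)
    thus "F.embed (gen (e (star D x))) = star F.compl (F.embed (gen (e x)))"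
      using star_hom_star[OF E g[OF x]] by simp
    fix y assume y: "y \<in> carrier D"
    have "F.embed (gen (e (x \<oplus>\<^bsub>D\<^esub> y))) = F.embed (gen (e x) + gen (e y))"
      by (intro eq copy_relationsI free_closed g x y D.a_closed)
    thus "F.embed (gen (e (x \<oplus>\<^bsub>D\<^esub> y))) = F.embed (gen (e x)) \<oplus>\<^bsub>F.compl\<^esub> F.embed (gen (e y))"
      using star_hom_add[OF E g[OF x] g[OF y]] by simp
    have "F.embed (gen (e (x \<otimes>\<^bsub>D\<^esub> y))) = F.embed (gen (e x) * gen (e y))"
      by (intro eq copy_relationsI free_closed g x y D.m_closed)
    thus "F.embed (gen (e (x \<otimes>\<^bsub>D\<^esub> y))) = F.embed (gen (e x)) \<otimes>\<^bsub>F.compl\<^esub> F.embed (gen (e y))"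
      using star_hom_mult[OF E g[OF x] g[OF y]] by simp
  next
    have "F.embed (gen (e \<one>\<^bsub>D\<^esub>)) = F.embed 1"
      by (intro eq copy_relationsI free_one_closed g D.one_closed)
    thus "F.embed (gen (e \<one>\<^bsub>D\<^esub>)) = \<one>\<^bsub>F.compl\<^esub>" using star_hom_one[OF E] by simp
  qed
qed

text \<open>The copy is a morphism from a C*-algebra into the completion for \<open>q\<close>, hence
  contractive. This is why the supremum over all such \<open>q\<close> is finite on copied
  elements.\<close>

lemma copy_seminorm_le:
  assumes q: "cstar_seminorm (free_star_alg G) q" and D: "cstar_algebra D"
    and e: "\<And>x. x \<in> carrier D \<Longrightarrow> e x \<in> G" and rel: "\<And>r. r \<in> copy_relations D e \<Longrightarrow> q r = 0"
    and x: "x \<in> carrier D"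
  shows "q (gen (e x)) \<le> cnorm D x"
proof -
  interpret D: cstar D using D by (simp add: cstar_def)
  interpret F: cstar_seminormed "free_star_alg G" q
    by (rule cstar_seminormed.intro[OF free_star_algebra], unfold_locales) (rule q)
  have "cnorm F.compl (F.embed (gen (e x))) \<le> cnorm D x"
    by (rule star_hom_contractive[OF D F.compl_cstar_algebra
          copy_star_hom[OF q D.star_algebra_axioms e rel] x])
  thus ?thesis by (simp add: F.cnorm_embed gen_closed e x)
qed

text \<open>\<open>bounded\<close> is the finiteness under which the real supremum in
  \<open>univ_seminorm\<close> is a genuine least upper bound.\<close>

locale univ_cstar_alg = star_algebra P for P :: "('a, 'e) star_alg_scheme" (structure) +
  fixes R :: "'a set"
  assumes rels_closed: "R \<subseteq> carrier P"
    and bounded: "x \<in> carrier P \<Longrightarrow>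
      \<exists>K. \<forall>q. cstar_seminorm P q \<and> (\<forall>r\<in>R. q r = 0) \<longrightarrow> q x \<le> K"
begin

text \<open>It shows that the supremum ranges over a nonempty set and is nonnegative.\<close>

lemma zero_seminorm: "cstar_seminorm P (\<lambda>_. 0)"
  by (simp add: cstar_seminorm_def)

lemma univ_seminorm_ge:
  assumes "x \<in> carrier P" "cstar_seminorm P q" "\<And>r. r \<in> R \<Longrightarrow> q r = 0"
  shows "q x \<le> univ_seminorm P R x"
proof -
  obtain K where K: "\<forall>q. cstar_seminorm P q \<and> (\<forall>r\<in>R. q r = 0) \<longrightarrow> q x \<le> K"
    using bounded[OF assms(1)] ..
  show ?thesis unfolding univ_seminorm_def
    by (rule cSUP_upper) (use assms K in \<open>auto simp: bdd_above_def\<close>)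
qed

lemma univ_seminorm_le:
  assumes "\<And>q. cstar_seminorm P q \<Longrightarrow> (\<And>r. r \<in> R \<Longrightarrow> q r = 0) \<Longrightarrow> q x \<le> K"
  shows "univ_seminorm P R x \<le> K"
  unfolding univ_seminorm_def
  by (rule cSUP_least) (use assms zero_seminorm in auto)

lemma univ_seminorm_rel: "r \<in> R \<Longrightarrow> univ_seminorm P R r = 0"
  using univ_seminorm_le[of r 0] univ_seminorm_ge[OF _ zero_seminorm, of r] rels_closed
  by (auto intro: antisym)

lemma univ_seminorm_nonneg: "x \<in> carrier P \<Longrightarrow> 0 \<le> univ_seminorm P R x"
  using univ_seminorm_ge[OF _ zero_seminorm, of x] by simp

lemma univ_seminorm_seminorm: "cstar_seminorm P (univ_seminorm P R)"
  unfolding cstar_seminorm_def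
proof (intro conjI ballI allI)
  fix x c assume x: "x \<in> carrier P"
  show "0 \<le> univ_seminorm P R x" by (rule univ_seminorm_nonneg[OF x])
  have le: "univ_seminorm P R (cscale P c x) \<le> cmod c * univ_seminorm P R x"
    if x: "x \<in> carrier P" for c x
  proof (rule univ_seminorm_le)
    fix q assume q: "cstar_seminorm P q" "\<And>r. r \<in> R \<Longrightarrow> q r = 0"
    interpret q: cstar_seminormed P q by unfold_locales (rule q(1))
    show "q (cscale P c x) \<le> cmod c * univ_seminorm P R x"
      unfolding q.q_cscale[OF x] by (rule mult_left_mono[OF univ_seminorm_ge[OF x q]]) simp_all
  qed
  show "univ_seminorm P R (cscale P c x) = cmod c * univ_seminorm P R x"
  proof (cases "c = 0")
    case True
    thus ?thesis using le[OF x, of c] univ_seminorm_nonneg[OF cscale_closed[OF x], of c] by simp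
  next
    case False
    \<comment> \<open>The reverse inequality is the first one for the scalar
      \<open>1 / c\<close>.\<close>
    have "univ_seminorm P R (cscale P (1 / c) (cscale P c x))
        \<le> cmod (1 / c) * univ_seminorm P R (cscale P c x)" by (rule le[OF cscale_closed[OF x]])
    hence "univ_seminorm P R x \<le> univ_seminorm P R (cscale P c x) / cmod c"
      using False x by (simp add: cscale_cscale norm_divide)
    hence "cmod c * univ_seminorm P R x \<le> univ_seminorm P R (cscale P c x)"
      using False by (simp add: field_simps)
    thus ?thesis using le[OF x, of c] by simp
  qed
  show "univ_seminorm P R (star P x \<otimes> x) = (univ_seminorm P R x)\<^sup>2"
  proof (rule antisym)
    show "univ_seminorm P R (star P x \<otimes> x) \<le> (univ_seminorm P R x)\<^sup>2"
    proof (rule univ_seminorm_le)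
      fix q assume q: "cstar_seminorm P q" "\<And>r. r \<in> R \<Longrightarrow> q r = 0"
      interpret q: cstar_seminormed P q by unfold_locales (rule q(1))
      show "q (star P x \<otimes> x) \<le> (univ_seminorm P R x)\<^sup>2"
        unfolding q.q_star_mult[OF x] by (intro power_mono univ_seminorm_ge x q q.q_nonneg)
    qed
    \<comment> \<open>The square of the supremum is at most the supremum of the squares: roots are
      taken for each competitor separately, and the supremum afterwards.\<close>
    have "univ_seminorm P R x \<le> sqrt (univ_seminorm P R (star P x \<otimes> x))"
    proof (rule univ_seminorm_le)
      fix q assume q: "cstar_seminorm P q" "\<And>r. r \<in> R \<Longrightarrow> q r = 0"
      interpret q: cstar_seminormed P q by unfold_locales (rule q(1))
      have "(q x)\<^sup>2 \<le> univ_seminorm P R (star P x \<otimes> x)"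
        unfolding q.q_star_mult[OF x, symmetric]
        by (intro univ_seminorm_ge q m_closed star_closed x)
      thus "q x \<le> sqrt (univ_seminorm P R (star P x \<otimes> x))" by (rule real_le_rsqrt)
    qed
    hence "(univ_seminorm P R x)\<^sup>2 \<le> (sqrt (univ_seminorm P R (star P x \<otimes> x)))\<^sup>2"
      by (rule power_mono) (rule univ_seminorm_nonneg[OF x])
    thus "(univ_seminorm P R x)\<^sup>2 \<le> univ_seminorm P R (star P x \<otimes> x)"
      using univ_seminorm_nonneg[OF m_closed[OF star_closed[OF x] x]] by simp
  qed
  fix y assume y: "y \<in> carrier P"
  show "univ_seminorm P R (x \<oplus> y) \<le> univ_seminorm P R x + univ_seminorm P R y"
  proof (rule univ_seminorm_le)
    fix q assume q: "cstar_seminorm P q" "\<And>r. r \<in> R \<Longrightarrow> q r = 0"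
    interpret q: cstar_seminormed P q by unfold_locales (rule q(1))
    show "q (x \<oplus> y) \<le> univ_seminorm P R x + univ_seminorm P R y"
      by (rule order_trans[OF q.q_add[OF x y]]) (intro add_mono univ_seminorm_ge x y q)
  qed
  show "univ_seminorm P R (x \<otimes> y) \<le> univ_seminorm P R x * univ_seminorm P R y"
  proof (rule univ_seminorm_le)
    fix q assume q: "cstar_seminorm P q" "\<And>r. r \<in> R \<Longrightarrow> q r = 0"
    interpret q: cstar_seminormed P q by unfold_locales (rule q(1))
    show "q (x \<otimes> y) \<le> univ_seminorm P R x * univ_seminorm P R y"
      by (rule order_trans[OF q.q_mult[OF x y]])
         (intro mult_mono univ_seminorm_ge univ_seminorm_nonneg x y q q.q_nonneg)
  qed
qed

sublocale U: cstar_seminormed P "univ_seminorm P R"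
  by unfold_locales (rule univ_seminorm_seminorm)

lemma univ_elem_embed: "univ_elem P R = U.embed"
  unfolding univ_elem_def U.embed_def U.cls_def by (rule refl)

lemma univ_cstar_algebra: "cstar_algebra (univ_cstar P R)"
  unfolding univ_cstar_def by (rule U.compl_cstar_algebra)

lemma univ_elem_star_hom: "univ_elem P R \<in> star_hom P (univ_cstar P R)"
  unfolding univ_cstar_def univ_elem_embed by (rule U.embed_star_hom)

lemma univ_elem_dense:
  "carrier (univ_cstar P R) \<subseteq> cnorm_closure (univ_cstar P R) (univ_elem P R ` carrier P)"
  unfolding univ_cstar_def univ_elem_embed by (rule U.embed_dense)

lemma univ_elem_cnorm: "x \<in> carrier P \<Longrightarrow> cnorm (univ_cstar P R) (univ_elem P R x) = univ_seminorm P R x"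
  unfolding univ_cstar_def univ_elem_embed by (rule U.cnorm_embed)

lemma univ_elem_eqI:
  assumes "x \<in> carrier P" "y \<in> carrier P" "x \<ominus> y \<in> R"
  shows "univ_elem P R x = univ_elem P R y"
  unfolding univ_elem_embed by (rule U.embed_eqI[OF assms(1,2) univ_seminorm_rel[OF assms(3)]])

text \<open>The norm of \<open>D\<close> pulled back along \<open>h\<close> vanishes on
  \<open>R\<close>, so it is one of the competitors and lies below the universal norm; then
  \<open>h\<close> extends by continuity.\<close>

lemma univ_lift:
  assumes D: "cstar_algebra D" and h: "h \<in> star_hom P D" and rel: "\<And>r. r \<in> R \<Longrightarrow> h r = \<zero>\<^bsub>D\<^esub>"
  shows "\<exists>H\<in>star_hom (univ_cstar P R) D. \<forall>x\<in>carrier P. H (univ_elem P R x) = h x"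
proof -
  interpret D: cstar D using D by (simp add: cstar_def)
  have "cnorm D (h x) \<le> cnorm (univ_cstar P R) (univ_elem P R x)" if x: "x \<in> carrier P" for x
    unfolding univ_elem_cnorm[OF x]
    by (rule univ_seminorm_ge[OF x pullback_seminorm[OF star_algebra_axioms D.seminorm h]])
       (simp add: rel)
  from star_hom_extend[OF star_algebra_axioms univ_cstar_algebra D univ_elem_star_hom h
      univ_elem_dense this]
  show ?thesis .
qed

end

text \<open>Bounds that are uniform over a set of seminorms can be added and multiplied, so
  finiteness of the supremum needs to be known on generators only.\<close>

lemma (in star_algebra) seminorms_bounded_generated:
  assumes S: "\<And>q. q \<in> S \<Longrightarrow> cstar_seminormed A q" and T: "T \<subseteq> carrier A"
    and bd: "\<And>t. t \<in> T \<Longrightarrow> \<exists>K. \<forall>q\<in>S. q t \<le> K" and x: "x \<in> star_generated A T"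
  shows "\<exists>K. \<forall>q\<in>S. q x \<le> K"
  using x
proof (induction rule: star_generated.induct)
  case (incl x)
  thus ?case by (rule bd)
next
  case one
  have "q \<one> \<le> 1" if "q \<in> S" for q
    by (rule cstar_seminormed.q_one_le[OF S[OF that]])
  thus ?case by (intro exI[of _ 1] ballI)
next
  case (add x y)
  have xy: "x \<in> carrier A" "y \<in> carrier A" using add.hyps star_generated_closed[OF _ T] by simp_all
  obtain K where K: "\<forall>q\<in>S. q x \<le> K" using add.IH(1) by (rule exE)
  obtain L where L: "\<forall>q\<in>S. q y \<le> L" using add.IH(2) by (rule exE)
  have "q (x \<oplus> y) \<le> K + L" if q: "q \<in> S" for q
    using cstar_seminormed.q_add[OF S[OF q] xy] bspec[OF K q] bspec[OF L q] by linarith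
  thus ?case by (intro exI[of _ "K + L"] ballI)
next
  case (mult x y)
  have xy: "x \<in> carrier A" "y \<in> carrier A" using mult.hyps star_generated_closed[OF _ T] by simp_all
  obtain K where K: "\<forall>q\<in>S. q x \<le> K" using mult.IH(1) by (rule exE)
  obtain L where L: "\<forall>q\<in>S. q y \<le> L" using mult.IH(2) by (rule exE)
  \<comment> \<open>The bounds from the induction hypotheses carry no sign; \<open>max\<close> with
    0 makes their product an upper bound.\<close>
  have "q (x \<otimes> y) \<le> max K 0 * max L 0" if q: "q \<in> S" for q
  proof -
    have "q x \<le> max K 0" "q y \<le> max L 0" using bspec[OF K q] bspec[OF L q] by simp_all
    hence "q x * q y \<le> max K 0 * max L 0"
      by (rule mult_mono) (simp_all add: cstar_seminormed.q_nonneg[OF S[OF q]] xy)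
    thus ?thesis using cstar_seminormed.q_mult[OF S[OF q] xy] by linarith
  qed
  thus ?case by (intro exI[of _ "max K 0 * max L 0"] ballI)
next
  case (cscale x a)
  have xc: "x \<in> carrier A" using cscale.hyps star_generated_closed[OF _ T] by simp
  obtain K where K: "\<forall>q\<in>S. q x \<le> K" using cscale.IH by (rule exE)
  have "q (Defs.cscale A a x) \<le> cmod a * K" if q: "q \<in> S" for q
    using mult_left_mono[OF bspec[OF K q] norm_ge_zero[of a]]
    by (simp only: cstar_seminormed.q_cscale[OF S[OF q] xc])
  thus ?case by (intro exI[of _ "cmod a * K"] ballI)
next
  case (star x)
  have xc: "x \<in> carrier A" using star.hyps star_generated_closed[OF _ T] by simp
  obtain K where K: "\<forall>q\<in>S. q x \<le> K" using star.IH by (rule exE)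
  have "q (Defs.star A x) \<le> K" if q: "q \<in> S" for q
    using bspec[OF K q] by (simp only: cstar_seminormed.q_star[OF S[OF q] xc])
  thus ?case by (intro exI[of _ K] ballI)
qed

lemma free_univ_cstar_alg:
  assumes R: "R \<subseteq> carrier (free_star_alg G)"
    and bd: "\<And>x. x \<in> G \<Longrightarrow>
      \<exists>K. \<forall>q. cstar_seminorm (free_star_alg G) q \<and> (\<forall>r\<in>R. q r = 0) \<longrightarrow> q (gen x) \<le> K"
  shows "univ_cstar_alg (free_star_alg G) R"
proof -
  interpret F: star_algebra "free_star_alg G" by (rule free_star_algebra)
  define S where "S = {q. cstar_seminorm (free_star_alg G) q \<and> (\<forall>r\<in>R. q r = 0)}"
  have S: "cstar_seminormed (free_star_alg G) q" if "q \<in> S" for q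
    using that
    by (intro cstar_seminormed.intro free_star_algebra cstar_seminormed_axioms.intro) (simp add: S_def)
  have g: "gen ` G \<subseteq> carrier (free_star_alg G)" by (rule image_subsetI) (rule gen_closed)
  have bg: "\<exists>K. \<forall>q\<in>S. q t \<le> K" if t: "t \<in> gen ` G" for t
  proof -
    obtain x where x: "t = gen x" "x \<in> G" using t by (rule imageE)
    obtain K where "\<forall>q. cstar_seminorm (free_star_alg G) q \<and> (\<forall>r\<in>R. q r = 0) \<longrightarrow> q (gen x) \<le> K"
      using bd[OF x(2)] by (rule exE)
    thus ?thesis unfolding S_def x(1) by (intro exI[of _ K]) simp
  qed
  have b: "\<exists>K. \<forall>q\<in>S. q x \<le> K" if "x \<in> carrier (free_star_alg G)" for x
    by (rule F.seminorms_bounded_generated[OF S g bg free_generated[OF that]])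
  show ?thesis
    unfolding univ_cstar_alg_def univ_cstar_alg_axioms_def
  proof (intro conjI free_star_algebra R allI impI)
    fix x assume "x \<in> carrier (free_star_alg G)"
    from b[OF this] obtain K where K: "\<forall>q\<in>S. q x \<le> K" by (rule exE)
    have "q x \<le> K" if "cstar_seminorm (free_star_alg G) q \<and> (\<forall>r\<in>R. q r = 0)" for q
      by (rule bspec[OF K]) (use that in \<open>simp add: S_def\<close>)
    thus "\<exists>K. \<forall>q. cstar_seminorm (free_star_alg G) q \<and> (\<forall>r\<in>R. q r = 0) \<longrightarrow> q x \<le> K"
      by (intro exI[of _ K] allI impI)
  qed
qed

section \<open>Universal C*-algebras given by generators and relations\<close>

locale free_univ =
  fixes G :: "'x set" and R :: "'x star_poly set"
  assumes univ: "univ_cstar_alg (free_star_alg G) R"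
begin

sublocale univ_cstar_alg "free_star_alg G" R by (rule univ)

abbreviation uc :: "((nat \<Rightarrow> 'x star_poly) set) cstar_alg" where
  "uc \<equiv> univ_cstar (free_star_alg G) R"

abbreviation ugen :: "'x \<Rightarrow> (nat \<Rightarrow> 'x star_poly) set" where
  "ugen x \<equiv> univ_elem (free_star_alg G) R (gen x)"

lemma ugen_closed: "x \<in> G \<Longrightarrow> ugen x \<in> carrier uc"
  by (rule star_hom_closed[OF univ_elem_star_hom gen_closed])

lemma ugen_dense: "carrier uc \<subseteq> cnorm_closure uc (star_generated uc (ugen ` G))"
proof -
  have g: "gen ` G \<subseteq> carrier (free_star_alg G)" by (rule image_subsetI) (rule gen_closed)
  have "univ_elem (free_star_alg G) R f \<in> star_generated uc (ugen ` G)"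
    if "f \<in> carrier (free_star_alg G)" for f
    by (rule star_hom_image_generated[OF free_star_algebra univ_elem_star_hom g free_generated[OF that]])
       (auto intro: star_generated.incl)
  hence "univ_elem (free_star_alg G) R ` carrier (free_star_alg G) \<subseteq> star_generated uc (ugen ` G)"
    by (rule image_subsetI)
  from subset_trans[OF univ_elem_dense cnorm_closure_mono[OF this]] show ?thesis .
qed

lemma ugen_lift:
  assumes D: "cstar_algebra D" and h: "h \<in> G \<rightarrow> carrier D"
    and rel: "\<And>r. r \<in> R \<Longrightarrow> star_algebra.eval_poly D h r = \<zero>\<^bsub>D\<^esub>"
  shows "\<exists>H\<in>star_hom uc D. \<forall>x\<in>G. H (ugen x) = h x"
proof -
  interpret D: cstar D using D by (simp add: cstar_def)
  have "\<exists>H\<in>star_hom uc D. \<forall>f\<in>carrier (free_star_alg G).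
      H (univ_elem (free_star_alg G) R f) = D.eval_poly h f"
    by (rule univ_lift[OF D D.eval_poly_star_hom[OF h]]) (rule rel)
  then obtain H where H: "H \<in> star_hom uc D"
    "\<forall>f\<in>carrier (free_star_alg G). H (univ_elem (free_star_alg G) R f) = D.eval_poly h f"
    by (rule bexE)
  have "H (ugen x) = h x" if "x \<in> G" for x
    using bspec[OF H(2) gen_closed[OF that]] D.eval_poly_gen[OF h that] by simp
  with H(1) show ?thesis by (intro bexI[of _ H] ballI)
qed

lemma ucopy:
  assumes D: "star_algebra D" and e: "\<And>x. x \<in> carrier D \<Longrightarrow> e x \<in> G"
    and rel: "copy_relations D e \<subseteq> R"
  shows "(\<lambda>x. ugen (e x)) \<in> star_hom D uc"
  unfolding univ_elem_embed univ_cstar_def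
  by (rule copy_star_hom[OF univ_seminorm_seminorm D e]) (use rel in \<open>auto intro: univ_seminorm_rel\<close>)

end

text \<open>The legs, \<open>x\<close> tensor 1 here and 1 tensor \<open>y\<close> next, are single
  generators and therefore morphisms; \<open>tensor_elem\<close> is their product.\<close>

definition tensor_inl ::
    "('a, 'e) cstar_alg_scheme \<Rightarrow> ('b, 'f) cstar_alg_scheme \<Rightarrow> 'a \<Rightarrow> (nat \<Rightarrow> ('a + 'b) star_poly) set" where
  "tensor_inl A B x = univ_elem (tensor_gens A B) (tensor_rels A B) (gen (Inl x))"

definition tensor_inr ::
    "('a, 'e) cstar_alg_scheme \<Rightarrow> ('b, 'f) cstar_alg_scheme \<Rightarrow> 'b \<Rightarrow> (nat \<Rightarrow> ('a + 'b) star_poly) set" where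
  "tensor_inr A B y = univ_elem (tensor_gens A B) (tensor_rels A B) (gen (Inr y))"

lemma copy_gen_bounded:
  assumes D: "cstar_algebra D" and e: "\<And>x. x \<in> carrier D \<Longrightarrow> e x \<in> G"
    and rel: "copy_relations D e \<subseteq> R" and x: "x \<in> carrier D"
  shows "\<exists>K. \<forall>q. cstar_seminorm (free_star_alg G) q \<and> (\<forall>r\<in>R. q r = 0) \<longrightarrow> q (gen (e x)) \<le> K"
proof (rule exI[of _ "cnorm D x"], rule allI, rule impI)
  fix q assume q: "cstar_seminorm (free_star_alg G) q \<and> (\<forall>r\<in>R. q r = 0)"
  show "q (gen (e x)) \<le> cnorm D x"
    by (rule copy_seminorm_le[OF conjunct1[OF q] D e _ x]) (use q rel in auto)
qed

section \<open>Maximal tensor products and free products\<close>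

context
  fixes A :: "('a, 'e) cstar_alg_scheme" and B :: "('b, 'f) cstar_alg_scheme"
  assumes A: "cstar_algebra A" and B: "cstar_algebra B"
begin

interpretation A: cstar A using A by (simp add: cstar_def)
interpretation B: cstar B using B by (simp add: cstar_def)

lemma tensor_free_univ: "free_univ (Inl ` carrier A \<union> Inr ` carrier B) (tensor_rels A B)"
proof (rule free_univ.intro, rule free_univ_cstar_alg)
  let ?G = "Inl ` carrier A \<union> Inr ` carrier B"
  have cl: "copy_relations A Inl \<subseteq> carrier (free_star_alg ?G)"
    "copy_relations B Inr \<subseteq> carrier (free_star_alg ?G)"
    by (rule copy_relations_closed, unfold_locales, simp)+
  show "tensor_rels A B \<subseteq> carrier (free_star_alg ?G)"
    unfolding tensor_rels_def
    by (intro Un_least cl subsetI) (auto intro!: free_closed gen_closed)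
  fix x assume "x \<in> ?G"
  thus "\<exists>K. \<forall>q. cstar_seminorm (free_star_alg ?G) q \<and> (\<forall>r\<in>tensor_rels A B. q r = 0) \<longrightarrow>
      q (gen x) \<le> K"
  proof (elim UnE imageE)
    fix y assume y: "x = Inl y" "y \<in> carrier A"
    show ?thesis unfolding y(1)
      by (rule copy_gen_bounded[OF A _ _ y(2)]) (simp_all add: tensor_rels_def le_supI1)
  next
    fix y assume y: "x = Inr y" "y \<in> carrier B"
    show ?thesis unfolding y(1)
      by (rule copy_gen_bounded[OF B _ _ y(2)]) (simp_all add: tensor_rels_def le_supI1)
  qed
qed

interpretation T: free_univ "Inl ` carrier A \<union> Inr ` carrier B" "tensor_rels A B"
  by (rule tensor_free_univ)

lemma max_tensor_uc: "max_tensor A B = T.uc"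
  by (simp add: max_tensor_def tensor_gens_def)

lemma max_tensor_cstar_algebra: "cstar_algebra (max_tensor A B)"
  unfolding max_tensor_uc by (rule T.univ_cstar_algebra)

lemma tensor_inl_star_hom: "tensor_inl A B \<in> star_hom A (max_tensor A B)"
  unfolding max_tensor_uc tensor_inl_def[abs_def] tensor_gens_def
  by (rule T.ucopy) (unfold_locales, auto simp: tensor_rels_def)

lemma tensor_inr_star_hom: "tensor_inr A B \<in> star_hom B (max_tensor A B)"
  unfolding max_tensor_uc tensor_inr_def[abs_def] tensor_gens_def
  by (rule T.ucopy) (unfold_locales, auto simp: tensor_rels_def)

lemma tensor_elem_eq:
  assumes "x \<in> carrier A" "y \<in> carrier B"
  shows "tensor_elem A B x y = tensor_inl A B x \<otimes>\<^bsub>max_tensor A B\<^esub> tensor_inr A B y"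
  using star_hom_mult[OF T.univ_elem_star_hom gen_closed gen_closed, of "Inl x" "Inr y"] assms
  by (simp add: tensor_elem_def tensor_inl_def tensor_inr_def max_tensor_uc tensor_gens_def)

lemma tensor_commute:
  assumes x: "x \<in> carrier A" and y: "y \<in> carrier B"
  shows "tensor_inl A B x \<otimes>\<^bsub>max_tensor A B\<^esub> tensor_inr A B y =
    tensor_inr A B y \<otimes>\<^bsub>max_tensor A B\<^esub> tensor_inl A B x"
proof -
  have g: "gen (Inl x) \<in> carrier (free_star_alg (Inl ` carrier A \<union> Inr ` carrier B))"
    "gen (Inr y) \<in> carrier (free_star_alg (Inl ` carrier A \<union> Inr ` carrier B))"
    using x y by (auto intro!: gen_closed)
  have "gen (Inl x) * gen (Inr y) - gen (Inr y) * gen (Inl x) \<in> tensor_rels A B"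
    unfolding tensor_rels_def using x y by blast
  hence "univ_elem (tensor_gens A B) (tensor_rels A B) (gen (Inl x) * gen (Inr y)) =
      univ_elem (tensor_gens A B) (tensor_rels A B) (gen (Inr y) * gen (Inl x))"
    unfolding tensor_gens_def using g by (intro T.univ_elem_eqI) (simp_all add: free_closed free_minus)
  thus ?thesis
    using star_hom_mult[OF T.univ_elem_star_hom g] star_hom_mult[OF T.univ_elem_star_hom g(2) g(1)]
    by (simp add: tensor_inl_def tensor_inr_def max_tensor_uc tensor_gens_def)
qed

text \<open>The universal property of the maximal tensor product; commuting ranges take care of the
  third family in \<open>tensor_rels\<close>.\<close>

lemma tensor_lift:
  assumes D: "cstar_algebra D" and f: "f \<in> star_hom A D" and g: "g \<in> star_hom B D"
    and comm: "\<And>x y. x \<in> carrier A \<Longrightarrow> y \<in> carrier B \<Longrightarrow> f x \<otimes>\<^bsub>D\<^esub> g y = g y \<otimes>\<^bsub>D\<^esub> f x"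
  shows "\<exists>H\<in>star_hom (max_tensor A B) D.
    \<forall>x\<in>carrier A. \<forall>y\<in>carrier B. H (tensor_elem A B x y) = f x \<otimes>\<^bsub>D\<^esub> g y"
proof -
  interpret D: cstar D using D by (simp add: cstar_def)
  let ?G = "Inl ` carrier A \<union> Inr ` carrier B"
  define h where "h = case_sum f g"
  have h: "h \<in> ?G \<rightarrow> carrier D"
    using star_hom_closed[OF f] star_hom_closed[OF g] by (auto simp: h_def)
  have "\<exists>H\<in>star_hom T.uc D. \<forall>x\<in>?G. H (T.ugen x) = h x"
  proof (rule T.ugen_lift[OF D h])
    fix r assume r: "r \<in> tensor_rels A B"
    show "D.eval_poly h r = \<zero>\<^bsub>D\<^esub>"
      using r unfolding tensor_rels_def
    proof (elim UnE)
      assume "r \<in> copy_relations A Inl"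
      thus ?thesis
        by (rule eval_copy_relations[OF D.star_algebra_axioms A.star_algebra_axioms f _ h, rotated 2])
           (simp_all add: h_def)
    next
      assume "r \<in> copy_relations B Inr"
      thus ?thesis
        by (rule eval_copy_relations[OF D.star_algebra_axioms B.star_algebra_axioms g _ h, rotated 2])
           (simp_all add: h_def)
    next
      assume "r \<in> {gen (Inl x) * gen (Inr y) - gen (Inr y) * gen (Inl x) |x y.
          x \<in> carrier A \<and> y \<in> carrier B}"
      then obtain x y where r: "r = gen (Inl x) * gen (Inr y) - gen (Inr y) * gen (Inl x)"
        and x: "x \<in> carrier A" and y: "y \<in> carrier B" by blast
      have G: "Inl x \<in> ?G" "Inr y \<in> ?G" using x y by auto
      note gc = gen_closed[OF G(1)] gen_closed[OF G(2)]
      have e: "D.eval_poly h (gen (Inl x)) = f x" "D.eval_poly h (gen (Inr y)) = g y"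
        using D.eval_poly_gen[OF h G(1)] D.eval_poly_gen[OF h G(2)] by (simp_all only: h_def sum.case)
      show ?thesis unfolding r
        by (rule D.eval_poly_minus_zero[OF h])
           (simp_all add: free_closed gc D.eval_poly_mult[OF h] e comm x y)
    qed
  qed
  then obtain H where H: "H \<in> star_hom T.uc D" "\<forall>x\<in>?G. H (T.ugen x) = h x" by (rule bexE)
  have "H (tensor_elem A B x y) = f x \<otimes>\<^bsub>D\<^esub> g y" if x: "x \<in> carrier A" and y: "y \<in> carrier B" for x y
  proof -
    have G: "Inl x \<in> ?G" "Inr y \<in> ?G" using x y by auto
    have "H (T.ugen (Inl x) \<otimes>\<^bsub>T.uc\<^esub> T.ugen (Inr y)) = h (Inl x) \<otimes>\<^bsub>D\<^esub> h (Inr y)"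
      by (simp only: star_hom_mult[OF H(1) T.ugen_closed[OF G(1)] T.ugen_closed[OF G(2)]]
          bspec[OF H(2) G(1)] bspec[OF H(2) G(2)])
    thus ?thesis
      unfolding tensor_elem_eq[OF x y] tensor_inl_def tensor_inr_def max_tensor_uc tensor_gens_def
      by (simp add: h_def)
  qed
  thus ?thesis using H(1) unfolding max_tensor_uc by (intro bexI[of _ H] ballI)
qed

lemma free_prod_free_univ:
  "free_univ (Inl ` (UNIV \<times> carrier A) \<union> Inr ` carrier B)
     (free_prod_rels A B :: ('n \<times> 'a + 'b) star_poly set)"
proof (rule free_univ.intro, rule free_univ_cstar_alg)
  let ?G = "Inl ` (UNIV \<times> carrier A) \<union> Inr ` carrier B :: ('n \<times> 'a + 'b) set"
  have cl: "copy_relations A (\<lambda>x. Inl (i, x)) \<subseteq> carrier (free_star_alg ?G)"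
    "copy_relations B Inr \<subseteq> carrier (free_star_alg ?G)" for i
    by (rule copy_relations_closed, unfold_locales, simp)+
  show "free_prod_rels A B \<subseteq> carrier (free_star_alg ?G)"
    unfolding free_prod_rels_def by (intro Un_least cl UN_least)
  fix x assume "x \<in> ?G"
  thus "\<exists>K. \<forall>q. cstar_seminorm (free_star_alg ?G) q \<and> (\<forall>r\<in>free_prod_rels A B. q r = 0) \<longrightarrow>
      q (gen x) \<le> K"
  proof (elim UnE imageE SigmaE)
    fix y i z assume y: "x = Inl y" "y = (i, z)" "z \<in> carrier A"
    show ?thesis unfolding y(1,2)
      by (rule copy_gen_bounded[OF A _ _ y(3)]) (auto simp: free_prod_rels_def)
  next
    fix y assume y: "x = Inr y" "y \<in> carrier B"
    show ?thesis unfolding y(1)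
      by (rule copy_gen_bounded[OF B _ _ y(2)]) (auto simp: free_prod_rels_def)
  qed
qed

interpretation F: free_univ "Inl ` (UNIV \<times> carrier A) \<union> Inr ` carrier B"
  "free_prod_rels A B :: ('n \<times> 'a + 'b) star_poly set"
  by (rule free_prod_free_univ)

lemma free_prod_uc: "free_prod A B = F.uc"
  by (simp add: free_prod_def free_prod_gens_def)

lemma free_prod_cstar_algebra:
  "cstar_algebra (free_prod A B :: ((nat \<Rightarrow> ('n \<times> 'a + 'b) star_poly) set) cstar_alg)"
  unfolding free_prod_uc by (rule F.univ_cstar_algebra)

lemma free_prod_inl_star_hom: "free_prod_inl A B i \<in> star_hom A (free_prod A B)"
  unfolding free_prod_uc free_prod_inl_def[abs_def] free_prod_gens_def
  by (rule F.ucopy) (unfold_locales, auto simp: free_prod_rels_def)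

lemma free_prod_inr_star_hom:
  "(free_prod_inr A B :: _ \<Rightarrow> (nat \<Rightarrow> ('n \<times> 'a + 'b) star_poly) set) \<in> star_hom B (free_prod A B)"
  unfolding free_prod_uc free_prod_inr_def[abs_def] free_prod_gens_def
  by (rule F.ucopy) (unfold_locales, auto simp: free_prod_rels_def)

lemma free_prod_dense:
  fixes F :: "((nat \<Rightarrow> ('n \<times> 'a + 'b) star_poly) set) cstar_alg"
  assumes F: "F = free_prod A B"
  shows "carrier F \<subseteq> cnorm_closure F (star_generated F
    ((\<Union>i. free_prod_inl A B i ` carrier A) \<union> free_prod_inr A B ` carrier B))"
proof -
  have eq: "(\<Union>i. free_prod_inl A B i ` carrier A) \<union> free_prod_inr A B ` carrier B =
      F.ugen ` (Inl ` (UNIV \<times> carrier A) \<union> Inr ` carrier B)"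
    unfolding free_prod_inl_def[abs_def] free_prod_inr_def[abs_def] free_prod_gens_def
    by (auto simp: image_Un image_image)
  show ?thesis unfolding F free_prod_uc eq by (rule F.ugen_dense)
qed

text \<open>The universal property of the free product, with an independent morphism for each copy
  of the first factor. In the wreath product this first factor is the algebra B.\<close>

lemma free_prod_lift:
  fixes f :: "'n \<Rightarrow> 'a \<Rightarrow> 'd"
  assumes D: "cstar_algebra D" and f: "\<And>i. f i \<in> star_hom A D" and g: "g \<in> star_hom B D"
  shows "\<exists>H\<in>star_hom (free_prod A B) D.
    (\<forall>i. \<forall>x\<in>carrier A. H (free_prod_inl A B i x) = f i x) \<and>
    (\<forall>y\<in>carrier B. H (free_prod_inr A B y) = g y)"
proof -
  interpret D: cstar D using D by (simp add: cstar_def)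
  let ?G = "Inl ` (UNIV \<times> carrier A) \<union> Inr ` carrier B :: ('n \<times> 'a + 'b) set"
  define h where "h = case_sum (\<lambda>(i, x). f i x) g"
  have h: "h \<in> ?G \<rightarrow> carrier D"
    using star_hom_closed[OF f] star_hom_closed[OF g] by (auto simp: h_def)
  have "\<exists>H\<in>star_hom F.uc D. \<forall>x\<in>?G. H (F.ugen x) = h x"
  proof (rule F.ugen_lift[OF D h])
    fix r assume r: "r \<in> (free_prod_rels A B :: ('n \<times> 'a + 'b) star_poly set)"
    show "D.eval_poly h r = \<zero>\<^bsub>D\<^esub>"
      using r unfolding free_prod_rels_def
    proof (elim UnE UN_E)
      fix i assume "r \<in> copy_relations A (\<lambda>x. Inl (i, x))"
      thus ?thesis
        by (rule eval_copy_relations[OF D.star_algebra_axioms A.star_algebra_axioms f[of i] _ h, rotated 2])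
           (simp_all add: h_def)
    next
      assume "r \<in> copy_relations B Inr"
      thus ?thesis
        by (rule eval_copy_relations[OF D.star_algebra_axioms B.star_algebra_axioms g _ h, rotated 2])
           (simp_all add: h_def)
    qed
  qed
  then obtain H where H: "H \<in> star_hom F.uc D" "\<forall>x\<in>?G. H (F.ugen x) = h x" by (rule bexE)
  have "H (free_prod_inl A B i x) = f i x" if "x \<in> carrier A" for i x
    using bspec[OF H(2), of "Inl (i, x)"] that
    by (simp add: h_def free_prod_inl_def free_prod_gens_def)
  moreover have "H (free_prod_inr A B y) = g y" if "y \<in> carrier B" for y
    using bspec[OF H(2), of "Inr y"] that
    by (simp add: h_def free_prod_inr_def free_prod_gens_def)
  ultimately show ?thesis using H(1) unfolding free_prod_uc by (intro bexI[of _ H] conjI allI ballI)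
qed

end

section \<open>The relations of a magic unitary and the algebra A_s(n)\<close>

lemma magic_unitaryD:
  assumes "magic_unitary A u"
  shows "u i j \<in> carrier A" "u i j \<otimes>\<^bsub>A\<^esub> u i j = u i j" "star A (u i j) = u i j"
    "j \<noteq> k \<Longrightarrow> u i j \<otimes>\<^bsub>A\<^esub> u i k = \<zero>\<^bsub>A\<^esub>" "i \<noteq> k \<Longrightarrow> u i j \<otimes>\<^bsub>A\<^esub> u k j = \<zero>\<^bsub>A\<^esub>"
    "(\<Oplus>\<^bsub>A\<^esub>j\<in>UNIV. u i j) = \<one>\<^bsub>A\<^esub>" "(\<Oplus>\<^bsub>A\<^esub>i\<in>UNIV. u i j) = \<one>\<^bsub>A\<^esub>"
  using assms by (simp_all add: magic_unitary_def)

lemma magic_relations_cases: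
  assumes "r \<in> magic_relations"
  obtains
    (idem) i j where "r = gen (i, j) * gen (i, j) - gen (i, j)"
  | (star) i j where "r = poly_star (gen (i, j)) - gen (i, j)"
  | (row) i j k where "j \<noteq> k" "r = gen (i, j) * gen (i, k)"
  | (col) i j k where "i \<noteq> k" "r = gen (i, j) * gen (k, j)"
  | (row_sum) i where "r = (\<Sum>j\<in>UNIV. gen (i, j)) - 1"
  | (col_sum) j where "r = (\<Sum>i\<in>UNIV. gen (i, j)) - 1"
  using assms unfolding magic_relations_def Un_iff mem_Collect_eq by metis

lemma gen_UNIV_closed: "gen x \<in> carrier (free_star_alg UNIV)"
  by (simp add: gen_closed)

text \<open>In the completion for \<open>q\<close> the element becomes a projection, and the
  C*-identity reads \<open>(q x)^2 = q x\<close>. This bounds the generators of \<open>A_s\<close>,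
  which are not copied from a C*-algebra.\<close>

lemma cstar_seminorm_projection_le:
  assumes F: "cstar_seminormed F q" and x: "x \<in> carrier F"
    and "q (star F x \<ominus>\<^bsub>F\<^esub> x) = 0" "q (x \<otimes>\<^bsub>F\<^esub> x \<ominus>\<^bsub>F\<^esub> x) = 0"
  shows "q x \<le> 1"
proof -
  interpret cstar_seminormed F q by (rule F)
  have e: "embed (star F x) = embed x" "embed (x \<otimes>\<^bsub>F\<^esub> x) = embed x"
    by (rule embed_eqI[OF star_closed[OF x] x assms(3)], rule embed_eqI[OF m_closed[OF x x] x assms(4)])
  have "cnorm compl (embed (star F x) \<otimes>\<^bsub>compl\<^esub> embed x) = cnorm compl (embed x)"
    unfolding e(1) using star_hom_mult[OF embed_star_hom x x] e(2) by simp
  hence "q (star F x \<otimes>\<^bsub>F\<^esub> x) = q x"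
    using star_hom_mult[OF embed_star_hom star_closed[OF x] x] x
    by (simp add: cnorm_embed[symmetric])
  hence "(q x)\<^sup>2 = q x" unfolding q_star_mult[OF x] .
  hence "q x = 0 \<or> q x = 1" by (simp add: power2_eq_square)
  thus ?thesis by auto
qed

lemma A_s_free_univ: "free_univ UNIV (magic_relations :: ('n::finite \<times> 'n) star_poly set)"
proof (rule free_univ.intro, rule free_univ_cstar_alg)
  show "(magic_relations :: ('n::finite \<times> 'n) star_poly set) \<subseteq> carrier (free_star_alg UNIV)"
    by (simp add: free_carrier words_def)
  fix x :: "'n \<times> 'n"
  obtain i j where x: "x = (i, j)" by (cases x)
  have "q (gen x) \<le> 1" if q: "cstar_seminorm (free_star_alg UNIV) q \<and> (\<forall>r\<in>magic_relations. q r = 0)" for q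
  proof (rule cstar_seminorm_projection_le[of "free_star_alg UNIV" q "gen x"])
    show "cstar_seminormed (free_star_alg UNIV) q"
      using q by (intro cstar_seminormed.intro free_star_algebra cstar_seminormed_axioms.intro) simp
    have "poly_star (gen x) - gen x \<in> {poly_star (gen (i, j)) - gen (i, j) | i j. True}"
      "gen x * gen x - gen x \<in> {gen (i, j) * gen (i, j) - gen (i, j) | i j. True}"
      unfolding x by blast+
    hence "poly_star (gen x) - gen x \<in> magic_relations" "gen x * gen x - gen x \<in> magic_relations"
      by (simp_all only: magic_relations_def Un_iff simp_thms)
    hence "q (poly_star (gen x) - gen x) = 0" "q (gen x * gen x - gen x) = 0"
      using bspec[OF conjunct2[OF q]] by simp_all
    thus "q (star (free_star_alg UNIV) (gen x) \<ominus>\<^bsub>free_star_alg UNIV\<^esub> gen x) = 0"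
      "q (gen x \<otimes>\<^bsub>free_star_alg UNIV\<^esub> gen x \<ominus>\<^bsub>free_star_alg UNIV\<^esub> gen x) = 0"
      by (simp_all add: free_minus free_closed gen_UNIV_closed)
  qed (rule gen_UNIV_closed)
  thus "\<exists>K. \<forall>q. cstar_seminorm (free_star_alg UNIV) q \<and> (\<forall>r\<in>magic_relations. q r = 0) \<longrightarrow>
      q (gen x) \<le> K" by (intro exI[of _ 1] allI impI)
qed

interpretation A_s: free_univ UNIV "magic_relations :: ('n::finite \<times> 'n) star_poly set"
  by (rule A_s_free_univ)

lemma A_s_cstar_algebra: "cstar_algebra A_s"
  unfolding A_s_def by (rule A_s.univ_cstar_algebra)

lemma A_s_lift:
  fixes u :: "'n::finite \<Rightarrow> 'n \<Rightarrow> 'd"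
  assumes D: "cstar_algebra D" and u: "magic_unitary D u"
  shows "\<exists>f\<in>star_hom A_s D. \<forall>i j. f (A_s_gen i j) = u i j"
proof -
  interpret D: cstar D using D by (simp add: cstar_def)
  note m = magic_unitaryD[OF u]
  define h where "h = (\<lambda>(i, j). u i j)"
  have h: "h \<in> UNIV \<rightarrow> carrier D" using m(1) by (auto simp: h_def)
  have hu: "h (i, j) = u i j" for i j by (simp add: h_def)
  note g = gen_UNIV_closed
  note ev = D.eval_poly_mult[OF h] D.eval_poly_star[OF h] D.eval_poly_one[OF h] D.eval_poly_gen[OF h UNIV_I]
    D.eval_poly_sum[OF h]
  have "\<exists>H\<in>star_hom A_s.uc D. \<forall>x\<in>UNIV. H (A_s.ugen x) = h x"
  proof (rule A_s.ugen_lift[OF D h])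
    fix r assume "r \<in> (magic_relations :: ('n \<times> 'n) star_poly set)"
    thus "D.eval_poly h r = \<zero>\<^bsub>D\<^esub>"
    proof (cases rule: magic_relations_cases)
      case (idem i j)
      show ?thesis unfolding idem
        by (rule D.eval_poly_minus_zero[OF h]) (simp_all add: free_closed g ev hu m)
    next
      case (star i j)
      show ?thesis unfolding star
        by (rule D.eval_poly_minus_zero[OF h]) (simp_all add: free_closed g ev hu m)
    next
      case (row i j k)
      show ?thesis unfolding row(2) using m(4)[OF row(1)] by (simp add: g ev hu)
    next
      case (col i j k)
      show ?thesis unfolding col(2) using m(5)[OF col(1)] by (simp add: g ev hu)
    next
      case (row_sum i)
      show ?thesis unfolding row_sum
        by (rule D.eval_poly_minus_zero[OF h])
           (simp_all add: free_sum_closed free_one_closed g ev hu m)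
    next
      case (col_sum j)
      show ?thesis unfolding col_sum
        by (rule D.eval_poly_minus_zero[OF h])
           (simp_all add: free_sum_closed free_one_closed g ev hu m)
    qed
  qed
  then obtain H where H: "H \<in> star_hom A_s.uc D" "\<forall>x\<in>UNIV. H (A_s.ugen x) = h x" by (rule bexE)
  have "H (A_s_gen i j) = u i j" for i j
    using bspec[OF H(2) UNIV_I, of "(i, j)"] by (simp add: A_s_gen_def hu)
  thus ?thesis using H(1) unfolding A_s_def by (intro bexI[of _ H] allI)
qed

text \<open>Used to recognise a given representation as a composite: the generators are
  topologically generating and morphisms are continuous.\<close>

lemma A_s_hom_eq:
  fixes f g :: "(nat \<Rightarrow> ('n::finite \<times> 'n) star_poly) set \<Rightarrow> 'd"
  assumes D: "cstar_algebra D" and f: "f \<in> star_hom A_s D" and g: "g \<in> star_hom A_s D"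
    and eq: "\<And>i j. f (A_s_gen i j) = g (A_s_gen i j)" and x: "x \<in> carrier A_s"
  shows "f x = g x"
proof (rule star_hom_eq_dense[OF A_s_cstar_algebra D f g _ _ _ x])
  show "range A_s.ugen \<subseteq> carrier (A_s :: ((nat \<Rightarrow> ('n \<times> 'n) star_poly) set) cstar_alg)"
    unfolding A_s_def by (rule image_subsetI) (rule A_s.ugen_closed)
  show "carrier (A_s :: ((nat \<Rightarrow> ('n \<times> 'n) star_poly) set) cstar_alg) \<subseteq> cnorm_closure A_s (star_generated A_s (range A_s.ugen))"
    unfolding A_s_def by (rule A_s.ugen_dense)
  fix s assume "s \<in> range (A_s.ugen :: 'n \<times> 'n \<Rightarrow> _)"
  then obtain p where s: "s = A_s.ugen p" by (rule rangeE)
  show "f s = g s" using eq[of "fst p" "snd p"] by (simp add: A_s_gen_def s)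
qed

section \<open>Magic unitaries and full quantum permutation algebras\<close>

context star_algebra
begin

lemma commute_mult:
  assumes "x \<in> carrier A" "y \<in> carrier A" "z \<in> carrier A"
    and "z \<otimes> x = x \<otimes> z" "z \<otimes> y = y \<otimes> z"
  shows "z \<otimes> (x \<otimes> y) = (x \<otimes> y) \<otimes> z"
proof -
  have "z \<otimes> (x \<otimes> y) = (z \<otimes> x) \<otimes> y" using assms(1-3) by (simp add: m_assoc)
  also have "\<dots> = x \<otimes> (z \<otimes> y)" unfolding assms(4) using assms(1-3) by (simp add: m_assoc)
  also have "\<dots> = (x \<otimes> y) \<otimes> z" unfolding assms(5) using assms(1-3) by (simp add: m_assoc)
  finally show ?thesis .
qed

lemma finsum_const_left:
  assumes "finite I" "f \<in> I \<rightarrow> carrier A" "z \<in> carrier A"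
  shows "z \<otimes> finsum A f I = (\<Oplus>i\<in>I. z \<otimes> f i)" "finsum A f I \<otimes> z = (\<Oplus>i\<in>I. f i \<otimes> z)"
  using finsum_rdistr[OF assms(1,3,2)] finsum_ldistr[OF assms(1,3,2)] by simp_all

lemma finsum_eqI: "(\<And>i. i \<in> I \<Longrightarrow> f i = g i) \<Longrightarrow> (\<And>i. i \<in> I \<Longrightarrow> g i \<in> carrier A) \<Longrightarrow>
    finsum A f I = finsum A g I"
  by (rule finsum_cong') auto

lemma commute_finsum:
  assumes "finite I" "\<And>i. i \<in> I \<Longrightarrow> f i \<in> carrier A" "z \<in> carrier A"
    and "\<And>i. i \<in> I \<Longrightarrow> z \<otimes> f i = f i \<otimes> z"
  shows "z \<otimes> finsum A f I = finsum A f I \<otimes> z"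
proof -
  have f: "f \<in> I \<rightarrow> carrier A" using assms(2) by blast
  show ?thesis unfolding finsum_const_left[OF assms(1) f assms(3)]
    by (rule finsum_eqI) (use assms in simp_all)
qed

lemma finsum_delta:
  fixes j :: "'n::finite"
  assumes "x \<in> carrier A" "\<And>k. k \<noteq> j \<Longrightarrow> f k = \<zero>" "f j = x"
  shows "(\<Oplus>k\<in>UNIV. f k) = x"
proof -
  have "(\<Oplus>k\<in>UNIV. f k) = (\<Oplus>k\<in>UNIV. if j = k then (\<lambda>_. x) k else \<zero>)"
    by (rule finsum_eqI) (use assms in auto)
  also have "\<dots> = x" by (subst finsum_singleton) (use assms in auto)
  finally show ?thesis .
qed

lemma finsum_UNIV_prod:
  fixes f :: "'n::finite \<times> 'm::finite \<Rightarrow> 'a"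
  assumes "\<And>p. f p \<in> carrier A"
  shows "(\<Oplus>p\<in>UNIV. f p) = (\<Oplus>i\<in>UNIV. \<Oplus>a\<in>UNIV. f (i, a))"
proof -
  have U: "(UNIV :: ('n \<times> 'm) set) = (\<Union>i\<in>UNIV. Pair i ` UNIV)" by auto
  have "(\<Oplus>p\<in>(\<Union>i\<in>UNIV. Pair i ` UNIV). f p) = (\<Oplus>i\<in>UNIV. \<Oplus>p\<in>Pair i ` UNIV. f p)"
    by (rule add.finprod_UN_disjoint) (auto simp: assms pairwise_def disjnt_def)
  also have "\<dots> = (\<Oplus>i\<in>UNIV. \<Oplus>a\<in>UNIV. f (i, a))"
  proof (rule finsum_eqI)
    fix i :: 'n
    show "(\<Oplus>p\<in>Pair i ` UNIV. f p) = (\<Oplus>a\<in>UNIV. f (i, a))"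
      by (rule finsum_reindex) (auto simp: assms inj_on_def)
  qed (auto simp: assms)
  finally show ?thesis unfolding U[symmetric] .
qed

text \<open>The common shape of a row and of a column of a magic unitary. The comultiplication glues
  morphisms along a row, the antipode along a column.\<close>

definition partition_of_one :: "('n::finite \<Rightarrow> 'a) \<Rightarrow> bool" where
  "partition_of_one e \<longleftrightarrow> (\<forall>k. e k \<in> carrier A \<and> e k \<otimes> e k = e k \<and> star A (e k) = e k) \<and>
     (\<forall>k l. k \<noteq> l \<longrightarrow> e k \<otimes> e l = \<zero>) \<and> (\<Oplus>k\<in>UNIV. e k) = \<one>"

lemma partition_of_oneD:
  assumes "partition_of_one e"
  shows "e k \<in> carrier A" "e k \<otimes> e k = e k" "star A (e k) = e k"
    "k \<noteq> l \<Longrightarrow> e k \<otimes> e l = \<zero>" "(\<Oplus>k\<in>UNIV. e k) = \<one>"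
  using assms by (simp_all add: partition_of_one_def)

text \<open>Orthogonality leaves one block. In the first claim \<open>x k\<close> is moved past
  \<open>e k\<close>, so that \<open>e j\<close> and \<open>e k\<close> meet; the factor
  \<open>z\<close> serves the product of two such sums, where it is a coefficient of the left
  one.\<close>

lemma partition_mult_single:
  assumes e: "partition_of_one e" and x: "\<And>k. x k \<in> carrier A"
    and comm: "\<And>k. x k \<otimes> e k = e k \<otimes> x k" and z: "z \<in> carrier A"
  shows "z \<otimes> e j \<otimes> (\<Oplus>k\<in>UNIV. x k \<otimes> e k) = z \<otimes> x j \<otimes> e j"
    and "(\<Oplus>k\<in>UNIV. x k \<otimes> e k) \<otimes> e j = x j \<otimes> e j"
proof -
  note ec = partition_of_oneD(1)[OF e]
  have f: "(\<lambda>k. x k \<otimes> e k) \<in> UNIV \<rightarrow> carrier A" using x ec by simp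
  show "z \<otimes> e j \<otimes> (\<Oplus>k\<in>UNIV. x k \<otimes> e k) = z \<otimes> x j \<otimes> e j"
    unfolding finsum_const_left(1)[OF finite f m_closed[OF z ec]]
  proof (rule finsum_delta)
    show "z \<otimes> e j \<otimes> (x k \<otimes> e k) = \<zero>" if "k \<noteq> j" for k
    proof -
      have "z \<otimes> e j \<otimes> (x k \<otimes> e k) = z \<otimes> ((e j \<otimes> e k) \<otimes> x k)"
        unfolding comm by (simp add: m_assoc x ec z)
      thus ?thesis using partition_of_oneD(4)[OF e not_sym[OF that]] by (simp add: x z)
    qed
    have "z \<otimes> e j \<otimes> (x j \<otimes> e j) = z \<otimes> ((e j \<otimes> e j) \<otimes> x j)"
      unfolding comm by (simp add: m_assoc x ec z)
    also have "\<dots> = z \<otimes> (x j \<otimes> e j)" unfolding partition_of_oneD(2)[OF e] comm ..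
    finally show "z \<otimes> e j \<otimes> (x j \<otimes> e j) = z \<otimes> x j \<otimes> e j" by (simp add: m_assoc x ec z)
  qed (simp add: x ec z)
  show "(\<Oplus>k\<in>UNIV. x k \<otimes> e k) \<otimes> e j = x j \<otimes> e j"
    unfolding finsum_const_left(2)[OF finite f ec]
  proof (rule finsum_delta)
    show "x k \<otimes> e k \<otimes> e j = \<zero>" if "k \<noteq> j" for k
      using partition_of_oneD(4)[OF e that] by (simp add: m_assoc x ec)
    show "x j \<otimes> e j \<otimes> e j = x j \<otimes> e j"
      using partition_of_oneD(2)[OF e] by (simp add: m_assoc x ec)
  qed (simp add: x ec)
qed

lemma partition_mult:
  assumes e: "partition_of_one e" and x: "\<And>k. x k \<in> carrier A" and y: "\<And>k. y k \<in> carrier A"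
    and comm: "\<And>k. y k \<otimes> e k = e k \<otimes> y k"
  shows "(\<Oplus>k\<in>UNIV. x k \<otimes> e k) \<otimes> (\<Oplus>k\<in>UNIV. y k \<otimes> e k) = (\<Oplus>k\<in>UNIV. x k \<otimes> y k \<otimes> e k)"
proof -
  note ec = partition_of_oneD(1)[OF e]
  have f: "(\<lambda>k. x k \<otimes> e k) \<in> UNIV \<rightarrow> carrier A" using x ec by simp
  have s: "(\<Oplus>k\<in>UNIV. y k \<otimes> e k) \<in> carrier A" using y ec by simp
  show ?thesis unfolding finsum_const_left(2)[OF finite f s]
    by (rule finsum_eqI) (simp_all add: partition_mult_single(1)[OF e y comm x] x y ec)
qed

text \<open>A block-diagonal sum of morphisms: cutting \<open>h k\<close> down by a projection that
  commutes with its range keeps the *-algebra laws except for the unit, and the projections add up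
  to the unit.\<close>

lemma partition_star_hom:
  assumes E: "star_algebra E" and h: "\<And>k. h k \<in> star_hom E A" and e: "partition_of_one e"
    and comm: "\<And>k x. x \<in> carrier E \<Longrightarrow> h k x \<otimes> e k = e k \<otimes> h k x"
  shows "(\<lambda>x. \<Oplus>k\<in>UNIV. h k x \<otimes> e k) \<in> star_hom E A"
proof (rule star_homI)
  interpret E: star_algebra E by (rule E)
  note ec = partition_of_oneD(1)[OF e] and hc = star_hom_closed[OF h]
  show "(\<Oplus>k\<in>UNIV. h k \<one>\<^bsub>E\<^esub> \<otimes> e k) = \<one>"
    using partition_of_oneD(5)[OF e] by (simp add: star_hom_one[OF h] ec)
  fix x c assume x: "x \<in> carrier E"
  show "(\<Oplus>k\<in>UNIV. h k x \<otimes> e k) \<in> carrier A" by (simp add: hc x ec)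
  show "(\<Oplus>k\<in>UNIV. h k (cscale E c x) \<otimes> e k) = cscale A c (\<Oplus>k\<in>UNIV. h k x \<otimes> e k)"
    by (subst cscale_finsum) (simp_all add: star_hom_cscale[OF h] hc x ec cscale_mult_left)
  have "star A (h k x \<otimes> e k) = h k (star E x) \<otimes> e k" for k
    using comm[of "star E x" k]
    by (simp add: star_mult hc x ec star_hom_star[OF h] partition_of_oneD(3)[OF e])
  thus "(\<Oplus>k\<in>UNIV. h k (star E x) \<otimes> e k) = star A (\<Oplus>k\<in>UNIV. h k x \<otimes> e k)"
    by (subst star_finsum) (simp_all add: hc x ec)
  fix y assume y: "y \<in> carrier E"
  have "(\<Oplus>k\<in>UNIV. h k (x \<oplus>\<^bsub>E\<^esub> y) \<otimes> e k) = (\<Oplus>k\<in>UNIV. h k x \<otimes> e k \<oplus> h k y \<otimes> e k)"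
    by (rule finsum_eqI) (simp_all add: star_hom_add[OF h] hc x y ec l_distr)
  also have "\<dots> = (\<Oplus>k\<in>UNIV. h k x \<otimes> e k) \<oplus> (\<Oplus>k\<in>UNIV. h k y \<otimes> e k)"
    by (rule finsum_addf) (simp_all add: hc x y ec)
  finally show "(\<Oplus>k\<in>UNIV. h k (x \<oplus>\<^bsub>E\<^esub> y) \<otimes> e k) =
      (\<Oplus>k\<in>UNIV. h k x \<otimes> e k) \<oplus> (\<Oplus>k\<in>UNIV. h k y \<otimes> e k)" .
  show "(\<Oplus>k\<in>UNIV. h k (x \<otimes>\<^bsub>E\<^esub> y) \<otimes> e k) =
      (\<Oplus>k\<in>UNIV. h k x \<otimes> e k) \<otimes> (\<Oplus>k\<in>UNIV. h k y \<otimes> e k)"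
    unfolding partition_mult[OF e hc[OF x] hc[OF y] comm[OF y]]
    by (rule finsum_eqI) (simp_all add: star_hom_mult[OF h] hc x y ec)
qed

lemma magic_unitary_partition:
  assumes "magic_unitary A u"
  shows "partition_of_one (u i)" "partition_of_one (\<lambda>k. u k j)"
  using magic_unitaryD[OF assms] by (simp_all add: partition_of_one_def)

text \<open>Products of commuting projections. Commutation is available only between
  \<open>c i\<close> and the i-th row of \<open>d\<close>, as in a free wreath product, so
  orthogonality within a column needs a case distinction.\<close>

lemma wreath_magic_unitary:
  fixes c :: "'n::finite \<Rightarrow> 'm::finite \<Rightarrow> 'm \<Rightarrow> 'a" and d :: "'n \<Rightarrow> 'n \<Rightarrow> 'a"
  assumes c: "\<And>i. magic_unitary A (c i)" and d: "magic_unitary A d"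
    and comm: "\<And>i j a b. c i a b \<otimes> d i j = d i j \<otimes> c i a b"
  shows "magic_unitary A (\<lambda>(i, a) (j, b). c i a b \<otimes> d i j)"
proof -
  note C = magic_unitaryD[OF c] and D = magic_unitaryD[OF d]
  have idem: "c i a b \<otimes> d i j \<otimes> (c i a b \<otimes> d i j) = c i a b \<otimes> d i j" for i j a b
  proof -
    have "c i a b \<otimes> d i j \<otimes> (c i a b \<otimes> d i j) = c i a b \<otimes> (d i j \<otimes> c i a b) \<otimes> d i j"
      by (simp add: m_assoc C D)
    also have "\<dots> = (c i a b \<otimes> c i a b) \<otimes> (d i j \<otimes> d i j)"
      unfolding comm[symmetric] by (simp add: m_assoc C(1) D(1))
    finally show ?thesis by (simp add: C D)
  qed
  have row: "c i a b \<otimes> d i j \<otimes> (c i a b' \<otimes> d i j') = \<zero>" if "(j, b) \<noteq> (j', b')" for i j j' a b b'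
  proof -
    have "c i a b \<otimes> d i j \<otimes> (c i a b' \<otimes> d i j') = c i a b \<otimes> (d i j \<otimes> c i a b') \<otimes> d i j'"
      by (simp add: m_assoc C D)
    also have "\<dots> = (c i a b \<otimes> c i a b') \<otimes> (d i j \<otimes> d i j')"
      unfolding comm[symmetric] by (simp add: m_assoc C(1) D(1))
    finally show ?thesis using that C(4)[of b b' i a] D(4)[of j j' i] C(1) D(1)
      by (cases "b = b'") auto
  qed
  have col: "c i a b \<otimes> d i j \<otimes> (c i' a' b \<otimes> d i' j) = \<zero>" if "(i, a) \<noteq> (i', a')" for i i' j a a' b
  proof (cases "i = i'")
    case True
    have "c i a b \<otimes> d i j \<otimes> (c i a' b \<otimes> d i j) = c i a b \<otimes> (d i j \<otimes> c i a' b) \<otimes> d i j"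
      by (simp add: m_assoc C D)
    also have "\<dots> = (c i a b \<otimes> c i a' b) \<otimes> (d i j \<otimes> d i j)"
      unfolding comm[symmetric] by (simp add: m_assoc C(1) D(1))
    finally show ?thesis using that True C(5)[of a a' i b] by (simp add: D)
  next
    case False
    \<comment> \<open>For different \<open>i\<close> and \<open>i'\<close> nothing relates
      \<open>c i'\<close> to \<open>d i\<close>. Writing the second factor as
      \<open>d i' j \<otimes> c i' a' b\<close> brings the orthogonal pair \<open>d i j\<close> and
      \<open>d i' j\<close> together.\<close>
    have "c i a b \<otimes> d i j \<otimes> (c i' a' b \<otimes> d i' j) = c i a b \<otimes> (d i j \<otimes> d i' j) \<otimes> c i' a' b"
      unfolding comm by (simp add: m_assoc C(1) D(1))
        (simp add: m_assoc[symmetric] C(1) D(1) comm)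
    thus ?thesis using D(5)[OF False] by (simp add: C(1))
  qed
  have rsum: "(\<Oplus>p\<in>UNIV. (case p of (j, b) \<Rightarrow> c i a b \<otimes> d i j)) = \<one>" for i a
  proof -
    have "(\<Oplus>p\<in>UNIV. (case p of (j, b) \<Rightarrow> c i a b \<otimes> d i j)) =
        (\<Oplus>j\<in>UNIV. \<Oplus>b\<in>UNIV. c i a b \<otimes> d i j)"
      by (subst finsum_UNIV_prod) (simp_all add: C(1) D(1) split: prod.splits)
    also have "\<dots> = (\<Oplus>j\<in>UNIV. d i j)"
    proof (rule finsum_eqI)
      fix j
      have "(\<Oplus>b\<in>UNIV. c i a b \<otimes> d i j) = (\<Oplus>b\<in>UNIV. c i a b) \<otimes> d i j"
        by (subst finsum_const_left) (simp_all add: C(1) D(1))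
      thus "(\<Oplus>b\<in>UNIV. c i a b \<otimes> d i j) = d i j" by (simp add: C(6) D(1))
    qed (simp add: D(1))
    finally show ?thesis by (simp add: D(6))
  qed
  have csum: "(\<Oplus>p\<in>UNIV. (case p of (i, a) \<Rightarrow> \<lambda>(j, b). c i a b \<otimes> d i j) (j, b)) = \<one>" for j b
  proof -
    have "(\<Oplus>p\<in>UNIV. (case p of (i, a) \<Rightarrow> \<lambda>(j, b). c i a b \<otimes> d i j) (j, b)) =
        (\<Oplus>i\<in>UNIV. \<Oplus>a\<in>UNIV. c i a b \<otimes> d i j)"
      by (subst finsum_UNIV_prod) (simp_all add: C(1) D(1) split: prod.splits)
    also have "\<dots> = (\<Oplus>i\<in>UNIV. d i j)"
    proof (rule finsum_eqI)
      fix i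
      have "(\<Oplus>a\<in>UNIV. c i a b \<otimes> d i j) = (\<Oplus>a\<in>UNIV. c i a b) \<otimes> d i j"
        by (subst finsum_const_left) (simp_all add: C(1) D(1))
      thus "(\<Oplus>a\<in>UNIV. c i a b \<otimes> d i j) = d i j" by (simp add: C(7) D(1))
    qed (simp add: D(1))
    finally show ?thesis by (simp add: D(7))
  qed
  have st: "star A (c i a b \<otimes> d i j) = c i a b \<otimes> d i j" for i j a b
    by (simp add: star_mult C(1,3) D(1,3) comm)
  show ?thesis
    unfolding magic_unitary_def split_paired_All case_prod_conv
    by (intro conjI allI impI idem st row col rsum csum m_closed C(1) D(1)) auto
qed

end

lemma star_hom_magic_unitary:
  assumes A: "star_algebra A" and B: "star_algebra B" and f: "f \<in> star_hom A B" and u: "magic_unitary A u"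
  shows "magic_unitary B (\<lambda>i j. f (u i j))"
proof -
  interpret A: star_algebra A by (rule A)
  note m = magic_unitaryD[OF u]
  have p: "f (u i j) \<otimes>\<^bsub>B\<^esub> f (u k l) = f (u i j \<otimes>\<^bsub>A\<^esub> u k l)" for i j k l
    by (rule star_hom_mult[OF f m(1) m(1), symmetric])
  have s: "(\<Oplus>\<^bsub>B\<^esub>k\<in>UNIV. f (g k)) = f (\<Oplus>\<^bsub>A\<^esub>k\<in>UNIV. g k)" if "\<And>k. g k \<in> carrier A" for g
    by (rule star_hom_finsum[OF A B f, symmetric]) (simp add: that)
  show ?thesis
    unfolding magic_unitary_def p
    by (simp add: m s star_hom_closed[OF f m(1)] star_hom_star[OF f m(1), symmetric]
        star_hom_zero[OF A B f] star_hom_one[OF f])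
qed

section \<open>The opposite algebra and the complex numbers as C*-algebras\<close>

lemma opposite_simps [simp]:
  "carrier (opposite A) = carrier A" "x \<otimes>\<^bsub>opposite A\<^esub> y = y \<otimes>\<^bsub>A\<^esub> x" "\<one>\<^bsub>opposite A\<^esub> = \<one>\<^bsub>A\<^esub>"
  "\<zero>\<^bsub>opposite A\<^esub> = \<zero>\<^bsub>A\<^esub>" "add (opposite A) = add A" "cscale (opposite A) = cscale A"
  "star (opposite A) = star A"
  by (simp_all add: opposite_def)

lemma opposite_star_algebra:
  assumes "star_algebra A"
  shows "star_algebra (opposite A)"
proof -
  interpret star_algebra A by fact
  have "ring (opposite A)"
  proof (rule ringI)
    show "abelian_group (opposite A)"
    proof (rule abelian_groupI)
      fix x assume "x \<in> carrier (opposite A)"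
      thus "\<exists>y\<in>carrier (opposite A). y \<oplus>\<^bsub>opposite A\<^esub> x = \<zero>\<^bsub>opposite A\<^esub>"
        by (intro bexI[of _ "\<ominus>\<^bsub>A\<^esub> x"]) (simp_all add: l_neg)
    qed (simp_all add: a_ac)
    show "monoid (opposite A)" by (rule monoidI) (simp_all add: m_assoc)
  qed (simp_all add: l_distr r_distr)
  thus ?thesis
    by (rule star_algebra.intro, intro star_algebra_axioms.intro)
       (simp_all add: cscale_add_right cscale_add_left cscale_cscale cscale_mult_left
         cscale_mult_right star_add star_mult star_cscale)
qed

lemma opposite_minus:
  assumes "star_algebra A" "x \<in> carrier A" "y \<in> carrier A"
  shows "x \<ominus>\<^bsub>opposite A\<^esub> y = x \<ominus>\<^bsub>A\<^esub> y"
proof -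
  interpret A: star_algebra A by fact
  interpret O: star_algebra "opposite A" by (rule opposite_star_algebra) fact
  show ?thesis
    using assms O.cscale_minus_one[of y] A.cscale_minus_one[of y] by (simp add: a_minus_def)
qed

lemma opposite_cnorm: "cnorm (opposite A) = cnorm (A :: ('a, 'e) cstar_alg_scheme)"
  by (simp add: opposite_def)

lemma opposite_cstar_algebra:
  assumes "cstar_algebra A"
  shows "cstar_algebra (opposite A)"
proof -
  interpret cstar A using assms by (simp add: cstar_def)
  have sa: "star_algebra A" by unfold_locales
  \<comment> \<open>The C*-identity of the reversed product is that of \<open>A\<close> at
    \<open>star A x\<close>, which has the same norm as \<open>x\<close>.\<close>
  have q: "cnorm A (x \<otimes>\<^bsub>A\<^esub> star A x) = (cnorm A x)\<^sup>2" if "x \<in> carrier A" for x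
    using q_star_mult[of "star A x"] q_star[of x] that by simp
  have cs: "cauchy_seqs (opposite A) (cnorm A) = cauchy_seqs A (cnorm A)"
    unfolding cauchy_seqs_def by (intro Collect_cong conj_cong) (simp_all add: opposite_minus[OF sa])
  show ?thesis
  proof (rule cstar_algebra.intro[OF opposite_star_algebra[OF sa]], rule cstar_algebra_axioms.intro)
    show "cstar_seminorm (opposite A) (cnorm (opposite A))"
      unfolding cstar_seminorm_def opposite_cnorm opposite_simps
    proof (intro conjI ballI allI)
      fix x y assume "x \<in> carrier A" "y \<in> carrier A"
      thus "cnorm A (y \<otimes>\<^bsub>A\<^esub> x) \<le> cnorm A x * cnorm A y" by (subst mult.commute) (rule q_mult)
    qed (simp_all add: q_add q_cscale q)
    fix x assume "x \<in> carrier (opposite A)" "cnorm (opposite A) x = 0"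
    thus "x = \<zero>\<^bsub>opposite A\<^esub>" using cnorm_definite by (simp add: opposite_cnorm)
  next
    fix f assume "f \<in> cauchy_seqs (opposite A) (cnorm (opposite A))"
    hence f: "f \<in> cauchy_seqs A (cnorm A)" by (simp only: cs opposite_cnorm)
    from complete[OF f] obtain x where x: "x \<in> carrier A" "(\<lambda>k. cnorm A (f k \<ominus>\<^bsub>A\<^esub> x)) \<longlonglongrightarrow> 0"
      by (rule bexE)
    thus "\<exists>x\<in>carrier (opposite A).
        (\<lambda>k. cnorm (opposite A) (f k \<ominus>\<^bsub>opposite A\<^esub> x)) \<longlonglongrightarrow> 0"
      using cauchy_seqs_closed[OF f]
      by (intro bexI[of _ x]) (simp_all add: opposite_cnorm opposite_minus[OF sa])
  qed
qed

lemma opposite_star_hom: "f \<in> star_hom A B \<Longrightarrow> f \<in> star_hom (opposite A) (opposite B)"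
  by (rule star_homI)
     (simp_all add: star_hom_closed star_hom_add star_hom_mult star_hom_one star_hom_cscale star_hom_star)

lemma opposite_finsum: "star_algebra A \<Longrightarrow> finsum (opposite A) f I = finsum A f I"
  by (simp add: finsum_def finprod_def opposite_def)

lemma complex_cstar_simps [simp]:
  "carrier complex_cstar = UNIV" "mult complex_cstar = (*)" "one complex_cstar = 1"
  "zero complex_cstar = 0" "add complex_cstar = (+)" "cscale complex_cstar = (*)"
  "star complex_cstar = cnj" "cnorm complex_cstar = cmod"
  by (simp_all add: complex_cstar_def)

lemma complex_star_algebra: "star_algebra complex_cstar"
proof -
  have "ring complex_cstar"
  proof (rule ringI)
    show "abelian_group complex_cstar"
    proof (rule abelian_groupI)
      fix x assume "x \<in> carrier complex_cstar"
      show "\<exists>y\<in>carrier complex_cstar. y \<oplus>\<^bsub>complex_cstar\<^esub> x = \<zero>\<^bsub>complex_cstar\<^esub>"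
        by (intro bexI[of _ "- x"]) simp_all
    qed (simp_all add: algebra_simps)
    show "monoid complex_cstar" by (rule monoidI) (simp_all add: algebra_simps)
  qed (simp_all add: algebra_simps)
  thus ?thesis
    by (rule star_algebra.intro, intro star_algebra_axioms.intro) (simp_all add: algebra_simps)
qed

lemma complex_minus: "x \<ominus>\<^bsub>complex_cstar\<^esub> y = x - y"
proof -
  interpret star_algebra complex_cstar by (rule complex_star_algebra)
  show ?thesis using minus_add_cancel[of x y] by (simp add: algebra_simps)
qed

lemma complex_cstar_algebra: "cstar_algebra complex_cstar"
proof (rule cstar_algebra.intro[OF complex_star_algebra], rule cstar_algebra_axioms.intro)
  show "cstar_seminorm complex_cstar (cnorm complex_cstar)"
    by (simp add: cstar_seminorm_def norm_mult norm_triangle_ineq power2_eq_square)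
next
  fix f assume f: "f \<in> cauchy_seqs complex_cstar (cnorm complex_cstar)"
  have "Cauchy f"
    using f by (intro CauchyI) (simp add: cauchy_seqs_def complex_minus)
  then obtain x where "f \<longlonglongrightarrow> x" using Cauchy_convergent convergent_def by blast
  hence "(\<lambda>k. cmod (f k - x)) \<longlonglongrightarrow> 0" by (simp add: LIM_zero tendsto_norm_zero)
  thus "\<exists>x\<in>carrier complex_cstar. (\<lambda>k. cnorm complex_cstar (f k \<ominus>\<^bsub>complex_cstar\<^esub> x)) \<longlonglongrightarrow> 0"
    by (intro bexI[of _ x]) (simp_all add: complex_minus)
qed simp

text \<open>No clause of \<open>star_generated\<close> refers to the carrier.\<close>

lemma star_generated_carrier_update:
  "star_generated (A\<lparr>carrier := X\<rparr>) S = star_generated (A :: ('a, 'e) star_alg_scheme) S"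
proof (rule equalityI; rule subsetI)
  fix x assume "x \<in> star_generated (A\<lparr>carrier := X\<rparr>) S"
  thus "x \<in> star_generated A S"
    by (induction rule: star_generated.induct) (simp_all add: star_generated.intros)
next
  fix x assume "x \<in> star_generated A S"
  thus "x \<in> star_generated (A\<lparr>carrier := X\<rparr>) S"
  proof (induction rule: star_generated.induct)
    case one
    show ?case using star_generated.one[of "A\<lparr>carrier := X\<rparr>" S] by simp
  next
    case (add x y)
    show ?case using star_generated.add[OF add.IH] by simp
  next
    case (mult x y)
    show ?case using star_generated.mult[OF mult.IH] by simp
  next
    case (cscale x c)
    show ?case using star_generated.cscale[OF cscale.IH, of c] by simp
  next
    case (star x)
    show ?case using star_generated.star[OF star.IH] by simp
  qed (rule star_generated.incl)
qed

text \<open>The kernel is an ideal, and it is norm closed because morphisms are contractive; so it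
  contains the smallest closed ideal around \<open>S\<close>. This is what lets a morphism pass to
  the quotient.\<close>

lemma closed_kernel:
  assumes F: "cstar_algebra F" and D: "cstar_algebra D" and h: "h \<in> star_hom F D"
    and S: "\<And>s. s \<in> S \<Longrightarrow> s \<in> carrier F \<and> h s = \<zero>\<^bsub>D\<^esub>"
  shows "closed_ideal_generated F S \<subseteq> a_kernel F D h"
proof -
  interpret F: cstar F using F by (simp add: cstar_def)
  interpret D: cstar D using D by (simp add: cstar_def)
  have ker: "a_kernel F D h = {x \<in> carrier F. h x = \<zero>\<^bsub>D\<^esub>}" by (simp add: a_kernel_def kernel_def)
  have "h \<in> ring_hom F D" using h by (simp add: star_hom_def)
  hence "ring_hom_ring F D h" by (intro ring_hom_ringI2 F.ring_axioms D.ring_axioms)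
  hence id: "ideal (a_kernel F D h) F" by (rule ring_hom_ring.kernel_is_ideal)
  have "cnorm_closure F (a_kernel F D h) \<subseteq> a_kernel F D h"
  proof
    fix x assume x: "x \<in> cnorm_closure F (a_kernel F D h)"
    have "a_kernel F D h \<subseteq> carrier F" by (auto simp: ker)
    from iffD1[OF F.cnorm_closure_iff[OF this] x]
    obtain s where s: "\<And>k. s k \<in> a_kernel F D h" "F.tends s x" by blast
    have "(\<lambda>k. h (s k)) = (\<lambda>k. \<zero>\<^bsub>D\<^esub>)" using s(1) by (intro ext) (simp add: ker)
    hence "h x = \<zero>\<^bsub>D\<^esub>"
      using D.tends_unique[OF star_hom_tends[OF F D h s(2)]] D.tends_const[OF D.zero_closed] by simp
    thus "x \<in> a_kernel F D h" using F.tends_closed(2)[OF s(2)] by (simp add: ker)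
  qed
  moreover have "S \<subseteq> a_kernel F D h" using S by (auto simp: ker)
  ultimately show ?thesis unfolding closed_ideal_generated_def using id by (intro Inter_lower) simp
qed

lemma qpaD:
  assumes "quantum_permutation_algebra A u"
  shows "cstar_algebra A" "magic_unitary A u"
    "cnorm_closure A (star_generated A (entries u)) = carrier A"
    "\<exists>\<Delta>\<in>star_hom A (max_tensor A A). \<forall>i j.
       \<Delta> (u i j) = (\<Oplus>\<^bsub>max_tensor A A\<^esub>k\<in>UNIV. tensor_elem A A (u i k) (u k j))"
    "\<exists>\<epsilon>\<in>star_hom A complex_cstar. \<forall>i j. \<epsilon> (u i j) = of_bool (i = j)"
    "\<exists>S\<in>star_hom A (opposite A). \<forall>i j. S (u i j) = u j i"
    "\<And>q x. cstar_seminorm (A\<lparr>carrier := star_generated A (entries u)\<rparr>) q \<Longrightarrow>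
       x \<in> star_generated A (entries u) \<Longrightarrow> q x \<le> cnorm A x"
  using assms by (simp_all add: quantum_permutation_algebra_def)

section \<open>The free wreath product\<close>

lemma tensor_elem_closed:
  assumes "cstar_algebra A" "cstar_algebra B" "x \<in> carrier A" "y \<in> carrier B"
  shows "tensor_elem A B x y \<in> carrier (max_tensor A B)"
proof -
  interpret T: cstar "max_tensor A B" using max_tensor_cstar_algebra[OF assms(1,2)] by (simp add: cstar_def)
  show ?thesis
    unfolding tensor_elem_eq[OF assms]
    using star_hom_closed[OF tensor_inl_star_hom[OF assms(1,2)] assms(3)]
      star_hom_closed[OF tensor_inr_star_hom[OF assms(1,2)] assms(4)] by simp
qed

text \<open>A quotient map \<open>p\<close> is fixed. The kernel equation is used in both
  directions: the commutators vanish in \<open>Q\<close>, and a morphism that kills the commutators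
  factors through \<open>p\<close>.\<close>

locale free_wreath =
  fixes B :: "('b, 'f) cstar_alg_scheme" and v :: "'m::finite \<Rightarrow> 'm \<Rightarrow> 'b"
    and A :: "('a, 'e) cstar_alg_scheme" and u :: "'n::finite \<Rightarrow> 'n \<Rightarrow> 'a"
    and Q :: "('q, 'g) cstar_alg_scheme" and w :: "'n \<times> 'm \<Rightarrow> 'n \<times> 'm \<Rightarrow> 'q"
    and p :: "(nat \<Rightarrow> ('n \<times> 'b + 'a) star_poly) set \<Rightarrow> 'q"
  assumes qB: "quantum_permutation_algebra B v" and qA: "quantum_permutation_algebra A u"
    and Q: "cstar_algebra Q" and p: "p \<in> star_hom (free_prod B A) Q"
    and onto: "p ` carrier (free_prod B A) = carrier Q"
    and ker: "a_kernel (free_prod B A) Q p =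
      closed_ideal_generated (free_prod B A) (wreath_commutators B v A u)"
    and w: "w (i, a) (j, b) =
      p (free_prod_inl B A i (v a b) \<otimes>\<^bsub>free_prod B A\<^esub> free_prod_inr B A (u i j))"
begin

lemma cstar_factors: "cstar_algebra B" "cstar_algebra A"
  using qpaD(1)[OF qB] qpaD(1)[OF qA] by simp_all

abbreviation F :: "((nat \<Rightarrow> ('n \<times> 'b + 'a) star_poly) set) cstar_alg" where
  "F \<equiv> free_prod B A"

lemma F_cstar: "cstar_algebra F"
  by (rule free_prod_cstar_algebra[OF cstar_factors])

sublocale B: cstar B using cstar_factors by (simp add: cstar_def)
sublocale A: cstar A using cstar_factors by (simp add: cstar_def)
sublocale Q: cstar Q using Q by (simp add: cstar_def)
sublocale F: cstar "free_prod B A :: ((nat \<Rightarrow> ('n \<times> 'b + 'a) star_poly) set) cstar_alg"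
  using F_cstar by (simp add: cstar_def)

lemmas sa = B.star_algebra_axioms A.star_algebra_axioms Q.star_algebra_axioms F.star_algebra_axioms

definition inB :: "'n \<Rightarrow> 'b \<Rightarrow> 'q" where "inB i x = p (free_prod_inl B A i x)"
definition inA :: "'a \<Rightarrow> 'q" where "inA y = p (free_prod_inr B A y)"

lemma inl: "(free_prod_inl B A i :: 'b \<Rightarrow> (nat \<Rightarrow> ('n \<times> 'b + 'a) star_poly) set) \<in> star_hom B F"
  by (rule free_prod_inl_star_hom[OF cstar_factors])

lemma inr: "(free_prod_inr B A :: 'a \<Rightarrow> (nat \<Rightarrow> ('n \<times> 'b + 'a) star_poly) set) \<in> star_hom A F"
  by (rule free_prod_inr_star_hom[OF cstar_factors])

lemma inB: "inB i \<in> star_hom B Q"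
  unfolding inB_def[abs_def] by (rule star_hom_comp[OF inl p])

lemma inA: "inA \<in> star_hom A Q"
  unfolding inA_def[abs_def] by (rule star_hom_comp[OF inr p])

lemmas mv = magic_unitaryD[OF qpaD(2)[OF qB]]
lemmas mu = magic_unitaryD[OF qpaD(2)[OF qA]]

lemma entries_closed: "entries v \<subseteq> carrier B" "entries u \<subseteq> carrier A"
  using mv(1) mu(1) by auto

lemma dense_factors:
  "carrier B \<subseteq> cnorm_closure B (star_generated B (entries v))"
  "carrier A \<subseteq> cnorm_closure A (star_generated A (entries u))"
  using qpaD(3)[OF qB] qpaD(3)[OF qA] by simp_all

lemma mB: "magic_unitary Q (\<lambda>a b. inB i (v a b))"
  by (rule star_hom_magic_unitary[OF sa(1,3) inB qpaD(2)[OF qB]])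

lemma mA: "magic_unitary Q (\<lambda>i j. inA (u i j))"
  by (rule star_hom_magic_unitary[OF sa(2,3) inA qpaD(2)[OF qA]])

lemma wreath_commutators_closed: "s \<in> wreath_commutators B v A u \<Longrightarrow> s \<in> carrier F"
  unfolding wreath_commutators_def
  using star_hom_closed[OF inl mv(1)] star_hom_closed[OF inr mu(1)] by auto

text \<open>The commutators lie in the ideal that is the kernel of \<open>p\<close>.\<close>

lemma commute: "inB i (v a b) \<otimes>\<^bsub>Q\<^esub> inA (u i j) = inA (u i j) \<otimes>\<^bsub>Q\<^esub> inB i (v a b)"
proof -
  let ?x = "free_prod_inl B A i (v a b) :: (nat \<Rightarrow> ('n \<times> 'b + 'a) star_poly) set"
  let ?y = "free_prod_inr B A (u i j) :: (nat \<Rightarrow> ('n \<times> 'b + 'a) star_poly) set"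
  have x: "?x \<in> carrier F" and y: "?y \<in> carrier F"
    using star_hom_closed[OF inl mv(1)] star_hom_closed[OF inr mu(1)] by simp_all
  have "?x \<otimes>\<^bsub>F\<^esub> ?y \<ominus>\<^bsub>F\<^esub> (?y \<otimes>\<^bsub>F\<^esub> ?x) \<in> wreath_commutators B v A u"
    unfolding wreath_commutators_def by blast
  hence "?x \<otimes>\<^bsub>F\<^esub> ?y \<ominus>\<^bsub>F\<^esub> (?y \<otimes>\<^bsub>F\<^esub> ?x) \<in> a_kernel F Q p"
    unfolding ker closed_ideal_generated_def by blast
  hence "p (?x \<otimes>\<^bsub>F\<^esub> ?y \<ominus>\<^bsub>F\<^esub> (?y \<otimes>\<^bsub>F\<^esub> ?x)) = \<zero>\<^bsub>Q\<^esub>" by (simp add: a_kernel_def kernel_def)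
  hence "p (?x \<otimes>\<^bsub>F\<^esub> ?y) \<ominus>\<^bsub>Q\<^esub> p (?y \<otimes>\<^bsub>F\<^esub> ?x) = \<zero>\<^bsub>Q\<^esub>"
    by (simp only: star_hom_minus[OF sa(4,3) p F.m_closed[OF x y] F.m_closed[OF y x]])
  hence "p (?x \<otimes>\<^bsub>F\<^esub> ?y) = p (?y \<otimes>\<^bsub>F\<^esub> ?x)"
    using Q.minus_eq_zero_iff[OF star_hom_closed[OF p F.m_closed[OF x y]]
        star_hom_closed[OF p F.m_closed[OF y x]]] by blast
  thus ?thesis unfolding star_hom_mult[OF p x y] star_hom_mult[OF p y x] inB_def inA_def .
qed

lemma w_eq: "w (i, a) (j, b) = inB i (v a b) \<otimes>\<^bsub>Q\<^esub> inA (u i j)"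
  unfolding w inB_def inA_def
  by (rule star_hom_mult[OF p star_hom_closed[OF inl mv(1)] star_hom_closed[OF inr mu(1)]])

lemma closed [simp]: "x \<in> carrier B \<Longrightarrow> inB i x \<in> carrier Q" "y \<in> carrier A \<Longrightarrow> inA y \<in> carrier Q"
  using star_hom_closed[OF inB] star_hom_closed[OF inA] by blast+

lemma w_closed: "w s t \<in> carrier Q"
  by (cases s; cases t) (simp add: w_eq mv mu)

text \<open>The antipode needs arbitrary elements of B here: gluing morphisms along projections from
  \<open>u\<close> requires commutation with their whole range.\<close>

lemma commute_inB: "x \<in> carrier B \<Longrightarrow> inB i x \<otimes>\<^bsub>Q\<^esub> inA (u i j) = inA (u i j) \<otimes>\<^bsub>Q\<^esub> inB i x"
  by (rule star_hom_commute_dense[OF cstar_factors(1) Q inB _ _ entries_closed(1) dense_factors(1)])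
     (use commute magic_unitaryD(3)[OF mA] in \<open>auto simp: mu\<close>)

lemma magic_w: "magic_unitary Q w"
proof -
  have "w = (\<lambda>(i, a) (j, b). inB i (v a b) \<otimes>\<^bsub>Q\<^esub> inA (u i j))"
    by (intro ext) (auto simp: w_eq)
  thus ?thesis using Q.wreath_magic_unitary[OF mB mA commute] by simp
qed

text \<open>Row \<open>a\<close> of the i-th copy of \<open>v\<close> sums to 1, whichever
  \<open>a\<close> is chosen.\<close>

lemma inA_w: "inA (u i j) = (\<Oplus>\<^bsub>Q\<^esub>b\<in>UNIV. w (i, a) (j, b))"
proof -
  have "(\<Oplus>\<^bsub>Q\<^esub>b\<in>UNIV. w (i, a) (j, b)) = (\<Oplus>\<^bsub>Q\<^esub>b\<in>UNIV. inB i (v a b)) \<otimes>\<^bsub>Q\<^esub> inA (u i j)"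
    unfolding w_eq by (subst Q.finsum_const_left) (simp_all add: mv mu)
  thus ?thesis using magic_unitaryD(6)[OF mB] by (simp add: mu)
qed

lemma inB_w: "inB i (v a b) = (\<Oplus>\<^bsub>Q\<^esub>j\<in>UNIV. w (i, a) (j, b))"
proof -
  have "(\<Oplus>\<^bsub>Q\<^esub>j\<in>UNIV. w (i, a) (j, b)) = inB i (v a b) \<otimes>\<^bsub>Q\<^esub> (\<Oplus>\<^bsub>Q\<^esub>j\<in>UNIV. inA (u i j))"
    unfolding w_eq by (subst Q.finsum_const_left) (simp_all add: mv mu)
  thus ?thesis using magic_unitaryD(6)[OF mA] by (simp add: mv)
qed

lemma entries_w: "entries w \<subseteq> carrier Q"
  using w_closed by auto

definition gQ :: "'q set" where "gQ = star_generated Q (entries w)"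
definition gB :: "'b set" where "gB = star_generated B (entries v)"
definition gA :: "'a set" where "gA = star_generated A (entries u)"

lemma generated_closed: "x \<in> gQ \<Longrightarrow> x \<in> carrier Q" "y \<in> gB \<Longrightarrow> y \<in> carrier B" "z \<in> gA \<Longrightarrow> z \<in> carrier A"
  unfolding gQ_def gB_def gA_def
  by (rule Q.star_generated_closed[OF _ entries_w] B.star_generated_closed[OF _ entries_closed(1)]
      A.star_generated_closed[OF _ entries_closed(2)], assumption)+

lemma generators: "w s t \<in> gQ" "v a b \<in> gB" "u i j \<in> gA"
  unfolding gQ_def gB_def gA_def by (rule star_generated.incl, blast)+

lemmas gQ_intros = star_generated.one[where A = Q and S = "entries w", folded gQ_def]
  star_generated.add[where A = Q and S = "entries w", folded gQ_def]
  star_generated.mult[where A = Q and S = "entries w", folded gQ_def]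
  star_generated.cscale[where A = Q and S = "entries w", folded gQ_def]
  star_generated.star[where A = Q and S = "entries w", folded gQ_def]

lemma dense_gB: "carrier B \<subseteq> cnorm_closure B gB" and dense_gA: "carrier A \<subseteq> cnorm_closure A gA"
  unfolding gB_def gA_def by (rule dense_factors)+

lemma inA_generated: "inA (u i j) \<in> gQ"
  \<comment> \<open>The identity holds for each row index \<open>a\<close>, so an unspecified one
    serves.\<close>
  unfolding inA_w[of i j undefined]
  by (rule Q.star_generated_finsum[OF _ entries_w, folded gQ_def]) (rule generators)

lemma inB_generated: "inB i (v a b) \<in> gQ"
  unfolding inB_w
  by (rule Q.star_generated_finsum[OF _ entries_w, folded gQ_def]) (rule generators)

lemma inB_maps_generated:
  assumes "x \<in> gB"
  shows "inB i x \<in> gQ"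
  unfolding gQ_def
proof (rule star_hom_image_generated[OF sa(1) inB entries_closed(1) assms[unfolded gB_def]])
  fix s assume "s \<in> entries v"
  then obtain a b where "s = v a b" by blast
  thus "inB i s \<in> star_generated Q (entries w)" using inB_generated unfolding gQ_def by simp
qed

lemma inA_maps_generated:
  assumes "x \<in> gA"
  shows "inA x \<in> gQ"
  unfolding gQ_def
proof (rule star_hom_image_generated[OF sa(2) inA entries_closed(2) assms[unfolded gA_def]])
  fix s assume "s \<in> entries u"
  then obtain i j where "s = u i j" by blast
  thus "inA s \<in> star_generated Q (entries w)" using inA_generated unfolding gQ_def by simp
qed

text \<open>A contractive map takes the closure of \<open>S\<close> into the closure of its image.
  It is applied to both factors and then to the free product, with a dense set for each.\<close>

lemma closed_limit:
  assumes E: "cstar_algebra E" and h: "h \<in> star_hom E Q" and S: "S \<subseteq> carrier E"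
    and dense: "carrier E \<subseteq> cnorm_closure E S"
    and gen: "\<And>x. x \<in> S \<Longrightarrow> h x \<in> cnorm_closure Q gQ" and x: "x \<in> carrier E"
  shows "h x \<in> cnorm_closure Q gQ"
proof -
  interpret E: cstar E using E by (simp add: cstar_def)
  have "\<exists>y\<in>gQ. cnorm Q (h x \<ominus>\<^bsub>Q\<^esub> y) < e" if e: "e > 0" for e
  proof -
    have e2: "e / 2 > 0" using e by simp
    have "x \<in> cnorm_closure E S" using dense x by (rule subsetD)
    hence "\<forall>e>0. \<exists>y\<in>S. cnorm E (x \<ominus>\<^bsub>E\<^esub> y) < e" unfolding cnorm_closure_def by blast
    from this[rule_format, OF e2] have "\<exists>y\<in>S. cnorm E (x \<ominus>\<^bsub>E\<^esub> y) < e / 2" .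
    then obtain y where y: "y \<in> S" "cnorm E (x \<ominus>\<^bsub>E\<^esub> y) < e / 2" by (rule bexE)
    have yc: "y \<in> carrier E" using S y(1) by (rule subsetD)
    have "\<forall>e>0. \<exists>z\<in>gQ. cnorm Q (h y \<ominus>\<^bsub>Q\<^esub> z) < e"
      using gen[OF y(1)] unfolding cnorm_closure_def by blast
    from this[rule_format, OF e2] have "\<exists>z\<in>gQ. cnorm Q (h y \<ominus>\<^bsub>Q\<^esub> z) < e / 2" .
    then obtain z where z: "z \<in> gQ" "cnorm Q (h y \<ominus>\<^bsub>Q\<^esub> z) < e / 2"
      by (rule bexE)
    have hc: "h x \<in> carrier Q" "h y \<in> carrier Q" using star_hom_closed[OF h] x yc by simp_all
    have "cnorm Q (h x \<ominus>\<^bsub>Q\<^esub> h y) \<le> cnorm E (x \<ominus>\<^bsub>E\<^esub> y)"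
      unfolding star_hom_minus[OF E.star_algebra_axioms sa(3) h x yc, symmetric]
      by (rule star_hom_contractive[OF E Q h E.minus_closed[OF x yc]])
    hence "cnorm Q (h x \<ominus>\<^bsub>Q\<^esub> z) < e"
      using Q.q_triangle[OF hc generated_closed(1)[OF z(1)]] y(2) z(2) by linarith
    thus ?thesis using z(1) by (rule bexI)
  qed
  thus ?thesis using star_hom_closed[OF h x] by (simp add: cnorm_closure_def)
qed

text \<open>The closure of a *-subalgebra is again one, as approximating sequences can be combined
  termwise.\<close>

lemma cnorm_closure_generated:
  assumes x: "x \<in> star_generated Q T"
    and T: "\<And>t. t \<in> T \<Longrightarrow> t \<in> cnorm_closure Q gQ"
  shows "x \<in> cnorm_closure Q gQ"
proof -
  have sub: "gQ \<subseteq> carrier Q"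
    by (rule subsetI) (rule generated_closed(1))
  note iff = Q.cnorm_closure_iff[OF sub]
  show ?thesis using x
  proof (induction rule: star_generated.induct)
    case one
    show ?case unfolding iff
      by (rule exI[of _ "\<lambda>_. \<one>\<^bsub>Q\<^esub>"]) (simp add: Q.tends_const gQ_intros)
  next
    case (add x y)
    from add.IH obtain f g where "\<forall>k. f k \<in> gQ" "Q.tends f x"
      "\<forall>k. g k \<in> gQ" "Q.tends g y" unfolding iff by auto
    thus ?case unfolding iff
      by (intro exI[of _ "\<lambda>k. f k \<oplus>\<^bsub>Q\<^esub> g k"]) (simp add: Q.tends_add gQ_intros)
  next
    case (mult x y)
    from mult.IH obtain f g where "\<forall>k. f k \<in> gQ" "Q.tends f x"
      "\<forall>k. g k \<in> gQ" "Q.tends g y" unfolding iff by auto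
    thus ?case unfolding iff
      by (intro exI[of _ "\<lambda>k. f k \<otimes>\<^bsub>Q\<^esub> g k"]) (simp add: Q.tends_mult gQ_intros)
  next
    case (cscale x c)
    from cscale.IH obtain f where "\<forall>k. f k \<in> gQ" "Q.tends f x"
      unfolding iff by auto
    thus ?case unfolding iff
      by (intro exI[of _ "\<lambda>k. Defs.cscale Q c (f k)"]) (simp add: Q.tends_cscale gQ_intros)
  next
    case (star x)
    from star.IH obtain f where "\<forall>k. f k \<in> gQ" "Q.tends f x"
      unfolding iff by auto
    thus ?case unfolding iff
      by (intro exI[of _ "\<lambda>k. Defs.star Q (f k)"]) (simp add: Q.tends_star gQ_intros)
  qed (rule T)
qed

lemma generated_subset_closure: "x \<in> gQ \<Longrightarrow> x \<in> cnorm_closure Q gQ"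
  unfolding cnorm_closure_def
  by (auto simp: generated_closed a_minus_def Q.r_neg intro!: bexI[of _ x])

text \<open>Density takes two rounds. The entries of \<open>v\<close> and \<open>u\<close> are
  obtained from \<open>w\<close>, so the copies of all of B and A lie in the closure; these copies
  generate a dense part of the free product, which maps onto \<open>Q\<close>.\<close>

lemma dense_w: "cnorm_closure Q gQ = carrier Q"
proof
  show "cnorm_closure Q gQ \<subseteq> carrier Q" by (auto simp: cnorm_closure_def)
  let ?T = "(\<Union>i. free_prod_inl B A i ` carrier B) \<union> free_prod_inr B A ` carrier A
    :: ((nat \<Rightarrow> ('n \<times> 'b + 'a) star_poly) set) set"
  have T: "?T \<subseteq> carrier F" using star_hom_closed[OF inl] star_hom_closed[OF inr] by auto
  have "gB \<subseteq> carrier B" "gA \<subseteq> carrier A" using generated_closed by auto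
  hence "inB i x \<in> cnorm_closure Q gQ" if "x \<in> carrier B" for i x
    by (intro closed_limit[OF cstar_factors(1) inB _ dense_gB _ that] generated_subset_closure
        inB_maps_generated)
  moreover have "inA x \<in> cnorm_closure Q gQ" if "x \<in> carrier A" for x
    using \<open>gA \<subseteq> carrier A\<close>
    by (intro closed_limit[OF cstar_factors(2) inA _ dense_gA _ that] generated_subset_closure
        inA_maps_generated)
  ultimately have pT: "t \<in> p ` ?T \<Longrightarrow> t \<in> cnorm_closure Q gQ" for t
    by (auto simp: inB_def inA_def)
  have pgen: "p x \<in> cnorm_closure Q gQ" if x: "x \<in> star_generated F ?T" for x
  proof -
    have "p x \<in> star_generated Q (p ` ?T)"
      by (rule star_hom_image_generated[OF sa(4) p T x]) (auto intro: star_generated.incl)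
    thus ?thesis by (rule cnorm_closure_generated[OF _ pT])
  qed
  show "carrier Q \<subseteq> cnorm_closure Q gQ"
  proof
    fix y assume "y \<in> carrier Q"
    then obtain x where x: "x \<in> carrier F" "y = p x" unfolding onto[symmetric] by (rule imageE)
    have "star_generated F ?T \<subseteq> carrier F" using F.star_generated_closed[OF _ T] by (rule subsetI)
    thus "y \<in> cnorm_closure Q gQ"
      unfolding x(2)
      by (rule closed_limit[OF F_cstar p _ free_prod_dense[OF cstar_factors refl] pgen x(1)])
  qed
qed

text \<open>The free product lifts \<open>f\<close> and \<open>g\<close>; the lift kills the
  commutators, hence the closed ideal they generate, which is the kernel of \<open>p\<close>. The
  structure maps, the fullness estimate and the map to operators are all obtained from here.\<close>

lemma wreath_lift:
  fixes f :: "'n \<Rightarrow> 'b \<Rightarrow> 'd"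
  assumes D: "cstar_algebra D" and f: "\<And>i. f i \<in> star_hom B D" and g: "g \<in> star_hom A D"
    and comm: "\<And>i j a b. f i (v a b) \<otimes>\<^bsub>D\<^esub> g (u i j) = g (u i j) \<otimes>\<^bsub>D\<^esub> f i (v a b)"
  shows "\<exists>H\<in>star_hom Q D. (\<forall>i. \<forall>x\<in>carrier B. H (inB i x) = f i x) \<and>
    (\<forall>y\<in>carrier A. H (inA y) = g y)"
proof -
  interpret D: cstar D using D by (simp add: cstar_def)
  have ex: "\<exists>H\<in>star_hom F D. (\<forall>i. \<forall>x\<in>carrier B. H (free_prod_inl B A i x) = f i x) \<and>
      (\<forall>y\<in>carrier A. H (free_prod_inr B A y) = g y)"
    by (rule free_prod_lift[OF cstar_factors D f g])
  obtain h where h: "h \<in> star_hom F D"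
    "(\<forall>i. \<forall>x\<in>carrier B. h (free_prod_inl B A i x) = f i x) \<and> (\<forall>y\<in>carrier A. h (free_prod_inr B A y) = g y)"
    using ex by (rule bexE)
  have hl: "h (free_prod_inl B A i x) = f i x" if "x \<in> carrier B" for i x using h(2) that by simp
  have hr: "h (free_prod_inr B A y) = g y" if "y \<in> carrier A" for y using h(2) that by simp
  have "closed_ideal_generated F (wreath_commutators B v A u) \<subseteq> a_kernel F D h"
  proof (rule closed_kernel[OF F_cstar D h(1)])
    fix s :: "(nat \<Rightarrow> ('n \<times> 'b + 'a) star_poly) set"
    assume s: "s \<in> wreath_commutators B v A u"
    then obtain i j a b where se: "s = free_prod_inl B A i (v a b) \<otimes>\<^bsub>F\<^esub> free_prod_inr B A (u i j)
        \<ominus>\<^bsub>F\<^esub> (free_prod_inr B A (u i j) \<otimes>\<^bsub>F\<^esub> free_prod_inl B A i (v a b))"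
      unfolding wreath_commutators_def by blast
    note c = star_hom_closed[OF inl mv(1), of i a b] star_hom_closed[OF inr mu(1), of i j]
    have "h s = f i (v a b) \<otimes>\<^bsub>D\<^esub> g (u i j) \<ominus>\<^bsub>D\<^esub> g (u i j) \<otimes>\<^bsub>D\<^esub> f i (v a b)"
      unfolding se
      by (simp add: star_hom_minus[OF sa(4) D.star_algebra_axioms h(1)] star_hom_mult[OF h(1)] c
          hl hr mv(1) mu(1))
    also have "\<dots> = \<zero>\<^bsub>D\<^esub>"
      unfolding comm using star_hom_closed[OF f mv(1), of i a b] star_hom_closed[OF g mu(1), of i j]
      by (simp add: a_minus_def D.r_neg)
    finally show "s \<in> carrier F \<and> h s = \<zero>\<^bsub>D\<^esub>" using wreath_commutators_closed[OF s] by simp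
  qed
  hence kr: "h x = \<zero>\<^bsub>D\<^esub>" if "x \<in> carrier F" "p x = \<zero>\<^bsub>Q\<^esub>" for x
    using that unfolding ker[symmetric] by (auto simp: a_kernel_def kernel_def)
  \<comment> \<open>Any preimage under \<open>p\<close> serves: two of them differ by an element of
    the kernel, on which \<open>h\<close> vanishes.\<close>
  define H where "H y = h (SOME x. x \<in> carrier F \<and> p x = y)" for y
  have Hp: "H (p x) = h x" if x: "x \<in> carrier F" for x
  proof -
    define x' where "x' = (SOME x'. x' \<in> carrier F \<and> p x' = p x)"
    have x': "x' \<in> carrier F \<and> p x' = p x"
      unfolding x'_def by (rule someI[of _ x]) (simp add: x)
    have "p (x' \<ominus>\<^bsub>F\<^esub> x) = p x' \<ominus>\<^bsub>Q\<^esub> p x"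
      by (rule star_hom_minus[OF sa(4,3) p conjunct1[OF x'] x])
    hence "p (x' \<ominus>\<^bsub>F\<^esub> x) = \<zero>\<^bsub>Q\<^esub>"
      using star_hom_closed[OF p x] x' by (simp add: a_minus_def Q.r_neg)
    hence "h (x' \<ominus>\<^bsub>F\<^esub> x) = \<zero>\<^bsub>D\<^esub>" using x' x by (intro kr) simp_all
    hence "h x' \<ominus>\<^bsub>D\<^esub> h x = \<zero>\<^bsub>D\<^esub>"
      using x' by (simp add: star_hom_minus[OF sa(4) D.star_algebra_axioms h(1) _ x])
    hence "h x' = h x"
      using D.minus_eq_zero_iff star_hom_closed[OF h(1)] x' x by simp
    thus ?thesis by (simp add: H_def x'_def)
  qed
  have "H \<in> star_hom Q D"
  proof (rule star_homI)
    show "H \<one>\<^bsub>Q\<^esub> = \<one>\<^bsub>D\<^esub>"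
      using Hp[OF F.one_closed] by (simp add: star_hom_one[OF p] star_hom_one[OF h(1)])
    fix y c assume "y \<in> carrier Q"
    then obtain x where x: "x \<in> carrier F" and y: "y = p x" unfolding onto[symmetric] by blast
    show "H y \<in> carrier D" unfolding y Hp[OF x] by (rule star_hom_closed[OF h(1) x])
    show "H (cscale Q c y) = cscale D c (H y)"
      unfolding y star_hom_cscale[OF p x, symmetric]
      by (simp add: Hp x star_hom_cscale[OF h(1)])
    show "H (star Q y) = star D (H y)"
      unfolding y star_hom_star[OF p x, symmetric]
      by (simp add: Hp x star_hom_star[OF h(1)])
    fix y' assume "y' \<in> carrier Q"
    then obtain x' where x': "x' \<in> carrier F" and y': "y' = p x'" unfolding onto[symmetric] by blast
    show "H (y \<oplus>\<^bsub>Q\<^esub> y') = H y \<oplus>\<^bsub>D\<^esub> H y'"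
      unfolding y y' star_hom_add[OF p x x', symmetric]
      by (simp add: Hp x x' star_hom_add[OF h(1)])
    show "H (y \<otimes>\<^bsub>Q\<^esub> y') = H y \<otimes>\<^bsub>D\<^esub> H y'"
      unfolding y y' star_hom_mult[OF p x x', symmetric]
      by (simp add: Hp x x' star_hom_mult[OF h(1)])
  qed
  moreover have "H (inB i x) = f i x" if "x \<in> carrier B" for i x
    unfolding inB_def by (simp add: Hp hl star_hom_closed[OF inl] that)
  moreover have "H (inA y) = g y" if "y \<in> carrier A" for y
    unfolding inA_def by (simp add: Hp hr star_hom_closed[OF inr] that)
  ultimately show ?thesis by (intro bexI[of _ H] conjI allI ballI)
qed

text \<open>Both counits are lifted together; commutation is automatic in a commutative
  target.\<close>

lemma counit: "\<exists>\<epsilon>\<in>star_hom Q complex_cstar. \<forall>s t. \<epsilon> (w s t) = of_bool (s = t)"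
proof -
  obtain eB where eB: "eB \<in> star_hom B complex_cstar" "\<forall>a b. eB (v a b) = of_bool (a = b)"
    using qpaD(5)[OF qB] by (rule bexE)
  obtain eA where eA: "eA \<in> star_hom A complex_cstar" "\<forall>i j. eA (u i j) = of_bool (i = j)"
    using qpaD(5)[OF qA] by (rule bexE)
  have "\<exists>H\<in>star_hom Q complex_cstar. (\<forall>i. \<forall>x\<in>carrier B. H (inB i x) = eB x) \<and>
      (\<forall>y\<in>carrier A. H (inA y) = eA y)"
    by (rule wreath_lift[OF complex_cstar_algebra eB(1) eA(1)]) (simp add: mult.commute)
  then obtain H where H: "H \<in> star_hom Q complex_cstar"
    "(\<forall>i. \<forall>x\<in>carrier B. H (inB i x) = eB x) \<and> (\<forall>y\<in>carrier A. H (inA y) = eA y)" by (rule bexE)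
  have "H (w s t) = of_bool (s = t)" for s t
    using H(2) eA(2) eB(2)
    by (cases s; cases t) (auto simp: w_eq star_hom_mult[OF H(1)] mv(1) mu(1))
  thus ?thesis using H(1) by (intro bexI[of _ H] allI)
qed

text \<open>Summing the prescribed values \<open>w (j, b) (i, a)\<close> over \<open>j\<close>
  dictates the image of the i-th copy of \<open>v a b\<close>: it is the sum over \<open>k\<close>
  of the k-th copy of \<open>v b a\<close> times \<open>u k i\<close>. So the morphisms
  \<open>h k\<close> are glued along the i-th column of \<open>u\<close>.\<close>

lemma antipode: "\<exists>S\<in>star_hom Q (opposite Q). \<forall>s t. S (w s t) = w t s"
proof -
  obtain sB where sB: "sB \<in> star_hom B (opposite B)" "\<forall>a b. sB (v a b) = v b a"
    using qpaD(6)[OF qB] by (rule bexE)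
  obtain sA where sA: "sA \<in> star_hom A (opposite A)" "\<forall>i j. sA (u i j) = u j i"
    using qpaD(6)[OF qA] by (rule bexE)
  interpret O: cstar "opposite Q" using opposite_cstar_algebra[OF Q] by (simp add: cstar_def)
  have sBc: "x \<in> carrier B \<Longrightarrow> sB x \<in> carrier B" for x using star_hom_closed[OF sB(1)] by simp
  define h where "h k x = inB k (sB x)" for k x
  have h: "h k \<in> star_hom B (opposite Q)" for k
    unfolding h_def[abs_def] by (rule star_hom_comp[OF sB(1) opposite_star_hom[OF inB]])
  define e where "e i k = inA (u k i)" for i k
  \<comment> \<open>The i-th column of \<open>u\<close>; reversing products does not affect
    orthogonality or idempotence.\<close>
  have e: "O.partition_of_one (e i)" for i
    using magic_unitaryD[OF mA]
    by (simp add: O.partition_of_one_def e_def mu opposite_finsum[OF sa(3)] eq_commute)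
  have hv: "h k (v a b) = inB k (v b a)" for k a b by (simp add: h_def sB(2))
  have comm: "h k x \<otimes>\<^bsub>opposite Q\<^esub> e i k = e i k \<otimes>\<^bsub>opposite Q\<^esub> h k x" if "x \<in> carrier B" for i k x
    using commute_inB[OF sBc[OF that]] by (simp add: h_def e_def)
  define f where "f i x = (\<Oplus>\<^bsub>opposite Q\<^esub>k\<in>UNIV. h k x \<otimes>\<^bsub>opposite Q\<^esub> e i k)" for i x
  have f: "f i \<in> star_hom B (opposite Q)" for i
    unfolding f_def[abs_def] by (rule O.partition_star_hom[OF sa(1) h e comm])
  define g where "g x = inA (sA x)" for x
  have g: "g \<in> star_hom A (opposite Q)"
    unfolding g_def[abs_def] by (rule star_hom_comp[OF sA(1) opposite_star_hom[OF inA]])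
  have gu: "g (u i j) = e i j" for i j by (simp add: g_def e_def sA(2))
  note hc = star_hom_closed[OF h mv(1)] and ec = O.partition_of_oneD(1)[OF e]
  \<comment> \<open>Multiplication by \<open>e i j\<close> isolates the j-th block, and the next
    fact gives the same block from the other side. So the images of the generators commute as the
    lift requires.\<close>
  have fe: "f i (v a b) \<otimes>\<^bsub>opposite Q\<^esub> e i j = h j (v a b) \<otimes>\<^bsub>opposite Q\<^esub> e i j" for i j a b
    unfolding f_def by (rule O.partition_mult_single(2)[OF e hc comm[OF mv(1)] O.one_closed])
  have ef: "e i j \<otimes>\<^bsub>opposite Q\<^esub> f i (v a b) = h j (v a b) \<otimes>\<^bsub>opposite Q\<^esub> e i j" for i j a b
    using O.partition_mult_single(1)[where e = "e i" and x = "\<lambda>k. h k (v a b)" and j = j,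
        OF e hc comm[OF mv(1)] O.one_closed]
    unfolding f_def O.l_one[OF ec] O.l_one[OF hc] .
  have "\<exists>H\<in>star_hom Q (opposite Q). (\<forall>i. \<forall>x\<in>carrier B. H (inB i x) = f i x) \<and>
      (\<forall>y\<in>carrier A. H (inA y) = g y)"
    by (rule wreath_lift[OF opposite_cstar_algebra[OF Q] f g]) (simp only: gu fe ef)
  then obtain H where H: "H \<in> star_hom Q (opposite Q)"
    "(\<forall>i. \<forall>x\<in>carrier B. H (inB i x) = f i x) \<and> (\<forall>y\<in>carrier A. H (inA y) = g y)" by (rule bexE)
  have Hi: "H (inB i (v a b)) = f i (v a b)" "H (inA (u i j)) = e i j" for i j a b
    using H(2) mv(1) mu(1) gu by simp_all
  have "H (w (i, a) (j, b)) = w (j, b) (i, a)" for i a j b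
  proof -
    have "H (w (i, a) (j, b)) = f i (v a b) \<otimes>\<^bsub>opposite Q\<^esub> e i j"
      unfolding w_eq star_hom_mult[OF H(1) closed(1)[OF mv(1)] closed(2)[OF mu(1)]] Hi ..
    also have "\<dots> = w (j, b) (i, a)"
      unfolding fe w_eq hv using commute by (simp add: e_def)
    finally show ?thesis .
  qed
  hence "\<forall>s t. H (w s t) = w t s" by simp
  thus ?thesis using H(1) by (intro bexI[of _ H])
qed

lemma fullB: "cstar_seminorm (B\<lparr>carrier := gB\<rparr>) q \<Longrightarrow> x \<in> gB \<Longrightarrow> q x \<le> cnorm B x"
  unfolding gB_def by (rule qpaD(7)[OF qB])

lemma fullA: "cstar_seminorm (A\<lparr>carrier := gA\<rparr>) q \<Longrightarrow> x \<in> gA \<Longrightarrow> q x \<le> cnorm A x"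
  unfolding gA_def by (rule qpaD(7)[OF qA])

text \<open>Complete the generated *-algebra for \<open>q\<close>. Pulled back to the dense
  subalgebras of B and A, \<open>q\<close> is dominated by their norms because they are full, so
  their copies extend to morphisms into the completion. The lift \<open>H\<close> agrees with the
  embedding on \<open>w\<close>, and contractivity of \<open>H\<close> is the claimed
  estimate.\<close>

lemma full:
  assumes q: "cstar_seminorm (Q\<lparr>carrier := gQ\<rparr>) q"
    and x: "x \<in> gQ"
  shows "q x \<le> cnorm Q x"
proof -
  let ?Q = "Q\<lparr>carrier := gQ\<rparr>"
  let ?B = "B\<lparr>carrier := gB\<rparr>"
  let ?A = "A\<lparr>carrier := gA\<rparr>"
  have sQ: "star_algebra ?Q" and sB: "star_algebra ?B" and sA: "star_algebra ?A"
    unfolding gQ_def gB_def gA_def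
    by (rule Q.generated_star_algebra[OF entries_w] B.generated_star_algebra[OF entries_closed(1)]
        A.generated_star_algebra[OF entries_closed(2)])+
  interpret C: cstar_seminormed ?Q q
    by (intro cstar_seminormed.intro sQ cstar_seminormed_axioms.intro q)
  have rB: "x \<in> gB \<Longrightarrow> x \<in> carrier B" for x
    by (rule generated_closed)
  have rA: "x \<in> gA \<Longrightarrow> x \<in> carrier A" for x
    by (rule generated_closed)
  note h = star_hom_add star_hom_mult star_hom_one star_hom_cscale star_hom_star
  have iB: "inB i \<in> star_hom ?B ?Q" for i
    by (rule star_homI) (simp_all add: inB_maps_generated rB h[OF inB])
  have iA: "inA \<in> star_hom ?A ?Q"
    by (rule star_homI) (simp_all add: inA_maps_generated rA h[OF inA])
  have idB: "(\<lambda>x. x) \<in> star_hom ?B B" by (rule star_homI) (simp_all add: rB)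
  have idA: "(\<lambda>x. x) \<in> star_hom ?A A" by (rule star_homI) (simp_all add: rA)
  have "\<exists>H\<in>star_hom B C.compl. \<forall>x\<in>carrier ?B. H x = C.embed (inB i x)" for i
  proof (rule star_hom_extend[OF sB cstar_factors(1) C.compl_cstar_algebra idB
        star_hom_comp[OF iB C.embed_star_hom]])
    show "carrier B \<subseteq> cnorm_closure B ((\<lambda>x. x) ` carrier ?B)" using dense_gB by simp
    fix x assume "x \<in> carrier ?B"
    thus "cnorm C.compl (C.embed (inB i x)) \<le> cnorm B x"
      using fullB[OF pullback_seminorm[OF sB q iB]] by (simp add: C.cnorm_embed inB_maps_generated)
  qed
  hence ex: "\<exists>H. H \<in> star_hom B C.compl \<and> (\<forall>x\<in>gB. H x = C.embed (inB i x))" for i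
    unfolding Bex_def by simp
  define f where "f i = (SOME H. H \<in> star_hom B C.compl \<and> (\<forall>x\<in>gB. H x = C.embed (inB i x)))" for i
  have f: "f i \<in> star_hom B C.compl" "\<forall>x\<in>gB. f i x = C.embed (inB i x)" for i
    using someI_ex[OF ex, of i] unfolding f_def by blast+
  have "\<exists>H\<in>star_hom A C.compl. \<forall>x\<in>carrier ?A. H x = C.embed (inA x)"
  proof (rule star_hom_extend[OF sA cstar_factors(2) C.compl_cstar_algebra idA
        star_hom_comp[OF iA C.embed_star_hom]])
    show "carrier A \<subseteq> cnorm_closure A ((\<lambda>x. x) ` carrier ?A)" using dense_gA by simp
    fix x assume "x \<in> carrier ?A"
    thus "cnorm C.compl (C.embed (inA x)) \<le> cnorm A x"
      using fullA[OF pullback_seminorm[OF sA q iA]] by (simp add: C.cnorm_embed inA_maps_generated)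
  qed
  then obtain g where g: "g \<in> star_hom A C.compl" "\<forall>x\<in>carrier ?A. g x = C.embed (inA x)" by (rule bexE)
  have fv: "f i (v a b) = C.embed (inB i (v a b))" for i a b
    by (rule bspec[OF f(2) generators(2)])
  have gu: "g (u i j) = C.embed (inA (u i j))" for i j
    by (rule bspec[OF g(2)]) (simp add: generators(3))
  have em: "C.embed (x \<otimes>\<^bsub>Q\<^esub> y) = C.embed x \<otimes>\<^bsub>C.compl\<^esub> C.embed y"
    if "x \<in> gQ" "y \<in> gQ" for x y
    using star_hom_mult[OF C.embed_star_hom, of x y] that by simp
  have "\<exists>H\<in>star_hom Q C.compl. (\<forall>i. \<forall>x\<in>carrier B. H (inB i x) = f i x) \<and>
      (\<forall>y\<in>carrier A. H (inA y) = g y)"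
  proof (rule wreath_lift[OF C.compl_cstar_algebra f(1) g(1)])
    fix i j a b
    show "f i (v a b) \<otimes>\<^bsub>C.compl\<^esub> g (u i j) = g (u i j) \<otimes>\<^bsub>C.compl\<^esub> f i (v a b)"
      unfolding fv gu em[OF inB_generated inA_generated, symmetric]
        em[OF inA_generated inB_generated, symmetric] commute ..
  qed
  then obtain H where H: "H \<in> star_hom Q C.compl"
    "(\<forall>i. \<forall>x\<in>carrier B. H (inB i x) = f i x) \<and> (\<forall>y\<in>carrier A. H (inA y) = g y)" by (rule bexE)
  have Hi: "H (inB i (v a b)) = C.embed (inB i (v a b))" "H (inA (u i j)) = C.embed (inA (u i j))" for i j a b
    using H(2) mv(1) mu(1) fv gu by simp_all
  have Hw: "H (w s t) = C.embed (w s t)" for s t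
    by (cases s; cases t)
       (simp add: w_eq star_hom_mult[OF H(1)] mv(1) mu(1) Hi em inB_generated inA_generated)
  have rQ: "x \<in> gQ \<Longrightarrow> x \<in> carrier Q" for x
    by (rule generated_closed)
  have H': "H \<in> star_hom ?Q C.compl"
    by (rule star_homI) (simp_all add: rQ h[OF H(1)] star_hom_closed[OF H(1)])
  \<comment> \<open>Two morphisms that agree on the entries of \<open>w\<close> agree on the
    *-algebra generated by them, which is where \<open>q\<close> lives.\<close>
  have "H x = C.embed x"
  proof (rule star_hom_eq_generated[OF sQ H' C.embed_star_hom])
    show "entries w \<subseteq> carrier ?Q" by (auto simp: generators)
    show "x \<in> star_generated ?Q (entries w)"
      unfolding star_generated_carrier_update gQ_def[symmetric] by (rule x)
    show "H s = C.embed s" if "s \<in> entries w" for s using that Hw by auto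
  qed
  hence "q x = cnorm C.compl (H x)" using C.cnorm_embed[of x] x by simp
  also have "\<dots> \<le> cnorm Q x" by (rule star_hom_contractive[OF Q C.compl_cstar_algebra H(1) rQ[OF x]])
  finally show ?thesis .
qed

text \<open>The image of the i-th copy of B is forced: summing the prescribed value for
  \<open>w (i, x) (j, y)\<close> over \<open>j\<close> leaves the sum over \<open>k\<close> of
  \<open>P i k (v x y)\<close> times the left-leg copy of \<open>u i k\<close>. Here
  \<open>P i k\<close> is the comultiplication of B followed by the i-th copy in the left leg and
  the k-th copy in the right leg.\<close>

lemma comultiplication:
  "\<exists>\<Delta>\<in>star_hom Q (max_tensor Q Q). \<forall>s t.
     \<Delta> (w s t) = (\<Oplus>\<^bsub>max_tensor Q Q\<^esub>r\<in>UNIV. tensor_elem Q Q (w s r) (w r t))"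
proof -
  define T where "T = max_tensor Q Q"
  have Tc: "cstar_algebra T" unfolding T_def by (rule max_tensor_cstar_algebra[OF Q Q])
  interpret T: cstar T using Tc by (simp add: cstar_def)
  define i1 where "i1 = tensor_inl Q Q"
  define i2 where "i2 = tensor_inr Q Q"
  have i1: "i1 \<in> star_hom Q T" unfolding i1_def T_def by (rule tensor_inl_star_hom[OF Q Q])
  have i2: "i2 \<in> star_hom Q T" unfolding i2_def T_def by (rule tensor_inr_star_hom[OF Q Q])
  have cross: "i1 x \<otimes>\<^bsub>T\<^esub> i2 y = i2 y \<otimes>\<^bsub>T\<^esub> i1 x" if "x \<in> carrier Q" "y \<in> carrier Q" for x y
    unfolding i1_def i2_def T_def by (rule tensor_commute[OF Q Q that])
  have te: "tensor_elem Q Q x y = i1 x \<otimes>\<^bsub>T\<^esub> i2 y" if "x \<in> carrier Q" "y \<in> carrier Q" for x y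
    unfolding i1_def i2_def T_def by (rule tensor_elem_eq[OF Q Q that])
  note ic [simp] = star_hom_closed[OF i1] star_hom_closed[OF i2]
  define a where "a i k = i1 (inA (u i k))" for i k
  define a' where "a' k j = i2 (inA (u k j))" for k j
  define s where "s i x c = i1 (inB i (v x c))" for i x c
  define s' where "s' k c y = i2 (inB k (v c y))" for k c y
  have cl [simp]: "a i k \<in> carrier T" "a' i k \<in> carrier T" "s i x c \<in> carrier T" "s' i x c \<in> carrier T"
    for i k x c by (simp_all add: a_def a'_def s_def s'_def mu(1) mv(1))
  \<comment> \<open>Within one leg, a copy of B is known to commute with its own row of
    \<open>u\<close>; elements of different legs always commute.\<close>
  have com: "a i k \<otimes>\<^bsub>T\<^esub> s i x c = s i x c \<otimes>\<^bsub>T\<^esub> a i k" "a i k \<otimes>\<^bsub>T\<^esub> s' l x c = s' l x c \<otimes>\<^bsub>T\<^esub> a i k"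
    "a i k \<otimes>\<^bsub>T\<^esub> a' l j = a' l j \<otimes>\<^bsub>T\<^esub> a i k" "a' l j \<otimes>\<^bsub>T\<^esub> s i x c = s i x c \<otimes>\<^bsub>T\<^esub> a' l j"
    "a' i k \<otimes>\<^bsub>T\<^esub> s' i x c = s' i x c \<otimes>\<^bsub>T\<^esub> a' i k" for i j k l x c
    unfolding a_def a'_def s_def s'_def
    by (simp_all add: star_hom_mult[OF i1, symmetric] star_hom_mult[OF i2, symmetric] commute cross
        mu(1) mv(1))
  obtain dA where dA: "dA \<in> star_hom A (max_tensor A A)"
    "\<forall>i j. dA (u i j) = (\<Oplus>\<^bsub>max_tensor A A\<^esub>k\<in>UNIV. tensor_elem A A (u i k) (u k j))"
    using qpaD(4)[OF qA] by (rule bexE)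
  obtain dB where dB: "dB \<in> star_hom B (max_tensor B B)"
    "\<forall>i j. dB (v i j) = (\<Oplus>\<^bsub>max_tensor B B\<^esub>k\<in>UNIV. tensor_elem B B (v i k) (v k j))"
    using qpaD(4)[OF qB] by (rule bexE)
  have TA: "star_algebra (max_tensor A A)" and TB: "star_algebra (max_tensor B B)"
    using max_tensor_cstar_algebra[OF cstar_factors(2,2)] max_tensor_cstar_algebra[OF cstar_factors(1,1)]
    by (simp_all add: cstar_algebra_def)
  \<comment> \<open>The tensor square of \<open>inA\<close>; below, \<open>HB i k\<close> is the
    tensor product of the i-th and the k-th copy of B. Their lifts exist because the two legs
    commute.\<close>
  have "\<exists>H\<in>star_hom (max_tensor A A) T. \<forall>x\<in>carrier A. \<forall>y\<in>carrier A.
      H (tensor_elem A A x y) = i1 (inA x) \<otimes>\<^bsub>T\<^esub> i2 (inA y)"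
    by (rule tensor_lift[OF cstar_factors(2,2) Tc star_hom_comp[OF inA i1] star_hom_comp[OF inA i2]])
       (simp add: cross)
  then obtain HA where HA: "HA \<in> star_hom (max_tensor A A) T" "\<forall>x\<in>carrier A. \<forall>y\<in>carrier A.
      HA (tensor_elem A A x y) = i1 (inA x) \<otimes>\<^bsub>T\<^esub> i2 (inA y)" by (rule bexE)
  have "\<exists>H\<in>star_hom (max_tensor B B) T. \<forall>x\<in>carrier B. \<forall>y\<in>carrier B.
      H (tensor_elem B B x y) = i1 (inB i x) \<otimes>\<^bsub>T\<^esub> i2 (inB k y)" for i k
    by (rule tensor_lift[OF cstar_factors(1,1) Tc star_hom_comp[OF inB i1] star_hom_comp[OF inB i2]])
       (simp add: cross)
  hence ex: "\<exists>H. H \<in> star_hom (max_tensor B B) T \<and> (\<forall>x\<in>carrier B. \<forall>y\<in>carrier B.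
      H (tensor_elem B B x y) = i1 (inB i x) \<otimes>\<^bsub>T\<^esub> i2 (inB k y))" for i k
    unfolding Bex_def .
  define HB where "HB i k = (SOME H. H \<in> star_hom (max_tensor B B) T \<and> (\<forall>x\<in>carrier B. \<forall>y\<in>carrier B.
      H (tensor_elem B B x y) = i1 (inB i x) \<otimes>\<^bsub>T\<^esub> i2 (inB k y)))" for i k
  have HB: "HB i k \<in> star_hom (max_tensor B B) T" "\<forall>x\<in>carrier B. \<forall>y\<in>carrier B.
      HB i k (tensor_elem B B x y) = i1 (inB i x) \<otimes>\<^bsub>T\<^esub> i2 (inB k y)" for i k
    using someI_ex[OF ex, of i k] unfolding HB_def by blast+
  define g where "g x = HA (dA x)" for x
  have g: "g \<in> star_hom A T" unfolding g_def[abs_def] by (rule star_hom_comp[OF dA(1) HA(1)])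
  \<comment> \<open>Each summand ends with the projection \<open>a i k\<close>, the form in which
    \<open>partition_mult\<close> multiplies sums.\<close>
  have gu: "g (u i j) = (\<Oplus>\<^bsub>T\<^esub>k\<in>UNIV. a' k j \<otimes>\<^bsub>T\<^esub> a i k)" for i j
  proof -
    have "g (u i j) = (\<Oplus>\<^bsub>T\<^esub>k\<in>UNIV. HA (tensor_elem A A (u i k) (u k j)))"
      unfolding g_def dA(2)[rule_format]
      by (rule star_hom_finsum[OF TA T.star_algebra_axioms HA(1)])
         (simp add: tensor_elem_closed cstar_factors mu(1))
    also have "\<dots> = (\<Oplus>\<^bsub>T\<^esub>k\<in>UNIV. a' k j \<otimes>\<^bsub>T\<^esub> a i k)"
      by (rule T.finsum_eqI)
         (simp_all add: HA(2)[rule_format] mu(1) a_def[symmetric] a'_def[symmetric] com)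
    finally show ?thesis .
  qed
  define P where "P i k x = HB i k (dB x)" for i k x
  have P: "P i k \<in> star_hom B T" for i k
    unfolding P_def[abs_def] by (rule star_hom_comp[OF dB(1) HB(1)])
  have Pv: "P i k (v x y) = (\<Oplus>\<^bsub>T\<^esub>c\<in>UNIV. s i x c \<otimes>\<^bsub>T\<^esub> s' k c y)" for i k x y
  proof -
    have "P i k (v x y) = (\<Oplus>\<^bsub>T\<^esub>c\<in>UNIV. HB i k (tensor_elem B B (v x c) (v c y)))"
      unfolding P_def dB(2)[rule_format]
      by (rule star_hom_finsum[OF TB T.star_algebra_axioms HB(1)])
         (simp add: tensor_elem_closed cstar_factors mv(1))
    also have "\<dots> = (\<Oplus>\<^bsub>T\<^esub>c\<in>UNIV. s i x c \<otimes>\<^bsub>T\<^esub> s' k c y)"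
      by (rule T.finsum_eqI)
         (simp_all add: HB(2)[rule_format] mv(1) s_def[symmetric] s'_def[symmetric])
    finally show ?thesis .
  qed
  note Pc [simp] = star_hom_closed[OF P mv(1)]
  \<comment> \<open>\<open>P i k\<close> has the i-th copy of B in the left leg, so it commutes with
    row \<open>i\<close> of \<open>u\<close> there. The next fact is the same for row
    \<open>k\<close> in the right leg.\<close>
  have aP: "a i k \<otimes>\<^bsub>T\<^esub> P i k (v x y) = P i k (v x y) \<otimes>\<^bsub>T\<^esub> a i k" for i k x y
    unfolding Pv by (rule T.commute_finsum) (simp_all add: T.commute_mult com)
  have a'P: "a' k j \<otimes>\<^bsub>T\<^esub> P i k (v x y) = P i k (v x y) \<otimes>\<^bsub>T\<^esub> a' k j" for i j k x y
    unfolding Pv by (rule T.commute_finsum) (simp_all add: T.commute_mult com)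
  have ma: "magic_unitary T a"
    using star_hom_magic_unitary[OF sa(3) T.star_algebra_axioms i1 mA] unfolding a_def[abs_def] .
  have e: "T.partition_of_one (a i)" for i by (rule T.magic_unitary_partition(1)[OF ma])
  have comm: "P i k x \<otimes>\<^bsub>T\<^esub> a i k = a i k \<otimes>\<^bsub>T\<^esub> P i k x" if "x \<in> carrier B" for i k x
    by (rule star_hom_commute_dense[OF cstar_factors(1) Tc P cl(1) magic_unitaryD(3)[OF ma]
          entries_closed(1) dense_factors(1) _ that]) (use aP in auto)
  define f where "f i x = (\<Oplus>\<^bsub>T\<^esub>k\<in>UNIV. P i k x \<otimes>\<^bsub>T\<^esub> a i k)" for i x
  have f: "f i \<in> star_hom B T" for i
    unfolding f_def[abs_def] by (rule T.partition_star_hom[OF sa(1) P e comm])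
  \<comment> \<open>Both products collapse to a single sum over \<open>k\<close>, and
    \<open>a'P\<close> identifies the summands: this is the commutation that the lift
    requires.\<close>
  have fg: "f i (v x y) \<otimes>\<^bsub>T\<^esub> g (u i j) = (\<Oplus>\<^bsub>T\<^esub>k\<in>UNIV. P i k (v x y) \<otimes>\<^bsub>T\<^esub> a' k j \<otimes>\<^bsub>T\<^esub> a i k)" for i j x y
    unfolding f_def gu by (rule T.partition_mult[OF e]) (simp_all add: com)
  have gf: "g (u i j) \<otimes>\<^bsub>T\<^esub> f i (v x y) = (\<Oplus>\<^bsub>T\<^esub>k\<in>UNIV. a' k j \<otimes>\<^bsub>T\<^esub> P i k (v x y) \<otimes>\<^bsub>T\<^esub> a i k)" for i j x y
    unfolding f_def gu by (rule T.partition_mult[OF e]) (simp_all add: aP)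
  have "\<exists>H\<in>star_hom Q T. (\<forall>i. \<forall>x\<in>carrier B. H (inB i x) = f i x) \<and> (\<forall>y\<in>carrier A. H (inA y) = g y)"
    by (rule wreath_lift[OF Tc f g]) (simp only: fg gf a'P)
  then obtain H where H: "H \<in> star_hom Q T"
    "(\<forall>i. \<forall>x\<in>carrier B. H (inB i x) = f i x) \<and> (\<forall>y\<in>carrier A. H (inA y) = g y)" by (rule bexE)
  have Hi: "H (inB i (v x y)) = f i (v x y)" "H (inA (u i j)) = g (u i j)" for i j x y
    using H(2) mv(1) mu(1) by simp_all
  have "H (w (i, x) (j, y)) = (\<Oplus>\<^bsub>T\<^esub>r\<in>UNIV. tensor_elem Q Q (w (i, x) r) (w r (j, y)))" for i x j y
  proof -
    have "H (w (i, x) (j, y)) = f i (v x y) \<otimes>\<^bsub>T\<^esub> g (u i j)"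
      unfolding w_eq star_hom_mult[OF H(1) closed(1)[OF mv(1)] closed(2)[OF mu(1)]] Hi ..
    also have "\<dots> = (\<Oplus>\<^bsub>T\<^esub>k\<in>UNIV. \<Oplus>\<^bsub>T\<^esub>c\<in>UNIV. (s i x c \<otimes>\<^bsub>T\<^esub> a i k) \<otimes>\<^bsub>T\<^esub> (s' k c y \<otimes>\<^bsub>T\<^esub> a' k j))"
      unfolding fg
    proof (rule T.finsum_eqI)
      fix k
      have "P i k (v x y) \<otimes>\<^bsub>T\<^esub> a' k j \<otimes>\<^bsub>T\<^esub> a i k = P i k (v x y) \<otimes>\<^bsub>T\<^esub> (a' k j \<otimes>\<^bsub>T\<^esub> a i k)"
        by (rule T.m_assoc) simp_all
      also have "\<dots> = (\<Oplus>\<^bsub>T\<^esub>c\<in>UNIV. s i x c \<otimes>\<^bsub>T\<^esub> s' k c y \<otimes>\<^bsub>T\<^esub> (a' k j \<otimes>\<^bsub>T\<^esub> a i k))"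
        unfolding Pv by (rule T.finsum_const_left(2)) simp_all
      also have "\<dots> = (\<Oplus>\<^bsub>T\<^esub>c\<in>UNIV. (s i x c \<otimes>\<^bsub>T\<^esub> a i k) \<otimes>\<^bsub>T\<^esub> (s' k c y \<otimes>\<^bsub>T\<^esub> a' k j))"
      proof (rule T.finsum_eqI)
        fix c
        have "s i x c \<otimes>\<^bsub>T\<^esub> s' k c y \<otimes>\<^bsub>T\<^esub> (a' k j \<otimes>\<^bsub>T\<^esub> a i k) =
            s i x c \<otimes>\<^bsub>T\<^esub> (s' k c y \<otimes>\<^bsub>T\<^esub> a' k j \<otimes>\<^bsub>T\<^esub> a i k)" by (simp add: T.m_assoc)
        \<comment> \<open>\<open>a i k\<close> moves left past both elements of the right leg, which
          separates the product into its two legs.\<close>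
        also have "\<dots> = s i x c \<otimes>\<^bsub>T\<^esub> (a i k \<otimes>\<^bsub>T\<^esub> (s' k c y \<otimes>\<^bsub>T\<^esub> a' k j))"
          by (subst T.commute_mult[of "s' k c y" "a' k j" "a i k"]) (simp_all add: com)
        also have "\<dots> = (s i x c \<otimes>\<^bsub>T\<^esub> a i k) \<otimes>\<^bsub>T\<^esub> (s' k c y \<otimes>\<^bsub>T\<^esub> a' k j)" by (simp add: T.m_assoc)
        finally show "s i x c \<otimes>\<^bsub>T\<^esub> s' k c y \<otimes>\<^bsub>T\<^esub> (a' k j \<otimes>\<^bsub>T\<^esub> a i k) =
            (s i x c \<otimes>\<^bsub>T\<^esub> a i k) \<otimes>\<^bsub>T\<^esub> (s' k c y \<otimes>\<^bsub>T\<^esub> a' k j)" .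
      qed simp
      finally show "P i k (v x y) \<otimes>\<^bsub>T\<^esub> a' k j \<otimes>\<^bsub>T\<^esub> a i k =
          (\<Oplus>\<^bsub>T\<^esub>c\<in>UNIV. (s i x c \<otimes>\<^bsub>T\<^esub> a i k) \<otimes>\<^bsub>T\<^esub> (s' k c y \<otimes>\<^bsub>T\<^esub> a' k j))" .
    qed simp
    also have "\<dots> = (\<Oplus>\<^bsub>T\<^esub>k\<in>UNIV. \<Oplus>\<^bsub>T\<^esub>c\<in>UNIV. tensor_elem Q Q (w (i, x) (k, c)) (w (k, c) (j, y)))"
    proof (intro T.finsum_eqI)
      fix k c
      have "tensor_elem Q Q (w (i, x) (k, c)) (w (k, c) (j, y)) =
          i1 (w (i, x) (k, c)) \<otimes>\<^bsub>T\<^esub> i2 (w (k, c) (j, y))" by (rule te[OF w_closed w_closed])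
      thus "(s i x c \<otimes>\<^bsub>T\<^esub> a i k) \<otimes>\<^bsub>T\<^esub> (s' k c y \<otimes>\<^bsub>T\<^esub> a' k j) =
          tensor_elem Q Q (w (i, x) (k, c)) (w (k, c) (j, y))"
        unfolding w_eq star_hom_mult[OF i1 closed(1)[OF mv(1)] closed(2)[OF mu(1)]]
          star_hom_mult[OF i2 closed(1)[OF mv(1)] closed(2)[OF mu(1)]] s_def s'_def a_def a'_def ..
    qed (simp_all add: te w_closed)
    also have "\<dots> = (\<Oplus>\<^bsub>T\<^esub>r\<in>UNIV. tensor_elem Q Q (w (i, x) r) (w r (j, y)))"
      by (rule T.finsum_UNIV_prod[symmetric]) (simp add: te w_closed)
    finally show ?thesis .
  qed
  hence "\<forall>s t. H (w s t) = (\<Oplus>\<^bsub>T\<^esub>r\<in>UNIV. tensor_elem Q Q (w s r) (w r t))" by simp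
  thus ?thesis using H(1) unfolding T_def by (intro bexI[of _ H])
qed

lemma quantum_permutation_algebra_wreath: "quantum_permutation_algebra Q w"
  unfolding quantum_permutation_algebra_def
  using Q magic_w dense_w[unfolded gQ_def] comultiplication counit antipode full[unfolded gQ_def]
  by blast

end

section \<open>Operators on Hilbert spaces\<close>

lemma scaleC_zero_left [simp]: "0 *\<^sub>C x = (0 :: 'h::chilbert_space)"
  using scaleC_of_real[of 0 x] by simp

lemma scaleC_one [simp]: "1 *\<^sub>C x = (x :: 'h::chilbert_space)"
  using scaleC_of_real[of 1 x] by simp

lemma scaleC_zero_right [simp]: "c *\<^sub>C 0 = (0 :: 'h::chilbert_space)"
  using scaleC_add_right[of c 0 0] by simp

lemma scaleC_minus_one: "(-1) *\<^sub>C x = - (x :: 'h::chilbert_space)"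
  using scaleC_of_real[of "-1" x] by simp

lemma scaleC_scaleR: "c *\<^sub>C (r *\<^sub>R x) = r *\<^sub>R (c *\<^sub>C (x :: 'h::chilbert_space))"
  by (simp add: scaleC_of_real[symmetric] scaleC_scaleC mult.commute)

lemma cinner_add_left: "cinner (x + y) z = cinner x z + cinner y (z :: 'h::chilbert_space)"
  using cinner_commute[of "x + y" z] cinner_commute[of x z] cinner_commute[of y z]
  by (simp add: cinner_add_right)

lemma cinner_scaleC_left: "cinner (c *\<^sub>C x) y = cnj c * cinner x (y :: 'h::chilbert_space)"
  using cinner_commute[of "c *\<^sub>C x" y] cinner_commute[of x y] by (simp add: cinner_scaleC_right)

lemma cinner_scaleR_right: "cinner x (r *\<^sub>R y) = of_real r * cinner x (y :: 'h::chilbert_space)"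
  by (simp add: scaleC_of_real[symmetric] cinner_scaleC_right)

lemma cinner_scaleR_left: "cinner (r *\<^sub>R x) y = of_real r * cinner x (y :: 'h::chilbert_space)"
  by (simp add: scaleC_of_real[symmetric] cinner_scaleC_left)

lemma cinner_zero [simp]: "cinner x (0 :: 'h::chilbert_space) = 0" "cinner (0 :: 'h::chilbert_space) x = 0"
  using cinner_scaleC_right[of x 0 0] cinner_scaleC_left[of 0 0 x] by simp_all

lemma cinner_minus_right: "cinner x (- y) = - cinner x (y :: 'h::chilbert_space)"
  using cinner_scaleC_right[of x "-1" y] by (simp add: scaleC_minus_one)

lemma cinner_minus_left: "cinner (- x) y = - cinner x (y :: 'h::chilbert_space)"
  using cinner_scaleC_left[of "-1" x y] by (simp add: scaleC_minus_one)

lemma cinner_diff_right: "cinner x (y - z) = cinner x y - cinner x (z :: 'h::chilbert_space)"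
  using cinner_add_right[of x y "- z"] by (simp add: cinner_minus_right)

lemma cinner_diff_left: "cinner (x - y) z = cinner x z - cinner y (z :: 'h::chilbert_space)"
  using cinner_add_left[of x "- y" z] by (simp add: cinner_minus_left)

lemma norm_power2_cinner: "(norm (x :: 'h::chilbert_space))\<^sup>2 = Re (cinner x x)"
  by (simp add: cinner_self)

lemma norm_scaleC: "norm (c *\<^sub>C x) = cmod c * norm (x :: 'h::chilbert_space)"
proof -
  have "complex_of_real ((norm (c *\<^sub>C x))\<^sup>2) = (c * cnj c) * complex_of_real ((norm x)\<^sup>2)"
    unfolding cinner_self[symmetric] by (simp add: cinner_scaleC_left cinner_scaleC_right mult_ac)
  hence "complex_of_real ((norm (c *\<^sub>C x))\<^sup>2) = complex_of_real ((cmod c * norm x)\<^sup>2)"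
    unfolding complex_norm_square[symmetric] by (simp add: power_mult_distrib)
  hence "(norm (c *\<^sub>C x))\<^sup>2 = (cmod c * norm x)\<^sup>2" by (simp only: of_real_eq_iff)
  thus ?thesis by (simp add: power2_eq_iff_nonneg)
qed

lemma cinner_Cauchy_Schwarz: "cmod (cinner x y) \<le> norm x * norm (y :: 'h::chilbert_space)"
proof (cases "y = 0")
  case False
  define n where "n = (norm y)\<^sup>2"
  have n: "n > 0" using False by (simp add: n_def)
  \<comment> \<open>The coefficient of the orthogonal projection of \<open>x\<close> onto
    \<open>y\<close>; the inequality is nonnegativity of the squared distance.\<close>
  define c where "c = cinner y x / of_real n"
  have xy: "cinner x y = cnj (cinner y x)" by (rule cinner_commute)
  define N where "N = cinner y x * cnj (cinner y x)"
  have 1: "c * cinner x y = N / of_real n" unfolding c_def xy N_def by simp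
  have 2: "cnj c * cinner y x = N / of_real n" unfolding c_def N_def by (simp add: mult.commute)
  have 3: "cnj c * (c * cinner y y) = N / of_real n"
    unfolding cinner_self n_def[symmetric] c_def N_def using n by (simp add: mult.commute)
  have "cinner (x - c *\<^sub>C y) (x - c *\<^sub>C y) =
      cinner x x - c * cinner x y - cnj c * cinner y x + cnj c * (c * cinner y y)"
    by (simp add: cinner_diff_left cinner_diff_right cinner_scaleC_left cinner_scaleC_right
        algebra_simps)
  hence "cinner (x - c *\<^sub>C y) (x - c *\<^sub>C y) = cinner x x - N / of_real n" unfolding 1 2 3 by simp
  hence "(norm (x - c *\<^sub>C y))\<^sup>2 = (norm x)\<^sup>2 - (cmod (cinner y x))\<^sup>2 / n"
    unfolding cinner_self N_def complex_norm_square[symmetric] of_real_divide[symmetric]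
      of_real_diff[symmetric] of_real_eq_iff .
  hence "(cmod (cinner y x))\<^sup>2 / n \<le> (norm x)\<^sup>2" using zero_le_power2[of "norm (x - c *\<^sub>C y)"] by linarith
  hence "(cmod (cinner y x))\<^sup>2 \<le> (norm x * norm y)\<^sup>2"
    using n by (simp add: n_def power_mult_distrib divide_le_eq)
  hence "cmod (cinner y x) \<le> norm x * norm y" by (rule power2_le_imp_le) simp
  thus ?thesis by (simp add: xy)
qed simp

lemma bounded_linear_cinner_right: "bounded_linear (\<lambda>y. cinner x (y :: 'h::chilbert_space))"
proof (rule bounded_linear_intro[where K = "norm x"])
  show "norm (cinner x y) \<le> norm y * norm x" for y :: 'h
    by (subst mult.commute) (rule cinner_Cauchy_Schwarz)
qed (simp_all add: cinner_add_right cinner_scaleR_right scaleR_conv_of_real)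

lemma bounded_linear_cinner_left: "bounded_linear (\<lambda>x. cinner x (y :: 'h::chilbert_space))"
  by (rule bounded_linear_intro[where K = "norm y"])
     (simp_all add: cinner_Cauchy_Schwarz cinner_add_left cinner_scaleR_left scaleR_conv_of_real)

lemma bounded_linear_scaleC: "bounded_linear (\<lambda>x. c *\<^sub>C (x :: 'h::chilbert_space))"
  by (rule bounded_linear_intro[where K = "cmod c"])
     (simp_all add: scaleC_add_right scaleC_scaleR norm_scaleC mult.commute)

lemma norm_add_power2:
  "(norm (x + y :: 'h::chilbert_space))\<^sup>2 = (norm x)\<^sup>2 + 2 * Re (cinner x y) + (norm y)\<^sup>2"
proof -
  have "Re (cinner y x) = Re (cinner x y)" using cinner_commute[of y x] by simp
  thus ?thesis unfolding norm_power2_cinner by (simp add: cinner_add_left cinner_add_right)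
qed

lemma parallelogram_law:
  "(norm (x - y :: 'h::chilbert_space))\<^sup>2 + (norm (x + y))\<^sup>2 = 2 * (norm x)\<^sup>2 + 2 * (norm y)\<^sup>2"
  using norm_add_power2[of x y] norm_add_power2[of x "- y"] by (simp add: cinner_minus_right)

text \<open>Riesz representation: the functional \<open>f\<close> is represented by the minimizer of \<open>\<parallel>y\<parallel>\<^sup>2 - 2 f y\<close>.\<close>

lemma Riesz_representation:
  fixes f :: "'h::chilbert_space \<Rightarrow> real"
  assumes f: "bounded_linear f"
  shows "\<exists>z. \<forall>y. Re (cinner z y) = f y"
proof -
  interpret bounded_linear f by fact
  obtain K where K: "\<And>y. norm (f y) \<le> norm y * K" using bounded by blast
  define J where "J y = (norm y)\<^sup>2 - 2 * f y" for y
  \<comment> \<open>Completing the square with \<open>f y <= norm y * K\<close> bounds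
    \<open>J\<close> from below.\<close>
  have bb: "- K\<^sup>2 \<le> J y" for y
  proof -
    have "f y \<le> norm y * K" using K[of y] by simp
    moreover have "0 \<le> (norm y - K)\<^sup>2" by simp
    ultimately show ?thesis unfolding J_def by (simp add: power2_diff)
  qed
  define m where "m = (INF y. J y)"
  have bd: "bdd_below (range J)" using bb by (auto simp: bdd_below_def)
  have m: "m \<le> J y" for y unfolding m_def using bd by (intro cINF_lower) auto
  have "\<exists>y. J y < m + inverse (real (Suc n))" for n
  proof (rule ccontr)
    assume "\<not> ?thesis"
    hence "m + inverse (real (Suc n)) \<le> m"
      unfolding m_def by (intro cINF_greatest) (auto simp: not_less)
    thus False by simp
  qed
  then obtain y where y: "\<And>n. J (y n) < m + inverse (real (Suc n))" by metis
  \<comment> \<open>\<open>y j\<close> and \<open>y k\<close> are nearly optimal and their midpoint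
    does not go below the infimum, so the parallelogram law forces them to be close.\<close>
  have dist: "(norm (y j - y k))\<^sup>2 \<le> 2 * inverse (real (Suc j)) + 2 * inverse (real (Suc k))" for j k
  proof -
    have "J ((1/2) *\<^sub>R (y j + y k)) = (norm (y j + y k))\<^sup>2 / 4 - (f (y j) + f (y k))"
      unfolding J_def scaleR add by (simp add: power_divide add_divide_distrib)
    hence 1: "(norm (y j + y k))\<^sup>2 \<ge> 4 * (m + (f (y j) + f (y k)))"
      using m[of "(1/2) *\<^sub>R (y j + y k)"] by simp
    have "(norm (y j))\<^sup>2 - 2 * f (y j) + ((norm (y k))\<^sup>2 - 2 * f (y k))
        \<le> m + inverse (real (Suc j)) + (m + inverse (real (Suc k)))"
      using add_mono[OF less_imp_le[OF y[of j]] less_imp_le[OF y[of k]]] unfolding J_def .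
    thus ?thesis using parallelogram_law[of "y j" "y k"] 1 by (simp add: algebra_simps)
  qed
  have "Cauchy y"
  proof (rule CauchyI)
    fix e :: real assume "e > 0"
    hence "e\<^sup>2 / 4 > 0" by simp
    then obtain N where N: "inverse (real (Suc N)) < e\<^sup>2 / 4" using reals_Archimedean by blast
    have "norm (y j - y k) < e" if "j \<ge> N" "k \<ge> N" for j k
    proof -
      have "inverse (real (Suc j)) \<le> inverse (real (Suc N))" "inverse (real (Suc k)) \<le> inverse (real (Suc N))"
        using that by simp_all
      hence "(norm (y j - y k))\<^sup>2 < e\<^sup>2" using dist[of j k] N by linarith
      thus ?thesis using \<open>e > 0\<close> by (simp add: power2_less_imp_less)
    qed
    thus "\<exists>M. \<forall>j\<ge>M. \<forall>k\<ge>M. norm (y j - y k) < e" by blast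
  qed
  then obtain z where z: "y \<longlonglongrightarrow> z" using Cauchy_convergent convergent_def by blast
  have "(\<lambda>n. J (y n)) \<longlonglongrightarrow> J z"
    unfolding J_def by (intro tendsto_intros z tendsto[OF z])
  moreover have "(\<lambda>n. m + inverse (real (Suc n))) \<longlonglongrightarrow> m + 0"
    by (intro tendsto_intros LIMSEQ_inverse_real_of_nat)
  ultimately have "J z \<le> m + 0" by (rule LIMSEQ_le) (use y less_imp_le in blast)
  hence Jz: "J z \<le> J x" for x using m[of x] by linarith
  have "Re (cinner z x) = f x" for x
  proof -
    define d where "d = Re (cinner z x) - f x"
    define n where "n = (norm x)\<^sup>2"
    have n: "0 \<le> n" by (simp add: n_def)
    \<comment> \<open>A step against the defect \<open>d\<close>. The optimum would be
      \<open>- d / n\<close>; dividing by \<open>n + 1\<close> also covers \<open>x = 0\<close>, and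
      minimality still yields \<open>d^2 * (n + 2) <= 0\<close>.\<close>
    define s where "s = - d / (n + 1)"
    have "J (z + s *\<^sub>R x) = J z + s\<^sup>2 * n + 2 * s * d"
      unfolding J_def norm_add_power2 add scaleR n_def d_def
      by (simp add: cinner_scaleR_right power_mult_distrib algebra_simps)
    hence "0 \<le> s\<^sup>2 * n + 2 * s * d" using Jz[of "z + s *\<^sub>R x"] by linarith
    hence "0 \<le> (s\<^sup>2 * n + 2 * s * d) * (n + 1)\<^sup>2" by simp
    also have "(s\<^sup>2 * n + 2 * s * d) * (n + 1)\<^sup>2 =
        (s * (n + 1))\<^sup>2 * n + 2 * (s * (n + 1)) * d * (n + 1)"
      by (simp add: power2_eq_square algebra_simps)
    also have "s * (n + 1) = - d" using n by (simp add: s_def)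
    finally have "d\<^sup>2 * (n + 2) \<le> 0" by (simp add: power2_eq_square algebra_simps)
    hence "d = 0" using n by (simp add: mult_le_0_iff)
    thus ?thesis by (simp add: d_def)
  qed
  thus ?thesis by blast
qed

lemma cinner_eqI:
  assumes "\<And>y. cinner x y = cinner x' (y :: 'h::chilbert_space)"
  shows "x = x'"
proof -
  have "cinner (x - x') (x - x') = 0" using assms by (simp add: cinner_diff_left)
  thus ?thesis by (simp add: cinner_self)
qed

section \<open>The C*-algebra of bounded operators\<close>

definition bop :: "('h::chilbert_space \<Rightarrow> 'h) \<Rightarrow> bool" where
  "bop T \<longleftrightarrow> bounded_linear T \<and> (\<forall>c x. T (c *\<^sub>C x) = c *\<^sub>C T x)"

lemma bounded_ops_simps [simp]:
  "carrier bounded_ops = {T. bop T}" "mult bounded_ops = (\<circ>)" "one bounded_ops = id"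
  "zero bounded_ops = (\<lambda>x. 0)" "add bounded_ops = (\<lambda>S T x. S x + T x)"
  "cscale bounded_ops = (\<lambda>c T x. c *\<^sub>C T x)" "cnorm bounded_ops = onorm"
  by (simp_all add: bounded_ops_def bop_def)

lemma bopD:
  assumes "bop T"
  shows "bounded_linear T" "T (c *\<^sub>C x) = c *\<^sub>C T x" "T (x + y) = T x + T y" "T 0 = 0"
  using assms linear_add[OF bounded_linear.linear] linear_0[OF bounded_linear.linear]
  by (auto simp: bop_def)

lemma bopI:
  assumes "\<And>x y. T (x + y) = T x + T y" "\<And>c x. T (c *\<^sub>C x) = c *\<^sub>C T x" "\<And>x. norm (T x) \<le> norm x * K"
  shows "bop T"
  unfolding bop_def using assms
  by (auto intro!: bounded_linear_intro[of T K] simp: scaleC_of_real[symmetric])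

lemma bop_norm: "bop T \<Longrightarrow> norm (T x) \<le> onorm T * norm x"
  by (rule onorm[OF bopD(1)])

lemma bop_compose: "bop S \<Longrightarrow> bop T \<Longrightarrow> bop (S \<circ> T)"
  unfolding bop_def by (auto intro: bounded_linear_compose simp: comp_def)

lemma bop_id: "bop id"
  unfolding bop_def id_def by (auto intro: bounded_linear_ident)

lemma bop_zero: "bop (\<lambda>x. 0)"
  unfolding bop_def by simp

lemma bop_add: "bop S \<Longrightarrow> bop T \<Longrightarrow> bop (\<lambda>x. S x + T x)"
  unfolding bop_def by (auto intro: bounded_linear_add simp: scaleC_add_right)

lemma bop_scaleC: "bop T \<Longrightarrow> bop (\<lambda>x. c *\<^sub>C T x)"
  unfolding bop_def
  by (auto intro: bounded_linear_compose[OF bounded_linear_scaleC] simp: scaleC_scaleC mult.commute)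

text \<open>Riesz representation is applied to the real part of the functional. Its imaginary part
  is, up to sign, the real part at the argument multiplied by the imaginary unit, so the same vector
  represents the complex functional.\<close>

lemma adjoint_exists:
  assumes T: "bop T"
  obtains T' where "bop T'" "\<And>x y. cinner (T' x) y = cinner x (T y)"
proof -
  have "\<exists>z. \<forall>y. cinner z y = cinner x (T y)" for x
  proof -
    have "bounded_linear (\<lambda>y. Re (cinner x (T y)))"
      by (rule bounded_linear_compose[OF bounded_linear_Re
            bounded_linear_compose[OF bounded_linear_cinner_right bopD(1)[OF T]]])
    from Riesz_representation[OF this] obtain z where
      z: "\<And>y. Re (cinner z y) = Re (cinner x (T y))" by blast
    have "cinner z y = cinner x (T y)" for y
    proof (rule complex_eqI)
      show "Re (cinner z y) = Re (cinner x (T y))" by (rule z)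
      show "Im (cinner z y) = Im (cinner x (T y))"
        using z[of "\<i> *\<^sub>C y"] by (simp add: bopD(2)[OF T] cinner_scaleC_right)
    qed
    thus ?thesis by blast
  qed
  then obtain T' where T': "\<And>x y. cinner (T' x) y = cinner x (T y)" by metis
  have "bop T'"
  proof (rule bopI)
    show "T' (x + y) = T' x + T' y" for x y
      by (rule cinner_eqI) (simp add: T' cinner_add_left)
    show "T' (c *\<^sub>C x) = c *\<^sub>C T' x" for c x
      by (rule cinner_eqI) (simp add: T' cinner_scaleC_left)
    show "norm (T' x) \<le> norm x * onorm T" for x
    proof (cases "T' x = 0")
      case True
      thus ?thesis using onorm_pos_le[OF bopD(1)[OF T]] by simp
    next
      case False
      \<comment> \<open>Cauchy-Schwarz at \<open>y = T' x\<close>, after which one factor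
        cancels.\<close>
      have "(norm (T' x))\<^sup>2 = cmod (cinner (T' x) (T' x))" by (simp add: cinner_self norm_power)
      also have "\<dots> \<le> norm x * norm (T (T' x))" unfolding T' by (rule cinner_Cauchy_Schwarz)
      also have "\<dots> \<le> norm x * (onorm T * norm (T' x))" by (intro mult_left_mono bop_norm T) simp
      finally have "norm (T' x) * norm (T' x) \<le> (norm x * onorm T) * norm (T' x)"
        by (simp add: power2_eq_square mult.assoc)
      thus ?thesis using False by simp
    qed
  qed
  thus ?thesis using T' by (rule that)
qed

lemma star_bounded_ops:
  assumes "\<And>x y. cinner (T' x) y = cinner x (T y)"
  shows "star bounded_ops T = T'"
proof -
  have "(THE T'. \<forall>x y. cinner (T' x) y = cinner x (T y)) = T'"
  proof (rule the_equality)
    fix S assume "\<forall>x y. cinner (S x) y = cinner x (T y)"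
    thus "S = T'" using assms by (intro ext cinner_eqI) simp
  qed (use assms in blast)
  thus ?thesis by (simp add: bounded_ops_def)
qed

lemma adjoint:
  assumes T: "bop T"
  shows "bop (star bounded_ops T)" "cinner (star bounded_ops T x) y = cinner x (T y)"
    "cinner x (star bounded_ops T y) = cinner (T x) y"
proof -
  obtain T' where T': "bop T'" "\<And>x y. cinner (T' x) y = cinner x (T y)"
    using adjoint_exists[OF T] by blast
  note e = star_bounded_ops[OF T'(2)]
  show "bop (star bounded_ops T)" "cinner (star bounded_ops T x) y = cinner x (T y)"
    using T' by (simp_all add: e)
  have "cinner x (T' y) = cnj (cinner (T' y) x)" by (rule cinner_commute)
  also have "\<dots> = cinner (T x) y" unfolding T'(2) by (rule cinner_commute[symmetric])
  finally show "cinner x (star bounded_ops T y) = cinner (T x) y" by (simp add: e)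
qed

lemma bounded_ops_star_algebra: "star_algebra (bounded_ops :: ('h::chilbert_space \<Rightarrow> 'h) cstar_alg)"
proof -
  note [simp] = bop_compose bop_id bop_zero bop_add bop_scaleC adjoint(1)
  have "ring (bounded_ops :: ('h \<Rightarrow> 'h) cstar_alg)"
  proof (rule ringI)
    show "abelian_group (bounded_ops :: ('h \<Rightarrow> 'h) cstar_alg)"
    proof (rule abelian_groupI)
      fix T :: "'h \<Rightarrow> 'h" assume "T \<in> carrier bounded_ops"
      thus "\<exists>S\<in>carrier bounded_ops. S \<oplus>\<^bsub>bounded_ops\<^esub> T = \<zero>\<^bsub>bounded_ops\<^esub>"
        by (intro bexI[of _ "\<lambda>x. (-1) *\<^sub>C T x"]) (simp_all add: scaleC_minus_one, simp add: bop_scaleC flip: scaleC_minus_one)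
    qed (simp_all add: algebra_simps)
    show "monoid (bounded_ops :: ('h \<Rightarrow> 'h) cstar_alg)"
      by (rule monoidI) (simp_all add: o_assoc)
  qed (auto simp: fun_eq_iff bopD)
  thus ?thesis
  proof (rule star_algebra.intro, intro star_algebra_axioms.intro)
    fix S T :: "'h \<Rightarrow> 'h" and c d :: complex
    assume "S \<in> carrier bounded_ops" hence S: "bop S" by simp
    show "cscale bounded_ops c S \<in> carrier bounded_ops" "star bounded_ops S \<in> carrier bounded_ops"
      using S by simp_all
    show "cscale bounded_ops (c + d) S = cscale bounded_ops c S \<oplus>\<^bsub>bounded_ops\<^esub> cscale bounded_ops d S"
      "cscale bounded_ops c (cscale bounded_ops d S) = cscale bounded_ops (c * d) S"
      "cscale bounded_ops 1 S = S"
      by (simp_all add: scaleC_add_left scaleC_scaleC)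
    show "star bounded_ops (star bounded_ops S) = S"
      by (rule star_bounded_ops) (simp add: adjoint(3)[OF S])
    show "star bounded_ops (cscale bounded_ops c S) = cscale bounded_ops (cnj c) (star bounded_ops S)"
      by (rule star_bounded_ops) (simp add: cinner_scaleC_left cinner_scaleC_right adjoint(2)[OF S])
    assume "T \<in> carrier bounded_ops" hence T: "bop T" by simp
    show "cscale bounded_ops c (S \<oplus>\<^bsub>bounded_ops\<^esub> T) =
        cscale bounded_ops c S \<oplus>\<^bsub>bounded_ops\<^esub> cscale bounded_ops c T"
      "cscale bounded_ops c S \<otimes>\<^bsub>bounded_ops\<^esub> T = cscale bounded_ops c (S \<otimes>\<^bsub>bounded_ops\<^esub> T)"
      "S \<otimes>\<^bsub>bounded_ops\<^esub> cscale bounded_ops c T = cscale bounded_ops c (S \<otimes>\<^bsub>bounded_ops\<^esub> T)"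
      by (simp_all add: scaleC_add_right fun_eq_iff bopD(2)[OF S])
    show "star bounded_ops (S \<oplus>\<^bsub>bounded_ops\<^esub> T) =
        star bounded_ops S \<oplus>\<^bsub>bounded_ops\<^esub> star bounded_ops T"
      by (rule star_bounded_ops)
         (simp add: cinner_add_left cinner_add_right adjoint(2)[OF S] adjoint(2)[OF T])
    show "star bounded_ops (S \<otimes>\<^bsub>bounded_ops\<^esub> T) =
        star bounded_ops T \<otimes>\<^bsub>bounded_ops\<^esub> star bounded_ops S"
      by (rule star_bounded_ops) (simp add: adjoint(2)[OF S] adjoint(2)[OF T])
  qed
qed

lemma bounded_ops_minus:
  assumes "bop S" "bop T"
  shows "S \<ominus>\<^bsub>bounded_ops\<^esub> T = (\<lambda>x. S x - T x)"
proof -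
  interpret star_algebra "bounded_ops :: ('a \<Rightarrow> 'a) cstar_alg" by (rule bounded_ops_star_algebra)
  have e: "(S \<ominus>\<^bsub>bounded_ops\<^esub> T) \<oplus>\<^bsub>bounded_ops\<^esub> T = S" using assms by (intro minus_add_cancel) simp_all
  have "(S \<ominus>\<^bsub>bounded_ops\<^esub> T) x + T x = S x" for x using fun_cong[OF e, of x] by simp
  thus ?thesis by (simp add: fun_eq_iff eq_diff_eq)
qed

lemma bop_onorm_le: "bop T \<Longrightarrow> (\<And>x. norm (T x) \<le> K * norm x) \<Longrightarrow> 0 \<le> K \<Longrightarrow> onorm T \<le> K"
  by (rule onorm_bound)

lemma onorm_adjoint_le:
  assumes T: "bop T"
  shows "onorm (star bounded_ops T) \<le> onorm T"
proof (rule bop_onorm_le[OF adjoint(1)[OF T] _ onorm_pos_le[OF bopD(1)[OF T]]])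
  fix x
  let ?T' = "star bounded_ops T"
  show "norm (?T' x) \<le> onorm T * norm x"
  proof (cases "?T' x = 0")
    case True
    thus ?thesis using onorm_pos_le[OF bopD(1)[OF T]] by simp
  next
    case False
    have "(norm (?T' x))\<^sup>2 = cmod (cinner (?T' x) (?T' x))" by (simp add: cinner_self norm_power)
    also have "\<dots> \<le> norm x * norm (T (?T' x))" unfolding adjoint(2)[OF T] by (rule cinner_Cauchy_Schwarz)
    also have "\<dots> \<le> norm x * (onorm T * norm (?T' x))" by (intro mult_left_mono bop_norm T) simp
    finally have "norm (?T' x) * norm (?T' x) \<le> (onorm T * norm x) * norm (?T' x)"
      by (simp add: power2_eq_square mult_ac)
    thus ?thesis using False by simp
  qed
qed

lemma bounded_ops_seminorm: "cstar_seminorm (bounded_ops :: ('h::chilbert_space \<Rightarrow> 'h) cstar_alg) onorm"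
  unfolding cstar_seminorm_def
proof (intro conjI ballI allI)
  fix S T :: "'h \<Rightarrow> 'h" and c :: complex
  assume "S \<in> carrier bounded_ops" hence S: "bop S" by simp
  show n0: "0 \<le> onorm S" by (rule onorm_pos_le[OF bopD(1)[OF S]])
  have le: "onorm (\<lambda>x. c *\<^sub>C R x) \<le> cmod c * onorm R" if R: "bop R" for R :: "'h \<Rightarrow> 'h" and c
    by (rule bop_onorm_le[OF bop_scaleC[OF R]])
       (simp_all add: norm_scaleC mult_left_mono bop_norm[OF R] mult.assoc onorm_pos_le[OF bopD(1)[OF R]])
  show "onorm (cscale bounded_ops c S) = cmod c * onorm S"
  proof (cases "c = 0")
    case True
    thus ?thesis by (simp add: onorm_zero)
  next
    case False
    have "onorm (\<lambda>x. (1 / c) *\<^sub>C (c *\<^sub>C S x)) \<le> cmod (1 / c) * onorm (\<lambda>x. c *\<^sub>C S x)"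
      by (rule le[OF bop_scaleC[OF S]])
    hence "onorm S \<le> onorm (\<lambda>x. c *\<^sub>C S x) / cmod c"
      using False by (simp add: scaleC_scaleC norm_divide)
    hence "cmod c * onorm S \<le> onorm (\<lambda>x. c *\<^sub>C S x)" using False by (simp add: field_simps)
    thus ?thesis using le[OF S, of c] by simp
  qed
  show "onorm (star bounded_ops S \<otimes>\<^bsub>bounded_ops\<^esub> S) = (onorm S)\<^sup>2"
  proof (rule antisym)
    have "onorm (star bounded_ops S \<circ> S) \<le> onorm (star bounded_ops S) * onorm S"
      by (rule onorm_compose[OF bopD(1)[OF adjoint(1)[OF S]] bopD(1)[OF S]])
    also have "\<dots> \<le> onorm S * onorm S" by (rule mult_right_mono[OF onorm_adjoint_le[OF S] n0])
    finally show "onorm (star bounded_ops S \<otimes>\<^bsub>bounded_ops\<^esub> S) \<le> (onorm S)\<^sup>2"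
      by (simp add: power2_eq_square)
    let ?R = "star bounded_ops S \<circ> S"
    have R: "bop ?R" by (rule bop_compose[OF adjoint(1)[OF S] S])
    \<comment> \<open>The other half of the C*-identity: the squared norm of \<open>S x\<close> is
      the inner product of \<open>?R x\<close> with \<open>x\<close>.\<close>
    have "onorm S \<le> sqrt (onorm ?R)"
    proof (rule bop_onorm_le[OF S])
      fix x
      have "(norm (S x))\<^sup>2 = cmod (cinner (S x) (S x))" by (simp add: cinner_self norm_power)
      also have "\<dots> = cmod (cinner (?R x) x)" using adjoint(2)[OF S, of "S x" x] by simp
      also have "\<dots> \<le> norm (?R x) * norm x" by (rule cinner_Cauchy_Schwarz)
      also have "\<dots> \<le> onorm ?R * norm x * norm x" by (intro mult_right_mono bop_norm R) simp
      also have "\<dots> = (sqrt (onorm ?R) * norm x)\<^sup>2"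
        using onorm_pos_le[OF bopD(1)[OF R]] by (simp add: power_mult_distrib power2_eq_square)
      finally show "norm (S x) \<le> sqrt (onorm ?R) * norm x"
        by (rule power2_le_imp_le) (use onorm_pos_le[OF bopD(1)[OF R]] in simp)
    qed (use onorm_pos_le[OF bopD(1)[OF R]] in simp)
    hence "(onorm S)\<^sup>2 \<le> (sqrt (onorm ?R))\<^sup>2" using n0 by (rule power_mono)
    thus "(onorm S)\<^sup>2 \<le> onorm (star bounded_ops S \<otimes>\<^bsub>bounded_ops\<^esub> S)"
      using onorm_pos_le[OF bopD(1)[OF R]] by simp
  qed
  assume "T \<in> carrier bounded_ops" hence T: "bop T" by simp
  show "onorm (S \<oplus>\<^bsub>bounded_ops\<^esub> T) \<le> onorm S + onorm T"
    using onorm_triangle[OF bopD(1)[OF S] bopD(1)[OF T]] by simp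
  show "onorm (S \<otimes>\<^bsub>bounded_ops\<^esub> T) \<le> onorm S * onorm T"
    using onorm_compose[OF bopD(1)[OF S] bopD(1)[OF T]] by simp
qed

text \<open>Completeness is taken from the Banach space of bounded real-linear maps, whose norm is
  also \<open>onorm\<close>; complex homogeneity survives because the limit is a pointwise one as
  well.\<close>

lemma bounded_ops_cstar_algebra: "cstar_algebra (bounded_ops :: ('h::chilbert_space \<Rightarrow> 'h) cstar_alg)"
proof (rule cstar_algebra.intro[OF bounded_ops_star_algebra], rule cstar_algebra_axioms.intro)
  show "cstar_seminorm (bounded_ops :: ('h \<Rightarrow> 'h) cstar_alg) (cnorm bounded_ops)"
    using bounded_ops_seminorm by simp
  fix T :: "'h \<Rightarrow> 'h" assume "T \<in> carrier bounded_ops" "cnorm bounded_ops T = 0"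
  hence T: "bop T" "onorm T = 0" by simp_all
  show "T = \<zero>\<^bsub>bounded_ops\<^esub>" using onorm_eq_0[OF bopD(1)[OF T(1)]] T(2) by (simp add: fun_eq_iff)
next
  fix f :: "nat \<Rightarrow> 'h \<Rightarrow> 'h" assume f: "f \<in> cauchy_seqs bounded_ops (cnorm bounded_ops)"
  have fb: "bop (f k)" for k using f by (simp add: cauchy_seqs_def)
  note ap = bounded_linear_Blinfun_apply[OF bopD(1)[OF fb]]
  have nm: "norm (Blinfun (f j) - Blinfun (f k)) = onorm (f j \<ominus>\<^bsub>bounded_ops\<^esub> f k)" for j k
    unfolding norm_blinfun.rep_eq bounded_ops_minus[OF fb fb]
    by (rule arg_cong[where f = onorm]) (simp add: fun_eq_iff blinfun.diff_left ap)
  have "Cauchy (\<lambda>k. Blinfun (f k))"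
    using f by (intro CauchyI) (simp add: cauchy_seqs_def nm)
  then obtain L where L: "(\<lambda>k. Blinfun (f k)) \<longlonglongrightarrow> L" using Cauchy_convergent convergent_def by blast
  have pt: "(\<lambda>k. f k x) \<longlonglongrightarrow> blinfun_apply L x" for x
    using bounded_linear.tendsto[OF blinfun.bounded_linear_left L, of x] by (simp add: ap)
  have "bop (blinfun_apply L)"
    unfolding bop_def
  proof (intro conjI allI)
    show "bounded_linear (blinfun_apply L)" by (rule blinfun.bounded_linear_right)
    fix c x
    have "(\<lambda>k. c *\<^sub>C f k x) \<longlonglongrightarrow> c *\<^sub>C blinfun_apply L x"
      by (rule bounded_linear.tendsto[OF bounded_linear_scaleC pt])
    thus "blinfun_apply L (c *\<^sub>C x) = c *\<^sub>C blinfun_apply L x"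
      using pt[of "c *\<^sub>C x"] by (simp add: bopD(2)[OF fb] LIMSEQ_unique)
  qed
  moreover from this have "(\<lambda>k. onorm (f k \<ominus>\<^bsub>bounded_ops\<^esub> blinfun_apply L)) \<longlonglongrightarrow> 0"
  proof -
    assume LB: "bop (blinfun_apply L)"
    have "norm (Blinfun (f k) - L) = onorm (f k \<ominus>\<^bsub>bounded_ops\<^esub> blinfun_apply L)" for k
      unfolding norm_blinfun.rep_eq bounded_ops_minus[OF fb LB]
      by (rule arg_cong[where f = onorm]) (simp add: fun_eq_iff blinfun.diff_left ap)
    thus ?thesis using tendsto_norm_zero[OF LIM_zero[OF L]] by simp
  qed
  ultimately show "\<exists>T\<in>carrier bounded_ops. (\<lambda>k. cnorm bounded_ops (f k \<ominus>\<^bsub>bounded_ops\<^esub> T)) \<longlonglongrightarrow> 0"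
    by (intro bexI[of _ "blinfun_apply L"]) simp_all
qed

section \<open>Amplification of operators to a Hilbert tensor product\<close>

text \<open>The list is a chosen representation of a finite sum of simple tensors. Independence of S
  tensor 1 from this choice comes only with the norm bound, so the vector (\<open>S = id\<close>)
  and its image are both read off the list.\<close>

definition tensor_sum ::
    "('h \<Rightarrow> 'k \<Rightarrow> 'l::real_vector) \<Rightarrow> ('h \<Rightarrow> 'h) \<Rightarrow> ('h \<times> 'k) list \<Rightarrow> 'l" where
  "tensor_sum t S xs = (\<Sum>(x, y)\<leftarrow>xs. t (S x) y)"

lemma tensor_sum_simps [simp]:
  "tensor_sum t S [] = 0" "tensor_sum t S ((x, y) # xs) = t (S x) y + tensor_sum t S xs"
  "tensor_sum t S (xs @ ys) = tensor_sum t S xs + tensor_sum t S ys"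
  by (simp_all add: tensor_sum_def)

lemma hilbert_tensorD:
  assumes "hilbert_tensor t"
  shows "t (x + x') y = t x y + t x' y" "t x (y + y') = t x y + t x y'"
    "t (c *\<^sub>C x) y = c *\<^sub>C t x y" "t x (c *\<^sub>C y) = c *\<^sub>C t x y"
    "cinner (t x y) (t x' y') = cinner x x' * cinner y y'"
    "closure (span (\<Union>x. range (t x))) = UNIV"
  using assms by (simp_all add: hilbert_tensor_def)

text \<open>With the factors exchanged, the construction of S tensor 1 also yields 1 tensor
  T.\<close>

lemma hilbert_tensor_flip:
  assumes "hilbert_tensor t"
  shows "hilbert_tensor (\<lambda>y x. t x y)"
proof -
  have "(\<Union>y. range (\<lambda>x. t x y)) = (\<Union>x. range (t x))" by auto
  thus ?thesis using hilbert_tensorD[OF assms] by (simp add: hilbert_tensor_def mult.commute)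
qed

text \<open>The set where two bounded linear maps agree is a closed subspace, and simple tensors
  have dense span.\<close>

lemma hilbert_tensor_eqI:
  fixes t :: "'h::chilbert_space \<Rightarrow> 'k::chilbert_space \<Rightarrow> 'l::chilbert_space"
    and f g :: "'l \<Rightarrow> 'z::real_normed_vector"
  assumes t: "hilbert_tensor t" and f: "bounded_linear f" and g: "bounded_linear g"
    and eq: "\<And>x y. f (t x y) = g (t x y)"
  shows "f z = g z"
proof -
  have "subspace {z. f z = g z}"
    using linear_add[OF bounded_linear.linear[OF f]] linear_add[OF bounded_linear.linear[OF g]]
      linear_scale[OF bounded_linear.linear[OF f]] linear_scale[OF bounded_linear.linear[OF g]]
      linear_0[OF bounded_linear.linear[OF f]] linear_0[OF bounded_linear.linear[OF g]]
    by (simp add: subspace_def)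
  hence "span (\<Union>x. range (t x)) \<subseteq> {z. f z = g z}"
    by (intro span_minimal) (auto simp: eq)
  moreover have "closed {z. f z = g z}"
    using linear_continuous_on[OF f] linear_continuous_on[OF g] by (intro closed_Collect_eq)
  ultimately have "closure (span (\<Union>x. range (t x))) \<subseteq> {z. f z = g z}" by (rule closure_minimal)
  thus ?thesis unfolding hilbert_tensorD(6)[OF t] by blast
qed

lemma bop_tensor_eqI:
  assumes t: "hilbert_tensor t" and X: "bop X" and Y: "bop Y"
    and eq: "\<And>x y. X (t x y) = Y (t x y)"
  shows "X = Y"
  by (rule ext, rule hilbert_tensor_eqI[OF t bopD(1)[OF X] bopD(1)[OF Y] eq])

text \<open>If \<open>R\<^sup>*R = 1 - S\<^sup>*S\<close>, then the squared norm of \<open>(S \<otimes> 1) \<xi>\<close> is that of \<open>\<xi>\<close> minus that of \<open>(R \<otimes> 1) \<xi>\<close>.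
  So \<open>S \<otimes> 1\<close> is contractive whenever \<open>norm S < 1\<close>.\<close>

lemma tensor_sum_bounded:
  fixes t :: "'h::chilbert_space \<Rightarrow> 'k::chilbert_space \<Rightarrow> 'l::chilbert_space"
  assumes t: "hilbert_tensor t" and S: "bop S"
  shows "\<exists>K. \<forall>xs. norm (tensor_sum t S xs) \<le> K * norm (tensor_sum t id xs)"
proof -
  interpret B: cstar "bounded_ops :: ('h \<Rightarrow> 'h) cstar_alg"
    using bounded_ops_cstar_algebra by (simp add: cstar_def)
  note T = hilbert_tensorD[OF t]
  have contr: "norm (tensor_sum t S xs) \<le> norm (tensor_sum t id xs)" if S: "bop S" "onorm S < 1" for S xs
  proof -
    let ?c = "star bounded_ops S \<circ> S"
    have c: "bop ?c" by (rule bop_compose[OF adjoint(1)[OF S(1)] S(1)])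
    have c': "?c \<in> carrier bounded_ops" using c by simp
    have cs: "star bounded_ops ?c = ?c"
      by (rule star_bounded_ops) (simp add: adjoint[OF S(1)])
    have "onorm ?c = (onorm S)\<^sup>2" using B.q_star_mult[of S] S(1) by simp
    also have "\<dots> < 1\<^sup>2" using S onorm_pos_le[OF bopD(1)[OF S(1)]] by (intro power_strict_mono) simp_all
    finally have cn: "cnorm bounded_ops ?c < 1" by simp
    \<comment> \<open>A self-adjoint square root of \<open>\<one> \<ominus> ?c\<close>; the strict
      bound on the norm of \<open>S\<close> is what makes it available.\<close>
    have "\<exists>R\<in>carrier bounded_ops. star bounded_ops R = R \<and>
        R \<otimes>\<^bsub>bounded_ops\<^esub> R = \<one>\<^bsub>bounded_ops\<^esub> \<ominus>\<^bsub>bounded_ops\<^esub> ?c"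
      by (rule B.sqrt_one_minus[OF c' cs cn]) (rule bexI, rule conjI)
    then obtain R where R: "R \<in> carrier bounded_ops" "star bounded_ops R = R"
      "R \<otimes>\<^bsub>bounded_ops\<^esub> R = \<one>\<^bsub>bounded_ops\<^esub> \<ominus>\<^bsub>bounded_ops\<^esub> ?c"
      by (elim bexE conjE)
    have Rb: "bop R" using R(1) by simp
    have RR: "R (R x) = x - star bounded_ops S (S x)" for x
      using fun_cong[OF R(3), of x] bounded_ops_minus[OF bop_id c] by simp
    have Rc: "cinner (R x) (R y) = cinner x y - cinner (S x) (S y)" for x y
    proof -
      have "cinner (R x) (R y) = cinner x (R (R y))" using adjoint(2)[OF Rb, of x "R y"] R(2) by simp
      also have "\<dots> = cinner x y - cinner x (star bounded_ops S (S y))" by (simp add: RR cinner_diff_right)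
      finally show ?thesis by (simp add: adjoint(3)[OF S(1)])
    qed
    \<comment> \<open>The identity is polarised to two lists so that each can be inducted on
      separately; the statement about norms is the case of equal lists.\<close>
    have e: "cinner (t (R x) y) (tensor_sum t R ys) =
        cinner (t (id x) y) (tensor_sum t id ys) - cinner (t (S x) y) (tensor_sum t S ys)" for x y ys
    proof (induction ys)
      case (Cons p ys)
      thus ?case by (cases p) (simp add: cinner_add_right T(5) Rc algebra_simps)
    qed simp
    have "cinner (tensor_sum t R xs) (tensor_sum t R ys) =
        cinner (tensor_sum t id xs) (tensor_sum t id ys) - cinner (tensor_sum t S xs) (tensor_sum t S ys)" for ys
    proof (induction xs)
      case (Cons p xs)
      show ?case
        by (cases p) (simp only: tensor_sum_simps cinner_add_left e Cons.IH
            diff_conv_add_uminus minus_add_distrib add_ac)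
    qed simp
    from this[of xs] have "Re (cinner (tensor_sum t R xs) (tensor_sum t R xs)) =
        Re (cinner (tensor_sum t id xs) (tensor_sum t id xs)) - Re (cinner (tensor_sum t S xs) (tensor_sum t S xs))"
      by simp
    hence "(norm (tensor_sum t S xs))\<^sup>2 \<le> (norm (tensor_sum t id xs))\<^sup>2"
      unfolding norm_power2_cinner[symmetric] using zero_le_power2[of "norm (tensor_sum t R xs)"] by linarith
    thus ?thesis by (rule power2_le_imp_le) simp
  qed
  \<comment> \<open>Adding 1 makes the rescaled operator strictly contractive and keeps
    \<open>r\<close> positive when \<open>S\<close> is zero.\<close>
  define r where "r = onorm S + 1"
  have r: "r > 0" "onorm S < r" using onorm_pos_le[OF bopD(1)[OF S]] by (simp_all add: r_def)
  define S' where "S' x = complex_of_real (1 / r) *\<^sub>C S x" for x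
  have S': "bop S'" unfolding S'_def[abs_def] by (rule bop_scaleC[OF S])
  have "onorm S' = onorm S / r"
    using B.q_cscale[of S "complex_of_real (1 / r)"] S r by (simp add: S'_def[abs_def] norm_divide)
  hence S'1: "onorm S' < 1" using r by simp
  have "tensor_sum t S' xs = (1 / r) *\<^sub>R tensor_sum t S xs" for xs
  proof (induction xs)
    case (Cons p xs)
    thus ?case by (cases p) (simp add: S'_def T(3) scaleC_add_right flip: scaleC_of_real)
  qed simp
  hence "norm (tensor_sum t S xs) \<le> r * norm (tensor_sum t id xs)" for xs
    using contr[OF S' S'1, of xs] r by (simp add: divide_le_eq mult.commute)
  thus ?thesis by blast
qed

lemma tensor_sum_scaleC:
  assumes "hilbert_tensor t" "bop S"
  shows "c *\<^sub>C tensor_sum t S xs = tensor_sum t S (map (\<lambda>(x, y). (c *\<^sub>C x, y)) xs)"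
proof (induction xs)
  case (Cons p xs)
  thus ?case
    by (cases p) (simp add: scaleC_add_right bopD(2)[OF assms(2)] hilbert_tensorD(3)[OF assms(1)])
qed simp

text \<open>The closure of the graph of \<open>S \<otimes> 1\<close> on finite sums of simple tensors is the graph of a
  bounded operator.\<close>

lemma amplification_exists:
  fixes t :: "'h::chilbert_space \<Rightarrow> 'k::chilbert_space \<Rightarrow> 'l::chilbert_space"
  assumes t: "hilbert_tensor t" and S: "bop S"
  shows "\<exists>X. bop X \<and> (\<forall>x y. X (t x y) = t (S x) y)"
proof -
  note T = hilbert_tensorD[OF t]
  obtain K where K: "\<And>xs. norm (tensor_sum t S xs) \<le> K * norm (tensor_sum t id xs)"
    using tensor_sum_bounded[OF t S] by blast
  define E where "E = range (\<lambda>xs. (tensor_sum t id xs, tensor_sum t S xs))"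
  have Ei: "(tensor_sum t id xs, tensor_sum t S xs) \<in> E" for xs by (simp add: E_def)
  have Ec: "(c *\<^sub>C a, c *\<^sub>C b) \<in> E" if "(a, b) \<in> E" for a b c
    using that unfolding E_def
    by (auto simp: tensor_sum_scaleC[OF t bop_id] tensor_sum_scaleC[OF t S])
  have Ea: "(a + a', b + b') \<in> E" if ab: "(a, b) \<in> E" "(a', b') \<in> E" for a b a' b'
  proof -
    obtain xs ys where "a = tensor_sum t id xs" "b = tensor_sum t S xs"
      "a' = tensor_sum t id ys" "b' = tensor_sum t S ys" using ab by (auto simp: E_def)
    thus ?thesis using Ei[of "xs @ ys"] by simp
  qed
  have "(0, 0) \<in> E" using Ei[of "[]"] by simp
  hence E: "subspace E"
    using Ea Ec by (auto simp: subspace_def zero_prod_def scaleC_of_real[symmetric])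
  have cE: "subspace (closure E)"
  proof (rule subspaceI)
    show "0 \<in> closure E" using subspace_0[OF E] closure_subset by blast
    fix a b r assume "a \<in> closure E"
    then obtain f where f: "\<And>n. f n \<in> E" "f \<longlonglongrightarrow> a" unfolding closure_sequential by blast
    show "r *\<^sub>R a \<in> closure E"
      unfolding closure_sequential using subspace_scale[OF E f(1)] tendsto_scaleR[OF tendsto_const f(2)]
      by (intro exI[of _ "\<lambda>n. r *\<^sub>R f n"]) simp
    assume "b \<in> closure E"
    then obtain g where g: "\<And>n. g n \<in> E" "g \<longlonglongrightarrow> b" unfolding closure_sequential by blast
    show "a + b \<in> closure E"
      unfolding closure_sequential using subspace_add[OF E f(1) g(1)] tendsto_add[OF f(2) g(2)]
      by (intro exI[of _ "\<lambda>n. f n + g n"]) simp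
  qed
  \<comment> \<open>The norm bound is a closed condition, so it survives in the closure of the
    graph; applied to differences it shows that the closure is single valued.\<close>
  have "closed {p :: 'l \<times> 'l. norm (snd p) \<le> K * norm (fst p)}"
    by (intro closed_Collect_le continuous_intros)
  moreover have "E \<subseteq> {p. norm (snd p) \<le> K * norm (fst p)}" using K by (auto simp: E_def)
  ultimately have "closure E \<subseteq> {p. norm (snd p) \<le> K * norm (fst p)}" by (intro closure_minimal)
  hence bound: "norm b \<le> K * norm a" if "(a, b) \<in> closure E" for a b using that by auto
  have uniq: "b = b'" if "(a, b) \<in> closure E" "(a, b') \<in> closure E" for a b b'
  proof -
    have "(a, b) - (a, b') \<in> closure E" using cE that by (rule subspace_diff)
    thus ?thesis using bound[of 0 "b - b'"] by simp
  qed
  have ex: "\<exists>b. (a, b) \<in> closure E" for a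
  proof -
    \<comment> \<open>The domain of the graph is a subspace containing the simple tensors, hence
      dense. The bound turns an approximating sequence of arguments into a Cauchy sequence of
      values.\<close>
    have "subspace (fst ` E)"
    proof (rule subspaceI)
      show "0 \<in> fst ` E" by (rule image_eqI[OF _ subspace_0[OF E]]) simp
      fix x y r assume "x \<in> fst ` E"
      then obtain p where p: "p \<in> E" "x = fst p" by blast
      show "r *\<^sub>R x \<in> fst ` E" by (rule image_eqI[OF _ subspace_scale[OF E p(1), of r]]) (simp add: p(2))
      assume "y \<in> fst ` E"
      then obtain q where q: "q \<in> E" "y = fst q" by blast
      show "x + y \<in> fst ` E" by (rule image_eqI[OF _ subspace_add[OF E p(1) q(1)]]) (simp add: p(2) q(2))
    qed
    moreover have "(\<Union>x. range (t x)) \<subseteq> fst ` E"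
    proof
      fix z assume "z \<in> (\<Union>x. range (t x))"
      then obtain x y where "z = t x y" by blast
      thus "z \<in> fst ` E" using Ei[of "[(x, y)]"] by force
    qed
    ultimately have "span (\<Union>x. range (t x)) \<subseteq> fst ` E" by (intro span_minimal)
    hence "closure (span (\<Union>x. range (t x))) \<subseteq> closure (fst ` E)" by (rule closure_mono)
    hence "a \<in> closure (fst ` E)" unfolding T(6) by blast
    then obtain s where s: "\<And>n. s n \<in> fst ` E" "s \<longlonglongrightarrow> a" unfolding closure_sequential by blast
    have "\<exists>b. (s n, b) \<in> E" for n using s(1)[of n] by force
    then obtain r where r: "\<And>n. (s n, r n) \<in> E" by metis
    have "Cauchy r"
    proof (rule CauchyI)
      fix e :: real assume e: "e > 0"
      have sC: "Cauchy s" using s(2) by (rule LIMSEQ_imp_Cauchy)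
      \<comment> \<open>Nothing is known about the sign of \<open>K\<close>;
        \<open>\<bar>K\<bar> + 1\<close> is a positive constant above it.\<close>
      have "e / (\<bar>K\<bar> + 1) > 0" using e by simp
      then obtain M where M: "\<And>m n. m \<ge> M \<Longrightarrow> n \<ge> M \<Longrightarrow> norm (s m - s n) < e / (\<bar>K\<bar> + 1)"
        using CauchyD[OF sC] by metis
      have "norm (r m - r n) < e" if mn: "m \<ge> M" "n \<ge> M" for m n
      proof -
        have "(s m, r m) - (s n, r n) \<in> closure E"
          using cE by (rule subspace_diff) (use r closure_subset in blast)+
        hence "norm (r m - r n) \<le> K * norm (s m - s n)" using bound by simp
        also have "\<dots> \<le> (\<bar>K\<bar> + 1) * norm (s m - s n)" by (intro mult_right_mono) simp_all
        also have "\<dots> < (\<bar>K\<bar> + 1) * (e / (\<bar>K\<bar> + 1))" using M[OF mn] by (intro mult_strict_left_mono) simp_all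
        also have "\<dots> = e" by simp
        finally show ?thesis .
      qed
      thus "\<exists>M. \<forall>m\<ge>M. \<forall>n\<ge>M. norm (r m - r n) < e" by blast
    qed
    then obtain b where b: "r \<longlonglongrightarrow> b" using Cauchy_convergent convergent_def by blast
    have "(\<lambda>n. (s n, r n)) \<longlonglongrightarrow> (a, b)" by (rule tendsto_Pair[OF s(2) b])
    hence "(a, b) \<in> closure E" unfolding closure_sequential using r by (intro exI[of _ "\<lambda>n. (s n, r n)"]) simp
    thus ?thesis by blast
  qed
  define X where "X a = (THE b. (a, b) \<in> closure E)" for a
  have XE: "(a, X a) \<in> closure E" for a
    unfolding X_def by (rule theI') (use ex[of a] uniq in blast)
  have XI: "X a = b" if "(a, b) \<in> closure E" for a b by (rule uniq[OF XE that])
  have "bop X"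
  proof (rule bopI)
    fix a b c
    have "(a, X a) + (b, X b) \<in> closure E" by (rule subspace_add[OF cE XE XE])
    thus "X (a + b) = X a + X b" by (intro XI) simp
    obtain p where p: "\<And>n. p n \<in> E" "p \<longlonglongrightarrow> (a, X a)" using XE[of a] unfolding closure_sequential by blast
    have "(\<lambda>n. (c *\<^sub>C fst (p n), c *\<^sub>C snd (p n))) \<longlonglongrightarrow> (c *\<^sub>C a, c *\<^sub>C X a)"
      using tendsto_Pair[OF bounded_linear.tendsto[OF bounded_linear_scaleC tendsto_fst[OF p(2)]]
          bounded_linear.tendsto[OF bounded_linear_scaleC tendsto_snd[OF p(2)]]] by simp
    moreover have "(c *\<^sub>C fst (p n), c *\<^sub>C snd (p n)) \<in> E" for n by (rule Ec) (simp add: p(1))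
    ultimately have "(c *\<^sub>C a, c *\<^sub>C X a) \<in> closure E"
      unfolding closure_sequential by (intro exI[of _ "\<lambda>n. (c *\<^sub>C fst (p n), c *\<^sub>C snd (p n))"]) simp
    thus "X (c *\<^sub>C a) = c *\<^sub>C X a" by (rule XI)
    show "norm (X a) \<le> norm a * K" using bound[OF XE[of a]] by (simp add: mult.commute)
  qed
  moreover have "X (t x y) = t (S x) y" for x y
    using Ei[of "[(x, y)]"] closure_subset[of E] by (intro XI) auto
  ultimately show ?thesis by blast
qed

text \<open>The operator S tensor 1. The choice is unique for bounded \<open>S\<close>, by
  \<open>bop_tensor_eqI\<close>.\<close>

definition amplify ::
    "('h::chilbert_space \<Rightarrow> 'k::chilbert_space \<Rightarrow> 'l::chilbert_space) \<Rightarrow> ('h \<Rightarrow> 'h) \<Rightarrow> 'l \<Rightarrow> 'l" where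
  "amplify t S = (SOME X. bop X \<and> (\<forall>x y. X (t x y) = t (S x) y))"

lemma amplify:
  assumes "hilbert_tensor t" "bop S"
  shows "bop (amplify t S)" "amplify t S (t x y) = t (S x) y"
  using someI_ex[OF amplification_exists[OF assms]] unfolding amplify_def by blast+

lemma amplify_eqI:
  assumes t: "hilbert_tensor t" and "bop S" "bop X" "\<And>x y. X (t x y) = t (S x) y"
  shows "amplify t S = X"
  by (rule bop_tensor_eqI[OF t amplify(1)[OF assms(1,2)] assms(3)])
     (simp add: amplify(2)[OF assms(1,2)] assms(4))

text \<open>Most laws are comparisons on simple tensors. For the adjoint, density is used once for
  each argument of the inner product.\<close>

lemma amplify_star_hom:
  fixes t :: "'h::chilbert_space \<Rightarrow> 'k::chilbert_space \<Rightarrow> 'l::chilbert_space"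
  assumes t: "hilbert_tensor t"
  shows "amplify t \<in> star_hom bounded_ops bounded_ops"
proof -
  note T = hilbert_tensorD[OF t] and am = amplify[OF t]
  have st: "amplify t (star bounded_ops S) = star bounded_ops (amplify t S)" if S: "bop S" for S
  proof (rule star_bounded_ops[symmetric])
    note S' = adjoint(1)[OF S]
    have 1: "cinner (amplify t (star bounded_ops S) (t x y)) b = cinner (t x y) (amplify t S b)" for x y b
      by (rule hilbert_tensor_eqI[OF t bounded_linear_cinner_right
            bounded_linear_compose[OF bounded_linear_cinner_right bopD(1)[OF am(1)[OF S]]]])
         (simp add: am S S' T(5) adjoint(2)[OF S])
    show "cinner (amplify t (star bounded_ops S) a) b = cinner a (amplify t S b)" for a b
      by (rule hilbert_tensor_eqI[OF t bounded_linear_compose[OF bounded_linear_cinner_left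
              bopD(1)[OF am(1)[OF S']]] bounded_linear_cinner_left 1])
  qed
  show ?thesis
  proof (rule star_homI)
    fix S R :: "'h \<Rightarrow> 'h" and c
    assume "S \<in> carrier bounded_ops" hence S: "bop S" by simp
    show "amplify t S \<in> carrier bounded_ops" using am(1)[OF S] by simp
    show "amplify t (cscale bounded_ops c S) = cscale bounded_ops c (amplify t S)"
      using S by (intro amplify_eqI[OF t]) (simp_all add: bop_scaleC am T(3))
    show "amplify t (star bounded_ops S) = star bounded_ops (amplify t S)" by (rule st[OF S])
    assume "R \<in> carrier bounded_ops" hence R: "bop R" by simp
    show "amplify t (S \<oplus>\<^bsub>bounded_ops\<^esub> R) = amplify t S \<oplus>\<^bsub>bounded_ops\<^esub> amplify t R"
      using S R by (intro amplify_eqI[OF t]) (simp_all add: bop_add am T(1))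
    show "amplify t (S \<otimes>\<^bsub>bounded_ops\<^esub> R) = amplify t S \<otimes>\<^bsub>bounded_ops\<^esub> amplify t R"
      using S R by (intro amplify_eqI[OF t]) (simp_all add: bop_compose am)
  next
    show "amplify t \<one>\<^bsub>bounded_ops\<^esub> = \<one>\<^bsub>bounded_ops\<^esub>"
      by (intro amplify_eqI[OF t]) (simp_all add: bop_id)
  qed
qed

text \<open>Both composites act on simple tensors as \<open>op_tensor\<close> demands. A bounded
  operator is determined there, which settles the definite description and the commutation.\<close>

lemma op_tensor_amplify:
  assumes t: "hilbert_tensor t" and S: "bop S" and T: "bop T"
  shows "op_tensor t S T = amplify t S \<circ> amplify (\<lambda>y x. t x y) T"
    and "amplify t S \<circ> amplify (\<lambda>y x. t x y) T = amplify (\<lambda>y x. t x y) T \<circ> amplify t S"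
proof -
  note t' = hilbert_tensor_flip[OF t]
  let ?X = "amplify t S \<circ> amplify (\<lambda>y x. t x y) T"
  have X: "bop ?X" by (rule bop_compose[OF amplify(1)[OF t S] amplify(1)[OF t' T]])
  have Xt: "?X (t x y) = t (S x) (T y)" for x y
    using amplify(2)[OF t S] amplify(2)[OF t' T] by simp
  show "op_tensor t S T = ?X"
    unfolding op_tensor_def
  proof (rule the_equality)
    fix Y assume "Y \<in> carrier bounded_ops \<and> (\<forall>x y. Y (t x y) = t (S x) (T y))"
    thus "Y = ?X" using X by (intro bop_tensor_eqI[OF t]) (simp_all add: Xt del: comp_apply)
  qed (use X Xt in \<open>simp del: comp_apply\<close>)
  show "?X = amplify (\<lambda>y x. t x y) T \<circ> amplify t S"
    by (rule bop_tensor_eqI[OF t X bop_compose[OF amplify(1)[OF t' T] amplify(1)[OF t S]]])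
       (use amplify(2)[OF t S] amplify(2)[OF t' T] in simp)
qed

section \<open>Factorization of the Dita product\<close>

text \<open>A syntax for noncommutative *-polynomials; coefficients are given by rational real and
  imaginary parts so that countably many generators give countably many expressions.\<close>

datatype 'x star_term = Gen 'x | One | Plus "'x star_term" "'x star_term" |
  Times "'x star_term" "'x star_term" | Scale rat rat "'x star_term" | Star "'x star_term"

instance star_term :: (countable) countable
  by countable_datatype

context star_algebra
begin

primrec eval_term :: "('x \<Rightarrow> 'a) \<Rightarrow> 'x star_term \<Rightarrow> 'a" where
  "eval_term h (Gen x) = h x"
| "eval_term h One = \<one>"
| "eval_term h (Plus s t) = eval_term h s \<oplus> eval_term h t"
| "eval_term h (Times s t) = eval_term h s \<otimes> eval_term h t"
| "eval_term h (Scale a b t) = cscale A (Complex (of_rat a) (of_rat b)) (eval_term h t)"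
| "eval_term h (Star t) = star A (eval_term h t)"

end

lemma complex_rat_approx:
  assumes "e > 0"
  shows "\<exists>a b. cmod (c - Complex (of_rat a) (of_rat b)) < e"
proof -
  have e: "e / 2 > 0" using assms by simp
  obtain a where a: "Re c - e / 2 < of_rat a" "of_rat a < Re c"
    using of_rat_dense[of "Re c - e / 2" "Re c"] e by auto
  obtain b where b: "Im c - e / 2 < of_rat b" "of_rat b < Im c"
    using of_rat_dense[of "Im c - e / 2" "Im c"] e by auto
  have "cmod (c - Complex (of_rat a) (of_rat b)) \<le> \<bar>Re c - of_rat a\<bar> + \<bar>Im c - of_rat b\<bar>"
    using cmod_le[of "c - Complex (of_rat a) (of_rat b)"] by simp
  also have "\<dots> < e" using a b by (simp add: abs_if)
  finally show ?thesis by blast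
qed

context cstar
begin

lemma cscale_diff_left: "x \<in> carrier A \<Longrightarrow> cscale A c x \<ominus> cscale A d x = cscale A (c - d) x"
  using cscale_add_left[of x c "- d"] cscale_cscale[of x "-1" d]
  by (simp add: a_minus_def cscale_minus_one)

text \<open>A finitely generated C*-algebra is separable: polynomials in the generators with coefficients in
  \<open>\<rat> + \<i>\<rat>\<close> are dense.\<close>

lemma generated_approx:
  assumes h: "\<And>x. h x \<in> carrier A" and z: "z \<in> star_generated A (range h)"
  shows "\<exists>s. (\<forall>k. \<exists>\<tau>. s k = eval_term h \<tau>) \<and> tends s z"
  using z
proof (induction rule: star_generated.induct)
  case (incl z)
  then obtain x where x: "z = h x" by blast
  have "\<exists>\<tau>. z = eval_term h \<tau>" by (rule exI[of _ "Gen x"]) (simp add: x)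
  moreover have "z \<in> carrier A" by (simp add: x h)
  ultimately show ?case by (intro exI[of _ "\<lambda>_. z"] conjI allI tends_const)
next
  case one
  have "\<exists>\<tau>. \<one> = eval_term h \<tau>" by (rule exI[of _ One]) simp
  thus ?case by (intro exI[of _ "\<lambda>_. \<one>"] conjI allI tends_const one_closed)
next
  case (add x y)
  then obtain s t where s: "\<forall>k. \<exists>\<tau>. s k = eval_term h \<tau>" "tends s x"
    and t: "\<forall>k. \<exists>\<tau>. t k = eval_term h \<tau>" "tends t y" by blast
  have "\<exists>\<tau>. s k \<oplus> t k = eval_term h \<tau>" for k using s(1) t(1) eval_term.simps(3) by metis
  thus ?case using tends_add[OF s(2) t(2)] by (intro exI[of _ "\<lambda>k. s k \<oplus> t k"]) simp
next
  case (mult x y)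
  then obtain s t where s: "\<forall>k. \<exists>\<tau>. s k = eval_term h \<tau>" "tends s x"
    and t: "\<forall>k. \<exists>\<tau>. t k = eval_term h \<tau>" "tends t y" by blast
  have "\<exists>\<tau>. s k \<otimes> t k = eval_term h \<tau>" for k using s(1) t(1) eval_term.simps(4) by metis
  thus ?case using tends_mult[OF s(2) t(2)] by (intro exI[of _ "\<lambda>k. s k \<otimes> t k"]) simp
next
  case (cscale x c)
  then obtain s where s: "\<forall>k. \<exists>\<tau>. s k = eval_term h \<tau>" "tends s x" by blast
  \<comment> \<open>Scalar and vector are approximated together: the error splits into
    \<open>d k\<close> times the error of \<open>s k\<close>, and \<open>d k - c\<close> times
    \<open>x\<close>, where \<open>cmod (d k)\<close> is at most \<open>cmod c + 1\<close>.\<close>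
  have "\<forall>k. \<exists>d. cmod (c - d) < inverse (real (Suc k)) \<and> (\<exists>a b. d = Complex (of_rat a) (of_rat b))"
  proof
    fix k
    have "inverse (real (Suc k)) > 0" by simp
    from complex_rat_approx[OF this, of c]
    show "\<exists>d. cmod (c - d) < inverse (real (Suc k)) \<and> (\<exists>a b. d = Complex (of_rat a) (of_rat b))" by blast
  qed
  then obtain d where d: "\<And>k. cmod (c - d k) < inverse (real (Suc k))"
    "\<And>k. \<exists>a b. d k = Complex (of_rat a) (of_rat b)" by metis
  note sc = tends_closed[OF s(2)]
  have d1: "cmod (d k) \<le> cmod c + 1" for k
  proof -
    have "inverse (real (Suc k)) \<le> 1" by (simp add: inverse_le_1_iff)
    thus ?thesis using norm_triangle_ineq2[of "d k" c] norm_minus_commute[of c "d k"] d(1)[of k] by linarith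
  qed
  have bd: "cnorm A (Defs.cscale A (d k) (s k) \<ominus> Defs.cscale A c x)
      \<le> (cmod c + 1) * cnorm A (s k \<ominus> x) + inverse (real (Suc k)) * cnorm A x" for k
  proof -
    have "cnorm A (Defs.cscale A (d k) (s k) \<ominus> Defs.cscale A c x) \<le>
        cnorm A (Defs.cscale A (d k) (s k) \<ominus> Defs.cscale A (d k) x) +
        cnorm A (Defs.cscale A (d k) x \<ominus> Defs.cscale A c x)"
      by (rule q_triangle) (simp_all add: sc)
    also have "cnorm A (Defs.cscale A (d k) (s k) \<ominus> Defs.cscale A (d k) x) =
        cmod (d k) * cnorm A (s k \<ominus> x)" by (simp add: cscale_minus[symmetric] q_cscale sc)
    also have "cnorm A (Defs.cscale A (d k) x \<ominus> Defs.cscale A c x) = cmod (d k - c) * cnorm A x"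
      by (simp add: cscale_diff_left q_cscale sc)
    also have "cmod (d k) * cnorm A (s k \<ominus> x) + cmod (d k - c) * cnorm A x \<le>
        (cmod c + 1) * cnorm A (s k \<ominus> x) + inverse (real (Suc k)) * cnorm A x"
      using d(1)[of k]
      by (intro add_mono mult_right_mono d1) (simp_all add: sc norm_minus_commute)
    finally show ?thesis .
  qed
  have "(\<lambda>k. (cmod c + 1) * cnorm A (s k \<ominus> x) + inverse (real (Suc k)) * cnorm A x)
      \<longlonglongrightarrow> (cmod c + 1) * 0 + 0 * cnorm A x"
    by (intro tendsto_intros LIMSEQ_inverse_real_of_nat) (use s(2) in \<open>simp add: tends_def\<close>)
  hence "(\<lambda>k. (cmod c + 1) * cnorm A (s k \<ominus> x) + inverse (real (Suc k)) * cnorm A x) \<longlonglongrightarrow> 0" by simp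
  from null_dominated[OF _ bd this]
  have "tends (\<lambda>k. Defs.cscale A (d k) (s k)) (Defs.cscale A c x)"
    by (simp add: tends_def sc)
  moreover have "\<exists>\<tau>. Defs.cscale A (d k) (s k) = eval_term h \<tau>" for k
  proof -
    obtain a b \<tau> where "d k = Complex (of_rat a) (of_rat b)" "s k = eval_term h \<tau>" using d(2) s(1) by metis
    thus ?thesis by (intro exI[of _ "Scale a b \<tau>"]) simp
  qed
  ultimately show ?case by (intro exI[of _ "\<lambda>k. Defs.cscale A (d k) (s k)"]) simp
next
  case (star x)
  then obtain s where s: "\<forall>k. \<exists>\<tau>. s k = eval_term h \<tau>" "tends s x" by blast
  have "\<exists>\<tau>. Defs.star A (s k) = eval_term h \<tau>" for k using s(1) eval_term.simps(6) by metis
  thus ?case using tends_star[OF s(2)] by (intro exI[of _ "\<lambda>k. Defs.star A (s k)"]) simp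
qed

text \<open>A point is determined by which expressions approximate it and how well. This is a set of
  natural numbers, and such sets inject into the reals.\<close>

lemma carrier_lepoll_reals:
  fixes h :: "'x::countable \<Rightarrow> 'a"
  assumes h: "\<And>x. h x \<in> carrier A"
    and dense: "carrier A \<subseteq> cnorm_closure A (star_generated A (range h))"
  shows "\<exists>j :: 'a \<Rightarrow> real. inj_on j (carrier A)"
proof -
  define code where "code z = {to_nat (\<tau>, k) | \<tau> k.
      cnorm A (eval_term h \<tau> \<ominus> z) < inverse (real (Suc k))}" for z
  have ec: "eval_term h \<tau> \<in> carrier A" for \<tau> by (induction \<tau>) (simp_all add: h)
  have rh: "range h \<subseteq> carrier A" using h by auto
  have approx: "\<exists>\<tau>. cnorm A (eval_term h \<tau> \<ominus> z) < e" if z: "z \<in> carrier A" and e: "e > 0" for z e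
  proof -
    have "\<exists>y\<in>star_generated A (range h). cnorm A (z \<ominus> y) < e / 2"
      using dense z e half_gt_zero[OF e] unfolding cnorm_closure_def by blast
    then obtain y where y: "y \<in> star_generated A (range h)" "cnorm A (z \<ominus> y) < e / 2" by (rule bexE)
    have yc: "y \<in> carrier A" by (rule star_generated_closed[OF y(1) rh])
    obtain s where s: "\<forall>k. \<exists>\<tau>. s k = eval_term h \<tau>" "tends s y" using generated_approx[OF h y(1)] by blast
    have "(\<lambda>k. cnorm A (s k \<ominus> y)) \<longlonglongrightarrow> 0" using s(2) by (simp add: tends_def)
    from LIMSEQ_D[OF this half_gt_zero[OF e]] obtain k where
      "\<forall>n\<ge>k. norm (cnorm A (s n \<ominus> y) - 0) < e / 2" by blast
    from this[rule_format, of k] have "cnorm A (s k \<ominus> y) < e / 2" by simp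
    moreover obtain \<tau> where "s k = eval_term h \<tau>" using s(1) by blast
    ultimately have "cnorm A (eval_term h \<tau> \<ominus> z) < e"
      using q_triangle[OF ec yc z, of \<tau>] q_minus_commute[OF z yc] y(2) by simp
    thus ?thesis by blast
  qed
  have inj: "inj_on code (carrier A)"
  proof (rule inj_onI)
    fix x y assume x: "x \<in> carrier A" and y: "y \<in> carrier A" and xy: "code x = code y"
    have "cnorm A (x \<ominus> y) \<le> 0"
    proof (rule field_le_epsilon)
      fix e :: real assume e: "e > 0"
      obtain k where k: "inverse (real (Suc k)) < e / 2" using reals_Archimedean[OF half_gt_zero[OF e]] by blast
      have "0 < inverse (real (Suc k))" by simp
      \<comment> \<open>An expression close to \<open>x\<close> is recorded in the code of
        \<open>x\<close>, hence in that of \<open>y\<close>, so it is close to both.\<close>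
      from approx[OF x this] obtain \<tau> where \<tau>: "cnorm A (eval_term h \<tau> \<ominus> x) < inverse (real (Suc k))" by blast
      hence "to_nat (\<tau>, k) \<in> code x" unfolding code_def by blast
      hence "to_nat (\<tau>, k) \<in> code y" unfolding xy .
      hence "cnorm A (eval_term h \<tau> \<ominus> y) < inverse (real (Suc k))" by (auto simp: code_def)
      thus "cnorm A (x \<ominus> y) \<le> 0 + e"
        using q_triangle[OF x ec y, of \<tau>] q_minus_commute[OF x ec, of \<tau>] \<tau> k by linarith
    qed
    hence "cnorm A (x \<ominus> y) = 0" using q_nonneg[OF minus_closed[OF x y]] by linarith
    hence "x \<ominus> y = \<zero>" by (rule cnorm_definite[OF minus_closed[OF x y]])
    thus "x = y" using minus_eq_zero_iff[OF x y] by simp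
  qed
  obtain g :: "nat set \<Rightarrow> real" where g: "inj g"
    using eqpoll_imp_lepoll[OF nat_sets_eqpoll_reals] unfolding lepoll_def by blast
  have "inj_on (\<lambda>z. g (code z)) (carrier A)"
    using comp_inj_on[OF inj inj_on_subset[OF g subset_UNIV]] by (simp add: comp_def)
  thus ?thesis by blast
qed

end

section \<open>Transport of a C*-algebra along an injection\<close>

definition transport :: "('a \<Rightarrow> 'b) \<Rightarrow> ('a, 'e) cstar_alg_scheme \<Rightarrow> 'b cstar_alg" where
  "transport j A = (let k = inv_into (carrier A) j in \<lparr>
     carrier = j ` carrier A,
     mult = (\<lambda>x y. j (k x \<otimes>\<^bsub>A\<^esub> k y)), one = j \<one>\<^bsub>A\<^esub>, zero = j \<zero>\<^bsub>A\<^esub>,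
     add = (\<lambda>x y. j (k x \<oplus>\<^bsub>A\<^esub> k y)),
     cscale = (\<lambda>c x. j (cscale A c (k x))), star = (\<lambda>x. j (star A (k x))),
     cnorm = (\<lambda>x. cnorm A (k x))\<rparr>)"

context
  fixes j :: "'a \<Rightarrow> 'b" and A :: "('a, 'e) cstar_alg_scheme"
  assumes A: "cstar_algebra A" and inj: "inj_on j (carrier A)"
begin

interpretation A: cstar A using A by (simp add: cstar_def)

lemma transport_simps:
  "carrier (transport j A) = j ` carrier A"
  "x \<in> carrier A \<Longrightarrow> y \<in> carrier A \<Longrightarrow> j x \<otimes>\<^bsub>transport j A\<^esub> j y = j (x \<otimes>\<^bsub>A\<^esub> y)"
  "\<one>\<^bsub>transport j A\<^esub> = j \<one>\<^bsub>A\<^esub>" "\<zero>\<^bsub>transport j A\<^esub> = j \<zero>\<^bsub>A\<^esub>"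
  "x \<in> carrier A \<Longrightarrow> y \<in> carrier A \<Longrightarrow> j x \<oplus>\<^bsub>transport j A\<^esub> j y = j (x \<oplus>\<^bsub>A\<^esub> y)"
  "x \<in> carrier A \<Longrightarrow> cscale (transport j A) c (j x) = j (cscale A c x)"
  "x \<in> carrier A \<Longrightarrow> star (transport j A) (j x) = j (star A x)"
  "x \<in> carrier A \<Longrightarrow> cnorm (transport j A) (j x) = cnorm A x"
  by (simp_all add: transport_def Let_def inv_into_f_f[OF inj])

lemma transport_star_algebra: "star_algebra (transport j A)"
proof -
  note [simp] = transport_simps
  have "ring (transport j A)"
  proof (rule ringI)
    show "abelian_group (transport j A)"
    proof (rule abelian_groupI)
      fix x assume "x \<in> carrier (transport j A)"
      then obtain a where a: "a \<in> carrier A" "x = j a" by auto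
      thus "\<exists>y\<in>carrier (transport j A). y \<oplus>\<^bsub>transport j A\<^esub> x = \<zero>\<^bsub>transport j A\<^esub>"
        by (intro bexI[of _ "j (\<ominus>\<^bsub>A\<^esub> a)"]) (simp_all add: A.l_neg)
    qed (auto simp: A.a_ac)
    show "monoid (transport j A)" by (rule monoidI) (auto simp: A.m_assoc)
  qed (auto simp: A.l_distr A.r_distr)
  thus ?thesis
    by (rule star_algebra.intro, intro star_algebra_axioms.intro)
       (auto simp: A.cscale_add_right A.cscale_add_left A.cscale_cscale A.cscale_mult_left
         A.cscale_mult_right A.star_add A.star_mult A.star_cscale)
qed

lemma transport_star_hom: "j \<in> star_hom A (transport j A)"
  by (rule star_homI) (simp_all add: transport_simps)

lemma transport_cstar_algebra: "cstar_algebra (transport j A)"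
proof (rule cstar_algebra.intro[OF transport_star_algebra], rule cstar_algebra_axioms.intro)
  note [simp] = transport_simps
  have m: "j x \<ominus>\<^bsub>transport j A\<^esub> j y = j (x \<ominus>\<^bsub>A\<^esub> y)" if "x \<in> carrier A" "y \<in> carrier A" for x y
    by (rule star_hom_minus[OF A.star_algebra_axioms transport_star_algebra transport_star_hom that, symmetric])
  show "cstar_seminorm (transport j A) (cnorm (transport j A))"
    unfolding cstar_seminorm_def
    by (auto simp: A.q_add A.q_cscale A.q_mult A.q_star_mult)
  fix x assume "x \<in> carrier (transport j A)" "cnorm (transport j A) x = 0"
  thus "x = \<zero>\<^bsub>transport j A\<^esub>" using A.cnorm_definite by auto
next
  note [simp] = transport_simps
  have m: "j x \<ominus>\<^bsub>transport j A\<^esub> j y = j (x \<ominus>\<^bsub>A\<^esub> y)" if "x \<in> carrier A" "y \<in> carrier A" for x y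
    by (rule star_hom_minus[OF A.star_algebra_axioms transport_star_algebra transport_star_hom that, symmetric])
  fix f assume f: "f \<in> cauchy_seqs (transport j A) (cnorm (transport j A))"
  define g where "g k = inv_into (carrier A) j (f k)" for k
  have g: "g k \<in> carrier A" "j (g k) = f k" for k
    using f by (auto simp: cauchy_seqs_def g_def inv_into_into f_inv_into_f)
  have "g \<in> cauchy_seqs A (cnorm A)"
    using f unfolding cauchy_seqs_def g(2)[symmetric] by (simp add: g(1) m)
  from A.complete[OF this] obtain x where x: "x \<in> carrier A" "(\<lambda>k. cnorm A (g k \<ominus>\<^bsub>A\<^esub> x)) \<longlonglongrightarrow> 0"
    by (rule bexE)
  thus "\<exists>x\<in>carrier (transport j A). (\<lambda>k. cnorm (transport j A) (f k \<ominus>\<^bsub>transport j A\<^esub> x)) \<longlonglongrightarrow> 0"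
    unfolding g(2)[symmetric] by (intro bexI[of _ "j x"]) (simp_all add: g(1) m)
qed

end

text \<open>Injectivity of \<open>j\<close> leaves the kernel of the quotient map unchanged, so the
  transported algebra presents the same quotient.\<close>

lemma free_wreath_product_transport:
  fixes v :: "'m::finite \<Rightarrow> 'm \<Rightarrow> 'b" and u :: "'n::finite \<Rightarrow> 'n \<Rightarrow> 'a"
  assumes B: "cstar_algebra B" and A: "cstar_algebra A"
    and fw: "free_wreath_product B v A u Q w" and j: "inj_on j (carrier Q)"
  shows "free_wreath_product B v A u (transport j Q) (\<lambda>s t. j (w s t))"
proof -
  let ?F = "free_prod B A :: ((nat \<Rightarrow> ('n \<times> 'b + 'a) star_poly) set) cstar_alg"
  have Q: "cstar_algebra Q" using fw by (simp add: free_wreath_product_def)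
  interpret Q: cstar Q using Q by (simp add: cstar_def)
  obtain p where p: "p \<in> star_hom ?F Q" "p ` carrier ?F = carrier Q"
    "a_kernel ?F Q p = closed_ideal_generated ?F (wreath_commutators B v A u)"
    "\<forall>i a j b. w (i, a) (j, b) = p (free_prod_inl B A i (v a b) \<otimes>\<^bsub>?F\<^esub> free_prod_inr B A (u i j))"
    using fw unfolding free_wreath_product_def by blast
  define p' where "p' x = j (p x)" for x
  have p': "p' \<in> star_hom ?F (transport j Q)"
    unfolding p'_def[abs_def] by (rule star_hom_comp[OF p(1) transport_star_hom[OF Q j]])
  have onto: "p' ` carrier ?F = carrier (transport j Q)"
    unfolding transport_simps(1)[OF Q j] p(2)[symmetric] p'_def by (simp add: image_image)
  have "p' x = \<zero>\<^bsub>transport j Q\<^esub> \<longleftrightarrow> p x = \<zero>\<^bsub>Q\<^esub>" if "x \<in> carrier ?F" for x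
    unfolding p'_def transport_simps(4)[OF Q j]
    by (rule inj_on_eq_iff[OF j star_hom_closed[OF p(1) that] Q.zero_closed])
  hence ker: "a_kernel ?F (transport j Q) p' = closed_ideal_generated ?F (wreath_commutators B v A u)"
    unfolding p(3)[symmetric] by (auto simp: a_kernel_def kernel_def)
  show ?thesis
    unfolding free_wreath_product_def
    using transport_cstar_algebra[OF Q j] p' onto ker p(4) by (intro conjI bexI[of _ p']) (simp_all add: p'_def)
qed

section \<open>The map from the wreath product to operators, and minimality\<close>

lemma free_wreath_productE:
  fixes v :: "'m::finite \<Rightarrow> 'm \<Rightarrow> 'b" and u :: "'n::finite \<Rightarrow> 'n \<Rightarrow> 'a"
  assumes "quantum_permutation_algebra B v" "quantum_permutation_algebra A u"
    and "free_wreath_product B v A u Q w"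
  obtains p where "free_wreath B v A u Q w p"
proof -
  let ?F = "free_prod B A :: ((nat \<Rightarrow> ('n \<times> 'b + 'a) star_poly) set) cstar_alg"
  obtain p where p: "p \<in> star_hom ?F Q" "p ` carrier ?F = carrier Q"
    "a_kernel ?F Q p = closed_ideal_generated ?F (wreath_commutators B v A u)"
    "\<forall>i a j b. w (i, a) (j, b) = p (free_prod_inl B A i (v a b) \<otimes>\<^bsub>?F\<^esub> free_prod_inr B A (u i j))"
    using assms(3) unfolding free_wreath_product_def by blast
  have "free_wreath B v A u Q w p"
    using assms p by (intro free_wreath.intro) (simp_all add: free_wreath_product_def)
  thus ?thesis by (rule that)
qed

text \<open>\<open>U \<otimes> (V\<^sup>1, \<dots>, V\<^sup>n)\<close> factors through the free wreath product, as \<open>B(H) \<otimes> 1\<close> and \<open>1 \<otimes> B(K)\<close> commute.\<close>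

lemma dita_factors_through_wreath:
  fixes t :: "'h::chilbert_space \<Rightarrow> 'k::chilbert_space \<Rightarrow> 'l::chilbert_space"
    and v :: "'m::finite \<Rightarrow> 'm \<Rightarrow> 'b" and u :: "'n::finite \<Rightarrow> 'n \<Rightarrow> 'a"
  assumes t: "hilbert_tensor t" and fw: "free_wreath B v A u Q w p"
    and gA: "gA \<in> star_hom A bounded_ops" "\<And>i j. gA (u i j) = U i j"
    and gB: "\<And>i. gB i \<in> star_hom B bounded_ops" "\<And>i a b. gB i (v a b) = V i a b"
    and \<pi>: "represents bounded_ops \<pi> (dita_product t U V)"
  shows "factors_through bounded_ops \<pi> Q w"
proof -
  interpret W: free_wreath B v A u Q w p by (rule fw)
  note t' = hilbert_tensor_flip[OF t]
  \<comment> \<open>\<open>a\<close> acts on the first tensor factor and \<open>b i\<close> on the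
    second; they commute by the second claim of \<open>op_tensor_amplify\<close>.\<close>
  define a where "a x = amplify t (gA x)" for x
  define b where "b i x = amplify (\<lambda>y x. t x y) (gB i x)" for i x
  have a: "a \<in> star_hom A bounded_ops"
    unfolding a_def[abs_def] by (rule star_hom_comp[OF gA(1) amplify_star_hom[OF t]])
  have b: "b i \<in> star_hom B bounded_ops" for i
    unfolding b_def[abs_def] by (rule star_hom_comp[OF gB(1) amplify_star_hom[OF t']])
  have bopU: "bop (U i j)" for i j using star_hom_closed[OF gA(1) W.mu(1), of i j] by (simp add: gA(2))
  have bopV: "bop (V i x y)" for i x y using star_hom_closed[OF gB(1) W.mv(1), of i x y] by (simp add: gB(2))
  have "\<exists>H\<in>star_hom Q bounded_ops. (\<forall>i. \<forall>x\<in>carrier B. H (W.inB i x) = b i x) \<and>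
      (\<forall>y\<in>carrier A. H (W.inA y) = a y)"
    by (rule W.wreath_lift[OF bounded_ops_cstar_algebra b a])
       (simp add: a_def b_def gA(2) gB(2) op_tensor_amplify(2)[OF t bopU bopV])
  then obtain g where g: "g \<in> star_hom Q bounded_ops"
    "(\<forall>i. \<forall>x\<in>carrier B. g (W.inB i x) = b i x) \<and> (\<forall>y\<in>carrier A. g (W.inA y) = a y)" by (rule bexE)
  have gw: "g (w s r) = dita_product t U V s r" for s r
  proof -
    obtain i x j y where s: "s = (i, x)" "r = (j, y)" by (cases s; cases r)
    have "g (w (i, x) (j, y)) = g (W.inB i (v x y)) \<circ> g (W.inA (u i j))"
      unfolding W.w_eq using star_hom_mult[OF g(1) W.closed(1)[OF W.mv(1)] W.closed(2)[OF W.mu(1)]] by simp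
    also have "\<dots> = amplify (\<lambda>y x. t x y) (V i x y) \<circ> amplify t (U i j)"
      using g(2) W.mv(1) W.mu(1) by (simp add: a_def b_def gA(2) gB(2))
    \<comment> \<open>In \<open>w\<close> the factor from B stands on the left, in the formula for
      \<open>op_tensor\<close> on the right; the two amplifications commute.\<close>
    also have "\<dots> = op_tensor t (U i j) (V i x y)"
      unfolding op_tensor_amplify[OF t bopU bopV] ..
    finally show ?thesis by (simp add: s dita_product_def)
  qed
  obtain f where f: "f \<in> star_hom A_s Q" "\<forall>s r. f (A_s_gen s r) = w s r"
    using A_s_lift[OF W.Q W.magic_w] by (rule bexE)
  have \<pi>h: "\<pi> \<in> star_hom A_s bounded_ops" and \<pi>g: "\<pi> (A_s_gen s r) = dita_product t U V s r" for s r
    using \<pi> unfolding represents_def by blast+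
  \<comment> \<open>Factorization is demanded on all of \<open>A_s\<close>; agreement on generators
    extends to it by density and continuity.\<close>
  have "\<pi> x = g (f x)" if "x \<in> carrier A_s" for x
    by (rule A_s_hom_eq[OF bounded_ops_cstar_algebra \<pi>h star_hom_comp[OF f(1) g(1)] _ that])
       (simp add: \<pi>g f(2) gw)
  thus ?thesis unfolding factors_through_def using f g(1) by (intro bexI[of _ f] bexI[of _ g] conjI) auto
qed

text \<open>A factorization followed on generators: its second map carries the magic unitary of the
  intermediate algebra to the represented one.\<close>

lemma factors_throughE:
  assumes "factors_through C \<pi> A u" "represents C \<pi> U"
  obtains g where "g \<in> star_hom A C" "\<And>i j. g (u i j) = U i j"
proof -
  obtain f g where f: "f \<in> star_hom A_s A" and g: "g \<in> star_hom A C"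
    and fg: "\<forall>i j. f (A_s_gen i j) = u i j" "\<forall>x\<in>carrier A_s. \<pi> x = g (f x)"
    using assms(1) unfolding factors_through_def by blast
  have "A_s_gen i j \<in> carrier A_s" for i j
    unfolding A_s_gen_def A_s_def by (rule free_univ.ugen_closed[OF A_s_free_univ UNIV_I])
  hence "g (u i j) = U i j" for i j
    using fg assms(2) unfolding represents_def by metis
  thus ?thesis using g that by blast
qed

theorem theorem3p8:
  fixes t :: "'h::chilbert_space \<Rightarrow> 'k::chilbert_space \<Rightarrow> 'l::chilbert_space"
    and U :: "'n::finite \<Rightarrow> 'n \<Rightarrow> 'h \<Rightarrow> 'h"
    and V :: "'n \<Rightarrow> 'm::finite \<Rightarrow> 'm \<Rightarrow> 'k \<Rightarrow> 'k"
    and A :: "'a cstar_alg" and u :: "'n \<Rightarrow> 'n \<Rightarrow> 'a"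
    and B :: "'b cstar_alg" and v :: "'m \<Rightarrow> 'm \<Rightarrow> 'b"
    and Q :: "'q cstar_alg" and w :: "'n \<times> 'm \<Rightarrow> 'n \<times> 'm \<Rightarrow> 'q"
    and C :: "'c cstar_alg" and z :: "'n \<times> 'm \<Rightarrow> 'n \<times> 'm \<Rightarrow> 'c"
  assumes "hilbert_tensor t"
    and "magic_unitary bounded_ops U"
    and "\<And>i. magic_unitary bounded_ops (V i)"
    and "hopf_image_for bounded_ops U A u"
    and "common_hopf_image_for bounded_ops V B v"
    and "free_wreath_product B v A u Q w"
    and "hopf_image_for bounded_ops (dita_product t U V) C z"
  shows "qpa_quotient C z Q w"
proof -
  obtain \<pi>U where \<pi>U: "represents bounded_ops \<pi>U U" "hopf_image bounded_ops \<pi>U A u"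
    using assms(4) unfolding hopf_image_for_def by blast
  obtain \<pi>V where \<pi>V: "\<And>i. represents bounded_ops (\<pi>V i) (V i)" "common_hopf_image bounded_ops \<pi>V B v"
    using assms(5) unfolding common_hopf_image_for_def by blast
  obtain \<pi> where \<pi>: "represents bounded_ops \<pi> (dita_product t U V)" "hopf_image bounded_ops \<pi> C z"
    using assms(7) unfolding hopf_image_for_def by blast
  have qA: "quantum_permutation_algebra A u" and qC: "quantum_permutation_algebra C z"
    using \<pi>U(2) \<pi>(2) by (simp_all add: hopf_image_def)
  have qB: "quantum_permutation_algebra B v" using \<pi>V(2) by (simp add: common_hopf_image_def)
  have "factors_through bounded_ops \<pi>U A u" using \<pi>U(2) by (simp add: hopf_image_def)
  then obtain gA where gA: "gA \<in> star_hom A bounded_ops" "\<And>i j. gA (u i j) = U i j"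
    using \<pi>U(1) by (rule factors_throughE) blast
  have "\<exists>g. g \<in> star_hom B bounded_ops \<and> (\<forall>a b. g (v a b) = V i a b)" for i
  proof -
    have "factors_through bounded_ops (\<pi>V i) B v" using \<pi>V(2) by (simp add: common_hopf_image_def)
    thus ?thesis using \<pi>V(1)[of i] by (rule factors_throughE) blast
  qed
  then obtain gB where gB: "\<And>i. gB i \<in> star_hom B bounded_ops" "\<And>i a b. gB i (v a b) = V i a b" by metis
  obtain p where p: "free_wreath B v A u Q w p" by (rule free_wreath_productE[OF qB qA assms(6)])
  have qQ: "quantum_permutation_algebra Q w" by (rule free_wreath.quantum_permutation_algebra_wreath[OF p])
  have Qc: "cstar_algebra Q" by (rule qpaD(1)[OF qQ])
  \<comment> \<open>The entries are indexed by the finite type of index pairs, which serves as the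
    countable family of generators for the injection into the reals.\<close>
  have "entries w = range (\<lambda>s. w (fst s) (snd s))"
  proof (rule equalityI; rule subsetI)
    fix x assume "x \<in> entries w"
    then obtain s r where "x = w s r" by blast
    thus "x \<in> range (\<lambda>s. w (fst s) (snd s))" by (intro range_eqI[of _ _ "(s, r)"]) simp
  qed blast
  hence "carrier Q \<subseteq> cnorm_closure Q (star_generated Q (range (\<lambda>s. w (fst s) (snd s))))"
    using qpaD(3)[OF qQ] by simp
  then obtain j :: "'q \<Rightarrow> real" where j: "inj_on j (carrier Q)"
    using cstar.carrier_lepoll_reals[of Q "\<lambda>s. w (fst s) (snd s)"] Qc magic_unitaryD(1)[OF qpaD(2)[OF qQ]]
    by (auto simp: cstar_def)
  \<comment> \<open>Minimality of \<open>C\<close> is available against competitors carried by sets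
    of reals. The copy \<open>transport j Q\<close> is such a competitor, and being again a free
    wreath product of the same data it inherits all that is known of them.\<close>
  define w' where "w' s r = j (w s r)" for s r
  have fw': "free_wreath_product B v A u (transport j Q) w'"
    unfolding w'_def[abs_def]
    by (rule free_wreath_product_transport[OF qpaD(1)[OF qB] qpaD(1)[OF qA] assms(6) j])
  obtain p' where p': "free_wreath B v A u (transport j Q) w' p'"
    by (rule free_wreath_productE[OF qB qA fw'])
  have "maps_onto (transport j Q) w' C z"
    using \<pi>(2) free_wreath.quantum_permutation_algebra_wreath[OF p']
      dita_factors_through_wreath[OF assms(1) p' gA gB \<pi>(1)]
    unfolding hopf_image_def by blast
  then obtain f where f: "f \<in> star_hom (transport j Q) C" "f ` carrier (transport j Q) = carrier C"
    "\<forall>s r. f (w' s r) = z s r" unfolding maps_onto_def by blast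
  \<comment> \<open>Precomposition with the isomorphism \<open>j\<close> returns from the real copy
    to \<open>Q\<close>.\<close>
  have "maps_onto Q w C z"
    unfolding maps_onto_def
  proof (intro bexI conjI)
    show "(\<lambda>x. f (j x)) \<in> star_hom Q C" by (rule star_hom_comp[OF transport_star_hom[OF Qc j] f(1)])
    show "(\<lambda>x. f (j x)) ` carrier Q = carrier C"
      unfolding f(2)[symmetric] transport_simps(1)[OF Qc j] by (simp add: image_image)
    show "\<forall>s r. f (j (w s r)) = z s r" using f(3) by (simp add: w'_def)
  qed
  thus ?thesis using qC qQ by (simp add: qpa_quotient_def)
qed

end
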